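(* Let $N\ge1$, $\nu>0$, and let $z_1^{(\nu-1)}>\dots>z_N^{(\nu-1)}>0$ be the zeros of the classical Laguerre polynomial $L_N^{(\nu-1)}$ (orthogonal with respect to $e^{-x}x^{\nu-1}$ on $]0,\infty[$). Put $r=(r_1,\dots,r_N)$ with $r_i:=\sqrt{2z_i^{(\nu-1)}}$. Fix a starting point $x\in C_N^B$ and for $\beta>0$ let $(X_{t,(\nu\beta,\beta)})_{t\ge0}$ be the Bessel process of type $B_N$ with multiplicities $(k_1,k_2)=(\nu\beta,\beta)$ started in $x$. Define $S=(s_{i,j})_{i,j=1,\dots,N}$ by $$s_{i,i}:=1+\frac{2\nu}{r_i^2}+2\sum_{l\ne i}(r_i-r_l)^{-2}+2\sum_{l\ne i}(r_i+r_l)^{-2},\qquad s_{i,j}:=2(r_i+r_j)^{-2}-2(r_i-r_j)^{-2}\ (i\ne j).$$ Then $S$ is invertible and, with $\Sigma:=S^{-1}$, for every $t>0$, $$X_{t,(\nu\beta,\beta)}-\sqrt{\beta t}\,r\ \longrightarrow\ N(0,t\Sigma)\qquad\text{in distribution as }\beta\to\infty.$$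
   Context: $C_N^B:=\{x\in\mathbb R^N: x_1\ge x_2\ge\dots\ge x_N\ge0\}$. For $k_1,k_2\ge0$, the Bessel process of type $B_N$ with multiplicities $(k_1,k_2)$ is the diffusion on $C_N^B$ with reflecting boundary whose generator is $Lf=\frac12\Delta f+k_2\sum_{i=1}^N\sum_{j\ne i}\big(\frac{1}{x_i-x_j}+\frac{1}{x_i+x_j}\big)\frac{\partial f}{\partial x_i}+k_1\sum_{i=1}^N\frac{1}{x_i}\frac{\partial f}{\partial x_i}$, with domain the restrictions to $C_N^B$ of $C^2$ functions on $\mathbb R^N$ invariant under permutations and sign changes of the coordinates. $N(0,t\Sigma)$ denotes the centered $N$-dimensional normal distribution with covariance matrix $t\Sigma$. *)

theory Defs
  imports "HOL-Probability.Probability"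
begin

text \<open>Classical Laguerre polynomial
  L_n^(a)(x) = sum_{k=0}^n binom(n+a, n-k) (-x)^k / k!, orthogonal w.r.t. e^(-x) x^a on ]0,oo[.\<close>
definition laguerre :: "nat \<Rightarrow> real \<Rightarrow> real \<Rightarrow> real" where
  "laguerre n a x = (\<Sum>k\<le>n. ((real n + a) gchoose (n - k)) * (- x) ^ k / fact k)"

definition chamberB :: "(real ^ ('n::{finite,linorder})) set" where
  "chamberB = {x. (\<forall>i j. i \<le> j \<longrightarrow> x $ j \<le> x $ i) \<and> (\<forall>i. 0 \<le> x $ i)}"

definition pd :: "('n::{finite,linorder}) \<Rightarrow> (real ^ ('n::{finite,linorder}) \<Rightarrow> real) \<Rightarrow> real ^ ('n::{finite,linorder}) \<Rightarrow> real" where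
  "pd i f x = deriv (\<lambda>h. f (x + h *\<^sub>R axis i 1)) 0"

definition C2 :: "(real ^ ('n::{finite,linorder}) \<Rightarrow> real) \<Rightarrow> bool" where
  "C2 f \<longleftrightarrow> f differentiable_on UNIV \<and> (\<forall>i. pd i f differentiable_on UNIV)
     \<and> (\<forall>i j. continuous_on UNIV (pd j (pd i f)))"

definition B_invariant :: "(real ^ ('n::{finite,linorder}) \<Rightarrow> real) \<Rightarrow> bool" where
  "B_invariant f \<longleftrightarrow>
     (\<forall>p x. p permutes (UNIV :: ('n::{finite,linorder}) set) \<longrightarrow> f (\<chi> i. x $ p i) = f x) \<and>
     (\<forall>s x. (\<forall>i. s i = 1 \<or> s i = -1) \<longrightarrow> f (\<chi> i. s i * x $ i) = f x)"

definition test_fun :: "(real ^ ('n::{finite,linorder}) \<Rightarrow> real) \<Rightarrow> bool" where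
  "test_fun f \<longleftrightarrow> C2 f \<and> B_invariant f \<and> (\<exists>K. compact K \<and> (\<forall>x. x \<notin> K \<longrightarrow> f x = 0))"

definition besselB_gen :: "real \<Rightarrow> real \<Rightarrow> (real ^ ('n::{finite,linorder}) \<Rightarrow> real) \<Rightarrow> real ^ ('n::{finite,linorder}) \<Rightarrow> real" where
  "besselB_gen k1 k2 f x =
     (1/2) * (\<Sum>i\<in>UNIV. pd i (pd i f) x)
     + k2 * (\<Sum>i\<in>UNIV. \<Sum>j\<in>UNIV - {i}.
              (1 / (x $ i - x $ j) + 1 / (x $ i + x $ j)) * pd i f x)
     + k1 * (\<Sum>i\<in>UNIV. (1 / x $ i) * pd i f x)"

definition nat_filt :: "'w measure \<Rightarrow> (real \<Rightarrow> 'w \<Rightarrow> real ^ ('n::{finite,linorder})) \<Rightarrow> real \<Rightarrow> 'w measure" where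
  "nat_filt M X s = sigma (space M)
     (\<Union>u\<in>{0..s}. {X u -` A \<inter> space M | A. A \<in> sets (borel :: (real ^ ('n::{finite,linorder})) measure)})"

definition besselB_process ::
  "'w measure \<Rightarrow> real \<Rightarrow> real \<Rightarrow> real ^ ('n::{finite,linorder}) \<Rightarrow> (real \<Rightarrow> 'w \<Rightarrow> real ^ ('n::{finite,linorder})) \<Rightarrow> bool" where
  "besselB_process M k1 k2 x X \<longleftrightarrow>
     prob_space M \<and>
     (\<forall>t\<ge>0. X t \<in> borel_measurable M) \<and>
     (\<forall>\<omega>\<in>space M. continuous_on {0..} (\<lambda>t. X t \<omega>) \<and> (\<forall>t\<ge>0. X t \<omega> \<in> chamberB) \<and> X 0 \<omega> = x) \<and>
     (\<forall>f. test_fun f \<longrightarrow>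
        (let Y = (\<lambda>t \<omega>. f (X t \<omega>) - (LINT u:{0..t}|lborel. besselB_gen k1 k2 f (X u \<omega>)))
         in \<forall>s t. 0 \<le> s \<longrightarrow> s \<le> t \<longrightarrow>
              (AE \<omega> in M. real_cond_exp M (nat_filt M X s) (Y t) \<omega> = Y s \<omega>)))"

text \<open>Centered normal distribution N(0,C) on R^N (C positive definite), via its density.\<close>
definition normal_vec :: "real ^ ('n::{finite,linorder}) ^ ('n::{finite,linorder}) \<Rightarrow> (real ^ ('n::{finite,linorder})) measure" where
  "normal_vec C = density lborel (\<lambda>y. ennreal
      ((2 * pi) powr (- real CARD('n) / 2) / sqrt (det C) * exp (- (y \<bullet> (matrix_inv C *v y)) / 2)))"

definition weak_conv_vec :: "('b \<Rightarrow> (real ^ ('n::{finite,linorder})) measure) \<Rightarrow> (real ^ ('n::{finite,linorder})) measure \<Rightarrow> 'b filter \<Rightarrow> bool" where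
  "weak_conv_vec \<mu> \<mu>0 F \<longleftrightarrow>
     (\<forall>f :: real ^ ('n::{finite,linorder}) \<Rightarrow> real. continuous_on UNIV f \<and> bounded (range f) \<longrightarrow>
        ((\<lambda>b. \<integral>y. f y \<partial>(\<mu> b)) \<longlongrightarrow> (\<integral>y. f y \<partial>\<mu>0)) F)"

definition S_mat :: "real \<Rightarrow> real ^ ('n::{finite,linorder}) \<Rightarrow> real ^ ('n::{finite,linorder}) ^ ('n::{finite,linorder})" where
  "S_mat \<nu> r = (\<chi> i j. if i = j then
        1 + 2 * \<nu> / (r $ i)\<^sup>2 + 2 * (\<Sum>l\<in>UNIV - {i}. 1 / (r $ i - r $ l)\<^sup>2)
          + 2 * (\<Sum>l\<in>UNIV - {i}. 1 / (r $ i + r $ l)\<^sup>2)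
      else 2 / (r $ i + r $ j)\<^sup>2 - 2 / (r $ i - r $ j)\<^sup>2)"

end

theory Submission
  imports Defs "HOL-Real_Asymp.Real_Asymp"
begin

text \<open>Put \<open>\<sigma> = 1 / \<beta>\<close> and \<open>Y = X / sqrt \<beta>\<close>. The elementary symmetric polynomials \<open>E\<^sub>k\<close> of the squared coordinates
  triangularise the generator of \<open>Y\<close>: \<open>L E\<^sub>k\<^sub>+\<^sub>1 = c\<^sub>k E\<^sub>k\<close>. Hence, for any terminal coefficients, solving a linear backward
  equation gives time-dependent combinations \<open>N\<^sub>s\<close> of the \<open>E\<^sub>k\<close> that are martingales along \<open>Y\<close>, and
  \<open>(\<partial>\<^sub>s + L) h(N\<^sub>s) = \<sigma>/2 h''(N\<^sub>s) |\<nabla>N\<^sub>s|\<^sup>2\<close>. Taking \<open>h\<close> to be the square shows that \<open>Y\<^sub>s\<close> concentrates at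
  \<open>sqrt s r\<close>; taking \<open>h = cos (\<sqdot> / sqrt \<sigma> + d)\<close> then identifies the limiting characteristic function as
  \<open>exp (- \<kappa> / 2)\<close>, where \<open>\<kappa>\<close> is the integral of \<open>|\<nabla>N\<^sub>s|\<^sup>2\<close> along the curve \<open>sqrt s r\<close>. With \<open>J\<^sub>k = \<nabla>E\<^sub>k(r)\<close>, the Laguerre
  equation gives \<open>k J\<^sub>k - c\<^sub>k\<^sub>-\<^sub>1 J\<^sub>k\<^sub>-\<^sub>1 = J\<^sub>k S / 2\<close>, which evaluates \<open>\<kappa>\<close> to the quadratic form of \<open>t S\<^sup>-\<^sup>1\<close>. Lagrange-type
  combinations of the \<open>E\<^sub>k\<close> serve as local coordinates at \<open>sqrt t r\<close>, and a Stone-Weierstrass argument turns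
  convergence of characteristic functions and tightness into weak convergence.

  The drift is singular on the walls of the Weyl chamber. Applying Dynkin's formula to \<open>\<epsilon> (1 - exp (- f / \<epsilon>))\<close> for a
  nonnegative test function \<open>f\<close> and letting \<open>\<epsilon> \<rightarrow> 0\<close> shows that almost surely, for almost every time, \<open>f = 0\<close> forces
  \<open>\<Delta>f = 0\<close>; for symmetric functions of the squared roots this excludes the walls.\<close>

text \<open>The rescaled starting point tends to 0, the most singular point of the drift, so
  expanding the process around the curve \<open>sqrt s r\<close> breaks down at time 0. The
  \<open>E_k\<close> avoid this: they are smooth at 0 and the coefficients \<open>c_k\<close> are
  polynomials in \<sigma>. But \<open>L E_(k+1) = c_k E_k\<close> is true only off the walls, where
  no denominator of the drift is 0.

  Only expectations at a single time occur. The martingale property enters through Dynkin's formula,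
  which is extended from compact support to polynomial growth by cutoffs and moment bounds; a
  martingale then shows up as a function whose expectation has an explicit time derivative.

  Each \<beta> comes with its own probability space, so every constant is chosen before the measure,
  \<sigma> and the process.

  The curve is identified through the \<open>E_k\<close> alone: with \<open>c_k\<close> taken at
  \<sigma> = 0, the recursion \<open>(k+1) E_(k+1)(r) = c_k E_k(r)\<close> says that
  \<open>s^k E_k(r)\<close> solves the noiseless system, and by Vieta it is the ratio of consecutive
  coefficients of the Laguerre polynomial.\<close>

section \<open>Partial derivatives and twice continuously differentiable functions\<close>

lemma pd_eqI: "((\<lambda>h. f (x + h *\<^sub>R axis i 1)) has_real_derivative D) (at 0) \<Longrightarrow> pd i f x = D"
  unfolding pd_def by (rule DERIV_imp_deriv)

lemma has_derivative_line:
  fixes f :: "real ^ ('n::{finite,linorder}) \<Rightarrow> real"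
  assumes "(f has_derivative f') (at x)"
  shows "((\<lambda>h. f (x + h *\<^sub>R v)) has_real_derivative f' v) (at 0)"
proof -
  have "((\<lambda>h::real. x + h *\<^sub>R v) has_derivative (\<lambda>h. h *\<^sub>R v)) (at 0)"
    by (auto intro!: derivative_eq_intros)
  moreover have "(f has_derivative f') (at (x + 0 *\<^sub>R v))"
    using assms by simp
  ultimately have "((f \<circ> (\<lambda>h::real. x + h *\<^sub>R v)) has_derivative (f' \<circ> (\<lambda>h. h *\<^sub>R v))) (at 0)"
    by (rule diff_chain_at)
  then have "((\<lambda>h::real. f (x + h *\<^sub>R v)) has_derivative (\<lambda>h. f' (h *\<^sub>R v))) (at 0)"
    by (simp add: o_def)
  moreover have "f' (h *\<^sub>R v) = f' v * h" for h
    using has_derivative_linear[OF assms] by (simp add: linear_scale)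
  ultimately show ?thesis
    by (simp add: has_field_derivative_def fun_eq_iff)
qed

lemma has_pd:
  assumes "f differentiable (at x)"
  shows "((\<lambda>h. f (x + h *\<^sub>R axis i 1)) has_real_derivative pd i f x) (at 0)"
proof -
  obtain f' where "(f has_derivative f') (at x)"
    using assms by (auto simp: differentiable_def)
  from has_derivative_line[OF this] pd_eqI show ?thesis
    by metis
qed

lemma has_derivative_pd:
  fixes f :: "real ^ ('n::{finite,linorder}) \<Rightarrow> real"
  assumes "f differentiable (at x)"
  shows "(f has_derivative (\<lambda>v. \<Sum>i\<in>UNIV. v $ i * pd i f x)) (at x)"
proof -
  obtain f' where f': "(f has_derivative f') (at x)"
    using assms by (auto simp: differentiable_def)
  have "f' v = (\<Sum>i\<in>UNIV. v $ i * pd i f x)" for v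
  proof -
    have "v = (\<Sum>i\<in>UNIV. v $ i *\<^sub>R axis i 1)"
      using basis_expansion[of v] by (simp add: scalar_mult_eq_scaleR)
    then have "f' v = f' (\<Sum>i\<in>UNIV. v $ i *\<^sub>R axis i 1)" by simp
    also have "\<dots> = (\<Sum>i\<in>UNIV. v $ i * f' (axis i 1))"
      using has_derivative_linear[OF f'] by (simp add: linear_sum linear_scale)
    finally show ?thesis
      using pd_eqI[OF has_derivative_line[OF f']] by simp
  qed
  then have "f' = (\<lambda>v. \<Sum>i\<in>UNIV. v $ i * pd i f x)" by auto
  with f' show ?thesis by simp
qed

lemma has_real_derivative_coordinate:
  fixes f :: "real ^ ('n::{finite,linorder}) \<Rightarrow> real"
  assumes "\<And>x. f differentiable (at x)"
  shows "((\<lambda>h. f (x + h *\<^sub>R axis i 1)) has_real_derivative pd i f (x + h *\<^sub>R axis i 1)) (at h)"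
proof -
  have "((\<lambda>k. f ((x + h *\<^sub>R axis i 1) + k *\<^sub>R axis i 1)) has_real_derivative
      pd i f (x + h *\<^sub>R axis i 1)) (at (h - h))"
    using has_pd[OF assms] by simp
  then have "((\<lambda>k. f ((x + h *\<^sub>R axis i 1) + (k - h) *\<^sub>R axis i 1)) has_real_derivative
      pd i f (x + h *\<^sub>R axis i 1)) (at h)"
    using DERIV_shift[of _ _ h "-h"] by (simp add: algebra_simps)
  then show ?thesis by (simp add: algebra_simps)
qed

lemma pd_const [simp]: "pd i (\<lambda>x. c) x = 0"
  by (rule pd_eqI) auto

lemma pd_nth [simp]: "pd i (\<lambda>x. x $ j) x = (if i = j then 1 else 0)"
  by (rule pd_eqI) (auto simp: axis_def intro!: derivative_eq_intros)

lemma pd_add: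
  assumes "f differentiable (at x)" "g differentiable (at x)"
  shows "pd i (\<lambda>x. f x + g x) x = pd i f x + pd i g x"
  by (rule pd_eqI) (auto intro!: derivative_eq_intros has_pd assms)

lemma pd_mult:
  assumes "f differentiable (at x)" "g differentiable (at x)"
  shows "pd i (\<lambda>x. f x * g x) x = pd i f x * g x + f x * pd i g x"
  by (rule pd_eqI) (auto intro!: derivative_eq_intros has_pd assms)

lemma pd_compose:
  assumes "f differentiable (at x)" "(h has_real_derivative D) (at (f x))"
  shows "pd i (\<lambda>x. h (f x)) x = D * pd i f x"
proof (rule pd_eqI)
  have "(h has_real_derivative D) (at (f (x + 0 *\<^sub>R axis i 1)))" using assms by simp
  from DERIV_chain2[OF this has_pd[OF assms(1)]]
  show "((\<lambda>k. h (f (x + k *\<^sub>R axis i 1))) has_real_derivative D * pd i f x) (at 0)" .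
qed

lemma C2I:
  fixes f :: "real ^ ('n::{finite,linorder}) \<Rightarrow> real"
  assumes "\<And>x. f differentiable (at x)" "\<And>x i. pd i f differentiable (at x)"
    and "\<And>i j. continuous_on UNIV (pd j (pd i f))"
  shows "C2 f"
  using assms unfolding C2_def differentiable_on_def by auto

lemma C2D:
  fixes f :: "real ^ ('n::{finite,linorder}) \<Rightarrow> real"
  assumes "C2 f"
  shows "f differentiable (at x)" "pd i f differentiable (at x)"
    "continuous_on UNIV (pd j (pd i f))"
  using assms unfolding C2_def differentiable_on_def by auto

lemma C2_continuous:
  fixes f :: "real ^ ('n::{finite,linorder}) \<Rightarrow> real"
  assumes "C2 f"
  shows "continuous_on UNIV f" "continuous_on UNIV (pd i f)"
  using C2D[OF assms] by (auto intro!: differentiable_imp_continuous_on simp: differentiable_on_def)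

lemma C2_const [simp]: "C2 (\<lambda>x. c)"
proof (rule C2I)
  show "pd i (\<lambda>x. c) differentiable at x" for i x
    by (subst ext[OF pd_const]) auto
  show "continuous_on UNIV (pd j (pd i (\<lambda>x. c)))" for i j
    by (simp add: ext[OF pd_const])
qed auto

lemma C2_nth [simp]: "C2 (\<lambda>x :: real ^ ('n::{finite,linorder}). x $ k)"
proof (rule C2I)
  have *: "pd i (\<lambda>x. x $ k) = (\<lambda>x :: (real, 'n) vec. if i = k then 1 else 0)" for i
    by auto
  show "(\<lambda>x :: (real, 'n) vec. x $ k) differentiable at x" for x
    by (intro bounded_linear_imp_differentiable bounded_linear_vec_nth)
  show "pd i (\<lambda>x :: (real, 'n) vec. x $ k) differentiable at x" for i x
    by (subst *) auto
  show "continuous_on UNIV (pd j (pd i (\<lambda>x :: (real, 'n) vec. x $ k)))" for i j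
    by (simp add: * ext[OF pd_const])
qed

lemma C2_pd_add:
  assumes "C2 f" "C2 g"
  shows "pd i (\<lambda>x. f x + g x) = (\<lambda>x. pd i f x + pd i g x)"
    "pd j (pd i (\<lambda>x. f x + g x)) = (\<lambda>x. pd j (pd i f) x + pd j (pd i g) x)"
  using C2D(1,2)[OF assms(1)] C2D(1,2)[OF assms(2)] by (simp_all add: ext[OF pd_add])

lemma C2_add:
  assumes "C2 f" "C2 g" shows "C2 (\<lambda>x. f x + g x)"
  using C2D[OF assms(1)] C2D[OF assms(2)]
  by (intro C2I; (subst C2_pd_add(2)[OF assms])?; (subst C2_pd_add(1)[OF assms])?)
     (auto intro: continuous_on_add)

lemma C2_pd_mult:
  assumes "C2 f" "C2 g"
  shows "pd i (\<lambda>x. f x * g x) = (\<lambda>x. pd i f x * g x + f x * pd i g x)"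
    "pd j (pd i (\<lambda>x. f x * g x)) = (\<lambda>x. pd j (pd i f) x * g x + pd i f x * pd j g x
       + (pd j f x * pd i g x + f x * pd j (pd i g) x))"
proof -
  show *: "pd i (\<lambda>x. f x * g x) = (\<lambda>x. pd i f x * g x + f x * pd i g x)"
    using C2D(1,2)[OF assms(1)] C2D(1,2)[OF assms(2)] by (auto simp: pd_mult)
  show "pd j (pd i (\<lambda>x. f x * g x)) = (\<lambda>x. pd j (pd i f) x * g x + pd i f x * pd j g x
       + (pd j f x * pd i g x + f x * pd j (pd i g) x))"
    unfolding * using C2D(1,2)[OF assms(1)] C2D(1,2)[OF assms(2)]
    by (auto simp: pd_mult pd_add)
qed

lemma C2_mult:
  assumes "C2 f" "C2 g" shows "C2 (\<lambda>x. f x * g x)"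
proof (rule C2I)
  note d = C2D[OF assms(1)] C2D[OF assms(2)]
  show "(\<lambda>x. f x * g x) differentiable at x" for x using d by auto
  show "pd i (\<lambda>x. f x * g x) differentiable at x" for i x
    unfolding C2_pd_mult(1)[OF assms] using d by auto
  show "continuous_on UNIV (pd j (pd i (\<lambda>x. f x * g x)))" for i j
    unfolding C2_pd_mult(2)[OF assms]
    by (intro continuous_intros d C2_continuous assms)
qed

lemma pd_cmult: "C2 f \<Longrightarrow> pd i (\<lambda>x. c * f x) = (\<lambda>x. c * pd i f x)"
  using C2_pd_mult(1)[of "\<lambda>x. c" f i] by simp

lemma C2_cmult: "C2 f \<Longrightarrow> C2 (\<lambda>x. c * f x)"
  by (intro C2_mult) auto

lemma C2_sum: "(\<And>k. k \<in> I \<Longrightarrow> C2 (f k)) \<Longrightarrow> C2 (\<lambda>x. \<Sum>k\<in>I. f k x)"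
  by (induction I rule: infinite_finite_induct) (auto intro: C2_add)

lemma C2_prod: "(\<And>k. k \<in> I \<Longrightarrow> C2 (f k)) \<Longrightarrow> C2 (\<lambda>x. \<Prod>k\<in>I. f k x)"
  by (induction I rule: infinite_finite_induct) (auto intro: C2_mult)

lemma C2_power: "C2 f \<Longrightarrow> C2 (\<lambda>x. f x ^ k)"
  by (induction k) (auto intro: C2_mult)

lemma pd_sum:
  "(\<And>k. k \<in> I \<Longrightarrow> C2 (f k)) \<Longrightarrow> pd i (\<lambda>x. \<Sum>k\<in>I. f k x) = (\<lambda>x. \<Sum>k\<in>I. pd i (f k) x)"
  by (induction I rule: infinite_finite_induct) (auto simp: C2_pd_add(1) C2_sum)

lemma C2_pd_compose:
  assumes "C2 f" "\<And>v. (h has_real_derivative h' v) (at v)" "\<And>v. (h' has_real_derivative h'' v) (at v)"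
  shows "pd i (\<lambda>x. h (f x)) = (\<lambda>x. h' (f x) * pd i f x)"
    "pd j (pd i (\<lambda>x. h (f x))) = (\<lambda>x. h'' (f x) * pd j f x * pd i f x + h' (f x) * pd j (pd i f) x)"
    "(\<lambda>x. h' (f x) * pd i f x) differentiable (at x)"
    "(\<lambda>x. h (f x)) differentiable (at x)"
proof -
  note d = C2D[OF assms(1)]
  show *: "pd i (\<lambda>x. h (f x)) = (\<lambda>x. h' (f x) * pd i f x)"
    using pd_compose[OF d(1) assms(2)] by auto
  have c: "k differentiable (at v) \<Longrightarrow> (\<lambda>x. k (f x)) differentiable (at x)"
    if "v = f x" for k :: "real \<Rightarrow> real" and x v
    using differentiable_chain_at[of f x k] d that by (simp add: o_def)
  have h: "h differentiable (at v)" "h' differentiable (at v)" for v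
    using assms by (meson field_differentiable_def field_differentiable_imp_differentiable)+
  show "(\<lambda>x. h (f x)) differentiable (at x)" for x using c[OF refl h(1)] .
  have h': "(\<lambda>x. h' (f x)) differentiable (at x)" for x using c[OF refl h(2)] .
  show "(\<lambda>x. h' (f x) * pd i f x) differentiable (at x)" for x
    using h' d by auto
  show "pd j (pd i (\<lambda>x. h (f x))) = (\<lambda>x. h'' (f x) * pd j f x * pd i f x + h' (f x) * pd j (pd i f) x)"
    unfolding * using h' d by (auto simp: pd_mult pd_compose[OF d(1) assms(3)])
qed

lemma C2_compose:
  assumes "C2 f" "\<And>v. (h has_real_derivative h' v) (at v)" "\<And>v. (h' has_real_derivative h'' v) (at v)"
    and "continuous_on UNIV h''"
  shows "C2 (\<lambda>x. h (f x))"
proof (rule C2I)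
  note p = C2_pd_compose[OF assms(1-3)]
  show "(\<lambda>x. h (f x)) differentiable (at x)" for x by (rule p)
  show "pd i (\<lambda>x. h (f x)) differentiable at x" for i x unfolding p(1) by (rule p)
  have "continuous_on UNIV h'"
    using assms(3) DERIV_isCont continuous_at_imp_continuous_on by blast
  note c = continuous_on_compose2[OF this C2_continuous(1)[OF assms(1)]]
    continuous_on_compose2[OF assms(4) C2_continuous(1)[OF assms(1)]]
  show "continuous_on UNIV (pd j (pd i (\<lambda>x. h (f x))))" for i j
    unfolding p(2) by (intro continuous_intros c C2_continuous assms C2D(3)) auto
qed

lemma B_invariant_compose:
  "(\<And>k. k \<in> I \<Longrightarrow> B_invariant (f k)) \<Longrightarrow> B_invariant (\<lambda>x. \<Sum>k\<in>I. a k * f k x)"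
  "B_invariant g \<Longrightarrow> B_invariant (\<lambda>x. h (g x))"
  "B_invariant g \<Longrightarrow> B_invariant g' \<Longrightarrow> B_invariant (\<lambda>x. g x * g' x)"
  unfolding B_invariant_def by auto

section \<open>Laplacian, gradient form and generator\<close>

definition laplacian :: "(real ^ ('n::{finite,linorder}) \<Rightarrow> real) \<Rightarrow> (real, 'n) vec \<Rightarrow> real" where
  "laplacian f x = (\<Sum>i\<in>UNIV. pd i (pd i f) x)"

definition grad_inner :: "(real ^ ('n::{finite,linorder}) \<Rightarrow> real) \<Rightarrow> ((real, 'n) vec \<Rightarrow> real) \<Rightarrow> (real, 'n) vec \<Rightarrow> real" where
  "grad_inner f g x = (\<Sum>i\<in>UNIV. pd i f x * pd i g x)"

text \<open>Division by zero gives 0, so \<open>drift\<close> is total. Its values on the walls are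
  a mere convention, and \<open>gen_es\<close>, which relies on genuine quotients, assumes
  \<open>off_walls\<close>.\<close>

definition drift :: "real \<Rightarrow> real ^ ('n::{finite,linorder}) \<Rightarrow> (real, 'n) vec" where
  "drift \<nu> x = (\<chi> i. (\<Sum>j\<in>UNIV - {i}. 1 / (x $ i - x $ j) + 1 / (x $ i + x $ j)) + \<nu> / x $ i)"

text \<open>The generator of the rescaled process \<open>X / sqrt \<beta>\<close>, where \<open>\<sigma> = 1 / \<beta>\<close>.\<close>

definition gen :: "real \<Rightarrow> real \<Rightarrow> (real ^ ('n::{finite,linorder}) \<Rightarrow> real) \<Rightarrow> (real, 'n) vec \<Rightarrow> real" where
  "gen \<sigma> \<nu> f x = \<sigma> / 2 * laplacian f x + (\<Sum>i\<in>UNIV. drift \<nu> x $ i * pd i f x)"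

lemma gen_mult:
  assumes "C2 f" "C2 g"
  shows "gen \<sigma> \<nu> (\<lambda>x. f x * g x) x = f x * gen \<sigma> \<nu> g x + g x * gen \<sigma> \<nu> f x + \<sigma> * grad_inner f g x"
  unfolding gen_def laplacian_def grad_inner_def C2_pd_mult(2)[OF assms]
  unfolding C2_pd_mult(1)[OF assms]
  by (simp add: sum.distrib sum_distrib_left algebra_simps)

text \<open>The noise enters only through the factor \<sigma> of the second term. For
  \<open>h\<close> varying on the scale \<open>sqrt \<sigma>\<close> this term becomes of order one;
  that is how \<open>char_limit\<close> sees the variance.\<close>

lemma gen_compose:
  assumes "C2 f" "\<And>v. (h has_real_derivative h' v) (at v)" "\<And>v. (h' has_real_derivative h'' v) (at v)"
  shows "gen \<sigma> \<nu> (\<lambda>x. h (f x)) x = h' (f x) * gen \<sigma> \<nu> f x + \<sigma> / 2 * h'' (f x) * grad_inner f f x"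
  unfolding gen_def laplacian_def grad_inner_def C2_pd_compose(2)[OF assms]
  unfolding C2_pd_compose(1)[OF assms]
  by (simp add: sum.distrib sum_distrib_left algebra_simps)

lemma gen_sum:
  assumes "finite I" "\<And>k. k \<in> I \<Longrightarrow> C2 (f k)"
  shows "gen \<sigma> \<nu> (\<lambda>x. \<Sum>k\<in>I. a k * f k x) x = (\<Sum>k\<in>I. a k * gen \<sigma> \<nu> (f k) x)"
proof -
  have c: "k \<in> I \<Longrightarrow> C2 (\<lambda>x. a k * f k x)" for k using assms by (auto intro: C2_cmult)
  have p: "pd i (\<lambda>x. \<Sum>k\<in>I. a k * f k x) = (\<lambda>x. \<Sum>k\<in>I. a k * pd i (f k) x)" for i
    using assms by (subst pd_sum[OF c]) (auto simp: pd_cmult)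
  \<comment> \<open>Differentiability of the partial sums travels through the induction together
    with the formula, because \<open>pd_add\<close> asks for it.\<close>
  have d: "pd i (\<lambda>x. \<Sum>k\<in>J. a k * pd i (f k) x) x = (\<Sum>k\<in>J. a k * pd i (pd i (f k)) x) \<and>
      (\<lambda>x. \<Sum>k\<in>J. a k * pd i (f k) x) differentiable (at x)" if "J \<subseteq> I" for i J
    using finite_subset[OF that assms(1)] that
  proof (induction J rule: finite_induct)
    case (insert k J)
    have "pd i (f k) differentiable (at x)" using assms(2) insert.prems C2D(2) by blast
    then show ?case using insert by (auto simp: pd_add pd_mult)
  qed simp
  show ?thesis
    unfolding gen_def laplacian_def p using d[OF order_refl]
    by (simp add: sum_distrib_left sum_distrib_right sum.distrib algebra_simps)
       (simp add: sum.swap[of _ I])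
qed

section \<open>Boundedness of the generator on test functions\<close>

lemma sum_offdiag_swap:
  fixes g :: "'a::finite \<Rightarrow> 'a \<Rightarrow> real"
  shows "(\<Sum>i\<in>UNIV. \<Sum>j\<in>UNIV - {i}. g i j) = (\<Sum>i\<in>UNIV. \<Sum>j\<in>UNIV - {i}. g j i)"
proof -
  have e: "(\<Sum>i\<in>UNIV. \<Sum>j\<in>UNIV - {i}. h i j) = (\<Sum>i\<in>UNIV. \<Sum>j\<in>UNIV. if i \<noteq> j then h i j else 0)"
    for h :: "'a \<Rightarrow> 'a \<Rightarrow> real"
    by (rule sum.cong[OF refl], rule sum.mono_neutral_cong_left) auto
  show ?thesis
    unfolding e by (subst sum.swap) (intro sum.cong refl, auto)
qed

text \<open>Averaging the pair \<open>(i, j)\<close> with \<open>(j, i)\<close> turns the singular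
  terms into difference quotients of \<open>p\<close>. For the gradient of an invariant function
  their numerators vanish on the walls.\<close>

lemma drift_sum:
  fixes x :: "(real, 'n::{finite,linorder}) vec"
  shows "(\<Sum>i\<in>UNIV. drift \<nu> x $ i * p i) =
    1/2 * (\<Sum>i\<in>UNIV. \<Sum>j\<in>UNIV - {i}. (p i - p j) / (x $ i - x $ j) + (p i + p j) / (x $ i + x $ j))
      + \<nu> * (\<Sum>i\<in>UNIV. p i / x $ i)"
proof -
  let ?g = "\<lambda>i j. (1 / (x $ i - x $ j) + 1 / (x $ i + x $ j)) * p i"
  have "(\<Sum>i\<in>UNIV. drift \<nu> x $ i * p i) =
      (\<Sum>i\<in>UNIV. \<Sum>j\<in>UNIV - {i}. ?g i j) + \<nu> * (\<Sum>i\<in>UNIV. p i / x $ i)"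
    by (simp add: drift_def distrib_right sum.distrib sum_distrib_left sum_distrib_right)
  also have "(\<Sum>i\<in>UNIV. \<Sum>j\<in>UNIV - {i}. ?g i j) =
      1/2 * ((\<Sum>i\<in>UNIV. \<Sum>j\<in>UNIV - {i}. ?g i j) + (\<Sum>i\<in>UNIV. \<Sum>j\<in>UNIV - {i}. ?g j i))"
    using sum_offdiag_swap[of ?g] by simp
  also have "(\<Sum>i\<in>UNIV. \<Sum>j\<in>UNIV - {i}. ?g i j) + (\<Sum>i\<in>UNIV. \<Sum>j\<in>UNIV - {i}. ?g j i) =
      (\<Sum>i\<in>UNIV. \<Sum>j\<in>UNIV - {i}. (p i - p j) / (x $ i - x $ j) + (p i + p j) / (x $ i + x $ j))"
  proof -
    have "?g i j + ?g j i = (p i - p j) / (x $ i - x $ j) + (p i + p j) / (x $ i + x $ j)" for i j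
    proof -
      have "1 / (x $ j - x $ i) = - (1 / (x $ i - x $ j))"
        by (metis minus_diff_eq minus_divide_right)
      then show ?thesis by (simp add: add.commute algebra_simps diff_divide_distrib add_divide_distrib)
    qed
    then show ?thesis by (simp add: sum.distrib[symmetric])
  qed
  finally show ?thesis .
qed

lemma pd_transfer:
  fixes f :: "(real, 'n::{finite,linorder}) vec \<Rightarrow> real"
  assumes "f differentiable (at y)" "\<And>h. f (x + h *\<^sub>R axis i 1) = f (y + h *\<^sub>R (c *\<^sub>R axis j 1))"
  shows "pd i f x = c * pd j f y"
proof (rule pd_eqI)
  have "((\<lambda>h. f (y + h *\<^sub>R (c *\<^sub>R axis j 1))) has_real_derivative
      (\<Sum>k\<in>UNIV. (c *\<^sub>R axis j 1 :: (real,'n) vec) $ k * pd k f y)) (at 0)"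
    by (rule has_derivative_line[OF has_derivative_pd[OF assms(1)]])
  also have "(\<Sum>k\<in>UNIV. (c *\<^sub>R axis j 1 :: (real,'n) vec) $ k * pd k f y) = c * pd j f y"
    by (simp add: axis_def if_distrib if_distribR cong: if_cong)
  finally show "((\<lambda>h. f (x + h *\<^sub>R axis i 1)) has_real_derivative c * pd j f y) (at 0)"
    using assms(2) by simp
qed

lemma B_invariant_signed_perm:
  assumes "B_invariant f" "p permutes UNIV" "\<And>i. s i = 1 \<or> s i = -1"
  shows "f (\<chi> i. s i * x $ p i) = f x"
proof -
  have "f (\<chi> i. s i * (\<chi> i. x $ p i) $ i) = f (\<chi> i. x $ p i)"
    using assms unfolding B_invariant_def by blast
  also have "\<dots> = f x" using assms unfolding B_invariant_def by blast
  finally show ?thesis by simp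
qed

text \<open>Differentiate the invariance of \<open>f\<close> under a signed permutation along a
  coordinate line.\<close>

lemma pd_B_invariant:
  fixes f :: "(real, 'n::{finite,linorder}) vec \<Rightarrow> real"
  assumes "C2 f" "B_invariant f" "p permutes UNIV" "\<And>i. s i = 1 \<or> s i = -1"
  shows "pd (p i) f x = s i * pd i f (\<chi> k. s k * x $ p k)"
proof (rule pd_transfer)
  show "f differentiable at (\<chi> k. s k * x $ p k)" using C2D assms(1) by blast
  fix h
  have "(\<chi> k. s k * x $ p k) + h *\<^sub>R s i *\<^sub>R axis i 1 = (\<chi> k. s k * (x + h *\<^sub>R axis (p i) 1) $ p k)"
    using inj_eq[OF permutes_inj[OF assms(3)]] by (simp add: vec_eq_iff axis_def distrib_left)
  then show "f (x + h *\<^sub>R axis (p i) 1) = f ((\<chi> k. s k * x $ p k) + h *\<^sub>R s i *\<^sub>R axis i 1)"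
    using B_invariant_signed_perm[OF assms(2-4), where x = "x + h *\<^sub>R axis (p i) 1"] by simp
qed

lemma pd_eq_0_outside:
  fixes f :: "(real, 'n::{finite,linorder}) vec \<Rightarrow> real"
  assumes "closed K" "\<And>x. x \<notin> K \<Longrightarrow> f x = 0" "x \<notin> K"
  shows "pd i f x = 0"
proof (rule pd_eqI)
  have "open ((\<lambda>h. x + h *\<^sub>R axis i (1::real)) -` (- K))"
    using assms(1) by (intro open_vimage) (auto intro!: continuous_intros)
  then show "((\<lambda>h. f (x + h *\<^sub>R axis i 1)) has_real_derivative 0) (at 0)"
    by (rule has_field_derivative_transform_within_open[where f = "\<lambda>_. 0", rotated])
       (use assms in auto)
qed

lemma bounded_compact_support:
  fixes g :: "(real, 'n::{finite,linorder}) vec \<Rightarrow> real"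
  assumes "compact K" "\<And>x. x \<notin> K \<Longrightarrow> g x = 0" "continuous_on UNIV g"
  shows "\<exists>B\<ge>0. \<forall>x. \<bar>g x\<bar> \<le> B"
proof -
  have "compact (g ` K)"
    using assms by (auto intro: compact_continuous_image continuous_on_subset)
  then obtain B where "\<forall>y\<in>g ` K. norm y \<le> B" "B > 0"
    using compact_imp_bounded bounded_pos by blast
  then show ?thesis using assms(2) by (intro exI[of _ B]) (force simp: less_imp_le)
qed

text \<open>Compact support bounds \<open>f\<close> and its derivatives of order one and two; the
  Lipschitz estimate is the mean value inequality. Summing all these bounds yields a single
  constant.\<close>

lemma test_fun_pd_bounds:
  fixes f :: "(real, 'n::{finite,linorder}) vec \<Rightarrow> real"
  assumes "test_fun f"
  obtains B where "B \<ge> 0" "\<And>x. \<bar>f x\<bar> \<le> B" "\<And>i x. \<bar>pd i f x\<bar> \<le> B" "\<And>i j x. \<bar>pd i (pd j f) x\<bar> \<le> B"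
    "\<And>i x y. \<bar>pd i f x - pd i f y\<bar> \<le> B * norm (x - y)"
proof -
  obtain K where K: "compact K" "\<And>x. x \<notin> K \<Longrightarrow> f x = 0" and C2: "C2 f"
    using assms by (auto simp: test_fun_def)
  note z1 = pd_eq_0_outside[OF compact_imp_closed[OF K(1)] K(2)]
  note z2 = pd_eq_0_outside[OF compact_imp_closed[OF K(1)] z1]
  obtain B0 where B0: "B0 \<ge> 0" "\<And>x. \<bar>f x\<bar> \<le> B0"
    using bounded_compact_support[OF K C2_continuous(1)[OF C2]] by blast
  have "\<forall>i. \<exists>B\<ge>0. \<forall>x. \<bar>pd i f x\<bar> \<le> B"
    using bounded_compact_support[OF K(1) z1 C2_continuous(2)[OF C2]] by blast
  then obtain B1 where B1: "\<And>i. B1 i \<ge> 0" "\<And>i x. \<bar>pd i f x\<bar> \<le> B1 i" by metis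
  have "\<forall>i j. \<exists>B\<ge>0. \<forall>x. \<bar>pd i (pd j f) x\<bar> \<le> B"
    using bounded_compact_support[OF K(1) z2 C2D(3)[OF C2]] by blast
  then obtain B2 where B2: "\<And>i j. B2 i j \<ge> 0" "\<And>i j x. \<bar>pd i (pd j f) x\<bar> \<le> B2 i j" by metis
  define B where "B = B0 + (\<Sum>i\<in>UNIV. B1 i) + (\<Sum>i\<in>UNIV. \<Sum>j\<in>UNIV. B2 j i)"
  have n: "0 \<le> (\<Sum>i\<in>UNIV. B1 i)" "0 \<le> (\<Sum>i\<in>UNIV. \<Sum>j\<in>UNIV. B2 j i)"
    by (auto intro!: sum_nonneg B1 B2)
  have b1: "B1 i \<le> (\<Sum>i\<in>UNIV. B1 i)" for i by (intro member_le_sum B1) auto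
  have b2': "(\<Sum>j\<in>UNIV. B2 j i) \<le> (\<Sum>i\<in>UNIV. \<Sum>j\<in>UNIV. B2 j i)" for i
    by (rule member_le_sum[where f = "\<lambda>i. \<Sum>j\<in>UNIV. B2 j i"]) (auto intro!: sum_nonneg B2)
  have b2: "B2 j i \<le> (\<Sum>j\<in>UNIV. B2 j i)" for i j
    by (rule member_le_sum[where f = "\<lambda>j. B2 j i"]) (auto intro!: B2)
  have "\<bar>pd i f x - pd i f y\<bar> \<le> B * norm (x - y)" for i x y
  proof -
    have "norm (pd i f x - pd i f y) \<le> B * norm (x - y)"
    proof (rule differentiable_bound[of UNIV _ "\<lambda>x v. \<Sum>j\<in>UNIV. v $ j * pd j (pd i f) x"])
      show "(pd i f has_derivative (\<lambda>v. \<Sum>j\<in>UNIV. v $ j * pd j (pd i f) x)) (at x within UNIV)" for x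
        using has_derivative_pd[OF C2D(2)[OF C2]] by simp
      show "onorm (\<lambda>v :: (real,'n) vec. \<Sum>j\<in>UNIV. v $ j * pd j (pd i f) x) \<le> B" for x
      proof (rule onorm_le)
        fix v :: "(real,'n) vec"
        have "\<bar>\<Sum>j\<in>UNIV. v $ j * pd j (pd i f) x\<bar> \<le> (\<Sum>j\<in>UNIV. norm v * B2 j i)"
          using B2 by (intro order_trans[OF sum_abs] sum_mono)
            (auto simp: abs_mult intro!: mult_mono component_le_norm_cart)
        also have "\<dots> = (\<Sum>j\<in>UNIV. B2 j i) * norm v" by (simp add: sum_distrib_left mult.commute)
        also have "\<dots> \<le> B * norm v"
          using b2'[of i] n B0 by (intro mult_right_mono) (auto simp: B_def)
        finally show "norm (\<Sum>j\<in>UNIV. v $ j * pd j (pd i f) x) \<le> B * norm v" by simp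
      qed
    qed auto
    then show ?thesis by simp
  qed
  moreover have "B \<ge> 0" using n B0 by (simp add: B_def)
  moreover have "\<bar>f x\<bar> \<le> B" for x
    using n B0(2)[of x] by (simp add: B_def)
  moreover have "\<bar>pd i f x\<bar> \<le> B" for i x
    using n B0 b1[of i] B1(2)[of i x] by (simp add: B_def)
  moreover have "\<bar>pd i (pd j f) x\<bar> \<le> B" for i j x
    using n B0 b2[of i j] b2'[of j] B2(2)[of i j x] by (simp add: B_def)
  ultimately show ?thesis using that by blast
qed

text \<open>The unbounded drift does no harm: the reflection in a wall moves \<open>x\<close> by a
  multiple of the denominator belonging to that wall, and by invariance the numerator is the change
  of one partial derivative under this move, hence controlled by its Lipschitz constant.\<close>

lemma gen_bounded:
  fixes f :: "(real, 'n::{finite,linorder}) vec \<Rightarrow> real"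
  assumes "test_fun f"
  shows "\<exists>C. \<forall>x. \<bar>gen \<sigma> \<nu> f x\<bar> \<le> C"
proof -
  have C2: "C2 f" and inv: "B_invariant f" using assms by (auto simp: test_fun_def)
  obtain B where B: "B \<ge> 0" "\<And>i j x. \<bar>pd i (pd j f) x\<bar> \<le> B"
    "\<And>i x y. \<bar>pd i f x - pd i f y\<bar> \<le> B * norm (x - y)"
    using test_fun_pd_bounds[OF assms] by metis
  have m: "\<bar>(pd i f x - pd j f x) / (x $ i - x $ j)\<bar> \<le> 2 * B" if "i \<noteq> j" for i j x
  \<comment> \<open>On the wall the quotient is 0 by convention.\<close>
  proof (cases "x $ i = x $ j")
    case False
    let ?y = "\<chi> k. 1 * x $ Transposition.transpose i j k"
    have "pd i f x = pd j f ?y"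
      using pd_B_invariant[OF C2 inv permutes_swap_id[of i UNIV j], of "\<lambda>_. 1" j x] by simp
    then have *: "\<bar>pd i f x - pd j f x\<bar> \<le> B * norm (?y - x)" using B(3)[of j ?y x] by simp
    have "norm (?y - x) \<le> (\<Sum>k\<in>UNIV. \<bar>(?y - x) $ k\<bar>)" by (rule norm_le_l1_cart)
    also have "\<dots> = (\<Sum>k\<in>{i,j}. \<bar>(?y - x) $ k\<bar>)"
      by (intro sum.mono_neutral_right) (auto simp: Transposition.transpose_def)
    also have "\<dots> = 2 * \<bar>x $ i - x $ j\<bar>" using that by simp
    finally have "norm (?y - x) \<le> 2 * \<bar>x $ i - x $ j\<bar>" .
    from order_trans[OF * mult_left_mono[OF this B(1)]] show ?thesis
      using False by (simp add: abs_divide pos_divide_le_eq mult_ac)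
  qed (simp add: B)
  have p: "\<bar>(pd i f x + pd j f x) / (x $ i + x $ j)\<bar> \<le> 2 * B" if "i \<noteq> j" for i j x
  proof (cases "x $ i + x $ j = 0")
    case False
    \<comment> \<open>The reflection in the wall \<open>x_i + x_j = 0\<close> exchanges the two
      coordinates and changes both signs.\<close>
    define s where "s k = (if k = i \<or> k = j then -1 else 1 :: real)" for k
    let ?y = "\<chi> k. s k * x $ Transposition.transpose i j k"
    have "pd i f x = - pd j f ?y"
      using pd_B_invariant[OF C2 inv permutes_swap_id[of i UNIV j], of s j x] by (simp add: s_def)
    then have *: "\<bar>pd i f x + pd j f x\<bar> \<le> B * norm (x - ?y)" using B(3)[of j x ?y] by simp
    have "norm (x - ?y) \<le> (\<Sum>k\<in>UNIV. \<bar>(x - ?y) $ k\<bar>)" by (rule norm_le_l1_cart)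
    also have "\<dots> = (\<Sum>k\<in>{i,j}. \<bar>(x - ?y) $ k\<bar>)"
      by (intro sum.mono_neutral_right) (auto simp: Transposition.transpose_def s_def)
    also have "\<dots> = 2 * \<bar>x $ i + x $ j\<bar>" using that by (simp add: s_def add.commute)
    finally have "norm (x - ?y) \<le> 2 * \<bar>x $ i + x $ j\<bar>" .
    from order_trans[OF * mult_left_mono[OF this B(1)]] show ?thesis
      using False by (simp add: abs_divide pos_divide_le_eq mult_ac)
  qed (simp add: B)
  have o: "\<bar>pd i f x / x $ i\<bar> \<le> B" for i x
  proof (cases "x $ i = 0")
    case False
    define s where "s k = (if k = i then -1 else 1 :: real)" for k
    let ?y = "\<chi> k. s k * x $ id k"
    have "pd i f x = - pd i f ?y"
      using pd_B_invariant[OF C2 inv permutes_id, of s i x] by (simp add: s_def)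
    then have *: "2 * \<bar>pd i f x\<bar> \<le> B * norm (x - ?y)" using B(3)[of i x ?y] by simp
    have "norm (x - ?y) \<le> (\<Sum>k\<in>UNIV. \<bar>(x - ?y) $ k\<bar>)" by (rule norm_le_l1_cart)
    also have "\<dots> = (\<Sum>k\<in>{i}. \<bar>(x - ?y) $ k\<bar>)"
      by (intro sum.mono_neutral_right) (auto simp: s_def)
    also have "\<dots> = 2 * \<bar>x $ i\<bar>" by (simp add: s_def)
    finally have "norm (x - ?y) \<le> 2 * \<bar>x $ i\<bar>" .
    from order_trans[OF * mult_left_mono[OF this B(1)]] show ?thesis
      using False by (simp add: abs_divide pos_divide_le_eq mult_ac)
  qed (simp add: B)
  define N where "N = real CARD('n)"
  have "\<bar>gen \<sigma> \<nu> f x\<bar> \<le> \<bar>\<sigma>\<bar> / 2 * (N * B) + (1/2 * (N * (N * (2 * B + 2 * B))) + \<bar>\<nu>\<bar> * (N * B))" for x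
  proof -
    have a: "\<bar>laplacian f x\<bar> \<le> N * B"
      unfolding laplacian_def N_def
      by (rule order_trans[OF sum_abs], rule order_trans[OF sum_bounded_above[of UNIV _ B]]) (use B in auto)
    have c: "\<bar>\<Sum>i\<in>UNIV. pd i f x / x $ i\<bar> \<le> N * B"
      unfolding N_def
      by (rule order_trans[OF sum_abs], rule order_trans[OF sum_bounded_above[of UNIV _ B]]) (use o in auto)
    have "\<bar>\<Sum>i\<in>UNIV. \<Sum>j\<in>UNIV - {i}. (pd i f x - pd j f x) / (x $ i - x $ j) + (pd i f x + pd j f x) / (x $ i + x $ j)\<bar>
       \<le> (\<Sum>i::'n\<in>UNIV. \<Sum>j\<in>UNIV - {i}. 2 * B + 2 * B)"
      by (intro order_trans[OF sum_abs] sum_mono order_trans[OF abs_triangle_ineq] add_mono m p) auto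
    also have "\<dots> \<le> (\<Sum>i::'n\<in>UNIV. \<Sum>j::'n\<in>UNIV. 2 * B + 2 * B)"
      using B by (intro sum_mono sum_mono2) auto
    finally have b: "\<bar>\<Sum>i\<in>UNIV. \<Sum>j\<in>UNIV - {i}. (pd i f x - pd j f x) / (x $ i - x $ j) + (pd i f x + pd j f x) / (x $ i + x $ j)\<bar>
       \<le> N * (N * (2 * B + 2 * B))" by (simp add: N_def)
    show ?thesis
      unfolding gen_def drift_sum
      by (intro order_trans[OF abs_triangle_ineq] add_mono; unfold abs_mult; intro mult_mono)
         (use a b c in auto)
  qed
  then show ?thesis by blast
qed

lemma gen_measurable:
  fixes f :: "(real, 'n::{finite,linorder}) vec \<Rightarrow> real"
  assumes "C2 f"
  shows "gen \<sigma> \<nu> f \<in> borel_measurable borel"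
proof -
  have [measurable]: "pd i (pd j f) \<in> borel_measurable borel" "pd i f \<in> borel_measurable borel" for i j
    using C2D(3)[OF assms] C2_continuous(2)[OF assms] by (auto intro: borel_measurable_continuous_onI)
  have [measurable]: "(\<lambda>x :: (real,'n) vec. x $ i) \<in> borel_measurable borel" for i
    by (intro borel_measurable_continuous_onI continuous_intros)
  show ?thesis
    unfolding gen_def laplacian_def drift_def vec_lambda_beta by measurable
qed

section \<open>From the martingale problem to Dynkin's formula\<close>

text \<open>Times are rounded down to the grid of mesh \<open>1 / (n + 1)\<close>: the rounded
  process takes countably many time values, so it is jointly measurable, and by path continuity it
  converges to \<open>X\<close>.\<close>

lemma joint_measurable_continuous_paths:
  fixes X :: "real \<Rightarrow> 'w \<Rightarrow> (real, 'n::{finite,linorder}) vec"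
  assumes "\<And>u. u \<ge> 0 \<Longrightarrow> X u \<in> borel_measurable M"
    and "\<And>\<omega>. \<omega> \<in> space M \<Longrightarrow> continuous_on {0..} (\<lambda>u. X u \<omega>)"
  shows "(\<lambda>z. X (fst z) (snd z)) \<in> borel_measurable (restrict_space lborel {0..t} \<Otimes>\<^sub>M M)"
proof (rule borel_measurable_LIMSEQ_metric)
  let ?R = "restrict_space lborel {0..t} \<Otimes>\<^sub>M M"
  define g where "g n z = nat \<lfloor>real (Suc n) * fst z\<rfloor>" for n and z :: "real \<times> 'w"
  have [measurable]: "fst \<in> borel_measurable ?R"
  proof -
    have "(\<lambda>u::real. u) \<in> measurable (restrict_space lborel {0..t}) borel"
      by (rule measurable_restrict_space1) simp
    from measurable_compose[OF measurable_fst this] show ?thesis .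
  qed
  show "(\<lambda>z. X (real (g n z) / real (Suc n)) (snd z)) \<in> borel_measurable ?R" for n
  proof (rule measurable_compose_countable[where f = "\<lambda>k z. X (real k / real (Suc n)) (snd z)" and g = "g n"])
    show "g n \<in> measurable ?R (count_space UNIV)" unfolding g_def by measurable
    show "(\<lambda>z. X (real k / real (Suc n)) (snd z)) \<in> borel_measurable ?R" for k
      by (rule measurable_compose[OF measurable_snd assms(1)]) simp
  qed
  fix z assume z: "z \<in> space ?R"
  then have u: "fst z \<ge> 0" and w: "snd z \<in> space M"
    by (auto simp: space_pair_measure)
  have lim: "(\<lambda>n. real (g n z) / real (Suc n)) \<longlonglongrightarrow> fst z"
  proof (rule real_tendsto_sandwich[where h = "\<lambda>_. fst z" and f = "\<lambda>n. fst z - 1 / real (Suc n)"])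
    have r: "real (g n z) = of_int \<lfloor>real (Suc n) * fst z\<rfloor>" for n
      using u by (simp add: g_def)
    show "\<forall>\<^sub>F n in sequentially. real (g n z) / real (Suc n) \<le> fst z"
      by (intro always_eventually allI) (simp add: r pos_divide_le_eq mult.commute del: of_nat_Suc)
    show "\<forall>\<^sub>F n in sequentially. fst z - 1 / real (Suc n) \<le> real (g n z) / real (Suc n)"
    proof (intro always_eventually allI)
      fix n
      have "real (Suc n) * fst z - 1 \<le> real (g n z)" unfolding r by linarith
      then have "(real (Suc n) * fst z - 1) / real (Suc n) \<le> real (g n z) / real (Suc n)"
        by (intro divide_right_mono) auto
      then show "fst z - 1 / real (Suc n) \<le> real (g n z) / real (Suc n)"
        by (simp add: diff_divide_distrib del: of_nat_Suc)
    qed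
    have "(\<lambda>n. fst z - 1 / real (Suc n)) \<longlonglongrightarrow> fst z - 0"
      by (intro tendsto_intros LIMSEQ_Suc lim_1_over_n)
    then show "(\<lambda>n. fst z - 1 / real (Suc n)) \<longlonglongrightarrow> fst z" by simp
  qed auto
  show "(\<lambda>n. X (real (g n z) / real (Suc n)) (snd z)) \<longlonglongrightarrow> X (fst z) (snd z)"
    by (rule continuous_on_tendsto_compose[OF assms(2)[OF w] lim]) (use u in auto)
qed

text \<open>What the analysis takes from the martingale problem: Dynkin's formula in integrated
  form, with the time integral written over the product space. The bound
  \<open>\<sigma> \<le> 1\<close> makes later constants uniform in \<sigma>.\<close>

locale dynkin_process = prob_space M for M :: "'w measure" +
  fixes \<sigma> \<nu> :: real and x0 :: "(real, 'n::{finite,linorder}) vec"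
    and X :: "real \<Rightarrow> 'w \<Rightarrow> (real, 'n) vec"
  assumes sigma: "0 < \<sigma>" "\<sigma> \<le> 1" and nu: "0 < \<nu>"
    and X_measurable: "\<And>u. 0 \<le> u \<Longrightarrow> X u \<in> borel_measurable M"
    and X_continuous: "\<And>\<omega>. \<omega> \<in> space M \<Longrightarrow> continuous_on {0..} (\<lambda>u. X u \<omega>)"
    and X_chamber: "\<And>u \<omega>. 0 \<le> u \<Longrightarrow> \<omega> \<in> space M \<Longrightarrow> X u \<omega> \<in> chamberB"
    and X_start: "\<And>\<omega>. \<omega> \<in> space M \<Longrightarrow> X 0 \<omega> = x0"
    and dynkin_test: "\<And>f t. test_fun f \<Longrightarrow> 0 \<le> t \<Longrightarrow> expectation (\<lambda>\<omega>. f (X t \<omega>)) =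
      f x0 + (\<integral>z. gen \<sigma> \<nu> f (X (fst z) (snd z)) \<partial>(restrict_space lborel {0..t} \<Otimes>\<^sub>M M))"

abbreviation "time_space t M \<equiv> restrict_space lborel {0..t::real} \<Otimes>\<^sub>M M"

lemma (in prob_space) pair_sigma_finite_time: "pair_sigma_finite (restrict_space lborel {0..t::real}) M"
proof -
  interpret R: finite_measure "restrict_space lborel {0..t}"
    by (rule finite_measureI) (simp add: emeasure_restrict_space space_restrict_space emeasure_lborel_Icc_eq)
  show ?thesis by unfold_locales
qed

lemma (in prob_space) finite_measure_time: "finite_measure (time_space t M)"
proof -
  interpret R: finite_measure "restrict_space lborel {0..t}"
    by (rule finite_measureI) (simp add: emeasure_restrict_space space_restrict_space emeasure_lborel_Icc_eq)
  show ?thesis by (rule finite_measure_pair_measure) unfold_locales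
qed

section \<open>Brownian scaling\<close>

context
  fixes f :: "(real, 'n::{finite,linorder}) vec \<Rightarrow> real" and c :: real
begin

lemma pd_scale:
  assumes "\<And>x. f differentiable (at x)"
  shows "pd i (\<lambda>x. f (c *\<^sub>R x)) = (\<lambda>x. c * pd i f (c *\<^sub>R x))"
proof
  fix x
  have "((\<lambda>h. f (c *\<^sub>R x + h *\<^sub>R axis i 1)) has_real_derivative pd i f (c *\<^sub>R x)) (at (c * 0))"
    using has_pd[OF assms, of "c *\<^sub>R x" i] by simp
  from DERIV_chain2[OF this DERIV_cmult[OF DERIV_ident]]
  show "pd i (\<lambda>x. f (c *\<^sub>R x)) x = c * pd i f (c *\<^sub>R x)"
    by (intro pd_eqI) (simp add: algebra_simps)
qed

lemma differentiable_scale: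
  assumes "\<And>x. f differentiable (at x)"
  shows "(\<lambda>x. f (c *\<^sub>R x)) differentiable (at x)"
  using differentiable_chain_at[of "\<lambda>x. c *\<^sub>R x" x f] assms by (simp add: o_def)

end

lemma pd_pd_scale:
  assumes "C2 f"
  shows "pd j (pd i (\<lambda>x. f (c *\<^sub>R x))) = (\<lambda>x. c * (c * pd j (pd i f) (c *\<^sub>R x)))"
proof -
  note d = C2D[OF assms]
  show ?thesis
    unfolding pd_scale[OF d(1)]
    using differentiable_scale[OF d(2)]
    by (auto simp: pd_mult pd_scale[OF d(2)])
qed

lemma C2_scale:
  fixes f :: "(real, 'n::{finite,linorder}) vec \<Rightarrow> real"
  assumes "C2 f"
  shows "C2 (\<lambda>x. f (c *\<^sub>R x))"
proof (rule C2I)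
  note d = C2D[OF assms]
  show "(\<lambda>x. f (c *\<^sub>R x)) differentiable at x" for x by (rule differentiable_scale) (rule d)
  show "pd i (\<lambda>x. f (c *\<^sub>R x)) differentiable at x" for i x
    unfolding pd_scale[OF d(1)] using differentiable_scale[OF d(2)] by auto
  have "continuous_on UNIV (\<lambda>x. pd j (pd i f) (c *\<^sub>R x))" for i j
    by (rule continuous_on_compose2[OF d(3)[of j i]]) (auto intro!: continuous_intros)
  then show "continuous_on UNIV (pd j (pd i (\<lambda>x. f (c *\<^sub>R x))))" for i j
    unfolding pd_pd_scale[OF assms] by (intro continuous_intros)
qed

lemma test_fun_scale:
  fixes f :: "(real, 'n::{finite,linorder}) vec \<Rightarrow> real"
  assumes "test_fun f" "c > 0"
  shows "test_fun (\<lambda>x. f (c *\<^sub>R x))"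
  unfolding test_fun_def
proof (intro conjI)
  show "C2 (\<lambda>x. f (c *\<^sub>R x))" using assms by (auto simp: test_fun_def intro: C2_scale)
  have inv: "B_invariant f" using assms by (auto simp: test_fun_def)
  have e: "c *\<^sub>R (\<chi> i. g i) = (\<chi> i. c * g i)" for g :: "'n \<Rightarrow> real" by (simp add: vec_eq_iff)
  show "B_invariant (\<lambda>x. f (c *\<^sub>R x))"
    unfolding B_invariant_def
  proof (intro conjI allI impI)
    fix p and x :: "(real, 'n) vec" assume "p permutes (UNIV :: 'n set)"
    then have "f (\<chi> i. (c *\<^sub>R x) $ p i) = f (c *\<^sub>R x)" using inv unfolding B_invariant_def by blast
    then show "f (c *\<^sub>R (\<chi> i. x $ p i)) = f (c *\<^sub>R x)" by (simp add: e)
  next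
    fix s :: "'n \<Rightarrow> real" and x :: "(real, 'n) vec" assume "\<forall>i. s i = 1 \<or> s i = (-1::real)"
    then have "f (\<chi> i. s i * (c *\<^sub>R x) $ i) = f (c *\<^sub>R x)" using inv unfolding B_invariant_def by blast
    then show "f (c *\<^sub>R (\<chi> i. s i * x $ i)) = f (c *\<^sub>R x)" by (simp add: e mult_ac)
  qed
  obtain K where K: "compact K" "\<And>x. x \<notin> K \<Longrightarrow> f x = 0" using assms by (auto simp: test_fun_def)
  have "compact ((\<lambda>x. (1 / c) *\<^sub>R x) ` K)" using K by (intro compact_scaling)
  moreover have "f (c *\<^sub>R x) = 0" if "x \<notin> (\<lambda>x. (1 / c) *\<^sub>R x) ` K" for x
  proof (rule K)
    show "c *\<^sub>R x \<notin> K"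
    proof
      assume "c *\<^sub>R x \<in> K"
      then have "(1 / c) *\<^sub>R (c *\<^sub>R x) \<in> (\<lambda>x. (1 / c) *\<^sub>R x) ` K" by (rule imageI)
      with that assms show False by simp
    qed
  qed
  ultimately show "\<exists>K. compact K \<and> (\<forall>x. x \<notin> K \<longrightarrow> f (c *\<^sub>R x) = 0)" by blast
qed

text \<open>Two derivatives produce the factor \<open>1 / \<beta>\<close>. In the drift one
  derivative and the homogeneity of degree -1 produce the same factor, which cancels the
  multiplicity \<beta>.\<close>

lemma besselB_gen_scale:
  assumes "C2 f" "\<beta> > 0"
  shows "besselB_gen (\<nu> * \<beta>) \<beta> (\<lambda>x. f ((1 / sqrt \<beta>) *\<^sub>R x)) x = gen (1 / \<beta>) \<nu> f ((1 / sqrt \<beta>) *\<^sub>R x)"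
proof -
  define c where "c = 1 / sqrt \<beta>"
  have c: "c > 0" "\<beta> * (c * c) = 1" "c * c = 1 / \<beta>" using assms by (auto simp: c_def)
  \<comment> \<open>Also true for \<open>u = 0\<close>, where both sides are 0; hence the two
    generators agree on the walls as well.\<close>
  have q: "\<beta> * (1 / u * (c * p)) = 1 / (c * u) * p" for u p
  proof -
    have "c / u = c * c * (1 / (c * u))" using c(1) by simp
    then have "\<beta> * (c / u * p) = \<beta> * (c * c) * (1 / (c * u) * p)" by (simp only: mult.assoc)
    then show ?thesis unfolding c(2) by (simp add: mult_ac)
  qed
  have k: "\<beta> * ((1 / (x $ i - x $ j) + 1 / (x $ i + x $ j)) * (c * p)) =
      (1 / (c * x $ i - c * x $ j) + 1 / (c * x $ i + c * x $ j)) * p" for i j p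
    using q[of "x $ i - x $ j" p] q[of "x $ i + x $ j" p]
    by (simp add: distrib_left distrib_right right_diff_distrib)
  have k1: "\<nu> * \<beta> * (1 / x $ i * (c * p)) = \<nu> / (c * x $ i) * p" for i p
  proof -
    have "\<nu> * \<beta> * (1 / x $ i * (c * p)) = \<nu> * (1 / (c * x $ i) * p)"
      by (simp only: mult.assoc q)
    then show ?thesis by simp
  qed
  have "besselB_gen (\<nu> * \<beta>) \<beta> (\<lambda>x. f (c *\<^sub>R x)) x = gen (1 / \<beta>) \<nu> f (c *\<^sub>R x)"
    unfolding besselB_gen_def pd_pd_scale[OF assms(1)]
    unfolding pd_scale[OF C2D(1)[OF assms(1)]] gen_def laplacian_def drift_def
    unfolding sum_distrib_left k k1
    by (simp add: distrib_right distrib_left sum.distrib sum_distrib_left sum_distrib_right c(3)[symmetric] mult_ac)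
  then show ?thesis by (simp add: c_def)
qed

lemma nat_filt_subalgebra:
  fixes X :: "real \<Rightarrow> 'w \<Rightarrow> (real, 'n::{finite,linorder}) vec"
  assumes "\<And>u. u \<ge> 0 \<Longrightarrow> X u \<in> borel_measurable M"
  shows "subalgebra M (nat_filt M X s)"
proof -
  have "(\<Union>u\<in>{0..s}. {X u -` A \<inter> space M | A. A \<in> sets borel}) \<subseteq> sets M"
    using assms by (auto intro: measurable_sets)
  then show ?thesis
    unfolding subalgebra_def nat_filt_def
    by (subst sets_measure_of) (auto simp: space_measure_of_conv intro!: sets.sigma_sets_subset dest: sets.sets_into_space)
qed

text \<open>The martingale identity between the times 0 and \<open>t\<close>, integrated with the
  tower property; Fubini then moves the time integral onto the product space.\<close>

lemma besselB_process_dynkin: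
  fixes X :: "real \<Rightarrow> 'w \<Rightarrow> (real, 'n::{finite,linorder}) vec"
  assumes "besselB_process M k1 k2 x X" "test_fun f" "0 \<le> t"
    and G: "\<And>y. \<bar>besselB_gen k1 k2 f y\<bar> \<le> C" "besselB_gen k1 k2 f \<in> borel_measurable borel"
  shows "(\<integral>\<omega>. f (X t \<omega>) \<partial>M) = f x + (\<integral>z. besselB_gen k1 k2 f (X (fst z) (snd z)) \<partial>time_space t M)"
proof -
  interpret prob_space M using assms by (auto simp: besselB_process_def)
  interpret P: pair_sigma_finite "restrict_space lborel {0..t::real}" M by (rule pair_sigma_finite_time)
  interpret F: finite_measure "time_space t M" by (rule finite_measure_time)
  have m: "\<And>u. u \<ge> 0 \<Longrightarrow> X u \<in> borel_measurable M"
    and co: "\<And>\<omega>. \<omega> \<in> space M \<Longrightarrow> continuous_on {0..} (\<lambda>u. X u \<omega>)"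
    and st: "\<And>\<omega>. \<omega> \<in> space M \<Longrightarrow> X 0 \<omega> = x"
    using assms(1) by (auto simp: besselB_process_def)
  let ?g = "besselB_gen k1 k2 f"
  let ?I = "\<lambda>\<omega>. LINT u:{0..t}|lborel. ?g (X u \<omega>)"
  have int: "integrable (time_space t M) (\<lambda>z. ?g (X (fst z) (snd z)))"
    by (rule F.integrable_const_bound[where B = C])
       (use G measurable_compose[OF joint_measurable_continuous_paths[OF m co, of t]] in auto)
  have I: "?I \<omega> = (\<integral>u. ?g (X u \<omega>) \<partial>restrict_space lborel {0..t})" for \<omega>
    unfolding set_lebesgue_integral_def by (subst integral_restrict_space) auto
  have int': "integrable (time_space t M) (\<lambda>(u, \<omega>). ?g (X u \<omega>))"
    unfolding case_prod_unfold using int .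
  have iI: "integrable M ?I" unfolding I by (rule P.integrable_snd[OF int'])
  have eI: "integral\<^sup>L M ?I = (\<integral>z. ?g (X (fst z) (snd z)) \<partial>time_space t M)"
    unfolding I P.integral_snd[OF int'] case_prod_unfold ..
  obtain B where B: "\<And>x. \<bar>f x\<bar> \<le> B" using test_fun_pd_bounds[OF assms(2)] by metis
  have "f \<in> borel_measurable borel"
    using assms(2) by (auto simp: test_fun_def intro: borel_measurable_continuous_onI C2_continuous)
  then have i1: "integrable M (\<lambda>\<omega>. f (X t \<omega>))"
    by (intro integrable_const_bound[where B = B]) (use B measurable_compose[OF m[OF assms(3)]] in auto)
  define Y where "Y t = (\<lambda>\<omega>. f (X t \<omega>) - (LINT u:{0..t}|lborel. ?g (X u \<omega>)))" for t
  have iY: "integrable M (Y t)" unfolding Y_def using i1 iI by (rule Bochner_Integration.integrable_diff)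
  interpret S: sigma_finite_subalgebra M "nat_filt M X 0"
    by (rule finite_measure_subalgebra_is_sigma_finite)
       (unfold_locales, rule nat_filt_subalgebra[OF m])
  have ae: "AE \<omega> in M. real_cond_exp M (nat_filt M X 0) (Y t) \<omega> = Y 0 \<omega>"
    using assms(1-3) unfolding besselB_process_def Let_def Y_def by blast
  have "integral\<^sup>L M (Y t) = integral\<^sup>L M (real_cond_exp M (nat_filt M X 0) (Y t))"
    using S.real_cond_exp_int(2)[OF iY] by simp
  also have "\<dots> = (\<integral>\<omega>. f x \<partial>M)"
  proof (rule integral_cong_AE)
    have y0: "Y 0 \<omega> = f x" if "\<omega> \<in> space M" for \<omega>
    proof -
      \<comment> \<open>The time integral over the single point 0 vanishes, so \<open>Y 0\<close> is
        the constant \<open>f x\<close>.\<close>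
      have "AE u in lborel. u \<noteq> (0::real)" by (rule AE_lborel_singleton)
      then have "(LINT u:{0..0}|lborel. ?g (X u \<omega>)) = 0"
        unfolding set_lebesgue_integral_def
        by (intro integral_eq_zero_AE) (erule eventually_mono, simp add: indicator_def)
      then show ?thesis unfolding Y_def using st[OF that] by simp
    qed
    show "AE \<omega> in M. real_cond_exp M (nat_filt M X 0) (Y t) \<omega> = f x"
      using ae AE_space by eventually_elim (simp add: y0)
  qed auto
  also have "\<dots> = f x" by (simp add: prob_space)
  finally have "integral\<^sup>L M (Y t) = f x" .
  moreover have "integral\<^sup>L M (Y t) = (\<integral>\<omega>. f (X t \<omega>) \<partial>M) - integral\<^sup>L M ?I"
    unfolding Y_def using i1 iI by (rule Bochner_Integration.integral_diff)
  ultimately show ?thesis using eI by simp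
qed

lemma chamberB_scale: "x \<in> chamberB \<Longrightarrow> 0 \<le> c \<Longrightarrow> c *\<^sub>R x \<in> chamberB"
  by (auto simp: chamberB_def mult_left_mono)

lemma besselB_process_scaled:
  fixes X :: "real \<Rightarrow> 'w \<Rightarrow> (real, 'n::{finite,linorder}) vec"
  assumes "besselB_process M (\<nu> * \<beta>) \<beta> x X" "\<beta> \<ge> 1" "\<nu> > 0"
  shows "dynkin_process M (1 / \<beta>) \<nu> ((1 / sqrt \<beta>) *\<^sub>R x) (\<lambda>t \<omega>. (1 / sqrt \<beta>) *\<^sub>R X t \<omega>)"
proof -
  interpret prob_space M using assms by (auto simp: besselB_process_def)
  have m: "\<And>u. u \<ge> 0 \<Longrightarrow> X u \<in> borel_measurable M"
    and co: "\<And>\<omega>. \<omega> \<in> space M \<Longrightarrow> continuous_on {0..} (\<lambda>u. X u \<omega>)"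
    and ch: "\<And>u \<omega>. \<omega> \<in> space M \<Longrightarrow> u \<ge> 0 \<Longrightarrow> X u \<omega> \<in> chamberB"
    and st: "\<And>\<omega>. \<omega> \<in> space M \<Longrightarrow> X 0 \<omega> = x"
    using assms(1) by (auto simp: besselB_process_def)
  show ?thesis
  proof unfold_locales
    fix f :: "(real,'n) vec \<Rightarrow> real" and t :: real
    assume f: "test_fun f" and t: "0 \<le> t"
    let ?f = "\<lambda>x. f ((1 / sqrt \<beta>) *\<^sub>R x)"
    have C2: "C2 f" using f by (simp add: test_fun_def)
    have e: "besselB_gen (\<nu> * \<beta>) \<beta> ?f = (\<lambda>x. gen (1 / \<beta>) \<nu> f ((1 / sqrt \<beta>) *\<^sub>R x))"
      using besselB_gen_scale[OF C2] assms by auto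
    obtain C where C: "\<And>x. \<bar>gen (1 / \<beta>) \<nu> f x\<bar> \<le> C" using gen_bounded[OF f] by blast
    have "(\<integral>\<omega>. ?f (X t \<omega>) \<partial>M) = ?f x + (\<integral>z. besselB_gen (\<nu> * \<beta>) \<beta> ?f (X (fst z) (snd z)) \<partial>time_space t M)"
    proof (rule besselB_process_dynkin[OF assms(1) _ t])
      show "test_fun ?f" using f assms by (intro test_fun_scale) auto
      show "besselB_gen (\<nu> * \<beta>) \<beta> ?f \<in> borel_measurable borel"
        unfolding e by (rule measurable_compose[OF _ gen_measurable[OF C2]]) simp
      show "\<bar>besselB_gen (\<nu> * \<beta>) \<beta> ?f y\<bar> \<le> C" for y unfolding e by (rule C)
    qed
    then show "(\<integral>\<omega>. f ((1 / sqrt \<beta>) *\<^sub>R X t \<omega>) \<partial>M) = f ((1 / sqrt \<beta>) *\<^sub>R x) +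
        (\<integral>z. gen (1 / \<beta>) \<nu> f ((1 / sqrt \<beta>) *\<^sub>R X (fst z) (snd z)) \<partial>time_space t M)"
      unfolding e .
  qed (use assms m co ch st in \<open>auto intro!: continuous_intros chamberB_scale\<close>)
qed

section \<open>Elementary symmetric functions and cutoffs\<close>

text \<open>The index set is a parameter because it is the set of coordinates in \<open>es\<close>
  and the set of roots in \<open>wall_poly\<close>.\<close>

definition elsym :: "nat \<Rightarrow> 'a set \<Rightarrow> ('a \<Rightarrow> real) \<Rightarrow> real" where
  "elsym k A y = (\<Sum>B | B \<subseteq> A \<and> card B = k. \<Prod>i\<in>B. y i)"

lemma elsym_reindex:
  assumes "bij_betw \<phi> A A'"
  shows "elsym k A (\<lambda>a. y (\<phi> a)) = elsym k A' y"
proof -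
  have inj: "inj_on \<phi> B" if "B \<subseteq> A" for B
    using assms that by (meson bij_betw_imp_inj_on inj_on_subset)
  have "bij_betw ((`) \<phi>) {B. B \<subseteq> A \<and> card B = k} {B. B \<subseteq> A' \<and> card B = k}"
    unfolding bij_betw_def
  proof
    show "inj_on ((`) \<phi>) {B. B \<subseteq> A \<and> card B = k}"
      using inj[OF order_refl] by (auto simp: inj_on_def inj_on_image_eq_iff)
    show "(`) \<phi> ` {B. B \<subseteq> A \<and> card B = k} = {B. B \<subseteq> A' \<and> card B = k}"
    proof (intro equalityI subsetI)
      fix B assume B: "B \<in> {B. B \<subseteq> A' \<and> card B = k}"
      then obtain C where C: "C \<subseteq> A" "B = \<phi> ` C"
        using assms by (auto simp: bij_betw_def subset_image_iff)
      then have "card C = k" using card_image[OF inj[OF C(1)]] B by simp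
      with C show "B \<in> (`) \<phi> ` {B. B \<subseteq> A \<and> card B = k}" by blast
    qed (use assms card_image[OF inj] in \<open>auto simp: bij_betw_def\<close>)
  qed
  from sum.reindex_bij_betw[OF this, of "\<lambda>B. \<Prod>i\<in>B. y i"]
  have "elsym k A' y = (\<Sum>B | B \<subseteq> A \<and> card B = k. \<Prod>i\<in>\<phi> ` B. y i)" by (simp add: elsym_def)
  also have "\<dots> = elsym k A (\<lambda>a. y (\<phi> a))"
    unfolding elsym_def by (intro sum.cong refl) (auto simp: prod.reindex[OF inj])
  finally show ?thesis by simp
qed

section \<open>A radial cutoff\<close>

definition sqn :: "(real, 'n::{finite,linorder}) vec \<Rightarrow> real" where
  "sqn x = (\<Sum>i\<in>UNIV. (x $ i)\<^sup>2)"

lemma sqn_norm: "sqn x = (norm x)\<^sup>2"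
  by (simp add: sqn_def norm_vec_def L2_set_def sum_nonneg)

lemma sqn_nonneg [simp]: "0 \<le> sqn x"
  by (simp add: sqn_norm)

lemma C2_sqn: "C2 sqn"
proof -
  have "C2 (\<lambda>x. sqn x)" unfolding sqn_def by (intro C2_sum C2_power C2_nth)
  then show ?thesis by simp
qed

lemma B_invariantI:
  fixes f :: "(real, 'n::{finite,linorder}) vec \<Rightarrow> real"
  assumes "\<And>p x. p permutes (UNIV :: 'n set) \<Longrightarrow> f (\<chi> i. x $ p i) = f x"
    and "\<And>(s :: 'n \<Rightarrow> real) x. (\<And>i. s i = 1 \<or> s i = -1) \<Longrightarrow> f (\<chi> i. s i * x $ i) = f x"
  shows "B_invariant f"
  using assms unfolding B_invariant_def by blast

lemma B_invariant_sqn: "B_invariant sqn"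
proof (rule B_invariantI)
  fix p :: "'n::{finite,linorder} \<Rightarrow> 'n" and x :: "(real,'n) vec"
  assume "p permutes (UNIV :: 'n set)"
  then show "sqn (\<chi> i. x $ p i) = sqn x"
    unfolding sqn_def using sum.permute[of p UNIV "\<lambda>i. (x $ i)\<^sup>2"] by (simp add: o_def)
next
  fix s :: "'n::{finite,linorder} \<Rightarrow> real" and x :: "(real,'n) vec"
  assume s: "\<And>i. s i = 1 \<or> s i = -1"
  have "(s i)\<^sup>2 = 1" for i using s[of i] by auto
  then show "sqn (\<chi> i. s i * x $ i) = sqn x"
    unfolding sqn_def by (simp add: power_mult_distrib)
qed

lemma DERIV_max_power:
  "((\<lambda>v::real. (max 0 v) ^ Suc (Suc n)) has_real_derivative real (Suc (Suc n)) * (max 0 v) ^ Suc n) (at v)"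
proof (cases v "0::real" rule: linorder_cases)
  case less
  have "((\<lambda>v. (max 0 v) ^ Suc (Suc n)) has_real_derivative 0) (at v)"
    by (rule has_field_derivative_transform_within_open[where f = "\<lambda>_. 0" and S = "{..<0}"])
       (use less in auto)
  then show ?thesis using less by simp
next
  case greater
  have "((\<lambda>v. (max 0 v) ^ Suc (Suc n)) has_real_derivative real (Suc (Suc n)) * v ^ Suc n) (at v)"
    by (rule has_field_derivative_transform_within_open[where f = "\<lambda>v. v ^ Suc (Suc n)" and S = "{0<..}"],
        rule DERIV_cong[OF DERIV_pow])
       (use greater in auto)
  then show ?thesis using greater by simp
next
  case equal
  have "((\<lambda>h::real. (max 0 h) ^ Suc (Suc n) / h) \<longlongrightarrow> 0) (at 0)"
  proof (rule Lim_null_comparison)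
    show "\<forall>\<^sub>F h in at 0. norm ((max 0 h) ^ Suc (Suc n) / h) \<le> \<bar>h\<bar> ^ Suc n"
      by (intro always_eventually allI) (auto simp: max_def abs_mult intro!: mult_nonpos_nonneg)
    have "((\<lambda>h::real. \<bar>h\<bar> ^ Suc n) \<longlongrightarrow> \<bar>0\<bar> ^ Suc n) (at 0)" by (intro tendsto_intros)
    then show "((\<lambda>h::real. \<bar>h\<bar> ^ Suc n) \<longlongrightarrow> 0) (at 0)" by simp
  qed
  then show ?thesis unfolding equal DERIV_def by simp
qed

text \<open>The cube is the smallest integer power of the positive part that is twice continuously
  differentiable. The cutoff equals 1 only at the origin, but by Bernoulli's inequality it differs
  from 1 by at most \<open>3 v / R\<close>, which suffices for \<open>R\<close> tending to
  infinity.\<close>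

definition cutoff_fun :: "real \<Rightarrow> real \<Rightarrow> real" where
  "cutoff_fun R v = (max 0 (1 - v / R)) ^ 3"

definition cutoff :: "real \<Rightarrow> (real, 'n::{finite,linorder}) vec \<Rightarrow> real" where
  "cutoff R x = cutoff_fun R (sqn x)"

lemma cutoff_fun_deriv:
  "(cutoff_fun R has_real_derivative (- 3 / R) * (max 0 (1 - v / R))\<^sup>2) (at v)"
  "((\<lambda>v. (- 3 / R) * (max 0 (1 - v / R))\<^sup>2) has_real_derivative (6 / R\<^sup>2) * max 0 (1 - v / R)) (at v)"
proof -
  have l: "((\<lambda>v. 1 - v / R) has_real_derivative - 1 / R) (at v)" for v
    by (rule DERIV_cong[OF DERIV_diff[OF DERIV_const DERIV_cdivide[OF DERIV_ident]]]) simp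
  have "((\<lambda>v. (max 0 (1 - v / R)) ^ Suc (Suc n)) has_real_derivative
     (real (Suc (Suc n)) * (max 0 (1 - v / R)) ^ Suc n) * (- 1 / R)) (at v)" for v n
    by (rule DERIV_chain2[OF DERIV_max_power l])
  from this[of 1] this[of 0]
  have d: "((\<lambda>v. (max 0 (1 - v / R)) ^ 3) has_real_derivative
      (3 * (max 0 (1 - v / R))\<^sup>2) * (- 1 / R)) (at v)"
    "((\<lambda>v. (max 0 (1 - v / R))\<^sup>2) has_real_derivative (2 * max 0 (1 - v / R)) * (- 1 / R)) (at v)" for v
    by (simp_all add: eval_nat_numeral)
  show "(cutoff_fun R has_real_derivative (- 3 / R) * (max 0 (1 - v / R))\<^sup>2) (at v)"
    unfolding cutoff_fun_def[abs_def] by (rule DERIV_cong[OF d(1)]) simp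
  show "((\<lambda>v. (- 3 / R) * (max 0 (1 - v / R))\<^sup>2) has_real_derivative (6 / R\<^sup>2) * max 0 (1 - v / R)) (at v)"
    by (rule DERIV_cong[OF DERIV_cmult[OF d(2)]]) (simp add: power2_eq_square)
qed

lemma cutoff_bounds:
  assumes "0 < R" shows "0 \<le> cutoff R x" "cutoff R x \<le> 1" "R \<le> sqn x \<Longrightarrow> cutoff R x = 0"
    "sqn x < R \<Longrightarrow> 0 < cutoff R x" "1 - cutoff R x \<le> 3 * sqn x / R"
proof -
  have v: "0 \<le> sqn x / R" using assms by simp
  show "0 \<le> cutoff R x" by (simp add: cutoff_def cutoff_fun_def)
  show "cutoff R x \<le> 1" unfolding cutoff_def cutoff_fun_def by (rule power_le_one) (use v in auto)
  show "R \<le> sqn x \<Longrightarrow> cutoff R x = 0" using assms by (simp add: cutoff_def cutoff_fun_def max_def)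
  show "sqn x < R \<Longrightarrow> 0 < cutoff R x" using assms by (simp add: cutoff_def cutoff_fun_def)
  show "1 - cutoff R x \<le> 3 * sqn x / R"
  proof (cases "sqn x / R \<le> 1")
    case True
    have "1 + real 3 * (- (sqn x / R)) \<le> (1 + (- (sqn x / R))) ^ 3"
      by (rule Bernoulli_inequality) (use True in auto)
    then show ?thesis using True by (simp add: cutoff_def cutoff_fun_def)
  next
    case False
    then show ?thesis using \<open>0 \<le> cutoff R x\<close> by simp
  qed
qed

lemma C2_cutoff: "C2 (cutoff R)"
proof -
  have "C2 (\<lambda>x. cutoff_fun R (sqn x))"
    by (rule C2_compose[OF C2_sqn cutoff_fun_deriv]) (unfold divide_inverse, intro continuous_intros)
  then show ?thesis unfolding cutoff_def[abs_def] .
qed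

lemma test_fun_cutoff:
  assumes "C2 f" "B_invariant f" "0 < R"
  shows "test_fun (\<lambda>x. f x * cutoff R x)"
  unfolding test_fun_def
proof (intro conjI)
  show "C2 (\<lambda>x. f x * cutoff R x)" by (intro C2_mult C2_cutoff assms)
  show "B_invariant (\<lambda>x. f x * cutoff R x)"
    unfolding cutoff_def
    by (rule B_invariant_compose(3)[OF assms(2) B_invariant_compose(2)[OF B_invariant_sqn]])
  have "f x * cutoff R x = 0" if "x \<notin> cball 0 (sqrt R)" for x
  proof -
    have "norm x > sqrt R" using that by simp
    then have "(sqrt R)\<^sup>2 \<le> (norm x)\<^sup>2" using assms(3) by (intro power_mono) auto
    then have "R \<le> sqn x" using assms(3) by (simp add: sqn_norm)
    then show ?thesis by (simp add: cutoff_bounds(3)[OF assms(3)])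
  qed
  then show "\<exists>K. compact K \<and> (\<forall>x. x \<notin> K \<longrightarrow> f x * cutoff R x = 0)"
    by (intro exI[of _ "cball 0 (sqrt R)"]) auto
qed

section \<open>The process spends no time on the walls\<close>

lemma second_order_expansion:
  fixes g :: "real \<Rightarrow> real"
  assumes "\<And>t. (g has_real_derivative g' t) (at t)" "\<And>t. (g' has_real_derivative g'' t) (at t)"
  shows "\<exists>t. \<bar>t\<bar> \<le> \<bar>h\<bar> \<and> g h = g 0 + g' 0 * h + g'' t / 2 * h\<^sup>2"
proof -
  define D where "D m = (if m = 0 then g else if m = 1 then g' else g'')" for m :: nat
  have "\<exists>t. \<bar>t\<bar> \<le> \<bar>h\<bar> \<and> g h = (\<Sum>m<2. D m 0 / (fact m) * h ^ m) + D 2 t / (fact 2) * h ^ 2"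
    by (rule Maclaurin_bi_le) (auto simp: D_def assms)
  then show ?thesis by (simp add: D_def lessThan_nat_numeral eval_nat_numeral)
qed

text \<open>The quadratic Taylor majorant of \<open>g\<close> stays nonnegative at its minimiser
  \<open>- g' 0 / B\<close>; this is the claim.\<close>

lemma nonneg_derivative_square_bound:
  fixes g :: "real \<Rightarrow> real"
  assumes "\<And>t. (g has_real_derivative g' t) (at t)" "\<And>t. (g' has_real_derivative g'' t) (at t)"
    and "\<And>t. 0 \<le> g t" "\<And>t. g'' t \<le> B" "0 < B"
  shows "(g' 0)\<^sup>2 \<le> 2 * B * g 0"
proof -
  define h where "h = - g' 0 / B"
  obtain t where "g h = g 0 + g' 0 * h + g'' t / 2 * h\<^sup>2"
    using second_order_expansion[OF assms(1,2)] by blast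
  also have "\<dots> \<le> g 0 + g' 0 * h + B / 2 * h\<^sup>2"
    using assms(4)[of t] by (intro add_left_mono mult_right_mono) auto
  also have "\<dots> = g 0 - (g' 0)\<^sup>2 / (2 * B)"
    using assms(5) by (simp add: h_def field_simps power2_eq_square)
  finally have "(g' 0)\<^sup>2 / (2 * B) \<le> g 0" using assms(3)[of h] by simp
  then show ?thesis using assms(5) by (simp add: pos_divide_le_eq mult.commute)
qed

text \<open>Otherwise the second derivative is below \<open>2 c\<close> near 0, and the Lagrange
  remainder makes \<open>g h\<close> smaller than \<open>c h^2\<close>.\<close>

lemma second_derivative_ge:
  fixes g :: "real \<Rightarrow> real"
  assumes "\<And>t. (g has_real_derivative g' t) (at t)" "\<And>t. (g' has_real_derivative g'' t) (at t)"
    and "isCont g'' 0" "g 0 = 0" "g' 0 = 0" "\<forall>\<^sub>F h in at 0. c * h\<^sup>2 \<le> g h"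
  shows "2 * c \<le> g'' 0"
proof (rule ccontr)
  assume "\<not> 2 * c \<le> g'' 0"
  then have "\<forall>\<^sub>F t in at 0. g'' t < 2 * c"
    using assms(3) by (intro order_tendstoD) (auto simp: isCont_def)
  then have "\<forall>\<^sub>F t in at 0. g'' t < 2 * c \<and> c * t\<^sup>2 \<le> g t" using assms(6) by (rule eventually_conj)
  then obtain d where d: "0 < d" "\<And>t. t \<noteq> 0 \<Longrightarrow> dist t 0 < d \<Longrightarrow> g'' t < 2 * c \<and> c * t\<^sup>2 \<le> g t"
    unfolding eventually_at by blast
  define h where "h = d / 2"
  obtain t where t: "\<bar>t\<bar> \<le> \<bar>h\<bar>" "g h = g'' t / 2 * h\<^sup>2"
    using second_order_expansion[OF assms(1,2), of h] assms(4,5) by auto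
  have "g'' t < 2 * c"
  proof (cases "t = 0")
    case True with \<open>\<not> 2 * c \<le> g'' 0\<close> show ?thesis by simp
  next
    case False with d(2)[of t] t(1) d(1) show ?thesis by (auto simp: h_def)
  qed
  then have "g'' t / 2 * h\<^sup>2 < c * h\<^sup>2"
    using d(1) by (intro mult_strict_right_mono) (auto simp: h_def)
  moreover have "c * h\<^sup>2 \<le> g h" using d(2)[of h] d(1) by (auto simp: h_def)
  ultimately show False using t by simp
qed

lemma C2_line_derivs:
  fixes f :: "(real, 'n::{finite,linorder}) vec \<Rightarrow> real"
  assumes "C2 f"
  shows "((\<lambda>h. f (x + h *\<^sub>R axis i 1)) has_real_derivative pd i f (x + h *\<^sub>R axis i 1)) (at h)"
    "((\<lambda>h. pd i f (x + h *\<^sub>R axis i 1)) has_real_derivative pd i (pd i f) (x + h *\<^sub>R axis i 1)) (at h)"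
    "isCont (\<lambda>h. pd i (pd i f) (x + h *\<^sub>R axis i 1)) h"
  using has_real_derivative_coordinate[OF C2D(1)[OF assms]] has_real_derivative_coordinate[OF C2D(2)[OF assms]]
    continuous_on_compose2[OF C2D(3)[OF assms, of i i], of UNIV "\<lambda>h. x + h *\<^sub>R axis i 1"]
  by (auto intro!: continuous_intros simp: continuous_on_eq_continuous_at)

text \<open>A nonnegative test function controls its own squared gradient, which tames the gradient
  term in \<open>AE_zero_imp_laplacian_zero\<close>. The summand 1 is there because \<open>B\<close>
  may be 0.\<close>

lemma pd_square_bound:
  fixes f :: "(real, 'n::{finite,linorder}) vec \<Rightarrow> real"
  assumes "C2 f" "\<And>x. 0 \<le> f x" "\<And>x. \<bar>pd i (pd i f) x\<bar> \<le> B"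
  shows "(pd i f x)\<^sup>2 \<le> 2 * (B + 1) * f x"
proof -
  have "(pd i f (x + 0 *\<^sub>R axis i 1))\<^sup>2 \<le> 2 * (B + 1) * f (x + 0 *\<^sub>R axis i 1)"
  proof (rule nonneg_derivative_square_bound[OF C2_line_derivs(1,2)[OF assms(1)]])
    show "pd i (pd i f) (x + t *\<^sub>R axis i 1) \<le> B + 1" for t
      using assms(3)[of "x + t *\<^sub>R axis i 1"] by simp
    show "0 < B + 1" using assms(3)[of x] by simp
  qed (use assms in auto)
  then show ?thesis by simp
qed

lemma pd_pd_ge:
  fixes f :: "(real, 'n::{finite,linorder}) vec \<Rightarrow> real"
  assumes "C2 f" "f x = 0" "pd i f x = 0" "\<forall>\<^sub>F h in at 0. c * h\<^sup>2 \<le> f (x + h *\<^sub>R axis i 1)"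
  shows "2 * c \<le> pd i (pd i f) x"
  using second_derivative_ge[OF C2_line_derivs[OF assms(1)], of x i c] assms by simp

context dynkin_process
begin

lemma Z_measurable [measurable]:
  "(\<lambda>z. X (fst z) (snd z)) \<in> borel_measurable (time_space t M)"
  by (rule joint_measurable_continuous_paths) (auto intro: X_measurable X_continuous)

text \<open>With \<open>fn n = \<epsilon> (1 - exp (- f / \<epsilon>))\<close> and
  \<open>\<epsilon> = 1 / (n + 1)\<close>, the boundary terms of Dynkin's formula are at most
  \<epsilon>, so the integrated generator tends to 0. By dominated convergence it also tends to the
  integral of \<open>H\<close>. Zeros of \<open>f\<close> are minima, hence \<open>H\<close> is
  nonnegative and must vanish almost everywhere.\<close>

lemma AE_zero_imp_laplacian_zero:
  assumes f: "test_fun f" "\<And>x. 0 \<le> f x" and t: "0 \<le> t"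
  shows "AE z in time_space t M. f (X (fst z) (snd z)) = 0 \<longrightarrow> laplacian f (X (fst z) (snd z)) = 0"
proof -
  interpret F: finite_measure "time_space t M" by (rule finite_measure_time)
  have C2: "C2 f" using f by (simp add: test_fun_def)
  obtain B where B: "B \<ge> 0" "\<And>x. \<bar>f x\<bar> \<le> B" "\<And>i j x. \<bar>pd i (pd j f) x\<bar> \<le> B"
    using test_fun_pd_bounds[OF f(1)] by metis
  obtain C where C: "\<And>x. \<bar>gen \<sigma> \<nu> f x\<bar> \<le> C" using gen_bounded[OF f(1)] by blast
  define A where "A = real CARD('n) * (2 * (B + 1))"
  have G: "grad_inner f f x \<le> A * f x" for x
  proof -
    have "grad_inner f f x \<le> (\<Sum>i\<in>(UNIV::'n set). 2 * (B + 1) * f x)"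
      unfolding grad_inner_def
      by (intro sum_mono) (use pd_square_bound[OF C2 f(2) B(3)] in \<open>auto simp: power2_eq_square\<close>)
    then show ?thesis by (simp add: A_def)
  qed
  have G0: "0 \<le> grad_inner f f x" for x unfolding grad_inner_def by (intro sum_nonneg) auto
  have A0: "0 \<le> A" using B(1) by (simp add: A_def)
  have grad0: "pd i f x = 0" if "f x = 0" for i x
    using pd_square_bound[OF C2 f(2) B(3), of i x] that by simp
  have lap0: "0 \<le> laplacian f x" if "f x = 0" for x
    unfolding laplacian_def
  proof (rule sum_nonneg)
    fix i
    show "0 \<le> pd i (pd i f) x"
      using pd_pd_ge[OF C2 that grad0[OF that], of 0 i] f(2) by simp
  qed
  \<comment> \<open>The pointwise limit of the generators of \<open>fn n\<close>: where
    \<open>f > 0\<close> the exponentials kill every term, and where \<open>f = 0\<close> the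
    gradient vanishes too, leaving only the Laplacian.\<close>
  define H where "H x = (if f x = 0 then \<sigma> / 2 * laplacian f x else 0)" for x
  have genf0: "gen \<sigma> \<nu> f x = \<sigma> / 2 * laplacian f x" if "f x = 0" for x
    by (simp add: gen_def grad0[OF that])
  define fn where "fn n = (\<lambda>x. (1 - exp (- real (Suc n) * f x)) / real (Suc n))" for n
  have der0: "((\<lambda>v. (1 - exp (- \<kappa> * v)) / \<kappa>) has_real_derivative exp (- \<kappa> * v)) (at v)"
    "((\<lambda>v. exp (- \<kappa> * v)) has_real_derivative - \<kappa> * exp (- \<kappa> * v)) (at v)" if "\<kappa> > 0" for \<kappa> v :: real
    using that by (auto intro!: derivative_eq_intros)
  note der = der0[of "real (Suc n)" for n, OF of_nat_0_less_iff[THEN iffD2, OF zero_less_Suc]]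
  have tf: "test_fun (fn n)" for n
    unfolding test_fun_def fn_def
  proof (intro conjI)
    show "C2 (\<lambda>x. (1 - exp (- real (Suc n) * f x)) / real (Suc n))"
      by (rule C2_compose[OF C2 der]) (auto intro!: continuous_intros)
    show "B_invariant (\<lambda>x. (1 - exp (- real (Suc n) * f x)) / real (Suc n))"
      using f(1) by (intro B_invariant_compose(2)[where h = "\<lambda>v. (1 - exp (- real (Suc n) * v)) / real (Suc n)"])
        (simp add: test_fun_def)
    show "\<exists>K. compact K \<and> (\<forall>x. x \<notin> K \<longrightarrow> (1 - exp (- real (Suc n) * f x)) / real (Suc n) = 0)"
      using f(1) unfolding test_fun_def by auto
  qed
  have genn: "gen \<sigma> \<nu> (fn n) x = exp (- real (Suc n) * f x) * gen \<sigma> \<nu> f x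
      - \<sigma> / 2 * (real (Suc n) * exp (- real (Suc n) * f x)) * grad_inner f f x" for n x
    unfolding fn_def by (subst gen_compose[OF C2 der]) (simp del: of_nat_Suc)
  let ?Z = "\<lambda>z. X (fst z) (snd z)"
  have fb: "0 \<le> fn n x" "fn n x \<le> 1 / real (Suc n)" for n x
    using f(2)[of x] by (auto simp: fn_def divide_right_mono simp del: of_nat_Suc)
  have "(\<lambda>n. expectation (\<lambda>\<omega>. fn n (X t \<omega>)) - fn n x0) \<longlonglongrightarrow> 0"
  proof (rule Lim_null_comparison)
    show "(\<lambda>n. 1 / real (Suc n) + 1 / real (Suc n)) \<longlonglongrightarrow> 0"
      using tendsto_add[OF LIMSEQ_Suc[OF lim_1_over_n] LIMSEQ_Suc[OF lim_1_over_n]] by simp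
    show "\<forall>\<^sub>F n in sequentially. norm (expectation (\<lambda>\<omega>. fn n (X t \<omega>)) - fn n x0) \<le> 1 / real (Suc n) + 1 / real (Suc n)"
    proof (intro always_eventually allI)
      fix n
      have "fn n \<in> borel_measurable borel"
        using tf[of n] by (auto simp: test_fun_def intro: borel_measurable_continuous_onI C2_continuous)
      then have "integrable M (\<lambda>\<omega>. fn n (X t \<omega>))"
        by (intro integrable_const_bound[where B = "1 / real (Suc n)"] measurable_compose[OF X_measurable[OF t]])
           (use fb in auto)
      then have "expectation (\<lambda>\<omega>. fn n (X t \<omega>)) \<le> 1 / real (Suc n)"
        by (intro integral_le_const) (use fb in auto)
      moreover have "0 \<le> expectation (\<lambda>\<omega>. fn n (X t \<omega>))"
        by (intro Bochner_Integration.integral_nonneg) (use fb in auto)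
      ultimately show "norm (expectation (\<lambda>\<omega>. fn n (X t \<omega>)) - fn n x0) \<le> 1 / real (Suc n) + 1 / real (Suc n)"
        using fb[of n x0] by simp
    qed
  qed
  then have lim0: "(\<lambda>n. \<integral>z. gen \<sigma> \<nu> (fn n) (?Z z) \<partial>time_space t M) \<longlonglongrightarrow> 0"
    using dynkin_test[OF tf t] by simp
  have gm: "gen \<sigma> \<nu> g \<in> borel_measurable borel" if "C2 g" for g :: "(real,'n) vec \<Rightarrow> real" by (rule gen_measurable[OF that])
  have Hm: "H \<in> borel_measurable borel"
  proof -
    have [measurable]: "f \<in> borel_measurable borel" "laplacian f \<in> borel_measurable borel"
      unfolding laplacian_def[abs_def]
      by (auto intro!: borel_measurable_continuous_onI C2_continuous[OF C2] continuous_intros C2D(3)[OF C2])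
    show ?thesis unfolding H_def by measurable
  qed
  have lim1: "(\<lambda>n. \<integral>z. gen \<sigma> \<nu> (fn n) (?Z z) \<partial>time_space t M) \<longlonglongrightarrow> (\<integral>z. H (?Z z) \<partial>time_space t M)"
  proof (rule integral_dominated_convergence[where w = "\<lambda>_. C + A / 2"])
    show "(\<lambda>z. H (?Z z)) \<in> borel_measurable (time_space t M)"
      by (rule measurable_compose[OF Z_measurable Hm])
    show "(\<lambda>z. gen \<sigma> \<nu> (fn n) (?Z z)) \<in> borel_measurable (time_space t M)" for n
      using tf[of n] by (intro measurable_compose[OF Z_measurable] gm) (simp add: test_fun_def)
    show "AE z in time_space t M. (\<lambda>n. gen \<sigma> \<nu> (fn n) (?Z z)) \<longlonglongrightarrow> H (?Z z)"
    proof (rule AE_I2)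
      fix z
      show "(\<lambda>n. gen \<sigma> \<nu> (fn n) (?Z z)) \<longlonglongrightarrow> H (?Z z)"
      proof (cases "f (?Z z) = 0")
        case True
        then have "grad_inner f f (?Z z) = 0" by (simp add: grad_inner_def grad0)
        then show ?thesis by (simp add: genn H_def True genf0)
      next
        case False
        then have p: "f (?Z z) > 0" using f(2)[of "?Z z"] by simp
        have s: "filterlim (\<lambda>n. real (Suc n)) at_top sequentially"
          using filterlim_Suc filterlim_real_sequentially by (rule filterlim_compose[rotated])
        have "((\<lambda>u. exp (- u * f (?Z z))) \<longlongrightarrow> 0) at_top"
          using p by real_asymp
        note e1 = filterlim_compose[OF this s]
        have "((\<lambda>u. u * exp (- u * f (?Z z))) \<longlongrightarrow> 0) at_top"
          using p by real_asymp
        note e2 = filterlim_compose[OF this s]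
        have "(\<lambda>n. gen \<sigma> \<nu> (fn n) (?Z z)) \<longlonglongrightarrow> 0 * gen \<sigma> \<nu> f (?Z z) - \<sigma> / 2 * 0 * grad_inner f f (?Z z)"
          unfolding genn by (intro tendsto_intros e1 e2)
        then show ?thesis using False by (simp add: H_def)
      qed
    qed
    show "AE z in time_space t M. norm (gen \<sigma> \<nu> (fn n) (?Z z)) \<le> C + A / 2" for n
    proof (rule AE_I2)
      fix z
      define x where "x = ?Z z"
      have e: "exp (- real (Suc n) * f x) \<le> 1" using f(2)[of x] by (simp del: of_nat_Suc)
      \<comment> \<open>With \<open>u = (n + 1) f x\<close>, the bound
        \<open>u exp (- u) \<le> 1\<close> absorbs the factor \<open>n + 1\<close>, since the
        squared gradient is at most \<open>A f\<close>.\<close>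
      have "real (Suc n) * f x \<le> exp (real (Suc n) * f x)"
        using exp_ge_add_one_self[of "real (Suc n) * f x"] by linarith
      then have "real (Suc n) * f x * exp (- real (Suc n) * f x) \<le> exp (real (Suc n) * f x) * exp (- real (Suc n) * f x)"
        by (intro mult_right_mono) auto
      also have "\<dots> = 1" by (simp flip: exp_add del: of_nat_Suc)
      finally have e2: "real (Suc n) * exp (- real (Suc n) * f x) * f x \<le> 1" by (simp add: mult_ac)
      have "\<bar>\<sigma> / 2 * (real (Suc n) * exp (- real (Suc n) * f x)) * grad_inner f f x\<bar>
          = \<sigma> / 2 * (real (Suc n) * exp (- real (Suc n) * f x) * grad_inner f f x)"
        using sigma(1) G0[of x] by (simp add: abs_mult del: of_nat_Suc)
      also have "\<dots> \<le> 1 / 2 * (real (Suc n) * exp (- real (Suc n) * f x) * (A * f x))"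
        using sigma G[of x] G0[of x] by (intro mult_mono) auto
      also have "\<dots> = A / 2 * (real (Suc n) * exp (- real (Suc n) * f x) * f x)" by simp
      also have "\<dots> \<le> A / 2 * 1" using A0 e2 by (intro mult_left_mono) auto
      finally have a: "\<bar>\<sigma> / 2 * (real (Suc n) * exp (- real (Suc n) * f x)) * grad_inner f f x\<bar> \<le> A / 2" by simp
      have "\<bar>exp (- real (Suc n) * f x) * gen \<sigma> \<nu> f x\<bar> \<le> 1 * C"
        unfolding abs_mult using e C[of x] by (intro mult_mono) auto
      with a show "norm (gen \<sigma> \<nu> (fn n) (?Z z)) \<le> C + A / 2"
        unfolding genn x_def[symmetric] by simp
    qed
  qed auto
  have "(\<integral>z. H (?Z z) \<partial>time_space t M) = 0" using LIMSEQ_unique[OF lim1 lim0] .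
  moreover have "integrable (time_space t M) (\<lambda>z. H (?Z z))"
  proof (rule F.integrable_const_bound[where B = C])
    have "\<bar>H x\<bar> \<le> C" for x using C[of x] genf0[of x] by (auto simp: H_def)
    then show "AE z in time_space t M. norm (H (?Z z)) \<le> C" by simp
    show "(\<lambda>z. H (?Z z)) \<in> borel_measurable (time_space t M)"
      by (rule measurable_compose[OF Z_measurable Hm])
  qed
  moreover have "AE z in time_space t M. 0 \<le> H (?Z z)"
    using lap0 sigma by (auto simp: H_def)
  ultimately have "AE z in time_space t M. H (?Z z) = 0"
    using integral_nonneg_eq_0_iff_AE by blast
  then show ?thesis by eventually_elim (use sigma in \<open>auto simp: H_def\<close>)
qed

end

text \<open>Redundant index set for the roots of \<open>B\<^sub>N\<close>: \<open>(i, j, True)\<close> stands for \<open>x\<^sub>i + x\<^sub>j\<close> (so \<open>(i, i, True)\<close>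
  is a multiple of \<open>x\<^sub>i\<close>) and \<open>(i, j, False)\<close> for \<open>x\<^sub>i - x\<^sub>j\<close>.\<close>

definition roots :: "('n \<times> 'n \<times> bool) set" where
  "roots = {(i, j, s). i \<noteq> j \<or> s}"

definition root_form :: "'n \<times> 'n \<times> bool \<Rightarrow> (real, 'n::{finite,linorder}) vec \<Rightarrow> real" where
  "root_form a x = x $ fst a + (if snd (snd a) then 1 else -1) * x $ fst (snd a)"

definition off_walls :: "(real, 'n::{finite,linorder}) vec \<Rightarrow> bool" where
  "off_walls x \<longleftrightarrow> (\<forall>a\<in>roots. root_form a x \<noteq> 0)"

text \<open>One polynomial for each number of nonvanishing roots. The product of all squared roots
  would not do: where several roots vanish together it has a zero of order at least four, so its
  Laplacian vanishes there as well.\<close>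

definition wall_poly :: "nat \<Rightarrow> (real, 'n::{finite,linorder}) vec \<Rightarrow> real" where
  "wall_poly m x = elsym m roots (\<lambda>a. (root_form a x)\<^sup>2)"

lemma C2_root_form: "C2 (root_form a)"
proof -
  have "C2 (\<lambda>x. root_form a x)" unfolding root_form_def by (intro C2_add C2_mult C2_nth C2_const)
  then show ?thesis by simp
qed

lemma C2_wall_poly: "C2 (wall_poly m)"
proof -
  have "C2 (\<lambda>x. wall_poly m x)" unfolding wall_poly_def elsym_def
    by (intro C2_sum C2_prod C2_power) (use C2_root_form in simp)
  then show ?thesis by simp
qed

lemma wall_poly_nonneg: "0 \<le> wall_poly m x"
  unfolding wall_poly_def elsym_def by (intro sum_nonneg prod_nonneg) auto

lemma B_invariant_wall_poly:
  "B_invariant (wall_poly m :: (real, 'n::{finite,linorder}) vec \<Rightarrow> real)"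
proof (rule B_invariantI)
  fix p :: "'n \<Rightarrow> 'n" and x :: "(real,'n) vec"
  assume p: "p permutes (UNIV :: 'n set)"
  define \<phi> where "\<phi> = (\<lambda>a :: 'n \<times> 'n \<times> bool. (p (fst a), p (fst (snd a)), snd (snd a)))"
  define \<psi> where "\<psi> = (\<lambda>a :: 'n \<times> 'n \<times> bool. (inv p (fst a), inv p (fst (snd a)), snd (snd a)))"
  have "bij_betw \<phi> roots roots"
    by (rule bij_betw_byWitness[where f' = \<psi>])
       (auto simp: \<phi>_def \<psi>_def roots_def permutes_inverses[OF p] inj_eq[OF permutes_inj[OF p]]
          inj_eq[OF permutes_inj[OF permutes_inv[OF p]]])
  from elsym_reindex[OF this, of m "\<lambda>a. (root_form a x)\<^sup>2"]
  show "wall_poly m (\<chi> i. x $ p i) = wall_poly m x"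
    by (simp add: wall_poly_def root_form_def \<phi>_def)
next
  fix s :: "'n \<Rightarrow> real" and x :: "(real,'n) vec"
  assume s: "\<And>i. s i = 1 \<or> s i = -1"
  \<comment> \<open>A sign change exchanges sum and difference, up to a global sign, exactly when
    \<open>s\<close> differs at the two indices. The map fixes the diagonal entries and is an
    involution.\<close>
  define \<phi> where "\<phi> = (\<lambda>a :: 'n \<times> 'n \<times> bool. (fst a, fst (snd a), snd (snd a) = (s (fst a) = s (fst (snd a)))))"
  have "bij_betw \<phi> roots roots"
    by (rule bij_betw_byWitness[where f' = \<phi>]) (auto simp: \<phi>_def roots_def)
  from elsym_reindex[OF this, of m "\<lambda>a. (root_form a x)\<^sup>2"]
  have "wall_poly m x = elsym m roots (\<lambda>a. (root_form (\<phi> a) x)\<^sup>2)" by (simp add: wall_poly_def)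
  moreover have "(root_form (\<phi> a) x)\<^sup>2 = (root_form a (\<chi> i. s i * x $ i))\<^sup>2" for a
    using s[of "fst a"] s[of "fst (snd a)"] by (auto simp: \<phi>_def root_form_def power2_eq_square algebra_simps)
  ultimately show "wall_poly m (\<chi> i. s i * x $ i) = wall_poly m x"
    by (simp add: wall_poly_def)
qed

text \<open>The degree is one more than the number of roots that do not vanish at \<open>x\<close>.
  Each product of that many squared roots then contains a vanishing one, while the product over
  \<open>nz\<close> and a single vanishing root \<open>a0\<close> grows quadratically along a
  coordinate axis.\<close>

lemma laplacian_wall_poly_pos:
  fixes x :: "(real, 'n::{finite,linorder}) vec"
  assumes "\<not> off_walls x" "sqn x < R"
  obtains m where "wall_poly m x * cutoff R x = 0" "laplacian (\<lambda>x. wall_poly m x * cutoff R x) x \<noteq> 0"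
proof -
  have R: "0 < R" using assms(2) sqn_nonneg[of x] by linarith
  define nz where "nz = {a \<in> roots. root_form a x \<noteq> 0}"
  obtain a0 where a0: "a0 \<in> roots" "root_form a0 x = 0" using assms(1) by (auto simp: off_walls_def)
  define m where "m = Suc (card nz)"
  define f where "f = (\<lambda>x :: (real,'n) vec. wall_poly m x * cutoff R x)"
  have fC2: "C2 f" unfolding f_def by (intro C2_mult C2_wall_poly C2_cutoff)
  have f0: "0 \<le> f y" for y unfolding f_def by (intro mult_nonneg_nonneg wall_poly_nonneg cutoff_bounds(1)[OF R])
  have "wall_poly m x = 0"
    unfolding wall_poly_def elsym_def
  proof (rule sum.neutral, safe)
    fix A :: "('n \<times> 'n \<times> bool) set" assume A: "A \<subseteq> roots" "m = card A"
    have "\<not> A \<subseteq> nz" using A card_mono[of nz A] by (auto simp: m_def)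
    then obtain a where "a \<in> A" "root_form a x = 0" using A by (auto simp: nz_def)
    then show "(\<Prod>i\<in>A. (root_form i x)\<^sup>2) = 0" by (intro prod_zero) auto
  qed
  then have fx: "f x = 0" by (simp add: f_def)
  have tf: "test_fun f" unfolding f_def by (intro test_fun_cutoff C2_wall_poly B_invariant_wall_poly R)
  obtain B where B: "\<And>i j x. \<bar>pd i (pd j f) x\<bar> \<le> B" using test_fun_pd_bounds[OF tf] by metis
  have p0: "pd i f x = 0" for i using pd_square_bound[OF fC2 f0 B, of i x] fx by simp
  have nn: "0 \<le> pd i (pd i f) x" for i
    using pd_pd_ge[OF fC2 fx p0, of 0 i] f0 by simp
  define i where "i = fst a0"
  \<comment> \<open>Half of the factor that multiplies the square of \<open>a0\<close> at
    \<open>x\<close>; by continuity the full factor exceeds \<open>c\<close> nearby.\<close>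
  define c where "c = (\<Prod>a\<in>nz. (root_form a x)\<^sup>2) * cutoff R x / 2"
  have cpos: "c > 0"
    unfolding c_def using cutoff_bounds(4)[OF R assms(2)]
    by (intro divide_pos_pos mult_pos_pos prod_pos) (auto simp: nz_def)
  have "2 * c \<le> pd i (pd i f) x"
  proof (rule pd_pd_ge[OF fC2 fx p0])
    define F where "F h = (\<Prod>a\<in>nz. (root_form a (x + h *\<^sub>R axis i 1))\<^sup>2) * cutoff R (x + h *\<^sub>R axis i 1)" for h
    have "continuous_on UNIV F"
      unfolding F_def
      by (intro continuous_intros continuous_on_compose2[OF C2_continuous(1)[OF C2_root_form]]
          continuous_on_compose2[OF C2_continuous(1)[OF C2_cutoff]]) auto
    then have "(F \<longlongrightarrow> F 0) (at 0)" by (simp add: continuous_on_def)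
    moreover have "c < F 0" using cpos by (simp add: F_def c_def mult.commute)
    ultimately have "\<forall>\<^sub>F h in at 0. c < F h" by (rule order_tendstoD)
    then show "\<forall>\<^sub>F h in at 0. c * h\<^sup>2 \<le> f (x + h *\<^sub>R axis i 1)"
    proof eventually_elim
      case (elim h)
      let ?y = "x + h *\<^sub>R axis i 1"
      have "h\<^sup>2 \<le> (root_form a0 ?y)\<^sup>2"
      \<comment> \<open>Along the axis \<open>i\<close> the root \<open>a0\<close> changes by
        \<open>h\<close>, or by \<open>2 h\<close> if it is the diagonal root at
        \<open>i\<close>.\<close>
      proof (cases "fst (snd a0) = i")
        case True
        then have "root_form a0 ?y = root_form a0 x + 2 * h"
          using a0(1) by (auto simp: root_form_def i_def axis_def roots_def)
        then show ?thesis using a0(2) by (simp add: power_mult_distrib)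
      next
        case False
        then have "root_form a0 ?y = root_form a0 x + h"
          by (simp add: root_form_def i_def axis_def)
        then show ?thesis using a0(2) by simp
      qed
      then have "c * h\<^sup>2 \<le> F h * (root_form a0 ?y)\<^sup>2"
        using elim cpos by (intro mult_mono) auto
      also have "\<dots> = (\<Prod>a\<in>insert a0 nz. (root_form a ?y)\<^sup>2) * cutoff R ?y"
        using a0 by (subst prod.insert) (auto simp: nz_def F_def mult_ac)
      also have "\<dots> \<le> f ?y"
        unfolding f_def wall_poly_def elsym_def
      proof (rule mult_right_mono[OF _ cutoff_bounds(1)[OF R]])
        have "card (insert a0 nz) = m" using a0 by (subst card_insert_disjoint) (auto simp: nz_def m_def)
        moreover have "insert a0 nz \<subseteq> roots" using a0 by (auto simp: nz_def)
        ultimately show "(\<Prod>a\<in>insert a0 nz. (root_form a ?y)\<^sup>2) \<le>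
            (\<Sum>B | B \<subseteq> roots \<and> card B = m. \<Prod>a\<in>B. (root_form a ?y)\<^sup>2)"
          by (intro member_le_sum[where f = "\<lambda>B. \<Prod>a\<in>B. (root_form a ?y)\<^sup>2"]) (auto intro!: prod_nonneg)
      qed
      finally show ?case .
    qed
  qed
  then have "0 < pd i (pd i f) x" using cpos by linarith
  also have "\<dots> \<le> laplacian f x"
    unfolding laplacian_def by (rule member_le_sum[where f = "\<lambda>i. pd i (pd i f) x"]) (use nn in auto)
  finally show ?thesis using that[of m] fx by (simp add: f_def)
qed

text \<open>Countably many degrees and cutoff radii, so the exceptional sets can be united; every
  wall point lies inside some cutoff radius and contradicts one of the implications.\<close>

lemma (in dynkin_process) AE_off_walls:
  assumes "0 \<le> t"
  shows "AE z in time_space t M. off_walls (X (fst z) (snd z))"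
proof -
  let ?f = "\<lambda>m n x. wall_poly m x * cutoff (real (Suc n)) x"
  have "AE z in time_space t M. ?f m n (X (fst z) (snd z)) = 0 \<longrightarrow> laplacian (?f m n) (X (fst z) (snd z)) = 0" for m n
    by (rule AE_zero_imp_laplacian_zero)
       (use assms in \<open>auto intro!: test_fun_cutoff C2_wall_poly B_invariant_wall_poly
          mult_nonneg_nonneg wall_poly_nonneg cutoff_bounds(1)\<close>)
  then have "AE z in time_space t M. \<forall>m n. ?f m n (X (fst z) (snd z)) = 0 \<longrightarrow> laplacian (?f m n) (X (fst z) (snd z)) = 0"
    by (simp add: AE_all_countable)
  then show ?thesis
  proof eventually_elim
    case (elim z)
    obtain n where "sqn (X (fst z) (snd z)) < real n" using reals_Archimedean2 by blast
    then have "sqn (X (fst z) (snd z)) < real (Suc n)" by simp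
    then show ?case using laplacian_wall_poly_pos elim by metis
  qed
qed

section \<open>The generator on elementary symmetric polynomials\<close>

lemma elsym_0: "finite A \<Longrightarrow> elsym 0 A y = 1"
proof -
  assume "finite A"
  then have "{B. B \<subseteq> A \<and> card B = 0} = {{}}" by (auto dest: finite_subset)
  then show ?thesis by (simp add: elsym_def)
qed

lemma elsym_eq_0:
  assumes "finite A" "card A < k" shows "elsym k A y = 0"
proof -
  have e: "{B. B \<subseteq> A \<and> card B = k} = {}" using assms(2) by (auto dest: card_mono[OF assms(1)])
  show ?thesis unfolding elsym_def e by simp
qed

lemma elsym_cong: "(\<And>i. i \<in> A \<Longrightarrow> y i = y' i) \<Longrightarrow> elsym k A y = elsym k A y'"
  unfolding elsym_def by (intro sum.cong prod.cong refl) auto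

lemma elsym_scale: "elsym k A (\<lambda>i. c * y i) = c ^ k * elsym k A y"
  unfolding elsym_def sum_distrib_left by (intro sum.cong refl) (auto simp: prod.distrib)

lemma elsym_insert:
  assumes "finite A" "a \<notin> A"
  shows "elsym (Suc k) (insert a A) y = elsym (Suc k) A y + y a * elsym k A y"
proof -
  let ?P = "\<lambda>k. {B. B \<subseteq> A \<and> card B = k}"
  have fin: "B \<subseteq> A \<Longrightarrow> finite B" for B using assms(1) finite_subset by blast
  have "{B. B \<subseteq> insert a A \<and> card B = Suc k} = ?P (Suc k) \<union> insert a ` ?P k"
  proof (intro equalityI subsetI)
    fix B assume B: "B \<in> {B. B \<subseteq> insert a A \<and> card B = Suc k}"
    show "B \<in> ?P (Suc k) \<union> insert a ` ?P k"
    proof (cases "a \<in> B")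
      case True
      then have "B = insert a (B - {a})" "B - {a} \<subseteq> A" using B by auto
      moreover have "card (B - {a}) = k" using True B by simp
      ultimately show ?thesis by blast
    qed (use B in auto)
  qed (use assms fin in \<open>auto simp: card_insert_if\<close>)
  moreover have "inj_on (insert a) (?P k)" using assms(2) by (auto simp: inj_on_def)
  moreover have "?P (Suc k) \<inter> insert a ` ?P k = {}" using assms(2) by auto
  ultimately have "elsym (Suc k) (insert a A) y =
      elsym (Suc k) A y + (\<Sum>B\<in>?P k. \<Prod>i\<in>insert a B. y i)"
    unfolding elsym_def using assms(1) by (simp add: sum.union_disjoint sum.reindex)
  also have "(\<Sum>B\<in>?P k. \<Prod>i\<in>insert a B. y i) = y a * elsym k A y"
    unfolding elsym_def sum_distrib_left
    by (intro sum.cong refl, subst prod.insert) (use assms fin in auto)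
  finally show ?thesis .
qed

lemma elsym_remove:
  assumes "finite A" "a \<in> A"
  shows "elsym (Suc k) A y = elsym (Suc k) (A - {a}) y + y a * elsym k (A - {a}) y"
  using elsym_insert[of "A - {a}" a k y] assms by (simp add: insert_absorb)

text \<open>Double counting: a \<open>k\<close>-subset is counted once for each index outside
  it.\<close>

lemma elsym_sum_remove:
  assumes "finite A"
  shows "(\<Sum>i\<in>A. elsym k (A - {i}) y) = (real (card A) - real k) * elsym k A y"
proof -
  let ?P = "{B. B \<subseteq> A \<and> card B = k}"
  have "(\<Sum>i\<in>A. elsym k (A - {i}) y) = (\<Sum>i\<in>A. \<Sum>B\<in>?P. if i \<notin> B then \<Prod>i\<in>B. y i else 0)"
    unfolding elsym_def
    by (rule sum.cong[OF refl], rule sum.mono_neutral_cong_left) (use assms in auto)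
  also have "\<dots> = (\<Sum>B\<in>?P. \<Sum>i\<in>A. if i \<notin> B then \<Prod>i\<in>B. y i else 0)" by (rule sum.swap)
  also have "\<dots> = (\<Sum>B\<in>?P. (real (card A) - real k) * (\<Prod>i\<in>B. y i))"
  proof (rule sum.cong[OF refl])
    fix B assume B: "B \<in> ?P"
    have "(\<Sum>i\<in>A. if i \<notin> B then \<Prod>i\<in>B. y i else 0) = (\<Sum>i\<in>A - B. \<Prod>i\<in>B. y i)"
      by (rule sum.mono_neutral_cong_right) (use assms in auto)
    also have "\<dots> = real (card (A - B)) * (\<Prod>i\<in>B. y i)" by simp
    also have "real (card (A - B)) = real (card A) - real k"
      using B assms by (subst card_Diff_subset) (auto intro: finite_subset simp: card_mono of_nat_diff)
    finally show "(\<Sum>i\<in>A. if i \<notin> B then \<Prod>i\<in>B. y i else 0) = (real (card A) - real k) * (\<Prod>i\<in>B. y i)" .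
  qed
  finally show ?thesis by (simp add: elsym_def sum_distrib_left)
qed

text \<open>Vieta's formula.\<close>

lemma prod_elsym:
  assumes "finite A"
  shows "(\<Prod>i\<in>A. w - y i) = (\<Sum>k\<le>card A. (-1) ^ k * w ^ (card A - k) * elsym k A y)"
proof -
  have "(\<Prod>i\<in>A. w - y i) = (\<Prod>i\<in>A. - y i + w)" by simp
  also have "\<dots> = (\<Sum>X\<in>Pow A. (\<Prod>i\<in>X. - y i) * (\<Prod>i\<in>A - X. w))" by (rule prod_add[OF assms])
  also have "\<dots> = (\<Sum>k\<le>card A. \<Sum>X | X \<in> Pow A \<and> card X = k. (\<Prod>i\<in>X. - y i) * (\<Prod>i\<in>A - X. w))"
    by (rule sum.group[symmetric]) (use assms in \<open>auto simp: card_mono\<close>)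
  also have "\<dots> = (\<Sum>k\<le>card A. (-1) ^ k * w ^ (card A - k) * elsym k A y)"
    unfolding elsym_def sum_distrib_left
  proof (intro sum.cong refl)
    fix k B assume B: "B \<in> {B. B \<subseteq> A \<and> card B = k}"
    then have "card (A - B) = card A - k" using assms by (auto simp: card_Diff_subset finite_subset)
    moreover have "(\<Prod>i\<in>B. - y i) = (-1) ^ k * (\<Prod>i\<in>B. y i)"
      using B prod.distrib[of "\<lambda>_. -1" y B] by simp
    ultimately show "(\<Prod>i\<in>B. - y i) * (\<Prod>i\<in>A - B. w) = (-1) ^ k * w ^ (card A - k) * (\<Prod>i\<in>B. y i)" by simp
  qed simp
  finally show ?thesis .
qed

section \<open>Symmetric polynomials of the squared coordinates\<close>

definition es :: "nat \<Rightarrow> 'n set \<Rightarrow> (real, 'n::{finite,linorder}) vec \<Rightarrow> real" where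
  "es k A x = elsym k A (\<lambda>i. (x $ i)\<^sup>2)"

lemma C2_es: "C2 (es k A)"
proof -
  have "C2 (\<lambda>x. es k A x)" unfolding es_def elsym_def by (intro C2_sum C2_prod C2_power C2_nth)
  then show ?thesis by simp
qed

lemma es_0 [simp]: "es 0 A x = 1"
  by (simp add: es_def elsym_0)

lemma es_remove: "i \<in> A \<Longrightarrow> es (Suc k) A x = es (Suc k) (A - {i}) x + (x $ i)\<^sup>2 * es k (A - {i}) x"
  by (simp add: es_def elsym_remove)

lemma es_sum_remove: "(\<Sum>i\<in>A. es k (A - {i}) x) = (real (card A) - real k) * es k A x"
  by (simp add: es_def elsym_sum_remove)

lemma es_nonneg: "0 \<le> es k A x"
  unfolding es_def elsym_def by (intro sum_nonneg prod_nonneg) auto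

lemma sqn_component: "(x $ i)\<^sup>2 \<le> sqn x"
  unfolding sqn_def by (rule member_le_sum[where f = "\<lambda>i. (x $ i)\<^sup>2"]) auto

lemma es_bound: "es k A (x :: (real, 'n::{finite,linorder}) vec) \<le> 2 ^ CARD('n) * (1 + sqn x) ^ CARD('n)"
proof -
  have "es k A x \<le> (\<Sum>B | B \<subseteq> A \<and> card B = k. (1 + sqn x) ^ CARD('n))"
    unfolding es_def elsym_def
  proof (rule sum_mono)
    fix B assume "B \<in> {B. B \<subseteq> A \<and> card B = k}"
    have "(\<Prod>i\<in>B. (x $ i)\<^sup>2) \<le> (\<Prod>i\<in>B. 1 + sqn x)"
      by (intro prod_mono) (use sqn_component[of x] in \<open>auto intro: add_increasing\<close>)
    also have "\<dots> \<le> (1 + sqn x) ^ CARD('n)" by (auto intro!: power_increasing card_mono)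
    finally show "(\<Prod>i\<in>B. (x $ i)\<^sup>2) \<le> (1 + sqn x) ^ CARD('n)" .
  qed
  also have "\<dots> = real (card {B. B \<subseteq> A \<and> card B = k}) * (1 + sqn x) ^ CARD('n)" by simp
  also have "\<dots> \<le> real (card (Pow (UNIV :: 'n set))) * (1 + sqn x) ^ CARD('n)"
    by (intro mult_right_mono of_nat_mono card_mono) auto
  also have "\<dots> = 2 ^ CARD('n) * (1 + sqn x) ^ CARD('n)" by (simp add: card_Pow)
  finally show ?thesis .
qed

lemma es_scale: "es k A (c *\<^sub>R x) = (c\<^sup>2) ^ k * es k A x"
  unfolding es_def by (simp add: power_mult_distrib elsym_scale)

lemma B_invariant_es: "B_invariant (es k (UNIV :: 'n::{finite,linorder} set))"
proof (rule B_invariantI)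
  fix p :: "'n \<Rightarrow> 'n" and x :: "(real,'n) vec"
  assume "p permutes (UNIV :: 'n set)"
  from elsym_reindex[OF permutes_imp_bij[OF this], of k "\<lambda>i. (x $ i)\<^sup>2"]
  show "es k UNIV (\<chi> i. x $ p i) = es k UNIV x" by (simp add: es_def)
next
  fix s :: "'n \<Rightarrow> real" and x :: "(real,'n) vec"
  assume s: "\<And>i. s i = 1 \<or> s i = -1"
  have "(s i)\<^sup>2 = 1" for i using s[of i] by auto
  then show "es k UNIV (\<chi> i. s i * x $ i) = es k UNIV x"
    by (simp add: es_def power_mult_distrib)
qed

lemma pd_indep: "(\<And>h. f (x + h *\<^sub>R axis i 1) = f x) \<Longrightarrow> pd i f x = 0"
  by (rule pd_eqI) simp

lemma pd_es_notin: "i \<notin> A \<Longrightarrow> pd i (es k A) x = 0"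
  by (rule pd_indep) (auto simp: es_def axis_def intro!: elsym_cong)

lemma pd_es: "i \<in> A \<Longrightarrow> pd i (es (Suc k) A) = (\<lambda>x. 2 * x $ i * es k (A - {i}) x)"
proof
  fix x assume i: "i \<in> A"
  have s: "C2 (\<lambda>x. (x $ i)\<^sup>2)" by (intro C2_power C2_nth)
  have "(\<lambda>x. x $ i * x $ i) = (\<lambda>x :: (real,'a) vec. (x $ i)\<^sup>2)" by (simp add: power2_eq_square)
  then have ps: "pd i (\<lambda>x. (x $ i)\<^sup>2) x = 2 * x $ i"
    using pd_mult[OF C2D(1)[OF C2_nth[of i]] C2D(1)[OF C2_nth[of i]], of i x] by simp
  have "es (Suc k) A = (\<lambda>x. es (Suc k) (A - {i}) x + (x $ i)\<^sup>2 * es k (A - {i}) x)"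
    using es_remove[OF i] by auto
  then show "pd i (es (Suc k) A) x = 2 * x $ i * es k (A - {i}) x"
    using C2_pd_add(1)[OF C2_es C2_mult[OF s C2_es]] C2_pd_mult(1)[OF s C2_es]
    by (simp add: pd_es_notin ps)
qed

lemma pd_pd_es: "i \<in> A \<Longrightarrow> pd i (pd i (es (Suc k) A)) x = 2 * es k (A - {i}) x"
  using C2_pd_mult(1)[OF C2_cmult[OF C2_nth[of i], of 2] C2_es, of i] pd_cmult[OF C2_nth[of i], of i 2]
  by (simp add: pd_es pd_es_notin)

lemma pd_es_0 [simp]: "pd i (es 0 A) x = 0"
  by (rule pd_indep) simp

text \<open>Euler's identity for homogeneous functions, of degree \<open>2 k\<close>.\<close>

lemma euler_es: "(\<Sum>i\<in>UNIV. x $ i * pd i (es k UNIV) x) = 2 * real k * es k UNIV x"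
proof (cases k)
  case (Suc m)
  have "x $ i * pd i (es k UNIV) x = 2 * (es k UNIV x - es k (UNIV - {i}) x)" for i
    using es_remove[of i UNIV m x] by (simp add: Suc pd_es power2_eq_square)
  then have "(\<Sum>i\<in>UNIV. x $ i * pd i (es k UNIV) x) =
      2 * (real CARD('a) * es k UNIV x - (\<Sum>i\<in>UNIV. es k (UNIV - {i}) x))"
    by (simp add: sum_distrib_left[symmetric] sum_subtractf)
  then show ?thesis by (simp add: es_sum_remove algebra_simps)
qed simp

lemma off_wallsD:
  assumes "off_walls x"
  shows "x $ i \<noteq> 0" "i \<noteq> j \<Longrightarrow> x $ i \<noteq> x $ j" "i \<noteq> j \<Longrightarrow> x $ i + x $ j \<noteq> 0" "i \<noteq> j \<Longrightarrow> (x $ i)\<^sup>2 \<noteq> (x $ j)\<^sup>2"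
proof -
  have r: "(i, j, s) \<in> roots \<Longrightarrow> x $ i + (if s then 1 else -1) * x $ j \<noteq> 0" for i j s
    using assms by (auto simp: off_walls_def root_form_def)
  show "x $ i \<noteq> 0" using r[of i i True] by (auto simp: roots_def)
  show a: "i \<noteq> j \<Longrightarrow> x $ i \<noteq> x $ j" using r[of i j False] by (auto simp: roots_def)
  show b: "i \<noteq> j \<Longrightarrow> x $ i + x $ j \<noteq> 0" using r[of i j True] by (auto simp: roots_def)
  show "i \<noteq> j \<Longrightarrow> (x $ i)\<^sup>2 \<noteq> (x $ j)\<^sup>2" using a b by (auto simp: power2_eq_iff)
qed

text \<open>The three summands come from the Laplacian, the terms \<open>1 / x_i\<close> and the
  pair interaction. The factor \<open>N - k\<close> vanishes at \<open>k = N\<close>, so sums over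
  \<open>k < N\<close> and \<open>k \<le> N\<close> may be exchanged; \<sigma> = 0 describes the
  noiseless limit.\<close>

definition es_coeff :: "nat \<Rightarrow> real \<Rightarrow> real \<Rightarrow> nat \<Rightarrow> real" where
  "es_coeff N \<sigma> \<nu> k = (real N - real k) * (\<sigma> + 2 * \<nu> + 2 * (real N - real k - 1))"

text \<open>\<open>es\<close> is affine in each squared coordinate, so every pair of singular terms
  collapses to a polynomial without the two variables involved; \<open>es_sum_remove\<close>,
  applied twice, counts these.\<close>

lemma gen_es:
  fixes x :: "(real, 'n::{finite,linorder}) vec"
  assumes "off_walls x"
  shows "gen \<sigma> \<nu> (es (Suc k) UNIV) x = es_coeff CARD('n) \<sigma> \<nu> k * es k UNIV x"
proof -
  let ?N = "real CARD('n)"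
  let ?e = "\<lambda>i. es k (UNIV - {i}) x"
  let ?p = "\<lambda>i. 2 * x $ i * ?e i"
  have s1: "(\<Sum>i\<in>UNIV. ?e i) = (?N - real k) * es k UNIV x" by (rule es_sum_remove)
  have lap: "laplacian (es (Suc k) UNIV) x = 2 * ((?N - real k) * es k UNIV x)"
    unfolding laplacian_def by (simp add: pd_pd_es sum_distrib_left[symmetric] s1)
  have pair: "(?p i - ?p j) / (x $ i - x $ j) + (?p i + ?p j) / (x $ i + x $ j) = 4 * es k (UNIV - {i} - {j}) x"
    if "i \<noteq> j" for i j
  proof -
    note w = off_wallsD(2-4)[OF assms that]
    let ?D = "es k (UNIV - {i} - {j}) x"
    \<comment> \<open>Expanding each side in the other variable, the terms containing both squares
      cancel.\<close>
    have "(x $ i)\<^sup>2 * ?e i - (x $ j)\<^sup>2 * ?e j = ((x $ i)\<^sup>2 - (x $ j)\<^sup>2) * ?D"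
    proof (cases k)
      case (Suc m)
      have "?e i = ?D + (x $ j)\<^sup>2 * es m (UNIV - {i} - {j}) x"
        unfolding Suc using that by (intro es_remove) auto
      moreover have "?e j = es k (UNIV - {j} - {i}) x + (x $ i)\<^sup>2 * es m (UNIV - {j} - {i}) x"
        unfolding Suc using that by (intro es_remove) auto
      moreover have "UNIV - {j} - {i} = UNIV - {i} - {j}" by auto
      ultimately show ?thesis by (simp add: algebra_simps)
    qed (simp add: algebra_simps)
    then have *: "4 * ?D * ((x $ i - x $ j) * (x $ i + x $ j)) =
        (?p i - ?p j) * (x $ i + x $ j) + (?p i + ?p j) * (x $ i - x $ j)"
      by (simp add: power2_eq_square algebra_simps)
    have "(?p i - ?p j) / (x $ i - x $ j) + (?p i + ?p j) / (x $ i + x $ j) =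
        ((?p i - ?p j) * (x $ i + x $ j) + (?p i + ?p j) * (x $ i - x $ j)) / ((x $ i - x $ j) * (x $ i + x $ j))"
      using w by (intro add_frac_eq) auto
    also have "\<dots> = 4 * ?D" unfolding *[symmetric] using w by simp
    finally show ?thesis .
  qed
  have "(\<Sum>i\<in>UNIV. \<Sum>j\<in>UNIV - {i}. (?p i - ?p j) / (x $ i - x $ j) + (?p i + ?p j) / (x $ i + x $ j)) =
      (\<Sum>i\<in>UNIV. \<Sum>j\<in>UNIV - {i}. 4 * es k (UNIV - {i} - {j}) x)"
    by (intro sum.cong refl pair) auto
  also have "\<dots> = (\<Sum>i\<in>UNIV. 4 * ((?N - 1 - real k) * ?e i))"
    using es_sum_remove[of k "UNIV - {i}" x for i]
    by (intro sum.cong refl) (simp add: sum_distrib_left[symmetric] card_Diff_subset of_nat_diff)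
  also have "\<dots> = 4 * ((?N - 1 - real k) * ((?N - real k) * es k UNIV x))"
    by (simp add: sum_distrib_left[symmetric] s1)
  finally have pairs: "(\<Sum>i\<in>UNIV. \<Sum>j\<in>UNIV - {i}. (?p i - ?p j) / (x $ i - x $ j) + (?p i + ?p j) / (x $ i + x $ j)) =
      4 * ((?N - 1 - real k) * ((?N - real k) * es k UNIV x))" .
  have one: "(\<Sum>i\<in>UNIV. ?p i / x $ i) = 2 * ((?N - real k) * es k UNIV x)"
    using off_wallsD(1)[OF assms] by (simp add: sum_distrib_left[symmetric] s1)
  have p: "pd i (es (Suc k) UNIV) x = ?p i" for i by (simp add: pd_es)
  show ?thesis
    unfolding gen_def drift_sum lap p pairs one by (simp add: es_coeff_def algebra_simps)
qed

section \<open>Laguerre zeros and the linearized drift\<close>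

text \<open>The Laguerre polynomial is compared with the monic polynomial having the zeros
  \<open>z_i\<close>, scaled by the leading coefficient \<open>(-1)^N / N!\<close>: the difference
  has degree below \<open>N\<close> and \<open>N\<close> distinct zeros.\<close>

lemma laguerre_zeros_elsym:
  fixes z :: "(real, 'n::{finite,linorder}) vec"
  assumes z: "\<And>i. laguerre CARD('n) a (z $ i) = 0" "\<And>i j. i < j \<Longrightarrow> z $ j < z $ i"
    and k: "k \<le> CARD('n)"
  shows "elsym k UNIV (\<lambda>i. z $ i) = fact CARD('n) / fact (CARD('n) - k) * ((real CARD('n) + a) gchoose k)"
proof -
  let ?N = "CARD('n)"
  define c where "c j = ((real ?N + a) gchoose (?N - j)) * (-1) ^ j / fact j" for j
  define d where "d j = (-1) ^ (?N - j) * elsym (?N - j) UNIV (\<lambda>i. z $ i)" for j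
  \<comment> \<open>The coefficients of that difference.\<close>
  define b where "b j = c j - (-1) ^ ?N / fact ?N * d j" for j
  have lag: "laguerre ?N a w = (\<Sum>j\<le>?N. c j * w ^ j)" for w
    unfolding laguerre_def c_def by (intro sum.cong refl) (simp add: power_minus[of w])
  have prod: "(\<Prod>i\<in>UNIV. w - z $ i) = (\<Sum>j\<le>?N. d j * w ^ j)" for w
  proof -
    have "(\<Prod>i\<in>UNIV. w - z $ i) = (\<Sum>k\<le>?N. (-1) ^ k * w ^ (?N - k) * elsym k UNIV (\<lambda>i. z $ i))"
      by (rule prod_elsym) simp
    also have "\<dots> = (\<Sum>j\<le>?N. d j * w ^ j)"
      by (rule sum.reindex_bij_witness[of _ "\<lambda>k. ?N - k" "\<lambda>k. ?N - k"]) (auto simp: d_def)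
    finally show ?thesis .
  qed
  have bN: "b ?N = 0" by (simp add: b_def c_def d_def elsym_0)
  have inj: "inj (\<lambda>i. z $ i)"
    by (rule injI) (metis z(2) less_irrefl linorder_less_linear)
  have root: "(\<Sum>j\<le>?N. b j * (z $ i) ^ j) = 0" for i
  proof -
    have "(\<Sum>j\<le>?N. d j * (z $ i) ^ j) = 0"
      unfolding prod[symmetric] by (rule prod_zero) auto
    moreover have "(\<Sum>j\<le>?N. b j * (z $ i) ^ j) = (\<Sum>j\<le>?N. c j * (z $ i) ^ j)
        - (-1) ^ ?N / fact ?N * (\<Sum>j\<le>?N. d j * (z $ i) ^ j)"
      by (simp add: b_def left_diff_distrib sum_subtractf mult.assoc sum_distrib_left)
    ultimately show ?thesis using z(1)[of i] by (simp add: lag)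
  qed
  obtain n where n: "?N = Suc n" using not0_implies_Suc[of ?N] by auto
  have b0: "b j = 0" if "j \<le> ?N" for j
  proof (rule ccontr)
    assume "b j \<noteq> 0"
    with bN that have "j \<le> n" unfolding n by (metis le_SucE)
    with \<open>b j \<noteq> 0\<close> have "\<exists>k\<le>n. b k \<noteq> 0" by blast
    note R = polyfun_rootbound[OF this]
    have "range (\<lambda>i. z $ i) \<subseteq> {w. (\<Sum>j\<le>n. b j * w ^ j) = 0}"
      using root bN by (auto simp: n)
    then have "card (range (\<lambda>i. z $ i)) \<le> n" using R card_mono le_trans by blast
    moreover have "card (range (\<lambda>i. z $ i)) = ?N" using inj by (simp add: card_image)
    ultimately show False using n by simp
  qed
  have "b (?N - k) = 0" using b0 by simp
  then have "((real ?N + a) gchoose k) * (-1) ^ (?N - k) / fact (?N - k) =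
      (-1) ^ ?N / fact ?N * ((-1) ^ k * elsym k UNIV (\<lambda>i. z $ i))"
    using k by (simp add: b_def c_def d_def)
  moreover have "(-1::real) ^ ?N = (-1) ^ (?N - k) * (-1) ^ k" using k by (simp flip: power_add)
  moreover have "(-1::real) ^ k * (-1) ^ k = 1" by (simp flip: power_mult_distrib)
  ultimately have "((real ?N + a) gchoose k) * (-1) ^ (?N - k) / fact (?N - k) =
      (-1) ^ (?N - k) / fact ?N * elsym k UNIV (\<lambda>i. z $ i)"
    by (simp add: mult.assoc)
  then have "((real ?N + a) gchoose k) / fact (?N - k) = elsym k UNIV (\<lambda>i. z $ i) / fact ?N"
    using minus_one_power_iff[where 'a = real, of "?N - k"] by (auto split: if_splits)
  then show ?thesis by (simp add: field_simps)
qed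

text \<open>\<open>r_rec\<close> is all that is kept of the Laguerre polynomial. It says that
  \<open>s^k es k UNIV r\<close>, the value of \<open>es k\<close> on the curve
  \<open>sqrt s r\<close>, solves the system of \<open>gen_es\<close> at \<sigma> = 0.\<close>

locale laguerre_point =
  fixes \<nu> :: real and r :: "(real, 'n::{finite,linorder}) vec"
  assumes nu_pos: "0 < \<nu>"
    and r_pos: "\<And>i. 0 < r $ i"
    and r_dec: "\<And>i j. i < j \<Longrightarrow> r $ j < r $ i"
    and r_rec: "\<And>k. real (Suc k) * es (Suc k) UNIV r = es_coeff CARD('n) 0 \<nu> k * es k UNIV r"

lemma laguerre_point:
  fixes z :: "(real, 'n::{finite,linorder}) vec"
  assumes nu: "\<nu> > 0" and z: "\<And>i. laguerre CARD('n) (\<nu> - 1) (z $ i) = 0" "\<And>i j. i < j \<Longrightarrow> z $ j < z $ i"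
    "\<And>i. z $ i > 0"
  shows "laguerre_point \<nu> (\<chi> i. sqrt (2 * z $ i))"
proof
  let ?r = "\<chi> i. sqrt (2 * z $ i)"
  let ?N = "CARD('n)"
  show "0 < ?r $ i" for i using z(3) by simp
  show "?r $ j < ?r $ i" if "i < j" for i j using z(2)[OF that] by simp
  have es: "es k UNIV ?r = 2 ^ k * elsym k UNIV (\<lambda>i. z $ i)" for k
    unfolding es_def elsym_scale[symmetric] using z(3) by (intro elsym_cong) (simp add: less_imp_le)
  fix k
  show "real (Suc k) * es (Suc k) UNIV ?r = es_coeff ?N 0 \<nu> k * es k UNIV ?r"
  proof (cases "k < ?N")
    case True
    let ?a = "real ?N + (\<nu> - 1)"
    \<comment> \<open>The factor \<open>?a - k = N + \<nu> - 1 - k\<close> is half of the second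
      factor of \<open>es_coeff\<close> at \<sigma> = 0; the first factor comes from the quotient of
      the factorials, and the 2 from \<open>r_i^2 = 2 z_i\<close>.\<close>
    have g: "real (Suc k) * (?a gchoose Suc k) = (?a - real k) * (?a gchoose k)"
      using gbinomial_mult_1[of ?a k] by (simp add: algebra_simps)
    have f: "fact (?N - k) = (real ?N - real k) * fact (?N - Suc k)"
      using True by (metis Suc_diff_Suc diff_Suc_Suc fact_Suc less_imp_le of_nat_diff)
    have fp: "(fact (?N - Suc k) :: real) \<noteq> 0" "real ?N - real k \<noteq> 0" using True by auto
    have "real (Suc k) * es (Suc k) UNIV ?r =
        2 ^ Suc k * (fact ?N / fact (?N - Suc k)) * (real (Suc k) * (?a gchoose Suc k))"
      unfolding es using True by (subst laguerre_zeros_elsym[OF z(1,2)]) auto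
    also have "\<dots> = 2 ^ Suc k * (fact ?N / fact (?N - Suc k)) * ((?a - real k) * (?a gchoose k))"
      unfolding g ..
    also have "\<dots> = es_coeff ?N 0 \<nu> k * (2 ^ k * (fact ?N / fact (?N - k) * (?a gchoose k)))"
      unfolding f es_coeff_def using fp by (simp add: field_simps)
    also have "\<dots> = es_coeff ?N 0 \<nu> k * es k UNIV ?r"
      unfolding es using True by (subst laguerre_zeros_elsym[OF z(1,2)]) auto
    finally show ?thesis .
  next
    case False
    then have "es (Suc k) UNIV ?r = 0" by (simp add: es_def elsym_eq_0)
    moreover have "k > ?N \<Longrightarrow> es k UNIV ?r = 0" by (simp add: es_def elsym_eq_0)
    ultimately show ?thesis using False by (cases "k = ?N") (auto simp: es_coeff_def)
  qed
qed (rule nu)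

text \<open>The Lagrange-type functional \<open>v\<^sub>i(x) = - \<Prod>\<^sub>l (c\<^sub>i\<^sup>2 - x\<^sub>l\<^sup>2) / (2 c\<^sub>i \<Prod>\<^sub>l\<^sub>\<noteq>\<^sub>i (c\<^sub>i\<^sup>2 - c\<^sub>l\<^sup>2))\<close> is linear in the
  elementary symmetric polynomials, and its differential at \<open>c\<close> is the \<open>i\<close>-th coordinate.\<close>

definition lagr_norm :: "(real, 'n::{finite,linorder}) vec \<Rightarrow> 'n \<Rightarrow> real" where
  "lagr_norm c i = - 1 / (2 * c $ i * (\<Prod>l\<in>UNIV - {i}. (c $ i)\<^sup>2 - (c $ l)\<^sup>2))"

definition lagr :: "(real, 'n::{finite,linorder}) vec \<Rightarrow> 'n \<Rightarrow> (real, 'n) vec \<Rightarrow> real" where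
  "lagr c i x = lagr_norm c i * (\<Prod>l\<in>UNIV. (c $ i)\<^sup>2 - (x $ l)\<^sup>2)"

text \<open>The Vieta expansion of a linear combination of the \<open>lagr c i\<close> in terms of
  the \<open>es k\<close>. In this form it can serve as terminal data of the backward
  equation.\<close>

definition lagr_coeff :: "(real, 'n::{finite,linorder}) vec \<Rightarrow> (real, 'n) vec \<Rightarrow> nat \<Rightarrow> real" where
  "lagr_coeff c \<zeta> k = (\<Sum>i\<in>UNIV. \<zeta> $ i * lagr_norm c i * ((-1) ^ k * ((c $ i)\<^sup>2) ^ (CARD('n) - k)))"

lemma lagr_coeff_sum:
  fixes c :: "(real, 'n::{finite,linorder}) vec"
  shows "(\<Sum>k\<le>CARD('n). lagr_coeff c \<zeta> k * es k UNIV x) = (\<Sum>i\<in>UNIV. \<zeta> $ i * lagr c i x)"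
proof -
  have "(\<Sum>k\<le>CARD('n). lagr_coeff c \<zeta> k * es k UNIV x) =
      (\<Sum>k\<le>CARD('n). \<Sum>i\<in>UNIV. \<zeta> $ i * lagr_norm c i * ((-1) ^ k * ((c $ i)\<^sup>2) ^ (CARD('n) - k) * es k UNIV x))"
    unfolding lagr_coeff_def sum_distrib_right by (simp add: mult_ac)
  also have "\<dots> = (\<Sum>i\<in>UNIV. \<zeta> $ i * lagr_norm c i * (\<Sum>k\<le>CARD('n). (-1) ^ k * ((c $ i)\<^sup>2) ^ (CARD('n) - k) * es k UNIV x))"
    by (subst sum.swap) (simp add: sum_distrib_left)
  also have "\<dots> = (\<Sum>i\<in>UNIV. \<zeta> $ i * lagr c i x)"
    using prod_elsym[of UNIV "(c $ i)\<^sup>2" "\<lambda>l. (x $ l)\<^sup>2" for i]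
    by (simp add: lagr_def es_def mult.assoc)
  finally show ?thesis .
qed

lemma C2_lagr: "C2 (lagr c i)"
proof -
  have "C2 (\<lambda>x. lagr_norm c i * (\<Prod>l\<in>UNIV. (c $ i)\<^sup>2 + (-1) * (x $ l)\<^sup>2))"
    by (intro C2_mult C2_prod C2_add C2_const C2_power C2_nth)
  then show ?thesis by (simp add: lagr_def[abs_def])
qed

text \<open>Only the factor of index \<open>j\<close> depends on the \<open>j\<close>-th coordinate;
  for \<open>j\<close> different from \<open>i\<close> the remaining product still contains the
  factor of index \<open>i\<close>, which vanishes at \<open>c\<close>.\<close>

lemma pd_lagr:
  fixes c :: "(real, 'n::{finite,linorder}) vec"
  assumes "c $ i \<noteq> 0" "\<And>l. l \<noteq> i \<Longrightarrow> (c $ i)\<^sup>2 \<noteq> (c $ l)\<^sup>2"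
  shows "pd j (lagr c i) c = (if i = j then 1 else 0)"
proof (rule pd_eqI)
  let ?P = "\<Prod>l\<in>UNIV - {j}. (c $ i)\<^sup>2 - (c $ l)\<^sup>2"
  have e: "lagr c i (c + h *\<^sub>R axis j 1) = lagr_norm c i * (((c $ i)\<^sup>2 - (c $ j + h)\<^sup>2) * ?P)" for h
  proof -
    have "(\<Prod>l\<in>UNIV - {j}. (c $ i)\<^sup>2 - ((c + h *\<^sub>R axis j 1) $ l)\<^sup>2) = ?P"
      by (intro prod.cong refl) (auto simp: axis_def)
    then show ?thesis
      unfolding lagr_def by (subst prod.remove[of UNIV j]) (auto simp: axis_def)
  qed
  have "((\<lambda>h. lagr_norm c i * (((c $ i)\<^sup>2 - (c $ j + h)\<^sup>2) * ?P)) has_real_derivative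
      lagr_norm c i * ((- 2 * c $ j) * ?P)) (at 0)"
    by (auto intro!: derivative_eq_intros)
  moreover have "lagr_norm c i * ((- 2 * c $ j) * ?P) = (if i = j then 1 else 0)"
  proof (cases "i = j")
    case True
    have "?P \<noteq> 0" using True assms(2) by (auto simp: prod_zero_iff)
    then show ?thesis using True assms(1) by (simp add: lagr_norm_def)
  next
    case False
    then have "?P = 0" by (intro prod_zero) auto
    then show ?thesis using False by simp
  qed
  ultimately show "((\<lambda>h. lagr c i (c + h *\<^sub>R axis j 1)) has_real_derivative (if i = j then 1 else 0)) (at 0)"
    unfolding e by simp
qed

text \<open>The gradients of the \<open>es k\<close> at a point off the walls therefore span the
  whole space, with explicit coefficients.\<close>

lemma lagr_coeff_pd:
  fixes c :: "(real, 'n::{finite,linorder}) vec"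
  assumes "\<And>i. c $ i \<noteq> 0" "\<And>i l. l \<noteq> i \<Longrightarrow> (c $ i)\<^sup>2 \<noteq> (c $ l)\<^sup>2"
  shows "(\<Sum>k\<le>CARD('n). lagr_coeff c \<zeta> k * pd j (es k UNIV) c) = \<zeta> $ j"
proof -
  have "(\<Sum>k\<le>CARD('n). lagr_coeff c \<zeta> k * pd j (es k UNIV) c) =
      pd j (\<lambda>x. \<Sum>k\<le>CARD('n). lagr_coeff c \<zeta> k * es k UNIV x) c"
    by (subst pd_sum) (auto intro: C2_cmult C2_es simp: pd_cmult[OF C2_es])
  also have "\<dots> = pd j (\<lambda>x. \<Sum>i\<in>UNIV. \<zeta> $ i * lagr c i x) c"
    unfolding lagr_coeff_sum ..
  also have "\<dots> = (\<Sum>i\<in>UNIV. \<zeta> $ i * pd j (lagr c i) c)"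
    by (subst pd_sum) (auto intro: C2_cmult C2_lagr simp: pd_cmult[OF C2_lagr])
  also have "\<dots> = (\<Sum>i\<in>UNIV. if i = j then \<zeta> $ i else 0)"
    using pd_lagr[OF assms] by (intro sum.cong refl) auto
  finally show ?thesis by simp
qed

section \<open>The matrix S as linearised drift\<close>

context laguerre_point
begin

lemma r_nz: "r $ i \<noteq> 0"
  using r_pos[of i] by simp

lemma r_distinct: "i \<noteq> j \<Longrightarrow> r $ i \<noteq> r $ j"
  using r_dec by (metis less_irrefl linorder_less_linear)

lemma off_walls_r: "off_walls r"
  using r_distinct r_pos
  by (auto simp: off_walls_def roots_def root_form_def) (smt (verit) r_pos)+

lemma r_sq_distinct: "l \<noteq> i \<Longrightarrow> (r $ i)\<^sup>2 \<noteq> (r $ l)\<^sup>2"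
  using off_wallsD(4)[OF off_walls_r] by metis

text \<open>\<open>gen_es\<close> at \<sigma> = 0 combined with Euler's identity for the field
  \<open>x / 2\<close>. At \<open>r\<close> the right-hand side vanishes by
  \<open>r_rec\<close>.\<close>

lemma drift_identity:
  fixes x :: "(real, 'n) vec"
  assumes "off_walls x"
  shows "(\<Sum>i\<in>UNIV. (drift \<nu> x $ i - x $ i / 2) * pd i (es (Suc k) UNIV) x) =
    es_coeff CARD('n) 0 \<nu> k * es k UNIV x - real (Suc k) * es (Suc k) UNIV x"
proof -
  have "(\<Sum>i\<in>UNIV. drift \<nu> x $ i * pd i (es (Suc k) UNIV) x) = es_coeff CARD('n) 0 \<nu> k * es k UNIV x"
    using gen_es[OF assms, of 0 \<nu> k] by (simp add: gen_def)
  moreover have "(\<Sum>i\<in>UNIV. x $ i / 2 * pd i (es (Suc k) UNIV) x) = real (Suc k) * es (Suc k) UNIV x"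
    using euler_es[of x "Suc k"] by (simp add: sum_divide_distrib[symmetric] del: of_nat_Suc)
  ultimately show ?thesis by (simp add: left_diff_distrib sum_subtractf)
qed

text \<open>The residual \<open>u\<close> is orthogonal to the gradients of all \<open>es k\<close>,
  and these span. This is Stieltjes' equilibrium relation for the Laguerre zeros, obtained from
  coefficients instead of the differential equation.\<close>

lemma drift_r: "drift \<nu> r $ i = r $ i / 2"
proof -
  define u where "u = (\<chi> i. drift \<nu> r $ i - r $ i / 2)"
  have u0: "(\<Sum>i\<in>UNIV. u $ i * pd i (es k UNIV) r) = 0" for k
  proof (cases k)
    case (Suc m)
    then show ?thesis using drift_identity[OF off_walls_r, of m] r_rec[of m] by (simp add: u_def)
  qed simp
  have "(\<Sum>j\<in>UNIV. u $ j * u $ j) = (\<Sum>j\<in>UNIV. u $ j * (\<Sum>k\<le>CARD('n). lagr_coeff r u k * pd j (es k UNIV) r))"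
    by (simp add: lagr_coeff_pd[OF r_nz r_sq_distinct])
  also have "\<dots> = (\<Sum>k\<le>CARD('n). lagr_coeff r u k * (\<Sum>j\<in>UNIV. u $ j * pd j (es k UNIV) r))"
    unfolding sum_distrib_left by (subst sum.swap) (simp add: mult_ac)
  also have "\<dots> = 0" by (simp add: u0)
  finally have "u $ i * u $ i = 0"
    by (subst (asm) sum_nonneg_eq_0_iff) auto
  then show ?thesis by (simp add: u_def)
qed

text \<open>The origin of \<open>S_mat\<close>: up to the factor -1/2 it is the Jacobian at
  \<open>r\<close> of the field that vanishes at \<open>r\<close> by \<open>drift_r\<close>.\<close>

lemma DERIV_drift:
  "((\<lambda>h. drift \<nu> (r + h *\<^sub>R axis j 1) $ i - (r + h *\<^sub>R axis j 1) $ i / 2) has_real_derivative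
    - (S_mat \<nu> r $ i $ j) / 2) (at 0)"
proof -
  define d where "d k = (if k = j then 1 else 0 :: real)" for k
  have c: "(r + h *\<^sub>R axis j 1) $ k = r $ k + h * d k" for h k by (simp add: axis_def d_def)
  have nz: "i \<noteq> l \<Longrightarrow> r $ i - r $ l \<noteq> 0" "r $ i + r $ l \<noteq> 0" "r $ i \<noteq> 0" for l
    using r_distinct[of i l] r_pos[of i] r_pos[of l] by auto
  have D: "((\<lambda>h. ((\<Sum>l\<in>UNIV - {i}. 1 / (r $ i + h * d i - (r $ l + h * d l)) + 1 / (r $ i + h * d i + (r $ l + h * d l)))
        + \<nu> / (r $ i + h * d i)) - (r $ i + h * d i) / 2) has_real_derivative
     ((\<Sum>l\<in>UNIV - {i}. - (d i - d l) / (r $ i - r $ l)\<^sup>2 + - (d i + d l) / (r $ i + r $ l)\<^sup>2)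
        + - \<nu> * d i / (r $ i)\<^sup>2) - d i / 2) (at 0)"
  proof -
    have q: "((\<lambda>h. w / (p + h * a)) has_real_derivative - w * a / p\<^sup>2) (at 0)" if "p \<noteq> 0" for p a w :: real
      using that by (auto intro!: derivative_eq_intros simp: power2_eq_square)
    have m: "((\<lambda>h. 1 / (r $ i + h * d i - (r $ l + h * d l))) has_real_derivative - (d i - d l) / (r $ i - r $ l)\<^sup>2) (at 0)"
      if "l \<in> UNIV - {i}" for l
      using q[of "r $ i - r $ l" 1 "d i - d l"] nz(1)[of l] that by (simp add: algebra_simps)
    have p: "((\<lambda>h. 1 / (r $ i + h * d i + (r $ l + h * d l))) has_real_derivative - (d i + d l) / (r $ i + r $ l)\<^sup>2) (at 0)"
      for l
      using q[of "r $ i + r $ l" 1 "d i + d l"] nz(2)[of l] by (simp add: algebra_simps)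
    have l: "((\<lambda>h. (r $ i + h * d i) / 2) has_real_derivative d i / 2) (at 0)"
      by (auto intro!: derivative_eq_intros)
    show ?thesis by (intro DERIV_diff DERIV_add DERIV_sum m p l q nz(3))
  qed
  have "((\<Sum>l\<in>UNIV - {i}. - (d i - d l) / (r $ i - r $ l)\<^sup>2 + - (d i + d l) / (r $ i + r $ l)\<^sup>2)
        + - \<nu> * d i / (r $ i)\<^sup>2) - d i / 2 = - (S_mat \<nu> r $ i $ j) / 2"
  proof (cases "i = j")
    case True
    have "(\<Sum>l\<in>UNIV - {i}. - (d i - d l) / (r $ i - r $ l)\<^sup>2 + - (d i + d l) / (r $ i + r $ l)\<^sup>2) =
        (\<Sum>l\<in>UNIV - {i}. - (1 / (r $ i - r $ l)\<^sup>2) - 1 / (r $ i + r $ l)\<^sup>2)"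
      using True by (intro sum.cong refl) (auto simp: d_def)
    then show ?thesis using True
      by (simp add: S_mat_def d_def sum.distrib sum_subtractf sum_negf field_simps)
  next
    case False
    have "(\<Sum>l\<in>UNIV - {i}. - (d i - d l) / (r $ i - r $ l)\<^sup>2 + - (d i + d l) / (r $ i + r $ l)\<^sup>2) =
        (\<Sum>l\<in>UNIV - {i}. if l = j then 1 / (r $ i - r $ l)\<^sup>2 - 1 / (r $ i + r $ l)\<^sup>2 else 0)"
      using False by (intro sum.cong refl) (auto simp: d_def)
    also have "\<dots> = 1 / (r $ i - r $ j)\<^sup>2 - 1 / (r $ i + r $ j)\<^sup>2"
      using False by simp
    finally show ?thesis using False by (simp add: S_mat_def d_def)
  qed
  with D show ?thesis unfolding c drift_def vec_lambda_beta by simp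
qed

text \<open>\<open>drift_identity\<close> differentiated at \<open>r\<close> along the axis
  \<open>j\<close>. The second derivatives of \<open>es\<close> disappear, being multiplied by the
  field that vanishes at \<open>r\<close>.\<close>

lemma es_gradient_S:
  "(\<Sum>i\<in>UNIV. S_mat \<nu> r $ i $ j * pd i (es (Suc k) UNIV) r) =
    2 * (real (Suc k) * pd j (es (Suc k) UNIV) r - es_coeff CARD('n) 0 \<nu> k * pd j (es k UNIV) r)"
proof -
  let ?y = "\<lambda>h. r + h *\<^sub>R axis j 1"
  have "((\<lambda>h. \<Sum>i\<in>UNIV. (drift \<nu> (?y h) $ i - ?y h $ i / 2) * pd i (es (Suc k) UNIV) (?y h)) has_real_derivative
      (\<Sum>i\<in>UNIV. - (S_mat \<nu> r $ i $ j) / 2 * pd i (es (Suc k) UNIV) r)) (at 0)"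
  proof (rule DERIV_sum)
    fix i
    have "((\<lambda>h. (drift \<nu> (?y h) $ i - ?y h $ i / 2) * pd i (es (Suc k) UNIV) (?y h)) has_real_derivative
      - (S_mat \<nu> r $ i $ j) / 2 * pd i (es (Suc k) UNIV) (?y 0)
        + pd j (pd i (es (Suc k) UNIV)) r * (drift \<nu> (?y 0) $ i - ?y 0 $ i / 2)) (at 0)"
      by (rule DERIV_mult[OF DERIV_drift has_pd[OF C2D(2)[OF C2_es]]])
    then show "((\<lambda>h. (drift \<nu> (?y h) $ i - ?y h $ i / 2) * pd i (es (Suc k) UNIV) (?y h)) has_real_derivative
      - (S_mat \<nu> r $ i $ j) / 2 * pd i (es (Suc k) UNIV) r) (at 0)"
      by (simp add: drift_r)
  qed
  moreover have "((\<lambda>h. \<Sum>i\<in>UNIV. (drift \<nu> (?y h) $ i - ?y h $ i / 2) * pd i (es (Suc k) UNIV) (?y h)) has_real_derivative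
      es_coeff CARD('n) 0 \<nu> k * pd j (es k UNIV) r - real (Suc k) * pd j (es (Suc k) UNIV) r) (at 0)"
  \<comment> \<open>The identity to be differentiated is available off the walls only; this is an
    open condition on \<open>h\<close> that holds at \<open>h = 0\<close>.\<close>
  proof (rule has_field_derivative_transform_within_open)
    show "((\<lambda>h. es_coeff CARD('n) 0 \<nu> k * es k UNIV (?y h) - real (Suc k) * es (Suc k) UNIV (?y h)) has_real_derivative
      es_coeff CARD('n) 0 \<nu> k * pd j (es k UNIV) r - real (Suc k) * pd j (es (Suc k) UNIV) r) (at 0)"
      by (intro DERIV_diff DERIV_cmult has_pd C2D(1)[OF C2_es])
    show "open (\<Inter>a\<in>roots. {h. root_form a (?y h) \<noteq> 0})"
      by (intro open_INT ballI open_Collect_neq continuous_intros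
          continuous_on_compose2[OF C2_continuous(1)[OF C2_root_form]]) auto
    show "0 \<in> (\<Inter>a\<in>roots. {h. root_form a (?y h) \<noteq> 0})"
      using off_walls_r by (simp add: off_walls_def)
    show "es_coeff CARD('n) 0 \<nu> k * es k UNIV (?y h) - real (Suc k) * es (Suc k) UNIV (?y h) =
        (\<Sum>i\<in>UNIV. (drift \<nu> (?y h) $ i - ?y h $ i / 2) * pd i (es (Suc k) UNIV) (?y h))"
      if "h \<in> (\<Inter>a\<in>roots. {h. root_form a (?y h) \<noteq> 0})" for h
      using that by (intro drift_identity[symmetric]) (simp add: off_walls_def)
  qed
  ultimately have "(\<Sum>i\<in>UNIV. - (S_mat \<nu> r $ i $ j) / 2 * pd i (es (Suc k) UNIV) r) =
      es_coeff CARD('n) 0 \<nu> k * pd j (es k UNIV) r - real (Suc k) * pd j (es (Suc k) UNIV) r"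
    by (rule DERIV_unique)
  moreover have "(\<Sum>i\<in>UNIV. - (S_mat \<nu> r $ i $ j) / 2 * pd i (es (Suc k) UNIV) r) =
      - (\<Sum>i\<in>UNIV. S_mat \<nu> r $ i $ j * pd i (es (Suc k) UNIV) r) / 2"
    by (simp add: sum_divide_distrib sum_negf)
  ultimately show ?thesis by simp
qed

lemma S_symmetric: "transpose (S_mat \<nu> r) = S_mat \<nu> r"
  by (simp add: transpose_def S_mat_def vec_eq_iff add.commute power2_commute)

text \<open>After symmetrisation over pairs the off-diagonal part is a sum of squares of
  \<open>v_i - v_l\<close> and \<open>v_i + v_l\<close> with positive weights.\<close>

lemma S_quadratic_ge: "v \<bullet> (S_mat \<nu> r *v v) \<ge> v \<bullet> v"
proof -
  let ?a = "\<lambda>i l. 2 * (v $ i)\<^sup>2 / (r $ i - r $ l)\<^sup>2 + 2 * (v $ i)\<^sup>2 / (r $ i + r $ l)\<^sup>2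
      + (2 / (r $ i + r $ l)\<^sup>2 - 2 / (r $ i - r $ l)\<^sup>2) * (v $ i * v $ l)"
  have row: "v $ i * (\<Sum>j\<in>UNIV. S_mat \<nu> r $ i $ j * v $ j) =
      (v $ i)\<^sup>2 * (1 + 2 * \<nu> / (r $ i)\<^sup>2) + (\<Sum>l\<in>UNIV - {i}. ?a i l)" for i
  proof -
    have "(\<Sum>j\<in>UNIV. S_mat \<nu> r $ i $ j * v $ j) = S_mat \<nu> r $ i $ i * v $ i
        + (\<Sum>j\<in>UNIV - {i}. S_mat \<nu> r $ i $ j * v $ j)"
      by (rule sum.remove) auto
    also have "(\<Sum>j\<in>UNIV - {i}. S_mat \<nu> r $ i $ j * v $ j) =
        (\<Sum>l\<in>UNIV - {i}. (2 / (r $ i + r $ l)\<^sup>2 - 2 / (r $ i - r $ l)\<^sup>2) * v $ l)"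
      by (intro sum.cong refl) (auto simp: S_mat_def)
    finally show ?thesis
      by (simp add: S_mat_def sum.distrib sum_distrib_left sum_distrib_right power2_eq_square
          distrib_left distrib_right mult_ac)
  qed
  have "(\<Sum>i\<in>UNIV. \<Sum>l\<in>UNIV - {i}. ?a i l) \<ge> 0"
  proof -
    have "2 * (\<Sum>i\<in>UNIV. \<Sum>l\<in>UNIV - {i}. ?a i l) =
        (\<Sum>i\<in>UNIV. \<Sum>l\<in>UNIV - {i}. ?a i l) + (\<Sum>i\<in>UNIV. \<Sum>l\<in>UNIV - {i}. ?a l i)"
      using sum_offdiag_swap[of ?a] by simp
    also have "\<dots> = (\<Sum>i\<in>UNIV. \<Sum>l\<in>UNIV - {i}. ?a i l + ?a l i)" by (simp add: sum.distrib)
    also have "\<dots> \<ge> 0"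
    proof (intro sum_nonneg)
      fix i l
      have "?a i l + ?a l i = 2 * (v $ i - v $ l)\<^sup>2 / (r $ i - r $ l)\<^sup>2 + 2 * (v $ i + v $ l)\<^sup>2 / (r $ i + r $ l)\<^sup>2"
        by (simp add: power2_commute[of "r $ l" "r $ i"] add.commute[of "r $ l" "r $ i"])
           (simp add: power2_diff power2_sum algebra_simps add_divide_distrib diff_divide_distrib)
      then show "0 \<le> ?a i l + ?a l i" by simp
    qed
    finally show ?thesis by simp
  qed
  moreover have "v \<bullet> (S_mat \<nu> r *v v) = (\<Sum>i\<in>UNIV. (v $ i)\<^sup>2 * (1 + 2 * \<nu> / (r $ i)\<^sup>2)) + (\<Sum>i\<in>UNIV. \<Sum>l\<in>UNIV - {i}. ?a i l)"
    by (simp add: inner_vec_def matrix_vector_mult_def row sum.distrib)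
  moreover have "v \<bullet> v \<le> (\<Sum>i\<in>UNIV. (v $ i)\<^sup>2 * (1 + 2 * \<nu> / (r $ i)\<^sup>2))"
    unfolding inner_vec_def
    by (intro sum_mono) (use nu_pos in \<open>simp add: distrib_left power2_eq_square\<close>)
  ultimately show ?thesis by simp
qed

lemma S_invertible: "invertible (S_mat \<nu> r)"
proof -
  have "inj ((*v) (S_mat \<nu> r))"
  proof (rule injI)
    fix x y assume "S_mat \<nu> r *v x = S_mat \<nu> r *v y"
    then have "S_mat \<nu> r *v (x - y) = 0" by (simp add: matrix_vector_mult_diff_distrib)
    then have "(x - y) \<bullet> (x - y) \<le> 0" using S_quadratic_ge[of "x - y"] by simp
    then show "x = y" using inner_ge_zero[of "x - y"] by (simp add: order_antisym_conv)
  qed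
  then show ?thesis
    using invertible_left_inverse matrix_left_invertible_injective by blast
qed

end

section \<open>Moments and Dynkin's formula for functions of polynomial growth\<close>

definition wt :: "(real, 'n::{finite,linorder}) vec \<Rightarrow> real" where
  "wt x = 1 + sqn x"

lemma wt_ge_1: "1 \<le> wt x" by (simp add: wt_def)

lemma wt_power_ge_1: "1 \<le> wt x ^ m" by (simp add: wt_ge_1 one_le_power)

lemma C2_wt: "C2 wt"
  unfolding wt_def[abs_def] by (intro C2_add C2_const C2_sqn)

definition pgrowth :: "((real, 'n::{finite,linorder}) vec \<Rightarrow> real) \<Rightarrow> bool" where
  "pgrowth p \<longleftrightarrow> (\<exists>K m. 0 \<le> K \<and> (\<forall>x. \<bar>p x\<bar> \<le> K * wt x ^ m))"

lemma pgrowthI: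
  fixes p :: "(real, 'n::{finite,linorder}) vec \<Rightarrow> real"
  assumes "\<And>x. \<bar>p x\<bar> \<le> K * wt x ^ m"
  shows "pgrowth p"
proof -
  have "\<bar>p x\<bar> \<le> \<bar>K\<bar> * wt x ^ m" for x
    by (rule order_trans[OF assms], rule mult_right_mono)
       (use wt_power_ge_1[of x m] in auto)
  then show ?thesis unfolding pgrowth_def by (metis abs_ge_zero)
qed

lemma pgrowth_const: "pgrowth (\<lambda>x. c)"
  by (rule pgrowthI[of _ "\<bar>c\<bar>" 0]) simp

lemma pgrowth_add:
  fixes p q :: "(real, 'n::{finite,linorder}) vec \<Rightarrow> real"
  assumes "pgrowth p" "pgrowth q" shows "pgrowth (\<lambda>x. p x + q x)"
proof -
  obtain K m where K: "0 \<le> K" "\<And>x. \<bar>p x\<bar> \<le> K * wt x ^ m" using assms(1) by (auto simp: pgrowth_def)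
  obtain L n where L: "0 \<le> L" "\<And>x. \<bar>q x\<bar> \<le> L * wt x ^ n" using assms(2) by (auto simp: pgrowth_def)
  show ?thesis
  proof (rule pgrowthI[of _ "K + L" "m + n"])
    fix x :: "(real, 'n) vec"
    have "K * wt x ^ m \<le> K * wt x ^ (m + n)" "L * wt x ^ n \<le> L * wt x ^ (m + n)"
      using K(1) L(1) wt_ge_1[of x] by (auto intro!: mult_left_mono power_increasing)
    then show "\<bar>p x + q x\<bar> \<le> (K + L) * wt x ^ (m + n)"
      using K(2)[of x] L(2)[of x] by (simp add: distrib_right)
  qed
qed

lemma pgrowth_mult:
  fixes p q :: "(real, 'n::{finite,linorder}) vec \<Rightarrow> real"
  assumes "pgrowth p" "pgrowth q" shows "pgrowth (\<lambda>x. p x * q x)"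
proof -
  obtain K m where K: "0 \<le> K" "\<And>x. \<bar>p x\<bar> \<le> K * wt x ^ m" using assms(1) by (auto simp: pgrowth_def)
  obtain L n where L: "0 \<le> L" "\<And>x. \<bar>q x\<bar> \<le> L * wt x ^ n" using assms(2) by (auto simp: pgrowth_def)
  show ?thesis
  proof (rule pgrowthI[of _ "K * L" "m + n"])
    fix x :: "(real, 'n) vec"
    have "\<bar>p x\<bar> * \<bar>q x\<bar> \<le> (K * wt x ^ m) * (L * wt x ^ n)" by (rule mult_mono') (use K L in auto)
    then show "\<bar>p x * q x\<bar> \<le> K * L * wt x ^ (m + n)" by (simp add: abs_mult power_add mult_ac)
  qed
qed

lemma pgrowth_sum: "(\<And>k. k \<in> I \<Longrightarrow> pgrowth (p k)) \<Longrightarrow> pgrowth (\<lambda>x. \<Sum>k\<in>I. p k x)"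
  by (induction I rule: infinite_finite_induct) (auto intro: pgrowth_add pgrowth_const)

lemma pgrowth_mono: "pgrowth q \<Longrightarrow> (\<And>x. \<bar>p x\<bar> \<le> \<bar>q x\<bar>) \<Longrightarrow> pgrowth p"
  unfolding pgrowth_def by (meson order_trans)

lemma pgrowth_es: "pgrowth (es k A)"
  by (rule pgrowthI[of _ "2 ^ CARD('a)" "CARD('a)"]) (use es_bound[of k A] es_nonneg[of k A] in \<open>simp add: wt_def\<close>)

lemma pgrowth_nth: "pgrowth (\<lambda>x. x $ i)"
proof (rule pgrowthI[of _ 1 1])
  fix x :: "(real,'a) vec"
  have "2 * \<bar>x $ i\<bar> \<le> 1 + (x $ i)\<^sup>2"
    using sum_squares_bound[of "\<bar>x $ i\<bar>" 1] by simp
  then show "\<bar>x $ i\<bar> \<le> 1 * wt x ^ 1" using sqn_component[of x i] by (simp add: wt_def)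
qed

lemma pgrowth_pd_es: "pgrowth (pd i (es k UNIV))"
proof (cases k)
  case (Suc m)
  then show ?thesis
    by (simp add: pd_es) (intro pgrowth_mult pgrowth_const pgrowth_nth pgrowth_es)
qed (simp add: pgrowth_const ext[OF pd_es_0])

lemma sqn_es: "sqn = es (Suc 0) UNIV"
proof
  fix x :: "(real,'a) vec"
  have "(\<Sum>i\<in>UNIV. x $ i * pd i (es (Suc 0) UNIV) x) = 2 * sqn x"
    by (simp add: pd_es sqn_def power2_eq_square sum_distrib_left mult_ac)
  then show "sqn x = es (Suc 0) UNIV x"
    using euler_es[of x "Suc 0"] by simp
qed

lemma gen_sqn: "off_walls (x :: (real, 'n::{finite,linorder}) vec) \<Longrightarrow> gen \<sigma> \<nu> sqn x = es_coeff CARD('n) \<sigma> \<nu> 0"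
  using gen_es[of x \<sigma> \<nu> 0] by (simp add: sqn_es)

lemma grad_inner_sqn: "grad_inner sqn sqn x = 4 * sqn x"
  unfolding grad_inner_def sqn_es by (simp add: pd_es) (simp add: sqn_es[symmetric] sqn_def power2_eq_square sum_distrib_left mult_ac)

text \<open>The cutoff depends on \<open>sqn\<close> only, whose generator is constant off the
  walls, so no singular drift appears. The summand 12 bounds the second-order term, using
  \<open>sqn x * u \<le> R\<close> and \<open>\<sigma> \<le> 1\<close>.\<close>

lemma gen_cutoff_bound:
  fixes x :: "(real, 'n::{finite,linorder}) vec"
  assumes x: "off_walls x" and R: "0 < R" and s: "0 < \<sigma>" "\<sigma> \<le> 1" and C: "0 \<le> C" "\<bar>es_coeff CARD('n) \<sigma> \<nu> 0\<bar> \<le> C"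
  shows "\<bar>gen \<sigma> \<nu> (cutoff R) x\<bar> \<le> (3 * C + 12) / R" "R \<le> sqn x \<Longrightarrow> gen \<sigma> \<nu> (cutoff R) x = 0"
    "\<bar>pd i (cutoff R) x\<bar> \<le> 6 * wt x / R" "R \<le> sqn x \<Longrightarrow> pd i (cutoff R) x = 0"
proof -
  define u where "u = max 0 (1 - sqn x / R)"
  have u: "0 \<le> u" "u \<le> 1" using R by (auto simp: u_def)
  have q: "sqn x * u \<le> R"
  proof (cases "sqn x \<le> R")
    case True
    have "sqn x * u \<le> R * 1" using True u R by (intro mult_mono) auto
    then show ?thesis by simp
  next
    case False
    then show ?thesis using R by (simp add: u_def max_def)
  qed
  have g: "gen \<sigma> \<nu> (cutoff R) x = - 3 / R * u\<^sup>2 * es_coeff CARD('n) \<sigma> \<nu> 0 + \<sigma> / 2 * (6 / R\<^sup>2 * u) * (4 * sqn x)"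
    unfolding cutoff_def[abs_def] gen_compose[OF C2_sqn cutoff_fun_deriv] gen_sqn[OF x] grad_inner_sqn u_def ..
  have "\<bar>- 3 / R * u\<^sup>2 * es_coeff CARD('n) \<sigma> \<nu> 0\<bar> \<le> 3 / R * 1 * C"
    unfolding abs_mult using C R u by (intro mult_mono) (auto simp: power_le_one)
  moreover have "\<bar>\<sigma> / 2 * (6 / R\<^sup>2 * u) * (4 * sqn x)\<bar> \<le> 12 / R"
  proof -
    have "\<bar>\<sigma> / 2 * (6 / R\<^sup>2 * u) * (4 * sqn x)\<bar> = \<sigma> * (12 / R\<^sup>2) * (sqn x * u)"
      using s u by (simp add: abs_mult)
    also have "\<dots> \<le> 1 * (12 / R\<^sup>2) * R" using s u q R by (intro mult_mono) auto
    finally show ?thesis using R by (simp add: power2_eq_square)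
  qed
  ultimately have "\<bar>gen \<sigma> \<nu> (cutoff R) x\<bar> \<le> 3 / R * 1 * C + 12 / R"
    unfolding g by (intro order_trans[OF abs_triangle_ineq] add_mono)
  then show "\<bar>gen \<sigma> \<nu> (cutoff R) x\<bar> \<le> (3 * C + 12) / R"
    by (simp add: add_divide_distrib)
  have p: "pd i (cutoff R) x = - 3 / R * u\<^sup>2 * (2 * x $ i)"
    unfolding cutoff_def[abs_def] C2_pd_compose(1)[OF C2_sqn cutoff_fun_deriv] u_def
    by (simp add: sqn_es pd_es)
  have "\<bar>- 3 / R * u\<^sup>2 * (2 * x $ i)\<bar> \<le> 3 / R * 1 * (2 * wt x)"
  proof -
    have "2 * \<bar>x $ i\<bar> \<le> 1 + (x $ i)\<^sup>2" using sum_squares_bound[of "\<bar>x $ i\<bar>" 1] by simp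
    then have "\<bar>x $ i\<bar> \<le> wt x" using sqn_component[of x i] by (simp add: wt_def)
    then show ?thesis unfolding abs_mult using R u by (intro mult_mono) (auto simp: power_le_one)
  qed
  then show "\<bar>pd i (cutoff R) x\<bar> \<le> 6 * wt x / R" unfolding p by simp
  assume "R \<le> sqn x"
  then have "u = 0" using R by (simp add: u_def max_def)
  then show "gen \<sigma> \<nu> (cutoff R) x = 0" "pd i (cutoff R) x = 0" unfolding g p by auto
qed

lemma C2_wt_power: "C2 (\<lambda>x. wt x ^ m)" by (intro C2_power) (use C2_wt in simp)

lemma gen_wt_power:
  fixes x :: "(real, 'n::{finite,linorder}) vec"
  assumes "off_walls x"
  shows "gen \<sigma> \<nu> (\<lambda>x. wt x ^ Suc m) x = real (Suc m) * wt x ^ m * es_coeff CARD('n) \<sigma> \<nu> 0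
    + \<sigma> / 2 * (real (Suc m) * (real m * wt x ^ (m - 1))) * (4 * sqn x)"
    "pd i (\<lambda>x. wt x ^ Suc m) x = real (Suc m) * wt x ^ m * (2 * x $ i)"
proof -
  have d1: "((\<lambda>v::real. (1 + v) ^ Suc m) has_real_derivative real (Suc m) * (1 + v) ^ m) (at v)" for v
    by (rule DERIV_cong[OF DERIV_chain2[OF DERIV_pow DERIV_add[OF DERIV_const DERIV_ident]]]) simp
  have d2: "((\<lambda>v::real. real (Suc m) * (1 + v) ^ m) has_real_derivative real (Suc m) * (real m * (1 + v) ^ (m - 1))) (at v)" for v
    by (auto intro!: derivative_eq_intros)
  show "gen \<sigma> \<nu> (\<lambda>x. wt x ^ Suc m) x = real (Suc m) * wt x ^ m * es_coeff CARD('n) \<sigma> \<nu> 0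
    + \<sigma> / 2 * (real (Suc m) * (real m * wt x ^ (m - 1))) * (4 * sqn x)"
    unfolding wt_def gen_compose[OF C2_sqn d1 d2] gen_sqn[OF assms] grad_inner_sqn ..
  show "pd i (\<lambda>x. wt x ^ Suc m) x = real (Suc m) * wt x ^ m * (2 * x $ i)"
    unfolding wt_def C2_pd_compose(1)[OF C2_sqn d1 d2] by (simp add: sqn_es pd_es)
qed

definition drift_bound :: "nat \<Rightarrow> real \<Rightarrow> real" where
  "drift_bound N \<nu> = real N * (1 + 2 * \<nu> + 2 * real N)"

text \<open>One summand for each term of the product rule applied to a power of the weight times a
  cutoff. Neither \<sigma> nor the cutoff radius occurs.\<close>

definition moment_const :: "nat \<Rightarrow> real \<Rightarrow> nat \<Rightarrow> real" where
  "moment_const N \<nu> m = 2 * (3 * drift_bound N \<nu> + 12) + (real (Suc m) * drift_bound N \<nu> + 2 * real (Suc m) * real m)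
     + real N * (24 * real (Suc m))"

lemma es_coeff_bound:
  assumes "0 < \<sigma>" "\<sigma> \<le> 1" "0 < \<nu>" "0 < N"
  shows "\<bar>es_coeff N \<sigma> \<nu> 0\<bar> \<le> drift_bound N \<nu>" "0 \<le> drift_bound N \<nu>"
proof -
  have N: "1 \<le> real N" using assms(4) by simp
  have "\<bar>\<sigma> + 2 * \<nu> + 2 * (real N - 1)\<bar> \<le> 1 + 2 * \<nu> + 2 * real N" using assms N by simp
  then show "\<bar>es_coeff N \<sigma> \<nu> 0\<bar> \<le> drift_bound N \<nu>"
    unfolding es_coeff_def drift_bound_def by (simp add: abs_mult mult_left_mono)
  show "0 \<le> drift_bound N \<nu>" using assms by (simp add: drift_bound_def)
qed

text \<open>One power of the weight is gained, which drives the induction on moments. The bound is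
  one-sided because only an upper bound for expectations is wanted.\<close>

lemma gen_wt_cutoff_bound:
  fixes x :: "(real, 'n::{finite,linorder}) vec"
  assumes x: "off_walls x" and R: "1 \<le> R" and s: "0 < \<sigma>" "\<sigma> \<le> 1" "0 < \<nu>"
  shows "gen \<sigma> \<nu> (\<lambda>x. wt x ^ Suc m * cutoff R x) x \<le> moment_const CARD('n) \<nu> m * wt x ^ m"
proof -
  let ?N = "CARD('n)"
  have R0: "0 < R" using R by simp
  define D where "D = drift_bound ?N \<nu>"
  have D: "\<bar>es_coeff ?N \<sigma> \<nu> 0\<bar> \<le> D" "0 \<le> D" unfolding D_def by (rule es_coeff_bound; use s in simp)+
  have w: "1 \<le> wt x" "1 \<le> wt x ^ m" by (rule wt_ge_1, rule wt_power_ge_1)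
  note cb = gen_cutoff_bound[OF x R0 s(1,2) D(2,1)]
  have a: "wt x ^ Suc m * gen \<sigma> \<nu> (cutoff R) x \<le> 2 * (3 * D + 12) * wt x ^ m"
  proof (cases "R \<le> sqn x")
    case True
    then show ?thesis using cb(2)[OF True] D w by simp
  next
    case False
    \<comment> \<open>Where the cutoff lives, the surplus power of the weight is paid for by the
      factor \<open>1 / R\<close> in the generator of the cutoff.\<close>
    then have "wt x \<le> 2 * R" using R by (simp add: wt_def)
    have "wt x ^ Suc m * gen \<sigma> \<nu> (cutoff R) x \<le> wt x ^ Suc m * ((3 * D + 12) / R)"
      using cb(1) w by (intro mult_left_mono) auto
    also have "\<dots> = (wt x / R) * ((3 * D + 12) * wt x ^ m)" by simp
    also have "\<dots> \<le> 2 * ((3 * D + 12) * wt x ^ m)"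
      using \<open>wt x \<le> 2 * R\<close> R0 D w by (intro mult_right_mono) (auto simp: pos_divide_le_eq)
    finally show ?thesis by (simp only: mult.assoc)
  qed
  have b: "cutoff R x * gen \<sigma> \<nu> (\<lambda>x. wt x ^ Suc m) x \<le> (real (Suc m) * D + 2 * real (Suc m) * real m) * wt x ^ m"
  proof -
    have "real (Suc m) * wt x ^ m * es_coeff ?N \<sigma> \<nu> 0 \<le> real (Suc m) * wt x ^ m * D"
      using D w by (intro mult_left_mono) auto
    moreover have "\<sigma> / 2 * (real (Suc m) * (real m * wt x ^ (m - 1))) * (4 * sqn x) \<le> 2 * real (Suc m) * real m * wt x ^ m"
    proof (cases m)
      case (Suc k)
      have "\<sigma> * (2 * real (Suc m) * real m * (wt x ^ k * sqn x)) \<le> 1 * (2 * real (Suc m) * real m * (wt x ^ k * wt x))"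
        using s w wt_power_ge_1[of x k] by (intro mult_mono) (auto simp: wt_def)
      moreover have "\<sigma> / 2 * (real (Suc m) * (real m * wt x ^ (m - 1))) * (4 * sqn x)
          = \<sigma> * (2 * real (Suc m) * real m * (wt x ^ k * sqn x))"
        by (simp add: Suc algebra_simps)
      moreover have "2 * real (Suc m) * real m * wt x ^ m = 1 * (2 * real (Suc m) * real m * (wt x ^ k * wt x))"
        by (simp add: Suc algebra_simps)
      ultimately show ?thesis by (simp only:)
    qed simp
    ultimately have "gen \<sigma> \<nu> (\<lambda>x. wt x ^ Suc m) x \<le> (real (Suc m) * D + 2 * real (Suc m) * real m) * wt x ^ m"
      unfolding gen_wt_power(1)[OF x] by (simp add: algebra_simps)
    then have "cutoff R x * gen \<sigma> \<nu> (\<lambda>x. wt x ^ Suc m) x \<le> cutoff R x * ((real (Suc m) * D + 2 * real (Suc m) * real m) * wt x ^ m)"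
      using cutoff_bounds(1)[OF R0] by (intro mult_left_mono)
    also have "\<dots> \<le> 1 * ((real (Suc m) * D + 2 * real (Suc m) * real m) * wt x ^ m)"
      using cutoff_bounds(2)[OF R0, of x] D w by (intro mult_right_mono) auto
    finally show ?thesis by simp
  qed
  have c: "\<sigma> * grad_inner (\<lambda>x. wt x ^ Suc m) (cutoff R) x \<le> real ?N * (24 * real (Suc m)) * wt x ^ m"
  proof -
    have "pd i (\<lambda>x. wt x ^ Suc m) x * pd i (cutoff R) x \<le> 24 * real (Suc m) * wt x ^ m" for i
    proof (cases "R \<le> sqn x")
      case True
      then show ?thesis using cb(4)[of i] w by simp
    next
      case False
      then have r: "wt x \<le> 2 * R" using R by (simp add: wt_def)
      have e: "pd i (cutoff R) x = - 3 / R * (max 0 (1 - sqn x / R))\<^sup>2 * (2 * x $ i)"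
        unfolding cutoff_def[abs_def] C2_pd_compose(1)[OF C2_sqn cutoff_fun_deriv] by (simp add: sqn_es pd_es)
      \<comment> \<open>The cutoff decreases in the direction in which the weight increases, so the
        cross term is nonpositive.\<close>
      have "pd i (\<lambda>x. wt x ^ Suc m) x * pd i (cutoff R) x =
          - (real (Suc m) * wt x ^ m * (12 / R) * (max 0 (1 - sqn x / R))\<^sup>2 * (x $ i)\<^sup>2)"
        unfolding gen_wt_power(2)[OF x] e by (simp add: power2_eq_square)
      also have "\<dots> \<le> 0"
        using R0 w by (simp add: zero_le_mult_iff)
      also have "0 \<le> 24 * real (Suc m) * wt x ^ m" using w by simp
      finally show ?thesis .
    qed
    then have "grad_inner (\<lambda>x. wt x ^ Suc m) (cutoff R) x \<le> (\<Sum>i\<in>(UNIV :: 'n set). 24 * real (Suc m) * wt x ^ m)"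
      unfolding grad_inner_def by (intro sum_mono)
    then have "grad_inner (\<lambda>x. wt x ^ Suc m) (cutoff R) x \<le> real ?N * (24 * real (Suc m)) * wt x ^ m" by (simp add: mult_ac)
    then have "\<sigma> * grad_inner (\<lambda>x. wt x ^ Suc m) (cutoff R) x \<le> \<sigma> * (real ?N * (24 * real (Suc m)) * wt x ^ m)"
      using s by (intro mult_left_mono) auto
    also have "\<dots> \<le> 1 * (real ?N * (24 * real (Suc m)) * wt x ^ m)"
      using s w by (intro mult_right_mono) auto
    finally show ?thesis by simp
  qed
  show ?thesis
    using a b c unfolding gen_mult[OF C2_wt_power C2_cutoff] moment_const_def D_def[symmetric]
    by (simp add: distrib_right)
qed

section \<open>Moments along the process\<close>

context dynkin_process
begin

lemma p_measurable:
  assumes "continuous_on UNIV p" "0 \<le> u"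
  shows "(\<lambda>\<omega>. p (X u \<omega>) :: real) \<in> borel_measurable M"
  using measurable_compose[OF X_measurable[OF assms(2)] borel_measurable_continuous_onI[OF assms(1)]] .

lemma wt_continuous: "continuous_on UNIV (\<lambda>x. wt x ^ m)"
  by (rule C2_continuous(1)[OF C2_wt_power])

lemma integrable_time:
  assumes "0 \<le> t" "\<And>s. s \<in> {0..t} \<Longrightarrow> integrable M (\<lambda>\<omega>. wt (X s \<omega>) ^ m) \<and> expectation (\<lambda>\<omega>. wt (X s \<omega>) ^ m) \<le> A"
  shows "integrable (time_space t M) (\<lambda>z. wt (X (fst z) (snd z)) ^ m)"
    "(\<integral>z. wt (X (fst z) (snd z)) ^ m \<partial>time_space t M) \<le> t * A"
proof -
  interpret P: pair_sigma_finite "restrict_space lborel {0..t::real}" M by (rule pair_sigma_finite_time)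
  have w0: "0 \<le> wt x ^ m" for x :: "(real,'n) vec" using wt_power_ge_1[of x m] by linarith
  have A0: "0 \<le> A"
    using assms(2)[of 0] assms(1) order_trans[OF Bochner_Integration.integral_nonneg[OF w0]] by fastforce
  have meas: "(\<lambda>z. wt (X (fst z) (snd z)) ^ m) \<in> borel_measurable (time_space t M)"
    by (rule measurable_compose[OF Z_measurable borel_measurable_continuous_onI[OF wt_continuous]])
  have "(\<integral>\<^sup>+z. ennreal (wt (X (fst z) (snd z)) ^ m) \<partial>time_space t M) =
      (\<integral>\<^sup>+u. \<integral>\<^sup>+\<omega>. ennreal (wt (X u \<omega>) ^ m) \<partial>M \<partial>restrict_space lborel {0..t})"
    using meas by (subst nn_integral_fst[symmetric]) auto
  also have "\<dots> \<le> (\<integral>\<^sup>+u. ennreal A \<partial>restrict_space lborel {0..t})"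
  proof (rule nn_integral_mono)
    fix u assume "u \<in> space (restrict_space lborel {0..t})"
    then have u: "u \<in> {0..t}" by simp
    then have "(\<integral>\<^sup>+\<omega>. ennreal (wt (X u \<omega>) ^ m) \<partial>M) = ennreal (expectation (\<lambda>\<omega>. wt (X u \<omega>) ^ m))"
      using assms(2) w0 by (intro nn_integral_eq_integral) auto
    then show "(\<integral>\<^sup>+\<omega>. ennreal (wt (X u \<omega>) ^ m) \<partial>M) \<le> ennreal A"
      using assms(2)[OF u] by (simp add: ennreal_leI)
  qed
  also have "\<dots> = ennreal (t * A)"
    using assms(1) A0
    by (simp add: emeasure_restrict_space space_restrict_space emeasure_lborel_Icc_eq ennreal_mult mult.commute)
  finally have le: "(\<integral>\<^sup>+z. ennreal (wt (X (fst z) (snd z)) ^ m) \<partial>time_space t M) \<le> ennreal (t * A)" .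
  show int: "integrable (time_space t M) (\<lambda>z. wt (X (fst z) (snd z)) ^ m)"
    by (rule integrableI_nonneg[OF meas]) (use w0 le in \<open>auto intro: le_less_trans simp: ennreal_less_top\<close>)
  show "(\<integral>z. wt (X (fst z) (snd z)) ^ m \<partial>time_space t M) \<le> t * A"
    using le nn_integral_eq_integral[OF int] w0 assms(1) A0 by (simp add: ennreal_le_iff)
qed

text \<open>Dynkin's formula for the truncated weight bounds its expectation by the previous moment,
  uniformly in the truncation; Fatou's lemma removes the truncation.\<close>

lemma moment_step:
  assumes T: "0 \<le> T"
    and m: "\<And>s. s \<in> {0..T} \<Longrightarrow> integrable M (\<lambda>\<omega>. wt (X s \<omega>) ^ m) \<and> expectation (\<lambda>\<omega>. wt (X s \<omega>) ^ m) \<le> A"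
    and s: "s \<in> {0..T}"
  shows "integrable M (\<lambda>\<omega>. wt (X s \<omega>) ^ Suc m) \<and>
    expectation (\<lambda>\<omega>. wt (X s \<omega>) ^ Suc m) \<le> wt x0 ^ Suc m + T * (moment_const CARD('n) \<nu> m * A)"
proof -
  let ?C = "moment_const CARD('n) \<nu> m"
  have s0: "0 \<le> s" "s \<le> T" using s by auto
  have wge: "0 \<le> wt x ^ k" for x :: "(real,'n) vec" and k using wt_power_ge_1[of x k] by linarith
  have A0: "0 \<le> A"
    using m[OF s] order_trans[OF Bochner_Integration.integral_nonneg[OF wge]] by fastforce
  have C0: "0 \<le> ?C"
    unfolding moment_const_def using es_coeff_bound(2)[OF sigma nu, of "CARD('n)"] by simp
  have ms: "\<And>u. u \<in> {0..s} \<Longrightarrow> integrable M (\<lambda>\<omega>. wt (X u \<omega>) ^ m) \<and> expectation (\<lambda>\<omega>. wt (X u \<omega>) ^ m) \<le> A"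
    using m s0 by auto
  let ?f = "\<lambda>n (x :: (real, 'n) vec). wt x ^ Suc m * cutoff (real (Suc n)) x"
  let ?B = "wt x0 ^ Suc m + T * (?C * A)"
  have B0: "0 \<le> ?B" using wge[of x0 "Suc m"] T A0 C0 by simp
  have tf: "test_fun (?f n)" for n
  proof (rule test_fun_cutoff[OF C2_wt_power])
    show "B_invariant (\<lambda>x. wt x ^ Suc m)"
      unfolding wt_def by (rule B_invariant_compose(2)[OF B_invariant_sqn, where h = "\<lambda>v. (1 + v) ^ Suc m"])
  qed simp
  have le: "expectation (\<lambda>\<omega>. ?f n (X s \<omega>)) \<le> ?B" for n
  proof -
    interpret F: finite_measure "time_space s M" by (rule finite_measure_time)
    obtain K where K: "\<And>x. \<bar>gen \<sigma> \<nu> (?f n) x\<bar> \<le> K" using gen_bounded[OF tf] by blast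
    have "expectation (\<lambda>\<omega>. ?f n (X s \<omega>)) = ?f n x0 + (\<integral>z. gen \<sigma> \<nu> (?f n) (X (fst z) (snd z)) \<partial>time_space s M)"
      by (rule dynkin_test[OF tf s0(1)])
    also have "(\<integral>z. gen \<sigma> \<nu> (?f n) (X (fst z) (snd z)) \<partial>time_space s M) \<le> (\<integral>z. ?C * wt (X (fst z) (snd z)) ^ m \<partial>time_space s M)"
    proof (rule integral_mono_AE)
      have "C2 (?f n)" using tf[of n] unfolding test_fun_def by blast
      then show "integrable (time_space s M) (\<lambda>z. gen \<sigma> \<nu> (?f n) (X (fst z) (snd z)))"
        by (intro F.integrable_const_bound[where B = K] AE_I2 measurable_compose[OF Z_measurable gen_measurable])
           (simp_all only: real_norm_def K)
      show "integrable (time_space s M) (\<lambda>z. ?C * wt (X (fst z) (snd z)) ^ m)"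
        using integrable_time(1)[OF s0(1) ms] by simp
      show "AE z in time_space s M. gen \<sigma> \<nu> (?f n) (X (fst z) (snd z)) \<le> ?C * wt (X (fst z) (snd z)) ^ m"
        using AE_off_walls[OF s0(1)] by eventually_elim (rule gen_wt_cutoff_bound; use sigma nu in simp)
    qed
    also have "(\<integral>z. ?C * wt (X (fst z) (snd z)) ^ m \<partial>time_space s M) \<le> ?C * (s * A)"
      using integrable_time(2)[OF s0(1) ms] C0 by (simp add: mult_left_mono)
    also have "?C * (s * A) \<le> T * (?C * A)"
      using s0 C0 A0 by (simp add: mult.left_commute mult_right_mono)
    also have "?f n x0 \<le> wt x0 ^ Suc m"
      using cutoff_bounds(2)[of "real (Suc n)" x0] wge[of x0 "Suc m"] by (simp add: mult_left_le)
    finally show ?thesis by simp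
  qed
  have meas: "(\<lambda>\<omega>. wt (X s \<omega>) ^ Suc m) \<in> borel_measurable M"
    by (rule p_measurable[OF wt_continuous s0(1)])
  have fint: "integrable M (\<lambda>\<omega>. ?f n (X s \<omega>))" for n
  proof -
    obtain K where "\<And>x. \<bar>?f n x\<bar> \<le> K" using test_fun_pd_bounds[OF tf] by metis
    moreover have "continuous_on UNIV (?f n)" using tf by (auto simp: test_fun_def intro: C2_continuous)
    ultimately show ?thesis
      by (intro integrable_const_bound[where B = K] p_measurable[OF _ s0(1)] AE_I2) (simp_all only: real_norm_def)
  qed
  have fnn: "0 \<le> ?f n x" for n x using wge[of x "Suc m"] cutoff_bounds(1)[of "real (Suc n)" x] by simp
  have "(\<integral>\<^sup>+\<omega>. ennreal (wt (X s \<omega>) ^ Suc m) \<partial>M) = (\<integral>\<^sup>+\<omega>. liminf (\<lambda>n. ennreal (?f n (X s \<omega>))) \<partial>M)"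
  proof (rule nn_integral_cong)
    fix \<omega>
    have "(\<lambda>n. ?f n (X s \<omega>)) \<longlonglongrightarrow> wt (X s \<omega>) ^ Suc m * 1"
    proof (rule tendsto_mult[OF tendsto_const])
      show "(\<lambda>n. cutoff (real (Suc n)) (X s \<omega>)) \<longlonglongrightarrow> 1"
      proof (rule real_tendsto_sandwich[where f = "\<lambda>n. 1 - 3 * sqn (X s \<omega>) * (1 / real (Suc n))" and h = "\<lambda>_. 1"])
        have "(\<lambda>n. 1 - 3 * sqn (X s \<omega>) * (1 / real (Suc n))) \<longlonglongrightarrow> 1 - 3 * sqn (X s \<omega>) * 0"
          by (intro tendsto_intros LIMSEQ_Suc[OF lim_1_over_n])
        then show "(\<lambda>n. 1 - 3 * sqn (X s \<omega>) * (1 / real (Suc n))) \<longlonglongrightarrow> 1" by simp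
        show "\<forall>\<^sub>F n in sequentially. 1 - 3 * sqn (X s \<omega>) * (1 / real (Suc n)) \<le> cutoff (real (Suc n)) (X s \<omega>)"
          using cutoff_bounds(5)[of "real (Suc n)" "X s \<omega>" for n] by (intro always_eventually allI) (simp add: diff_le_eq add.commute)
      qed (auto intro!: always_eventually cutoff_bounds(2))
    qed
    then have "(\<lambda>n. ennreal (?f n (X s \<omega>))) \<longlonglongrightarrow> ennreal (wt (X s \<omega>) ^ Suc m)"
      by (intro tendsto_ennrealI) simp
    then show "ennreal (wt (X s \<omega>) ^ Suc m) = liminf (\<lambda>n. ennreal (?f n (X s \<omega>)))"
      by (simp add: lim_imp_Liminf)
  qed
  also have "\<dots> \<le> liminf (\<lambda>n. \<integral>\<^sup>+\<omega>. ennreal (?f n (X s \<omega>)) \<partial>M)"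
    by (rule nn_integral_liminf) (use borel_measurable_integrable[OF fint] in simp)
  also have "\<dots> \<le> ennreal ?B"
  proof (rule Liminf_le[OF trivial_limit_sequentially], intro always_eventually allI)
    fix n
    have "(\<integral>\<^sup>+\<omega>. ennreal (?f n (X s \<omega>)) \<partial>M) = ennreal (expectation (\<lambda>\<omega>. ?f n (X s \<omega>)))"
      using fint fnn by (intro nn_integral_eq_integral) auto
    then show "(\<integral>\<^sup>+\<omega>. ennreal (?f n (X s \<omega>)) \<partial>M) \<le> ennreal ?B" using le by (simp only: ennreal_leI)
  qed
  finally have fin: "(\<integral>\<^sup>+\<omega>. ennreal (wt (X s \<omega>) ^ Suc m) \<partial>M) \<le> ennreal ?B" .
  have int: "integrable M (\<lambda>\<omega>. wt (X s \<omega>) ^ Suc m)"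
    by (rule integrableI_nonneg[OF meas], rule AE_I2[OF wge])
       (use le_less_trans[OF fin ennreal_less_top] in simp)
  moreover have "expectation (\<lambda>\<omega>. wt (X s \<omega>) ^ Suc m) \<le> ?B"
    using fin nn_integral_eq_integral[OF int AE_I2[OF wge]] B0 by (simp only: ennreal_le_iff)
  ultimately show ?thesis by blast
qed

end

text \<open>\<open>A\<close> precedes the measure, \<sigma> and the process, since all of these
  change with \<beta>; the starting point enters only through the bound \<open>Q\<close>.\<close>

lemma uniform_moments:
  fixes \<nu> T Q :: real
  assumes "0 \<le> T"
  shows "\<exists>A. \<forall>(M :: 'w measure) \<sigma> (x0 :: (real, 'n::{finite,linorder}) vec) X s.
    dynkin_process M \<sigma> \<nu> x0 X \<longrightarrow> wt x0 \<le> Q \<longrightarrow> s \<in> {0..T} \<longrightarrow>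
    integrable M (\<lambda>\<omega>. wt (X s \<omega>) ^ m) \<and> (\<integral>\<omega>. wt (X s \<omega>) ^ m \<partial>M) \<le> A"
proof (induction m)
  case 0
  show ?case
  proof (intro exI[of _ 1] allI impI)
    fix M :: "'w measure" and \<sigma> s and x0 :: "(real,'n) vec" and X
    assume "dynkin_process M \<sigma> \<nu> x0 X"
    then interpret dynkin_process M \<sigma> \<nu> x0 X .
    show "integrable M (\<lambda>\<omega>. wt (X s \<omega>) ^ 0) \<and> (\<integral>\<omega>. wt (X s \<omega>) ^ 0 \<partial>M) \<le> 1" by (simp add: prob_space)
  qed
next
  case (Suc m)
  then obtain A where A: "\<forall>(M :: 'w measure) \<sigma> (x0 :: (real, 'n) vec) X s.
    dynkin_process M \<sigma> \<nu> x0 X \<longrightarrow> wt x0 \<le> Q \<longrightarrow> s \<in> {0..T} \<longrightarrow>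
    integrable M (\<lambda>\<omega>. wt (X s \<omega>) ^ m) \<and> (\<integral>\<omega>. wt (X s \<omega>) ^ m \<partial>M) \<le> A" by blast
  show ?case
  proof (intro exI[of _ "Q ^ Suc m + T * (moment_const CARD('n) \<nu> m * A)"] allI impI)
    fix M :: "'w measure" and \<sigma> s and x0 :: "(real,'n) vec" and X
    assume p: "dynkin_process M \<sigma> \<nu> x0 X" and Q: "wt x0 \<le> Q" and s: "s \<in> {0..T}"
    interpret dynkin_process M \<sigma> \<nu> x0 X by (rule p)
    have "integrable M (\<lambda>\<omega>. wt (X s \<omega>) ^ Suc m) \<and>
        expectation (\<lambda>\<omega>. wt (X s \<omega>) ^ Suc m) \<le> wt x0 ^ Suc m + T * (moment_const CARD('n) \<nu> m * A)"
      by (rule moment_step[OF assms _ s]) (use A p Q in blast)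
    moreover have "wt x0 ^ Suc m \<le> Q ^ Suc m" using Q wt_ge_1[of x0] by (intro power_mono) auto
    ultimately show "integrable M (\<lambda>\<omega>. wt (X s \<omega>) ^ Suc m) \<and>
        (\<integral>\<omega>. wt (X s \<omega>) ^ Suc m \<partial>M) \<le> Q ^ Suc m + T * (moment_const CARD('n) \<nu> m * A)" by simp
  qed
qed

section \<open>Dynkin's formula beyond compact support\<close>

context dynkin_process
begin

lemma moments:
  assumes "0 \<le> T"
  obtains A where "\<And>s. s \<in> {0..T} \<Longrightarrow> integrable M (\<lambda>\<omega>. wt (X s \<omega>) ^ m)"
    "\<And>s. s \<in> {0..T} \<Longrightarrow> expectation (\<lambda>\<omega>. wt (X s \<omega>) ^ m) \<le> A"
proof -
  obtain A where A: "\<forall>(M :: 'w measure) \<sigma> (x0 :: (real, 'n) vec) Y s.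
    dynkin_process M \<sigma> \<nu> x0 Y \<longrightarrow> wt x0 \<le> wt x0' \<longrightarrow> s \<in> {0..T} \<longrightarrow>
    integrable M (\<lambda>\<omega>. wt (Y s \<omega>) ^ m) \<and> (\<integral>\<omega>. wt (Y s \<omega>) ^ m \<partial>M) \<le> A" if "x0' = x0" for x0'
    using uniform_moments[OF assms, where m = m and \<nu> = \<nu> and Q = "wt x0" and 'w = 'w and 'n = 'n] by metis
  have "dynkin_process M \<sigma> \<nu> x0 X" by unfold_locales
  then show ?thesis using A[OF refl] by (intro that[of A]) blast+
qed

lemma integrable_wt:
  assumes "0 \<le> s" shows "integrable M (\<lambda>\<omega>. wt (X s \<omega>) ^ m)"
proof (rule moments[OF assms, of m])
  fix A assume "\<And>u. u \<in> {0..s} \<Longrightarrow> integrable M (\<lambda>\<omega>. wt (X u \<omega>) ^ m)"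
  from this[of s] assms show ?thesis by simp
qed

lemma integrable_pgrowth:
  assumes "continuous_on UNIV p" "pgrowth p" "0 \<le> s"
  shows "integrable M (\<lambda>\<omega>. p (X s \<omega>))"
proof -
  obtain K m where K: "0 \<le> K" "\<And>x. \<bar>p x\<bar> \<le> K * wt x ^ m" using assms(2) by (auto simp: pgrowth_def)
  have "integrable M (\<lambda>\<omega>. wt (X s \<omega>) ^ m)" by (rule integrable_wt[OF assms(3)])
  then have "integrable M (\<lambda>\<omega>. K * wt (X s \<omega>) ^ m)" by simp
  then show ?thesis
    by (rule Bochner_Integration.integrable_bound[OF _ p_measurable[OF assms(1,3)] AE_I2])
       (simp only: real_norm_def order_trans[OF K(2) abs_ge_self])
qed

lemma expectation_pgrowth_bound:
  assumes "continuous_on UNIV p" "\<And>x. \<bar>p x\<bar> \<le> K * wt x ^ m" "0 \<le> s"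
  shows "\<bar>expectation (\<lambda>\<omega>. p (X s \<omega>))\<bar> \<le> K * expectation (\<lambda>\<omega>. wt (X s \<omega>) ^ m)"
proof -
  have i: "integrable M (\<lambda>\<omega>. p (X s \<omega>))" using assms by (intro integrable_pgrowth pgrowthI[of p K m])
  have j: "integrable M (\<lambda>\<omega>. wt (X s \<omega>) ^ m)" by (rule integrable_wt[OF assms(3)])
  have "\<bar>expectation (\<lambda>\<omega>. p (X s \<omega>))\<bar> \<le> expectation (\<lambda>\<omega>. \<bar>p (X s \<omega>)\<bar>)"
    by (rule integral_abs_bound)
  also have "\<dots> \<le> expectation (\<lambda>\<omega>. K * wt (X s \<omega>) ^ m)"
    using i j assms(2) by (intro integral_mono) auto
  finally show ?thesis using j by simp
qed

text \<open>A uniform limit of continuous functions: the truncated expectations are continuous by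
  dominated convergence along the paths, and the next higher moment makes the truncation error
  \<open>O(1/n)\<close> uniformly in time.\<close>

lemma continuous_expectation:
  assumes p: "continuous_on UNIV p" "pgrowth p" and T: "0 \<le> T"
  shows "continuous_on {0..T} (\<lambda>s. expectation (\<lambda>\<omega>. p (X s \<omega>)))"
proof -
  obtain K m where K: "0 \<le> K" "\<And>x. \<bar>p x\<bar> \<le> K * wt x ^ m" using p(2) by (auto simp: pgrowth_def)
  obtain A where A: "\<And>s. s \<in> {0..T} \<Longrightarrow> integrable M (\<lambda>\<omega>. wt (X s \<omega>) ^ Suc m)"
    "\<And>s. s \<in> {0..T} \<Longrightarrow> expectation (\<lambda>\<omega>. wt (X s \<omega>) ^ Suc m) \<le> A" using moments[OF T] by metis
  define pn where "pn n x = p x * cutoff (real (Suc n)) x" for n x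
  have pc: "continuous_on UNIV (pn n)" for n
    unfolding pn_def[abs_def] by (intro continuous_on_mult p C2_continuous(1)[OF C2_cutoff])
  have pb: "\<bar>pn n x\<bar> \<le> K * (1 + real (Suc n)) ^ m" for n x
  proof (cases "real (Suc n) \<le> sqn x")
    case True
    then show ?thesis using K by (simp add: pn_def cutoff_bounds(3))
  next
    case False
    have c: "0 \<le> cutoff (real (Suc n)) x" "cutoff (real (Suc n)) x \<le> 1" by (rule cutoff_bounds; simp)+
    have "\<bar>pn n x\<bar> \<le> \<bar>p x\<bar> * 1" unfolding pn_def abs_mult using c by (intro mult_left_mono) auto
    also have "\<dots> \<le> K * wt x ^ m" using K by simp
    also have "\<dots> \<le> K * (1 + real (Suc n)) ^ m"
      using False K wt_ge_1[of x] by (intro mult_left_mono power_mono) (auto simp: wt_def)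
    finally show ?thesis .
  qed
  have cn: "continuous_on {0..T} (\<lambda>s. expectation (\<lambda>\<omega>. pn n (X s \<omega>)))" for n
    unfolding continuous_on_sequentially
  proof (intro allI ballI impI, elim conjE)
    fix u :: "nat \<Rightarrow> real" and s assume u: "s \<in> {0..T}" "\<forall>k. u k \<in> {0..T}" "u \<longlonglongrightarrow> s"
    show "((\<lambda>s. expectation (\<lambda>\<omega>. pn n (X s \<omega>))) \<circ> u) \<longlonglongrightarrow> expectation (\<lambda>\<omega>. pn n (X s \<omega>))"
      unfolding o_def
    proof (rule integral_dominated_convergence[where w = "\<lambda>_. K * (1 + real (Suc n)) ^ m"])
      show "(\<lambda>\<omega>. pn n (X s \<omega>)) \<in> borel_measurable M" using u by (intro p_measurable pc) auto
      show "(\<lambda>\<omega>. pn n (X (u k) \<omega>)) \<in> borel_measurable M" for k using u by (intro p_measurable pc) auto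
      show "AE \<omega> in M. (\<lambda>k. pn n (X (u k) \<omega>)) \<longlonglongrightarrow> pn n (X s \<omega>)"
      proof (rule AE_I2)
        fix \<omega> assume w: "\<omega> \<in> space M"
        have "(\<lambda>k. X (u k) \<omega>) \<longlonglongrightarrow> X s \<omega>"
          by (rule continuous_on_tendsto_compose[OF X_continuous[OF w] u(3)]) (use u in auto)
        then show "(\<lambda>k. pn n (X (u k) \<omega>)) \<longlonglongrightarrow> pn n (X s \<omega>)"
          by (rule continuous_on_tendsto_compose[OF pc]) auto
      qed
      show "AE \<omega> in M. norm (pn n (X (u k) \<omega>)) \<le> K * (1 + real (Suc n)) ^ m" for k
        by (rule AE_I2) (use pb in simp)
    qed simp
  qed
  have ul: "uniform_limit {0..T} (\<lambda>n s. expectation (\<lambda>\<omega>. pn n (X s \<omega>))) (\<lambda>s. expectation (\<lambda>\<omega>. p (X s \<omega>))) sequentially"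
  proof (rule uniform_limitI)
    fix e :: real assume e: "0 < e"
    have "(\<lambda>n. 3 * K * A * (1 / real (Suc n))) \<longlonglongrightarrow> 3 * K * A * 0"
      by (intro tendsto_intros LIMSEQ_Suc[OF lim_1_over_n])
    then have "\<forall>\<^sub>F n in sequentially. 3 * K * A * (1 / real (Suc n)) < e" using e by (intro order_tendstoD) auto
    then show "\<forall>\<^sub>F n in sequentially. \<forall>s\<in>{0..T}. dist (expectation (\<lambda>\<omega>. pn n (X s \<omega>))) (expectation (\<lambda>\<omega>. p (X s \<omega>))) < e"
    proof eventually_elim
      case (elim n)
      show ?case
      proof
        fix s assume s: "s \<in> {0..T}"
        have i1: "integrable M (\<lambda>\<omega>. p (X s \<omega>))" using s p by (intro integrable_pgrowth) auto
        have i2: "integrable M (\<lambda>\<omega>. pn n (X s \<omega>))"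
          using s pb[of n] by (intro integrable_pgrowth pc pgrowthI[of _ "K * (1 + real (Suc n)) ^ m" 0]) auto
        have d: "\<bar>p x - pn n x\<bar> \<le> 3 * K / real (Suc n) * wt x ^ Suc m" for x
        proof -
          have "0 \<le> 1 - cutoff (real (Suc n)) x" using cutoff_bounds(2)[of "real (Suc n)" x] by simp
          moreover have "1 - cutoff (real (Suc n)) x \<le> 3 * sqn x / real (Suc n)" by (rule cutoff_bounds) simp
          moreover have "3 * sqn x / real (Suc n) \<le> 3 * wt x / real (Suc n)" by (intro divide_right_mono) (auto simp: wt_def)
          ultimately have "\<bar>1 - cutoff (real (Suc n)) x\<bar> \<le> 3 * wt x / real (Suc n)" by linarith
          then have "\<bar>p x\<bar> * \<bar>1 - cutoff (real (Suc n)) x\<bar> \<le> (K * wt x ^ m) * (3 * wt x / real (Suc n))"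
            by (intro mult_mono') (use K in auto)
          moreover have "p x - pn n x = p x * (1 - cutoff (real (Suc n)) x)" by (simp add: pn_def right_diff_distrib)
          ultimately show ?thesis by (simp add: abs_mult mult_ac)
        qed
        have "\<bar>expectation (\<lambda>\<omega>. p (X s \<omega>) - pn n (X s \<omega>))\<bar> \<le> 3 * K / real (Suc n) * expectation (\<lambda>\<omega>. wt (X s \<omega>) ^ Suc m)"
          using s by (intro expectation_pgrowth_bound[where p = "\<lambda>x. p x - pn n x"] d continuous_on_diff p pc) auto
        also have "\<dots> \<le> 3 * K / real (Suc n) * A" using A(2)[OF s] K by (intro mult_left_mono) auto
        also have "\<dots> < e" using elim by simp
        finally show "dist (expectation (\<lambda>\<omega>. pn n (X s \<omega>))) (expectation (\<lambda>\<omega>. p (X s \<omega>))) < e"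
          using i1 i2 by (simp add: dist_real_def abs_minus_commute)
      qed
    qed
  qed
  show ?thesis by (rule uniform_limit_theorem[OF _ ul]) (use cn in auto)
qed

text \<open>\<open>g\<close> is a continuous substitute for the generator of \<open>f\<close>;
  agreement off the walls is enough by \<open>AE_off_walls\<close>. The terms that the cutoff adds
  through the product rule are \<open>O(1/n)\<close> times functions of polynomial growth.\<close>

lemma dynkin_pgrowth:
  assumes f: "C2 f" "B_invariant f" "pgrowth f" "\<And>i. pgrowth (pd i f)"
    and g: "continuous_on UNIV g" "pgrowth g" "\<And>x. off_walls x \<Longrightarrow> gen \<sigma> \<nu> f x = g x"
    and t: "0 \<le> t"
  shows "expectation (\<lambda>\<omega>. f (X t \<omega>)) = f x0 + integral {0..t} (\<lambda>s. expectation (\<lambda>\<omega>. g (X s \<omega>)))"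
proof -
  interpret P: pair_sigma_finite "restrict_space lborel {0..t::real}" M by (rule pair_sigma_finite_time)
  have fc: "continuous_on UNIV f" using C2_continuous f by blast
  define D where "D = drift_bound CARD('n) \<nu>"
  have D: "\<bar>es_coeff CARD('n) \<sigma> \<nu> 0\<bar> \<le> D" "0 \<le> D" unfolding D_def by (rule es_coeff_bound; use sigma nu in simp)+
  \<comment> \<open>A dominating function valid for all cutoff radii at once: the factors
    \<open>1 / (n + 1)\<close> from \<open>gen_cutoff_bound\<close> are replaced by 1.\<close>
  define w where "w x = \<bar>g x\<bar> + \<bar>f x\<bar> * (3 * D + 12) + (\<Sum>i\<in>UNIV. \<bar>pd i f x\<bar>) * (6 * wt x)" for x
  have pg: "pgrowth (\<lambda>x. \<bar>g x\<bar>)" "pgrowth (\<lambda>x. \<bar>f x\<bar>)" "pgrowth (\<lambda>x. \<bar>pd i f x\<bar>)" "pgrowth (\<lambda>x :: (real, 'n) vec. wt x)" for i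
  proof -
    show "pgrowth (\<lambda>x. \<bar>g x\<bar>)" by (rule pgrowth_mono[OF g(2)]) simp
    show "pgrowth (\<lambda>x. \<bar>f x\<bar>)" by (rule pgrowth_mono[OF f(3)]) simp
    show "pgrowth (\<lambda>x. \<bar>pd i f x\<bar>)" by (rule pgrowth_mono[OF f(4)[of i]]) simp
    show "pgrowth (\<lambda>x :: (real, 'n) vec. wt x)" by (rule pgrowthI[of _ 1 1]) (simp add: wt_def)
  qed
  have wg: "pgrowth w"
    unfolding w_def
    by (intro pgrowth_add pgrowth_mult pgrowth_const pgrowth_sum pg)
  have wc: "continuous_on UNIV w"
    unfolding w_def using g(1) fc C2_continuous(2)[OF f(1)] C2_continuous(1)[OF C2_wt]
    by (auto intro!: continuous_intros)
  have time_int: "integrable (time_space t M) (\<lambda>z. p (X (fst z) (snd z)))" if pp: "continuous_on UNIV p" "pgrowth p" for p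
  proof -
    obtain K m where K: "0 \<le> K" "\<And>x. \<bar>p x\<bar> \<le> K * wt x ^ m" using pp(2) by (auto simp: pgrowth_def)
    obtain A where A: "\<And>s. s \<in> {0..t} \<Longrightarrow> integrable M (\<lambda>\<omega>. wt (X s \<omega>) ^ m)"
      "\<And>s. s \<in> {0..t} \<Longrightarrow> expectation (\<lambda>\<omega>. wt (X s \<omega>) ^ m) \<le> A" using moments[OF t] by metis
    have "integrable (time_space t M) (\<lambda>z. wt (X (fst z) (snd z)) ^ m)" using integrable_time(1)[OF t] A by blast
    then have "integrable (time_space t M) (\<lambda>z. K * wt (X (fst z) (snd z)) ^ m)" by simp
    then show ?thesis
      by (rule Bochner_Integration.integrable_bound[OF _
            measurable_compose[OF Z_measurable borel_measurable_continuous_onI[OF pp(1)]] AE_I2])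
         (simp only: real_norm_def order_trans[OF K(2) abs_ge_self])
  qed
  let ?f = "\<lambda>n x. f x * cutoff (real (Suc n)) x"
  let ?Z = "\<lambda>z. X (fst z) (snd z)"
  have tf: "test_fun (?f n)" for n by (rule test_fun_cutoff[OF f(1,2)]) simp
  have cut: "(\<lambda>n. cutoff (real (Suc n)) x) \<longlonglongrightarrow> 1" for x :: "(real,'n) vec"
  proof (rule real_tendsto_sandwich[where f = "\<lambda>n. 1 - 3 * sqn x * (1 / real (Suc n))" and h = "\<lambda>_. 1"])
    have "(\<lambda>n. 1 - 3 * sqn x * (1 / real (Suc n))) \<longlonglongrightarrow> 1 - 3 * sqn x * 0"
      by (intro tendsto_intros LIMSEQ_Suc[OF lim_1_over_n])
    then show "(\<lambda>n. 1 - 3 * sqn x * (1 / real (Suc n))) \<longlonglongrightarrow> 1" by simp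
    show "\<forall>\<^sub>F n in sequentially. 1 - 3 * sqn x * (1 / real (Suc n)) \<le> cutoff (real (Suc n)) x"
      using cutoff_bounds(5)[of "real (Suc n)" x for n] by (intro always_eventually allI) (simp add: diff_le_eq add.commute)
  qed (auto intro!: always_eventually cutoff_bounds(2))
  have c01: "0 \<le> cutoff (real (Suc n)) x" "cutoff (real (Suc n)) x \<le> 1" for n and x :: "(real,'n) vec"
    by (rule cutoff_bounds; simp)+
  have lim1: "(\<lambda>n. expectation (\<lambda>\<omega>. ?f n (X t \<omega>))) \<longlonglongrightarrow> expectation (\<lambda>\<omega>. f (X t \<omega>))"
  proof (rule integral_dominated_convergence[where w = "\<lambda>\<omega>. \<bar>f (X t \<omega>)\<bar>"])
    show "(\<lambda>\<omega>. f (X t \<omega>)) \<in> borel_measurable M" by (rule p_measurable[OF fc t])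
    show "(\<lambda>\<omega>. ?f n (X t \<omega>)) \<in> borel_measurable M" for n
      by (rule p_measurable[OF continuous_on_mult[OF fc C2_continuous(1)[OF C2_cutoff]] t])
    show "integrable M (\<lambda>\<omega>. \<bar>f (X t \<omega>)\<bar>)" using integrable_pgrowth[OF fc f(3) t] by simp
    show "AE \<omega> in M. (\<lambda>n. ?f n (X t \<omega>)) \<longlonglongrightarrow> f (X t \<omega>)"
      using tendsto_mult[OF tendsto_const cut] by (intro AE_I2) (metis mult.right_neutral)
    show "AE \<omega> in M. norm (?f n (X t \<omega>)) \<le> \<bar>f (X t \<omega>)\<bar>" for n
      using c01 by (intro AE_I2) (auto simp: abs_mult intro!: mult_left_le)
  qed
  have lim2: "(\<lambda>n. \<integral>z. gen \<sigma> \<nu> (?f n) (?Z z) \<partial>time_space t M) \<longlonglongrightarrow> (\<integral>z. g (?Z z) \<partial>time_space t M)"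
  proof (rule integral_dominated_convergence[where w = "\<lambda>z. w (?Z z)"])
    show "(\<lambda>z. g (?Z z)) \<in> borel_measurable (time_space t M)"
      by (rule measurable_compose[OF Z_measurable borel_measurable_continuous_onI[OF g(1)]])
    show "(\<lambda>z. gen \<sigma> \<nu> (?f n) (?Z z)) \<in> borel_measurable (time_space t M)" for n
      by (rule measurable_compose[OF Z_measurable gen_measurable[OF C2_mult[OF f(1) C2_cutoff]]])
    show "integrable (time_space t M) (\<lambda>z. w (?Z z))" by (rule time_int[OF wc wg])
    have ge: "gen \<sigma> \<nu> (?f n) x = f x * gen \<sigma> \<nu> (cutoff (real (Suc n))) x + cutoff (real (Suc n)) x * g x
        + \<sigma> * grad_inner f (cutoff (real (Suc n))) x" if "off_walls x" for n x
      unfolding gen_mult[OF f(1) C2_cutoff] using g(3)[OF that] by simp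
    have bd: "\<bar>gen \<sigma> \<nu> (cutoff (real (Suc n))) x\<bar> \<le> (3 * D + 12) / real (Suc n)"
      "\<bar>pd i (cutoff (real (Suc n))) x\<bar> \<le> 6 * wt x / real (Suc n)" if "off_walls x" for n i and x :: "(real,'n) vec"
      by (rule gen_cutoff_bound[OF that _ sigma D(2,1)]; simp)+
    show "AE z in time_space t M. (\<lambda>n. gen \<sigma> \<nu> (?f n) (?Z z)) \<longlonglongrightarrow> g (?Z z)"
      using AE_off_walls[OF t]
    proof eventually_elim
      case (elim z)
      have z0: "(\<lambda>n. c / real (Suc n)) \<longlonglongrightarrow> 0" for c :: real
        using tendsto_mult[OF tendsto_const[of c] LIMSEQ_Suc[OF lim_1_over_n]] by simp
      have l1: "(\<lambda>n. gen \<sigma> \<nu> (cutoff (real (Suc n))) (?Z z)) \<longlonglongrightarrow> 0"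
        by (rule Lim_null_comparison[OF always_eventually z0[of "3 * D + 12"]]) (use bd(1)[OF elim] in simp)
      have l2: "(\<lambda>n. pd i (cutoff (real (Suc n))) (?Z z)) \<longlonglongrightarrow> 0" for i
        by (rule Lim_null_comparison[OF always_eventually z0[of "6 * wt (?Z z)"]]) (use bd(2)[OF elim] in simp)
      have "(\<lambda>n. f (?Z z) * gen \<sigma> \<nu> (cutoff (real (Suc n))) (?Z z) + cutoff (real (Suc n)) (?Z z) * g (?Z z)
          + \<sigma> * (\<Sum>i\<in>UNIV. pd i f (?Z z) * pd i (cutoff (real (Suc n))) (?Z z)))
          \<longlonglongrightarrow> f (?Z z) * 0 + 1 * g (?Z z) + \<sigma> * (\<Sum>i\<in>UNIV. pd i f (?Z z) * 0)"
        by (intro tendsto_intros l1 l2 cut)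
      then show ?case unfolding ge[OF elim] grad_inner_def by simp
    qed
    show "AE z in time_space t M. norm (gen \<sigma> \<nu> (?f n) (?Z z)) \<le> w (?Z z)" for n
      using AE_off_walls[OF t]
    proof eventually_elim
      case (elim z)
      define x where "x = ?Z z"
      note x = elim[folded x_def]
      have n1: "c / real (Suc n) \<le> c" if "0 \<le> c" for c :: real
        using that by (simp add: field_simps)
      have a: "\<bar>f x * gen \<sigma> \<nu> (cutoff (real (Suc n))) x\<bar> \<le> \<bar>f x\<bar> * (3 * D + 12)"
        unfolding abs_mult using bd(1)[OF x, of n] n1[of "3 * D + 12"] D(2) by (intro mult_left_mono) auto
      have b: "\<bar>cutoff (real (Suc n)) x * g x\<bar> \<le> \<bar>g x\<bar>"
        unfolding abs_mult using c01[of n x] by (auto intro: mult_left_le_one_le)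
      have "\<bar>grad_inner f (cutoff (real (Suc n))) x\<bar> \<le> (\<Sum>i\<in>UNIV. \<bar>pd i f x\<bar> * (6 * wt x))"
        unfolding grad_inner_def
      proof (rule order_trans[OF sum_abs], rule sum_mono)
        fix i
        show "\<bar>pd i f x * pd i (cutoff (real (Suc n))) x\<bar> \<le> \<bar>pd i f x\<bar> * (6 * wt x)"
          unfolding abs_mult using bd(2)[OF x, of i n] n1[of "6 * wt x"] wt_ge_1[of x] by (intro mult_left_mono) auto
      qed
      moreover have "\<bar>\<sigma> * grad_inner f (cutoff (real (Suc n))) x\<bar> \<le> 1 * \<bar>grad_inner f (cutoff (real (Suc n))) x\<bar>"
        unfolding abs_mult using sigma by (intro mult_right_mono) auto
      ultimately have c: "\<bar>\<sigma> * grad_inner f (cutoff (real (Suc n))) x\<bar> \<le> (\<Sum>i\<in>UNIV. \<bar>pd i f x\<bar>) * (6 * wt x)"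
        by (simp add: sum_distrib_right)
      have tri: "\<bar>p + q + r\<bar> \<le> \<bar>q\<bar> + \<bar>p\<bar> + \<bar>r\<bar>" for p q r :: real by linarith
      show ?case unfolding x_def[symmetric] ge[OF x] w_def real_norm_def
        by (rule order_trans[OF tri add_mono[OF add_mono[OF b a] c]])
    qed
  qed
  have "(\<lambda>n. expectation (\<lambda>\<omega>. ?f n (X t \<omega>))) \<longlonglongrightarrow> f x0 * 1 + (\<integral>z. g (?Z z) \<partial>time_space t M)"
    unfolding dynkin_test[OF tf t] by (intro tendsto_add lim2 tendsto_mult tendsto_const cut)
  then have "expectation (\<lambda>\<omega>. f (X t \<omega>)) = f x0 + (\<integral>z. g (?Z z) \<partial>time_space t M)"
    using LIMSEQ_unique[OF lim1] by simp
  also have "(\<integral>z. g (?Z z) \<partial>time_space t M) = (\<integral>u. expectation (\<lambda>\<omega>. g (X u \<omega>)) \<partial>restrict_space lborel {0..t})"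
    using P.integral_fst'[OF time_int[OF g(1,2)]] by simp
  also have "\<dots> = (LINT u:{0..t}|lborel. expectation (\<lambda>\<omega>. g (X u \<omega>)))"
    unfolding set_lebesgue_integral_def by (subst integral_restrict_space) auto
  also have "\<dots> = integral {0..t} (\<lambda>s. expectation (\<lambda>\<omega>. g (X s \<omega>)))"
    by (intro set_borel_integral_eq_integral borel_integrable_atLeastAtMost' continuous_expectation g t)
  finally show ?thesis .
qed

text \<open>The fundamental theorem of calculus; the integrand is continuous by
  \<open>continuous_expectation\<close>. At the endpoints the derivative is one-sided.\<close>

lemma dynkin_derivative:
  assumes f: "C2 f" "B_invariant f" "pgrowth f" "\<And>i. pgrowth (pd i f)"
    and g: "continuous_on UNIV g" "pgrowth g" "\<And>x. off_walls x \<Longrightarrow> gen \<sigma> \<nu> f x = g x"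
    and t: "t \<in> {0..T}"
  shows "((\<lambda>t. expectation (\<lambda>\<omega>. f (X t \<omega>))) has_real_derivative expectation (\<lambda>\<omega>. g (X t \<omega>))) (at t within {0..T})"
proof -
  have T: "0 \<le> T" using t by simp
  have "((\<lambda>t. integral {0..t} (\<lambda>s. expectation (\<lambda>\<omega>. g (X s \<omega>)))) has_real_derivative expectation (\<lambda>\<omega>. g (X t \<omega>))) (at t within {0..T})"
    by (rule integral_has_real_derivative[OF continuous_expectation[OF g(1,2) T] t])
  then have "((\<lambda>t. f x0 + integral {0..t} (\<lambda>s. expectation (\<lambda>\<omega>. g (X s \<omega>)))) has_real_derivative 0 + expectation (\<lambda>\<omega>. g (X t \<omega>))) (at t within {0..T})"
    by (intro DERIV_add DERIV_const)
  then have "((\<lambda>t. f x0 + integral {0..t} (\<lambda>s. expectation (\<lambda>\<omega>. g (X s \<omega>)))) has_real_derivative expectation (\<lambda>\<omega>. g (X t \<omega>))) (at t within {0..T})"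
    by simp
  then show ?thesis
    unfolding has_field_derivative_def
    by (rule has_derivative_transform[OF t, rotated]) (use dynkin_pgrowth[OF f g] in auto)
qed

end

section \<open>Time-dependent functionals of the elementary symmetric polynomials\<close>

definition esum :: "(nat \<Rightarrow> real) \<Rightarrow> (real, 'n::{finite,linorder}) vec \<Rightarrow> real" where
  "esum a x = (\<Sum>k\<le>CARD('n). a k * es k UNIV x)"

lemma C2_esum: "C2 (esum a)"
  unfolding esum_def[abs_def] by (intro C2_sum C2_cmult C2_es)

lemma pd_esum: "pd i (esum a :: (real, 'n::{finite,linorder}) vec \<Rightarrow> real) x = (\<Sum>k\<le>CARD('n). a k * pd i (es k UNIV) x)"
  unfolding esum_def[abs_def] by (subst pd_sum) (auto intro: C2_cmult C2_es simp: pd_cmult[OF C2_es])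

lemma B_invariant_esum: "B_invariant (esum a)"
  unfolding esum_def[abs_def] by (intro B_invariant_compose(1) B_invariant_es)

lemma pgrowth_esum: "pgrowth (esum a)"
  unfolding esum_def[abs_def] by (intro pgrowth_sum pgrowth_mult pgrowth_const pgrowth_es)

lemma pgrowth_pd_esum: "pgrowth (pd i (esum a))"
  unfolding pd_esum[abs_def] by (intro pgrowth_sum pgrowth_mult pgrowth_const pgrowth_pd_es)

lemma grad_inner_props:
  assumes "C2 f" "C2 g" shows "continuous_on UNIV (grad_inner f g)"
  unfolding grad_inner_def[abs_def] by (intro continuous_intros C2_continuous assms)

lemma pgrowth_grad_inner:
  assumes "\<And>i. pgrowth (pd i f)" "\<And>i. pgrowth (pd i g)" shows "pgrowth (grad_inner f g)"
  unfolding grad_inner_def[abs_def] by (intro pgrowth_sum pgrowth_mult assms)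

text \<open>The generator acts on coefficients as a weighted shift, so a backward equation for the
  coefficients is a finite triangular linear system.\<close>

lemma gen_esum:
  fixes x :: "(real, 'n::{finite,linorder}) vec"
  assumes "off_walls x"
  shows "gen \<sigma> \<nu> (esum a) x = esum (\<lambda>k. es_coeff CARD('n) \<sigma> \<nu> k * a (Suc k)) x"
proof -
  let ?c = "es_coeff CARD('n) \<sigma> \<nu>"
  have e0: "gen \<sigma> \<nu> (es 0 UNIV) x = 0"
    by (simp add: gen_def laplacian_def ext[OF pd_es_0])
  have "gen \<sigma> \<nu> (esum a) x = (\<Sum>k\<le>CARD('n). a k * gen \<sigma> \<nu> (es k UNIV) x)"
    unfolding esum_def[abs_def] by (rule gen_sum) (auto intro: C2_es)
  also have "\<dots> = (\<Sum>k<CARD('n). a (Suc k) * (?c k * es k UNIV x))"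
    unfolding sum.atMost_shift e0 gen_es[OF assms] by simp
  \<comment> \<open>The added summand \<open>k = N\<close> is 0 because \<open>es_coeff\<close>
    vanishes there.\<close>
  also have "\<dots> = (\<Sum>k<Suc CARD('n). ?c k * a (Suc k) * es k UNIV x)"
    by (simp add: es_coeff_def mult_ac)
  finally show ?thesis unfolding esum_def lessThan_Suc_atMost .
qed

lemma esum_diff_bound:
  fixes x :: "(real, 'n::{finite,linorder}) vec"
  shows "\<bar>esum a x\<bar> \<le> (\<Sum>k\<le>CARD('n). \<bar>a k\<bar>) * (2 ^ CARD('n) * wt x ^ CARD('n))"
  unfolding esum_def sum_distrib_right wt_def
  by (intro order_trans[OF sum_abs] sum_mono)
     (auto simp: abs_mult es_nonneg intro!: mult_left_mono es_bound)

lemma esum_diff: "esum a x - esum b x = esum (\<lambda>k. a k - b k) x"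
  by (simp add: esum_def left_diff_distrib sum_subtractf)

text \<open>Covers the two functions needed later, the square and a rescaled cosine. A bounded
  second derivative limits \<open>h\<close> to quadratic growth, so composition keeps polynomial
  growth.\<close>

locale c2_bounded =
  fixes h h' h'' :: "real \<Rightarrow> real" and H :: real
  assumes dh: "\<And>v. (h has_real_derivative h' v) (at v)"
    and dh': "\<And>v. (h' has_real_derivative h'' v) (at v)"
    and ch'': "continuous_on UNIV h''"
    and bh'': "\<And>v. \<bar>h'' v\<bar> \<le> H"
begin

lemma taylor_bound: "\<bar>h v - h w - h' w * (v - w)\<bar> \<le> H / 2 * (v - w)\<^sup>2"
proof -
  have d: "((\<lambda>t. g (w + t)) has_real_derivative g' (w + t)) (at t)"
    if "\<And>v. (g has_real_derivative g' v) (at v)" for g g' :: "real \<Rightarrow> real" and t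
    using that[of "t + w"] DERIV_shift[of g "g' (t + w)" t w] by (simp add: add.commute)
  obtain t where "h (w + (v - w)) = h (w + 0) + h' (w + 0) * (v - w) + h'' (w + t) / 2 * (v - w)\<^sup>2"
    using second_order_expansion[of "\<lambda>t. h (w + t)" "\<lambda>t. h' (w + t)" "\<lambda>t. h'' (w + t)", OF d[OF dh] d[OF dh']] by blast
  then have "\<bar>h v - h w - h' w * (v - w)\<bar> = \<bar>h'' (w + t)\<bar> / 2 * (v - w)\<^sup>2" by (simp add: abs_mult)
  also have "\<dots> \<le> H / 2 * (v - w)\<^sup>2" using bh''[of "w + t"] by (intro mult_right_mono) auto
  finally show ?thesis .
qed

lemma H_nonneg: "0 \<le> H" using bh''[of 0] by linarith

lemma h'_bound: "\<bar>h' v\<bar> \<le> \<bar>h' 0\<bar> + H * \<bar>v\<bar>"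
proof -
  have "norm (h' v - h' 0) \<le> H * norm (v - 0)"
    by (rule field_differentiable_bound[of UNIV h' h'']) (use dh' bh'' in auto)
  then show ?thesis by simp
qed

lemma h_bound: "\<bar>h v\<bar> \<le> \<bar>h 0\<bar> + \<bar>h' 0\<bar> * \<bar>v\<bar> + H / 2 * (v * v)"
proof -
  have "\<bar>h v\<bar> \<le> \<bar>h v - h 0 - h' 0 * v\<bar> + \<bar>h 0\<bar> + \<bar>h' 0 * v\<bar>" by linarith
  moreover have "\<bar>h v - h 0 - h' 0 * v\<bar> \<le> H / 2 * (v * v)"
    using taylor_bound[of v 0] by (simp add: power2_eq_square)
  ultimately show ?thesis unfolding abs_mult by linarith
qed

lemma pgrowth_abs: "pgrowth p \<Longrightarrow> pgrowth (\<lambda>x. \<bar>p x\<bar>)"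
  by (rule pgrowth_mono[of p]) auto

lemma pgrowth_h':
  assumes "pgrowth p" shows "pgrowth (\<lambda>x. h' (p x))"
proof (rule pgrowth_mono)
  show "pgrowth (\<lambda>x. \<bar>h' 0\<bar> + H * \<bar>p x\<bar>)"
    by (intro pgrowth_add pgrowth_const pgrowth_mult pgrowth_abs assms)
  show "\<bar>h' (p x)\<bar> \<le> \<bar>\<bar>h' 0\<bar> + H * \<bar>p x\<bar>\<bar>" for x
    by (rule order_trans[OF h'_bound abs_ge_self])
qed

lemma pgrowth_h:
  assumes "pgrowth p" shows "pgrowth (\<lambda>x. h (p x))"
proof (rule pgrowth_mono)
  show "pgrowth (\<lambda>x. \<bar>h 0\<bar> + \<bar>h' 0\<bar> * \<bar>p x\<bar> + H / 2 * (p x * p x))"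
    by (intro pgrowth_add pgrowth_const pgrowth_mult pgrowth_abs assms)
  show "\<bar>h (p x)\<bar> \<le> \<bar>\<bar>h 0\<bar> + \<bar>h' 0\<bar> * \<bar>p x\<bar> + H / 2 * (p x * p x)\<bar>" for x
    by (rule order_trans[OF h_bound abs_ge_self])
qed

lemma pgrowth_h'': "pgrowth (\<lambda>x. h'' (p x))"
  by (rule pgrowthI[of _ H 0]) (use bh'' in simp)

lemma cont_h: "continuous_on UNIV h" "continuous_on UNIV h'"
  using dh dh' by (meson DERIV_isCont continuous_at_imp_continuous_on)+

end

text \<open>Dynkin's formula handles the motion of \<open>X\<close> for frozen coefficients, a
  first-order Taylor expansion handles the motion of the coefficients. The two contributions of
  \<open>h'\<close> cancel by the backward equation, leaving the second-order term.\<close>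

lemma (in dynkin_process) time_dependent:
  fixes a :: "nat \<Rightarrow> real \<Rightarrow> real"
  assumes a: "\<And>k s. k \<le> CARD('n) \<Longrightarrow> (a k has_real_derivative - (es_coeff CARD('n) \<sigma> \<nu> k * a (Suc k) s)) (at s)"
    and "c2_bounded h h' h'' H" and s: "s \<in> {0..T}"
  defines "e \<equiv> \<lambda>s. esum (\<lambda>k. a k s)"
  shows "((\<lambda>s. expectation (\<lambda>\<omega>. h (e s (X s \<omega>)))) has_real_derivative
    \<sigma> / 2 * expectation (\<lambda>\<omega>. h'' (e s (X s \<omega>)) * grad_inner (e s) (e s) (X s \<omega>))) (at s within {0..T})"
proof -
  interpret c2_bounded h h' h'' H by fact
  let ?N = "CARD('n)"
  let ?c = "es_coeff ?N \<sigma> \<nu>"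
  let ?F = "at s within {0..T}"
  have T: "0 \<le> T" using s by simp
  have eC2: "C2 (e u)" for u unfolding e_def by (rule C2_esum)
  note ec = C2_continuous(1)[OF eC2]
  have epg: "pgrowth (e u)" "pgrowth (pd i (e u))" for u i
    unfolding e_def by (rule pgrowth_esum, rule pgrowth_pd_esum)
  note cc = continuous_on_compose2[OF cont_h(1) ec] continuous_on_compose2[OF cont_h(2) ec] continuous_on_compose2[OF ch'' ec]
  define L where "L = (esum (\<lambda>k. ?c k * a (Suc k) s) :: (real,'n) vec \<Rightarrow> real)"
  define G where "G x = h' (e s x) * L x + \<sigma> / 2 * (h'' (e s x) * grad_inner (e s) (e s) x)" for x
  have Lc: "continuous_on UNIV L" unfolding L_def by (rule C2_continuous(1)[OF C2_esum])
  have Lg: "pgrowth L" unfolding L_def by (rule pgrowth_esum)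
  have c1: "continuous_on UNIV (\<lambda>x. h' (e s x) * L x)" by (intro continuous_on_mult cc Lc) auto
  have c2: "continuous_on UNIV (\<lambda>x. h'' (e s x) * grad_inner (e s) (e s) x)"
    by (intro continuous_on_mult cc grad_inner_props eC2) auto
  have p1: "pgrowth (\<lambda>x. h' (e s x) * L x)" by (intro pgrowth_mult pgrowth_h' epg Lg)
  have p2: "pgrowth (\<lambda>x. h'' (e s x) * grad_inner (e s) (e s) x)"
    by (intro pgrowth_mult pgrowth_h'' pgrowth_grad_inner epg)
  have Gc: "continuous_on UNIV G"
    unfolding G_def[abs_def] by (intro continuous_on_add c1 continuous_on_mult[OF continuous_on_const c2])
  have Gg: "pgrowth G"
    unfolding G_def[abs_def] by (intro pgrowth_add p1 pgrowth_mult[OF pgrowth_const p2])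
  have F': "((\<lambda>u. expectation (\<lambda>\<omega>. h (e s (X u \<omega>)))) has_real_derivative expectation (\<lambda>\<omega>. G (X s \<omega>))) ?F"
  proof (rule dynkin_derivative[OF _ _ _ _ Gc Gg _ s])
    show "C2 (\<lambda>x. h (e s x))" by (rule C2_compose[OF eC2 dh dh' ch''])
    show "B_invariant (\<lambda>x. h (e s x))" unfolding e_def by (rule B_invariant_compose(2)[OF B_invariant_esum])
    show "pgrowth (\<lambda>x. h (e s x))" by (rule pgrowth_h[OF epg(1)])
    show "pgrowth (pd i (\<lambda>x. h (e s x)))" for i
      unfolding C2_pd_compose(1)[OF eC2 dh dh'] by (intro pgrowth_mult pgrowth_h' epg)
    show "gen \<sigma> \<nu> (\<lambda>x. h (e s x)) x = G x" if "off_walls x" for x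
      unfolding gen_compose[OF eC2 dh dh'] G_def L_def
      using gen_esum[OF that, of \<sigma> \<nu> "\<lambda>k. a k s"] by (simp add: e_def)
  qed
  \<comment> \<open>Sensitivity of the expectation to the \<open>k\<close>-th coefficient, with the
    coefficients frozen at time \<open>s\<close>.\<close>
  define \<Phi> where "\<Phi> k u = expectation (\<lambda>\<omega>. h' (e s (X u \<omega>)) * es k UNIV (X u \<omega>))" for k u
  have pc: "continuous_on UNIV (\<lambda>x. h' (e s x) * es k UNIV x)" for k
    by (intro continuous_on_mult cc C2_continuous(1)[OF C2_es]) auto
  have pp: "pgrowth (\<lambda>x. h' (e s x) * es k UNIV x)" for k
    by (intro pgrowth_mult pgrowth_h' epg pgrowth_es)
  have \<Phi>c: "(\<Phi> k \<longlongrightarrow> \<Phi> k s) ?F" for k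
    using continuous_expectation[OF pc pp T] s unfolding \<Phi>_def[abs_def] continuous_on_def by blast
  define \<Delta> where "\<Delta> k u = a k u - a k s" for k u
  \<comment> \<open>The error of linearising in the coefficients. By \<open>taylor_bound\<close> and
    the moments it is quadratic in \<Delta>, hence \<open>o(u - s)\<close>.\<close>
  define R where "R u = expectation (\<lambda>\<omega>. h (e u (X u \<omega>))) - expectation (\<lambda>\<omega>. h (e s (X u \<omega>)))
      - (\<Sum>k\<le>?N. \<Delta> k u * \<Phi> k u)" for u
  obtain A where A: "\<And>u. u \<in> {0..T} \<Longrightarrow> integrable M (\<lambda>\<omega>. wt (X u \<omega>) ^ (2 * ?N))"
    "\<And>u. u \<in> {0..T} \<Longrightarrow> expectation (\<lambda>\<omega>. wt (X u \<omega>) ^ (2 * ?N)) \<le> A"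
    using moments[OF T, of "2 * ?N"] by blast
  define B where "B = H / 2 * (2 ^ ?N)\<^sup>2 * A"
  have Rb: "\<bar>R u\<bar> \<le> B * (\<Sum>k\<le>?N. \<bar>\<Delta> k u\<bar>)\<^sup>2" if u: "u \<in> {0..T}" for u
  proof -
    have u0: "0 \<le> u" using u by simp
    define q where "q x = h (e u x) - h (e s x) - h' (e s x) * (e u x - e s x)" for x
    have qc: "continuous_on UNIV q"
      unfolding q_def by (intro continuous_on_diff continuous_on_mult cc ec) auto
    have i1: "integrable M (\<lambda>\<omega>. h (e v (X u \<omega>)))" for v
      by (intro integrable_pgrowth[where p = "\<lambda>x. h (e v x)"] pgrowth_h epg cc u0) auto
    have i2: "integrable M (\<lambda>\<omega>. h' (e s (X u \<omega>)) * es k UNIV (X u \<omega>))" for k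
      by (rule integrable_pgrowth[OF pc pp u0])
    have ed: "h' (e s x) * (e u x - e s x) = (\<Sum>k\<le>?N. \<Delta> k u * (h' (e s x) * es k UNIV x))" for x
      unfolding e_def esum_diff unfolding esum_def by (simp add: \<Delta>_def sum_distrib_left mult_ac)
    have "expectation (\<lambda>\<omega>. q (X u \<omega>)) = R u"
      unfolding q_def R_def ed \<Phi>_def using i1 i2 by simp
    moreover have "\<bar>expectation (\<lambda>\<omega>. q (X u \<omega>))\<bar> \<le> (H / 2 * (2 ^ ?N)\<^sup>2 * (\<Sum>k\<le>?N. \<bar>\<Delta> k u\<bar>)\<^sup>2) * expectation (\<lambda>\<omega>. wt (X u \<omega>) ^ (2 * ?N))"
    proof (rule expectation_pgrowth_bound[OF qc _ u0])
      fix x :: "(real,'n) vec"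
      have "\<bar>e u x - e s x\<bar> \<le> (\<Sum>k\<le>?N. \<bar>\<Delta> k u\<bar>) * (2 ^ ?N * wt x ^ ?N)"
        unfolding e_def esum_diff \<Delta>_def by (rule esum_diff_bound)
      then have "(e u x - e s x)\<^sup>2 \<le> ((\<Sum>k\<le>?N. \<bar>\<Delta> k u\<bar>) * (2 ^ ?N * wt x ^ ?N))\<^sup>2"
        by (rule abs_le_square_iff[THEN iffD1, OF order_trans[OF _ abs_ge_self]])
      then have "H / 2 * (e u x - e s x)\<^sup>2 \<le> H / 2 * ((\<Sum>k\<le>?N. \<bar>\<Delta> k u\<bar>) * (2 ^ ?N * wt x ^ ?N))\<^sup>2"
        using H_nonneg by (intro mult_left_mono) auto
      then show "\<bar>q x\<bar> \<le> (H / 2 * (2 ^ ?N)\<^sup>2 * (\<Sum>k\<le>?N. \<bar>\<Delta> k u\<bar>)\<^sup>2) * wt x ^ (2 * ?N)"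
        using taylor_bound[of "e u x" "e s x"]
        by (simp add: q_def power_mult_distrib power_mult[symmetric] mult_ac)
    qed
    moreover have "\<dots> \<le> (H / 2 * (2 ^ ?N)\<^sup>2 * (\<Sum>k\<le>?N. \<bar>\<Delta> k u\<bar>)\<^sup>2) * A"
      using A(2)[OF u] H_nonneg by (intro mult_left_mono) auto
    ultimately show ?thesis by (simp add: B_def mult_ac)
  qed
  have \<Delta>d: "((\<lambda>u. \<Delta> k u / (u - s)) \<longlongrightarrow> - (?c k * a (Suc k) s)) ?F" if "k \<le> ?N" for k
    using has_field_derivative_at_within[OF a[OF that, of s], of "{0..T}"]
    unfolding has_field_derivative_iff \<Delta>_def .
  have us: "((\<lambda>u. \<bar>u - s\<bar>) \<longlongrightarrow> 0) ?F"
  proof -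
    have "((\<lambda>u. \<bar>u - s\<bar>) \<longlongrightarrow> \<bar>s - s\<bar>) ?F" by (intro tendsto_intros)
    then show ?thesis by simp
  qed
  have Rl: "((\<lambda>u. R u / (u - s)) \<longlongrightarrow> 0) ?F"
  proof (rule Lim_null_comparison)
    have "((\<lambda>u. B * (\<Sum>k\<le>?N. \<bar>\<Delta> k u / (u - s)\<bar>)\<^sup>2 * \<bar>u - s\<bar>) \<longlongrightarrow>
        B * (\<Sum>k\<le>?N. \<bar>- (?c k * a (Suc k) s)\<bar>)\<^sup>2 * 0) ?F"
      by (intro tendsto_intros \<Delta>d us) auto
    then show "((\<lambda>u. B * (\<Sum>k\<le>?N. \<bar>\<Delta> k u / (u - s)\<bar>)\<^sup>2 * \<bar>u - s\<bar>) \<longlongrightarrow> 0) ?F" by simp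
    have "norm (R u / (u - s)) \<le> B * (\<Sum>k\<le>?N. \<bar>\<Delta> k u / (u - s)\<bar>)\<^sup>2 * \<bar>u - s\<bar>" if "u \<in> {0..T}" "u \<noteq> s" for u
    proof -
      have "norm (R u / (u - s)) \<le> B * (\<Sum>k\<le>?N. \<bar>\<Delta> k u\<bar>)\<^sup>2 / \<bar>u - s\<bar>"
        using Rb[OF that(1)] by (simp add: divide_right_mono)
      also have "(\<Sum>k\<le>?N. \<bar>\<Delta> k u\<bar>) = (\<Sum>k\<le>?N. \<bar>\<Delta> k u / (u - s)\<bar>) * \<bar>u - s\<bar>"
        using that(2) by (simp add: sum_divide_distrib[symmetric])
      also have "B * (\<dots>)\<^sup>2 / \<bar>u - s\<bar> = B * (\<Sum>k\<le>?N. \<bar>\<Delta> k u / (u - s)\<bar>)\<^sup>2 * \<bar>u - s\<bar>"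
        using that(2) by (simp add: power_mult_distrib power2_eq_square)
      finally show ?thesis .
    qed
    then show "\<forall>\<^sub>F u in ?F. norm (R u / (u - s)) \<le> B * (\<Sum>k\<le>?N. \<bar>\<Delta> k u / (u - s)\<bar>)\<^sup>2 * \<bar>u - s\<bar>"
      unfolding eventually_at_filter by simp
  qed
  have lim: "((\<lambda>u. (expectation (\<lambda>\<omega>. h (e s (X u \<omega>))) - expectation (\<lambda>\<omega>. h (e s (X s \<omega>)))) / (u - s)
      + (\<Sum>k\<le>?N. \<Delta> k u / (u - s) * \<Phi> k u) + R u / (u - s)) \<longlongrightarrow>
      expectation (\<lambda>\<omega>. G (X s \<omega>)) + (\<Sum>k\<le>?N. - (?c k * a (Suc k) s) * \<Phi> k s) + 0) ?F"
    using F'[unfolded has_field_derivative_iff] by (intro tendsto_intros \<Delta>d \<Phi>c Rl) auto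
  have s0: "0 \<le> s" using s by simp
  have i1: "integrable M (\<lambda>\<omega>. h' (e s (X s \<omega>)) * L (X s \<omega>))" by (rule integrable_pgrowth[OF c1 p1 s0])
  have i2: "integrable M (\<lambda>\<omega>. h'' (e s (X s \<omega>)) * grad_inner (e s) (e s) (X s \<omega>))"
    by (rule integrable_pgrowth[OF c2 p2 s0])
  have EL: "expectation (\<lambda>\<omega>. h' (e s (X s \<omega>)) * L (X s \<omega>)) = (\<Sum>k\<le>?N. ?c k * a (Suc k) s * \<Phi> k s)"
  proof -
    have "h' (e s x) * L x = (\<Sum>k\<le>?N. ?c k * a (Suc k) s * (h' (e s x) * es k UNIV x))" for x
      unfolding L_def esum_def by (simp add: sum_distrib_left mult_ac)
    then show ?thesis unfolding \<Phi>_def using integrable_pgrowth[OF pc pp s0] by simp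
  qed
  \<comment> \<open>Here the backward equation acts: \<open>L\<close> has the coefficients
    \<open>c_k a_(k+1)\<close>, and the \<open>a_k\<close> move with exactly the opposite
    rates.\<close>
  have val: "expectation (\<lambda>\<omega>. G (X s \<omega>)) + (\<Sum>k\<le>?N. - (?c k * a (Suc k) s) * \<Phi> k s) + 0 =
      \<sigma> / 2 * expectation (\<lambda>\<omega>. h'' (e s (X s \<omega>)) * grad_inner (e s) (e s) (X s \<omega>))"
    unfolding G_def using i1 i2 EL by (simp add: sum_negf)
  show ?thesis
    unfolding has_field_derivative_iff val[symmetric]
  proof (rule Lim_transform_eventually[OF lim])
    have "(expectation (\<lambda>\<omega>. h (e s (X u \<omega>))) - expectation (\<lambda>\<omega>. h (e s (X s \<omega>)))) / (u - s)
      + (\<Sum>k\<le>?N. \<Delta> k u / (u - s) * \<Phi> k u) + R u / (u - s) =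
      (expectation (\<lambda>\<omega>. h (e u (X u \<omega>))) - expectation (\<lambda>\<omega>. h (e s (X s \<omega>)))) / (u - s)" for u
      by (simp add: R_def sum_divide_distrib diff_divide_distrib add_divide_distrib)
    then show "\<forall>\<^sub>F u in ?F. (expectation (\<lambda>\<omega>. h (e s (X u \<omega>))) - expectation (\<lambda>\<omega>. h (e s (X s \<omega>)))) / (u - s)
      + (\<Sum>k\<le>?N. \<Delta> k u / (u - s) * \<Phi> k u) + R u / (u - s) =
      (expectation (\<lambda>\<omega>. h (e u (X u \<omega>))) - expectation (\<lambda>\<omega>. h (e s (X s \<omega>)))) / (u - s)"
      by simp
  qed
qed

section \<open>Weak convergence from trigonometric test functions\<close>

text \<open>Products stay in this class by the product-to-sum formula; the phase \<open>d\<close>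
  provides the sines.\<close>

inductive trig_poly :: "((real, 'n::{finite,linorder}) vec \<Rightarrow> real) \<Rightarrow> bool" where
  cos: "trig_poly (\<lambda>y. cos (\<zeta> \<bullet> y + d))"
| cmult: "trig_poly f \<Longrightarrow> trig_poly (\<lambda>y. c * f y)"
| add: "trig_poly f \<Longrightarrow> trig_poly g \<Longrightarrow> trig_poly (\<lambda>y. f y + g y)"

lemma trig_poly_const: "trig_poly (\<lambda>y. c)"
  using trig_poly.cmult[OF trig_poly.cos[of 0 0], of c] by simp

lemma trig_poly_mult_cos: "trig_poly g \<Longrightarrow> trig_poly (\<lambda>y. cos (\<zeta> \<bullet> y + d) * g y)"
proof (induction rule: trig_poly.induct)
  case (cos \<xi> e)
  have "cos (\<zeta> \<bullet> y + d) * cos (\<xi> \<bullet> y + e) =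
      1/2 * cos ((\<zeta> - \<xi>) \<bullet> y + (d - e)) + 1/2 * cos ((\<zeta> + \<xi>) \<bullet> y + (d + e))" for y
    using cos_times_cos[of "\<zeta> \<bullet> y + d" "\<xi> \<bullet> y + e"]
    by (simp add: inner_add_left inner_diff_left algebra_simps add_divide_distrib)
  then show ?case by (simp only: trig_poly.intros)
next
  case (cmult f c)
  then show ?case using trig_poly.cmult[OF cmult.IH, of c] by (simp add: mult_ac)
next
  case (add f g)
  then show ?case using trig_poly.add[OF add.IH] by (simp add: distrib_left)
qed

lemma trig_poly_mult: "trig_poly f \<Longrightarrow> trig_poly g \<Longrightarrow> trig_poly (\<lambda>y. f y * g y)"
proof (induction rule: trig_poly.induct)
  case (cos \<zeta> d)
  then show ?case by (rule trig_poly_mult_cos)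
next
  case (cmult f c)
  then show ?case using trig_poly.cmult[OF cmult.IH, of c] by (simp add: mult_ac)
next
  case (add f f')
  then show ?case using trig_poly.add[OF add.IH] by (simp add: distrib_right)
qed

lemma trig_poly_sum: "(\<And>i. i \<in> I \<Longrightarrow> trig_poly (f i)) \<Longrightarrow> trig_poly (\<lambda>y. \<Sum>i\<in>I. f i y)"
  by (induction I rule: infinite_finite_induct) (auto intro: trig_poly.add trig_poly_const)

text \<open>The bridge from algebraic approximation on a cube to test functions whose integrals are
  known from characteristic functions.\<close>

lemma trig_poly_polynomial_sin:
  fixes P :: "(real, 'n::{finite,linorder}) vec \<Rightarrow> real"
  assumes "real_polynomial_function P"
  shows "trig_poly (\<lambda>y. P (\<chi> i. sin (y $ i / L)))"
  using assms
proof (induction rule: real_polynomial_function.induct)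
  case (linear f)
  have s: "trig_poly (\<lambda>y :: (real,'n) vec. sin (y $ i / L))" for i
  proof -
    have "sin (y $ i / L) = cos (axis i (1 / L) \<bullet> y + - pi / 2)" for y :: "(real,'n) vec"
      by (simp add: inner_axis' cos_diff flip: cos_sin_eq)
    then show ?thesis by (simp only: trig_poly.cos)
  qed
  have fe: "f v = (\<Sum>i\<in>UNIV. f (axis i 1) * v $ i)" for v
  proof -
    have "f v = f (\<Sum>i\<in>UNIV. v $ i *\<^sub>R axis i 1)"
      using basis_expansion[of v] by (simp add: scalar_mult_eq_scaleR)
    then show ?thesis
      using linear bounded_linear.linear[OF linear] by (simp add: linear_sum linear_scale mult.commute)
  qed
  have "(\<lambda>y. f (\<chi> i. sin (y $ i / L))) = (\<lambda>y. \<Sum>i\<in>UNIV. f (axis i 1) * sin (y $ i / L))"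
    by (rule ext, subst fe, simp)
  moreover have "trig_poly (\<lambda>y. \<Sum>i\<in>UNIV. f (axis i 1) * sin (y $ i / L))"
    by (rule trig_poly_sum, rule trig_poly.cmult[OF s])
  ultimately show ?case by simp
next
  case (const c)
  show ?case by (rule trig_poly_const)
next
  case (add f g)
  show ?case by (rule trig_poly.add[OF add.IH])
next
  case (mult f g)
  show ?case by (rule trig_poly_mult[OF mult.IH])
qed

lemma trig_poly_continuous_bounded:
  "trig_poly f \<Longrightarrow> continuous_on UNIV f \<and> (\<exists>B. \<forall>y. \<bar>f y\<bar> \<le> B)"
proof (induction rule: trig_poly.induct)
  case (cos \<zeta> d)
  show ?case by (auto intro!: continuous_intros exI[of _ 1])
next
  case (cmult f c)
  then obtain B where "continuous_on UNIV f" "\<And>y. \<bar>f y\<bar> \<le> B" by blast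
  then show ?case
    by (auto intro!: continuous_intros exI[of _ "\<bar>c\<bar> * B"] simp: abs_mult mult_left_mono)
next
  case (add f g)
  then obtain B C where "continuous_on UNIV f" "\<And>y. \<bar>f y\<bar> \<le> B" "continuous_on UNIV g" "\<And>y. \<bar>g y\<bar> \<le> C" by blast
  then show ?case
    by (auto intro!: continuous_intros exI[of _ "B + C"] order_trans[OF abs_triangle_ineq] add_mono)
qed

lemma integrable_bounded_continuous:
  fixes f :: "(real, 'n::{finite,linorder}) vec \<Rightarrow> real"
  assumes "prob_space M" "sets M = sets borel" "continuous_on UNIV f" "\<And>y. \<bar>f y\<bar> \<le> B"
  shows "integrable M f"
proof -
  interpret prob_space M by fact
  show ?thesis
    by (rule integrable_const_bound[where B = B])
       (use assms in \<open>auto simp: measurable_cong_sets[OF assms(2) refl] intro: borel_measurable_continuous_onI\<close>)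
qed

lemma trig_poly_integral_tendsto:
  fixes \<mu> :: "'b \<Rightarrow> (real, 'n::{finite,linorder}) vec measure"
  assumes "\<forall>\<^sub>F b in F. prob_space (\<mu> b) \<and> sets (\<mu> b) = sets borel"
    and "prob_space \<mu>0" "sets \<mu>0 = sets borel"
    and "\<And>\<zeta> d. ((\<lambda>b. \<integral>y. cos (\<zeta> \<bullet> y + d) \<partial>\<mu> b) \<longlongrightarrow> (\<integral>y. cos (\<zeta> \<bullet> y + d) \<partial>\<mu>0)) F"
    and "trig_poly f"
  shows "((\<lambda>b. \<integral>y. f y \<partial>\<mu> b) \<longlongrightarrow> (\<integral>y. f y \<partial>\<mu>0)) F"
  using assms(5)
proof (induction rule: trig_poly.induct)
  case (cos \<zeta> d)
  show ?case by (rule assms(4))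
next
  case (cmult f c)
  then show ?case by (auto intro: tendsto_intros)
next
  case (add f g)
  have i: "integrable m f" "integrable m g" if "prob_space m" "sets m = sets borel" for m
    using integrable_bounded_continuous[OF that] add.hyps trig_poly_continuous_bounded by blast+
  have e: "(\<integral>y. f y + g y \<partial>m) = (\<integral>y. f y \<partial>m) + (\<integral>y. g y \<partial>m)" if "prob_space m" "sets m = sets borel" for m
    using i[OF that] by simp
  have "((\<lambda>b. (\<integral>y. f y \<partial>\<mu> b) + (\<integral>y. g y \<partial>\<mu> b)) \<longlongrightarrow> (\<integral>y. f y \<partial>\<mu>0) + (\<integral>y. g y \<partial>\<mu>0)) F"
    by (intro tendsto_add add.IH)
  then show ?case unfolding e[OF assms(2,3)]
    by (rule Lim_transform_eventually) (use assms(1) in \<open>auto elim!: eventually_mono simp: e\<close>)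
qed

lemma tight_single:
  fixes M :: "(real, 'n::{finite,linorder}) vec measure"
  assumes "prob_space M" "sets M = sets borel" "0 < e"
  shows "\<exists>R>0. measure M {y. R < norm y} \<le> e"
proof -
  interpret prob_space M by fact
  let ?A = "\<lambda>n. {y :: (real,'n) vec. real n < norm y}"
  have "range ?A \<subseteq> sets M" using assms(2) by (auto intro!: borel_open open_Collect_less continuous_intros)
  then have "(\<lambda>n. measure M (?A n)) \<longlonglongrightarrow> measure M (\<Inter>n. ?A n)"
    by (rule finite_Lim_measure_decseq) (auto simp: decseq_def)
  moreover have "(\<Inter>n. ?A n) = {}" using reals_Archimedean2 less_asym by fastforce
  ultimately have "(\<lambda>n. measure M (?A n)) \<longlonglongrightarrow> 0" by simp
  then have "\<forall>\<^sub>F n in sequentially. measure M (?A n) < e" using assms(3) by (rule order_tendstoD)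
  then obtain n where n: "measure M (?A n) < e" by (auto simp: eventually_sequentially)
  have "measure M {y. real n + 1 < norm y} \<le> measure M (?A n)"
    using \<open>range ?A \<subseteq> sets M\<close> by (intro finite_measure_mono) auto
  then show ?thesis using n by (intro exI[of _ "real n + 1"]) auto
qed

text \<open>A polynomial approximating \<open>f (L arcsin v)\<close> on the cube, evaluated at
  \<open>v = sin (y / L)\<close>, is a trigonometric polynomial close to \<open>f\<close> on a large
  ball. By periodicity it stays bounded outside, where tightness makes the error small.\<close>

lemma weak_conv_vecI_trig:
  fixes \<mu> :: "'b \<Rightarrow> (real, 'n::{finite,linorder}) vec measure"
  assumes P: "\<forall>\<^sub>F b in F. prob_space (\<mu> b) \<and> sets (\<mu> b) = sets borel"
    and P0: "prob_space \<mu>0" "sets \<mu>0 = sets borel"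
    and conv: "\<And>\<zeta> d. ((\<lambda>b. \<integral>y. cos (\<zeta> \<bullet> y + d) \<partial>\<mu> b) \<longlongrightarrow> (\<integral>y. cos (\<zeta> \<bullet> y + d) \<partial>\<mu>0)) F"
    and tight: "\<And>e. 0 < e \<Longrightarrow> \<exists>R. \<forall>\<^sub>F b in F. measure (\<mu> b) {y. R < norm y} \<le> e"
  shows "weak_conv_vec \<mu> \<mu>0 F"
  unfolding weak_conv_vec_def
proof (intro allI impI, elim conjE, rule tendstoI)
  fix f :: "(real, 'n) vec \<Rightarrow> real" and e :: real
  assume fc: "continuous_on UNIV f" and fb: "bounded (range f)" and e: "0 < e"
  obtain B where B: "0 < B" "\<And>y. \<bar>f y\<bar> \<le> B" using fb by (auto simp: bounded_pos)
  \<comment> \<open>Replacing \<open>f\<close> by the trigonometric polynomial costs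
    \<open>\<epsilon> + (2 B + 1) \<epsilon>\<close> under each of the two measures, and the
    convergence for that polynomial costs one more \<epsilon>: \<open>(5 + 4 B) \<epsilon>\<close>
    in total.\<close>
  define \<epsilon> where "\<epsilon> = min 1 (e / (6 + 4 * B))"
  have \<epsilon>: "0 < \<epsilon>" "\<epsilon> \<le> 1" "\<epsilon> * (5 + 4 * B) < e"
  proof -
    show "0 < \<epsilon>" "\<epsilon> \<le> 1" using e B by (auto simp: \<epsilon>_def)
    have "\<epsilon> * (5 + 4 * B) < \<epsilon> * (6 + 4 * B)" using \<open>0 < \<epsilon>\<close> by simp
    also have "\<dots> \<le> e / (6 + 4 * B) * (6 + 4 * B)" using B by (intro mult_right_mono) (auto simp: \<epsilon>_def)
    also have "\<dots> = e" using B by simp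
    finally show "\<epsilon> * (5 + 4 * B) < e" .
  qed
  obtain R1 where R1: "\<forall>\<^sub>F b in F. measure (\<mu> b) {y. R1 < norm y} \<le> \<epsilon>" using tight[OF \<epsilon>(1)] by blast
  obtain R2 where R2: "0 < R2" "measure \<mu>0 {y. R2 < norm y} \<le> \<epsilon>"
    using tight_single[OF P0 \<epsilon>(1)] by blast
  define L where "L = max R1 R2"
  have L: "0 < L" using R2 by (simp add: L_def)
  define K where "K = cbox (\<chi> i. -1) ((\<chi> i. 1) :: (real, 'n) vec)"
  have K: "v \<in> K \<longleftrightarrow> (\<forall>i. -1 \<le> v $ i \<and> v $ i \<le> 1)" for v :: "(real,'n) vec"
    by (simp add: K_def mem_box_cart)
  have fK: "continuous_on K (\<lambda>v. f (\<chi> i. L * arcsin (v $ i)))"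
    by (rule continuous_on_compose2[OF fc])
       (auto intro!: continuous_on_vec_lambda continuous_intros simp: K)
  obtain p where p: "real_polynomial_function p" "\<And>v. v \<in> K \<Longrightarrow> \<bar>f (\<chi> i. L * arcsin (v $ i)) - p v\<bar> < \<epsilon>"
    by (rule Stone_Weierstrass_real_polynomial_function[OF _ fK \<epsilon>(1)]) (auto simp: K_def)
  define T where "T y = p (\<chi> i. sin (y $ i / L))" for y :: "(real,'n) vec"
  have tT: "trig_poly T" unfolding T_def[abs_def] by (rule trig_poly_polynomial_sin[OF p(1)])
  have sK: "(\<chi> i. sin (y $ i / L)) \<in> K" for y :: "(real,'n) vec" by (simp add: K)
  \<comment> \<open>Valid for every \<open>y\<close>, since the sines always land in the cube; this
    controls the tails.\<close>
  have T1: "\<bar>f y - T y\<bar> \<le> 2 * B + 1" for y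
    using p(2)[OF sK[of y]] B(2)[of y] B(2)[of "\<chi> i. L * arcsin ((\<chi> i. sin (y $ i / L)) $ i)"] \<epsilon>(2)
    unfolding T_def by linarith
  have T2: "\<bar>f y - T y\<bar> \<le> \<epsilon>" if "norm y \<le> L" for y
  proof -
    have "\<bar>y $ i\<bar> \<le> L" for i using component_le_norm_cart[of y i] that by linarith
    then have b1: "\<bar>y $ i / L\<bar> \<le> 1" for i using L by simp
    \<comment> \<open>Inside the ball the arguments lie in the interval on which
      \<open>arcsin\<close> inverts \<open>sin\<close>.\<close>
    have hb: "\<bar>y $ i / L\<bar> \<le> pi / 2" for i
      by (rule order_trans[OF b1]) (use pi_ge_two in simp)
    have "arcsin (sin (y $ i / L)) = y $ i / L" for i
      by (intro arcsin_sin; use hb[of i] in linarith)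
    then have "(\<chi> i. L * arcsin ((\<chi> i. sin (y $ i / L)) $ i)) = y" using L by (simp add: vec_eq_iff)
    then show ?thesis using p(2)[OF sK[of y]] by (simp add: T_def)
  qed
  have cT: "continuous_on UNIV T" using trig_poly_continuous_bounded[OF tT] by blast
  obtain C where C: "\<And>y. \<bar>T y\<bar> \<le> C" using trig_poly_continuous_bounded[OF tT] by blast
  have est: "\<bar>(\<integral>y. f y \<partial>m) - (\<integral>y. T y \<partial>m)\<bar> \<le> \<epsilon> + (2 * B + 1) * \<epsilon>"
    if m: "prob_space m" "sets m = sets borel" "measure m {y. R < norm y} \<le> \<epsilon>" "R \<le> L" for m R
  proof -
    interpret prob_space m by (rule m)
    have i: "integrable m f" "integrable m T"
      by (rule integrable_bounded_continuous[OF m(1,2) fc B(2)], rule integrable_bounded_continuous[OF m(1,2) cT C])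
    have S: "{y :: (real,'n) vec. R < norm y} \<in> sets m"
      using m(2) by (auto intro!: borel_open open_Collect_less continuous_intros)
    have "\<bar>(\<integral>y. f y \<partial>m) - (\<integral>y. T y \<partial>m)\<bar> = \<bar>\<integral>y. f y - T y \<partial>m\<bar>" using i by simp
    also have "\<dots> \<le> (\<integral>y. \<bar>f y - T y\<bar> \<partial>m)" by (rule integral_abs_bound)
    also have "\<dots> \<le> (\<integral>y. \<epsilon> + (2 * B + 1) * indicator {y. R < norm y} y \<partial>m)"
    proof (rule integral_mono)
      show "integrable m (\<lambda>y. \<epsilon> + (2 * B + 1) * indicator {y. R < norm y} y)"
        using S by (intro Bochner_Integration.integrable_add integrable_mult_right) (auto simp: integrable_indicator_iff emeasure_eq_measure)
      show "\<bar>f y - T y\<bar> \<le> \<epsilon> + (2 * B + 1) * indicator {y. R < norm y} y" for y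
        using T1[of y] T2[of y] \<epsilon>(1) m(4) by (cases "R < norm y") auto
    qed (use i in auto)
    also have "\<dots> = \<epsilon> + (2 * B + 1) * measure m {y. R < norm y}"
      using S by (subst Bochner_Integration.integral_add) (auto simp: integrable_indicator_iff emeasure_eq_measure prob_space)
    also have "\<dots> \<le> \<epsilon> + (2 * B + 1) * \<epsilon>" using m(3) B by (intro add_left_mono mult_left_mono) auto
    finally show ?thesis .
  qed
  have "\<forall>\<^sub>F b in F. dist (\<integral>y. T y \<partial>\<mu> b) (\<integral>y. T y \<partial>\<mu>0) < \<epsilon>"
    using trig_poly_integral_tendsto[OF P P0 conv tT] \<epsilon>(1) by (rule tendstoD)
  then show "\<forall>\<^sub>F b in F. dist (\<integral>y. f y \<partial>\<mu> b) (\<integral>y. f y \<partial>\<mu>0) < e"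
    using P R1
  proof eventually_elim
    case (elim b)
    have "\<bar>(\<integral>y. f y \<partial>\<mu> b) - (\<integral>y. T y \<partial>\<mu> b)\<bar> \<le> \<epsilon> + (2 * B + 1) * \<epsilon>"
      by (rule est[of _ R1]) (use elim in \<open>auto simp: L_def\<close>)
    moreover have "\<bar>(\<integral>y. f y \<partial>\<mu>0) - (\<integral>y. T y \<partial>\<mu>0)\<bar> \<le> \<epsilon> + (2 * B + 1) * \<epsilon>"
      by (rule est[of _ R2]) (use R2 P0 in \<open>auto simp: L_def\<close>)
    ultimately have "dist (\<integral>y. f y \<partial>\<mu> b) (\<integral>y. f y \<partial>\<mu>0) < \<epsilon> * (5 + 4 * B)"
      using elim(1) unfolding dist_real_def by (simp add: algebra_simps)
    also have "\<dots> < e" by (rule \<epsilon>(3))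
    finally show ?case .
  qed
qed

section \<open>The characteristic function of the multivariate normal distribution\<close>

text \<open>The identity plus the rank-one matrix with \<open>d\<close> in row \<open>k\<close>: a
  shear combined with a scaling of the coordinate \<open>k\<close>.\<close>

definition elim_mat :: "'n \<Rightarrow> (real, 'n::{finite,linorder}) vec \<Rightarrow> ((real, 'n) vec, 'n) vec" where
  "elim_mat k d = (\<chi> a b. (if a = b then 1 else 0) + (if a = k then d $ b else 0))"

lemma elim_mat_mult: "elim_mat k d *v y = y + (d \<bullet> y) *\<^sub>R axis k 1"
proof (subst vec_eq_iff, rule allI)
  fix a
  have "(\<Sum>b\<in>UNIV. ((if a = b then 1 else 0) + (if a = k then d $ b else 0)) * y $ b) =
      (\<Sum>b\<in>UNIV. if a = b then y $ b else 0) + (if a = k then d \<bullet> y else 0)"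
    unfolding inner_vec_def by (cases "a = k") (simp_all add: distrib_right sum.distrib mult_if_delta)
  then show "(elim_mat k d *v y) $ a = (y + (d \<bullet> y) *\<^sub>R axis k 1) $ a"
    by (simp add: elim_mat_def matrix_vector_mult_def axis_def)
qed

lemma elim_mat_congruence:
  "(transpose (elim_mat k d) ** G ** elim_mat k d) $ i $ j =
    G $ i $ j + d $ j * G $ i $ k + d $ i * G $ k $ j + d $ i * d $ j * G $ k $ k"
proof -
  have s: "(\<Sum>a\<in>UNIV. ((if a = i then 1 else 0) + (if a = k then c else 0)) * f a) = f i + c * f k"
    "(\<Sum>a\<in>UNIV. f a * ((if a = i then 1 else 0) + (if a = k then c else 0))) = f i + f k * c"
    for f :: "'a \<Rightarrow> real" and c :: real and i
  proof -
    have 1: "((if a = i then 1 else 0) + (if a = k then c else 0)) * f a = (if a = i then f a else 0) + (if a = k then c * f a else 0)" for a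
      by (simp add: distrib_right)
    show "(\<Sum>a\<in>UNIV. ((if a = i then 1 else 0) + (if a = k then c else 0)) * f a) = f i + c * f k"
      unfolding 1 sum.distrib by simp
    then show "(\<Sum>a\<in>UNIV. f a * ((if a = i then 1 else 0) + (if a = k then c else 0))) = f i + f k * c"
      by (simp only: mult.commute)
  qed
  show ?thesis
    unfolding matrix_matrix_mult_def transpose_def elim_mat_def vec_lambda_beta s
    by (simp add: algebra_simps)
qed

text \<open>The matrix arises from a diagonal one by adding multiples of other rows to row
  \<open>k\<close>.\<close>

lemma det_elim_mat: "det (elim_mat k d :: ((real, 'n::{finite,linorder}) vec, 'n) vec) = 1 + d $ k"
proof -
  define D where "D = (\<chi> a b. if a = b then (if a = k then 1 + d $ k else 1) else 0)"
  define x where "x = (\<chi> b. if b = k then 0 else d $ b)"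
  have rD: "j \<noteq> k \<Longrightarrow> row j D = axis j 1" for j :: 'n by (auto simp: row_def D_def vec_eq_iff axis_def)
  have xe: "x = (\<Sum>j\<in>UNIV - {k}. d $ j *s row j D)"
  proof -
    have "(\<Sum>j\<in>UNIV - {k}. d $ j *s row j D) = (\<Sum>j\<in>UNIV - {k}. d $ j *s axis j 1)"
      by (intro sum.cong refl) (simp add: rD)
    also have "\<dots> = x"
      by (simp add: vec_eq_iff x_def axis_def if_distrib cong: if_cong)
    finally show ?thesis by simp
  qed
  have "x \<in> vec.span {row j D | j. j \<noteq> k}"
    unfolding xe by (intro vec.span_sum vec.span_scale vec.span_base) auto
  from det_row_span[OF this]
  have "det (\<chi> a. if a = k then row k D + x else row a D) = det D" .
  moreover have "(\<chi> a. if a = k then row k D + x else row a D) = elim_mat k d"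
    by (auto simp: vec_eq_iff elim_mat_def D_def x_def row_def)
  moreover have "det D = 1 + d $ k"
    by (subst det_diagonal) (auto simp: D_def prod.If_cases)
  ultimately show ?thesis by simp
qed

lemma measurable_matrix_vector_mult:
  fixes B :: "((real, 'n::{finite,linorder}) vec, 'n) vec"
  shows "(\<lambda>y. B *v y) \<in> borel_measurable borel"
  by (rule borel_measurable_continuous_onI[OF matrix_vector_mult_linear_continuous_on])

text \<open>With the other coordinates fixed, the map is affine in the coordinate \<open>k\<close>
  with slope \<open>1 + d_k\<close>; Fubini reduces the claim to the line.\<close>

lemma nn_integral_elim_mat:
  fixes F :: "(real, 'n::{finite,linorder}) vec \<Rightarrow> ennreal"
  assumes F: "F \<in> borel_measurable borel" and c: "0 < 1 + d $ k"
  shows "(\<integral>\<^sup>+y. F y \<partial>lborel) = ennreal (1 + d $ k) * (\<integral>\<^sup>+y. F (elim_mat k d *v y) \<partial>lborel)"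
proof -
  let ?B = "Basis :: (real,'n) vec set"
  define b0 where "b0 = (axis k 1 :: (real,'n) vec)"
  define I where "I = ?B - {b0}"
  have b0: "b0 \<in> ?B" by (auto simp: b0_def Basis_vec_def)
  have B: "?B = insert b0 I" "b0 \<notin> I" "finite I" using b0 by (auto simp: I_def)
  interpret P: product_sigma_finite "\<lambda>_ :: (real,'n) vec. lborel :: real measure" by unfold_locales
  define \<phi> where "\<phi> = (\<lambda>f :: (real,'n) vec \<Rightarrow> real. \<Sum>b\<in>?B. f b *\<^sub>R b)"
  have \<phi>m: "\<phi> \<in> measurable (Pi\<^sub>M ?B (\<lambda>_. lborel)) borel" unfolding \<phi>_def by measurable
  define v where "v x = (\<Sum>b\<in>I. x b *\<^sub>R b)" for x :: "(real,'n) vec \<Rightarrow> real"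
  have \<phi>u: "\<phi> (x(b0 := y)) = y *\<^sub>R b0 + v x" for x y
    unfolding \<phi>_def B(1) v_def using B(2,3) by (simp add: sum.insert) (intro sum.cong refl, auto)
  have red: "(\<integral>\<^sup>+y. H y \<partial>lborel) = (\<integral>\<^sup>+x. \<integral>\<^sup>+y. H (y *\<^sub>R b0 + v x) \<partial>lborel \<partial>Pi\<^sub>M I (\<lambda>_. lborel))"
    if H: "H \<in> borel_measurable borel" for H :: "(real,'n) vec \<Rightarrow> ennreal"
  proof -
    have "(\<integral>\<^sup>+y. H y \<partial>lborel) = (\<integral>\<^sup>+x. H (\<phi> x) \<partial>Pi\<^sub>M ?B (\<lambda>_. lborel))"
      by (subst lborel_eq) (use H \<phi>m in \<open>simp add: nn_integral_distr \<phi>_def\<close>)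
    also have "\<dots> = (\<integral>\<^sup>+x. \<integral>\<^sup>+y. H (\<phi> (x(b0 := y))) \<partial>lborel \<partial>Pi\<^sub>M I (\<lambda>_. lborel))"
      using measurable_compose[OF \<phi>m H] unfolding B(1) by (intro P.product_nn_integral_insert B) auto
    finally show ?thesis unfolding \<phi>u .
  qed
  have "(\<integral>\<^sup>+y. F y \<partial>lborel) = (\<integral>\<^sup>+x. \<integral>\<^sup>+y. F (y *\<^sub>R b0 + v x) \<partial>lborel \<partial>Pi\<^sub>M I (\<lambda>_. lborel))"
    by (rule red[OF F])
  also have "\<dots> = (\<integral>\<^sup>+x. ennreal (1 + d $ k) * (\<integral>\<^sup>+y. F (elim_mat k d *v (y *\<^sub>R b0 + v x)) \<partial>lborel) \<partial>Pi\<^sub>M I (\<lambda>_. lborel))"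
  proof (rule nn_integral_cong)
    fix x
    have "(\<lambda>y. F (y *\<^sub>R b0 + v x)) \<in> borel_measurable borel"
      by (rule measurable_compose[OF _ F]) measurable
    then have "(\<integral>\<^sup>+y. F (y *\<^sub>R b0 + v x) \<partial>lborel) =
        \<bar>1 + d $ k\<bar> * (\<integral>\<^sup>+y. F ((d \<bullet> v x + (1 + d $ k) * y) *\<^sub>R b0 + v x) \<partial>lborel)"
      using c by (intro nn_integral_real_affine) auto
    moreover have "(d \<bullet> v x + (1 + d $ k) * y) *\<^sub>R b0 + v x = elim_mat k d *v (y *\<^sub>R b0 + v x)" for y
      unfolding elim_mat_mult by (simp add: b0_def inner_axis algebra_simps inner_add_right)
    ultimately show "(\<integral>\<^sup>+y. F (y *\<^sub>R b0 + v x) \<partial>lborel) =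
        ennreal (1 + d $ k) * (\<integral>\<^sup>+y. F (elim_mat k d *v (y *\<^sub>R b0 + v x)) \<partial>lborel)"
      using c by simp
  qed
  also have "\<dots> = ennreal (1 + d $ k) * (\<integral>\<^sup>+x. (\<integral>\<^sup>+y. F (elim_mat k d *v (y *\<^sub>R b0 + v x)) \<partial>lborel) \<partial>Pi\<^sub>M I (\<lambda>_. lborel))"
  proof (rule nn_integral_cmult)
    have "(\<lambda>(x, y). F (elim_mat k d *v (y *\<^sub>R b0 + v x))) \<in> borel_measurable (Pi\<^sub>M I (\<lambda>_. lborel) \<Otimes>\<^sub>M lborel)"
      unfolding case_prod_beta
      by (rule measurable_compose[OF measurable_compose[OF _ measurable_matrix_vector_mult] F]) (unfold v_def, measurable)
    then show "(\<lambda>x. \<integral>\<^sup>+y. F (elim_mat k d *v (y *\<^sub>R b0 + v x)) \<partial>lborel) \<in> borel_measurable (Pi\<^sub>M I (\<lambda>_. lborel))"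
      by (rule lborel.borel_measurable_nn_integral)
  qed
  also have "\<dots> = ennreal (1 + d $ k) * (\<integral>\<^sup>+y. F (elim_mat k d *v y) \<partial>lborel)"
    using red[OF measurable_compose[OF measurable_matrix_vector_mult F]] by simp
  finally show ?thesis .
qed

text \<open>The linear change of variables as a property of the matrix. It is closed under products
  and is carried along the elimination.\<close>

definition scales_lborel :: "((real, 'n::{finite,linorder}) vec, 'n) vec \<Rightarrow> bool" where
  "scales_lborel B \<longleftrightarrow> (\<forall>F \<in> borel_measurable borel.
     (\<integral>\<^sup>+y. F y \<partial>lborel) = ennreal \<bar>det B\<bar> * (\<integral>\<^sup>+y. F (B *v y) \<partial>lborel))"

lemma scales_lborel_mult:
  assumes "scales_lborel B" "scales_lborel E"
  shows "scales_lborel (B ** E)"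
  unfolding scales_lborel_def
proof
  fix F :: "(real,'a) vec \<Rightarrow> ennreal" assume F: "F \<in> borel_measurable borel"
  have "(\<integral>\<^sup>+y. F y \<partial>lborel) = ennreal \<bar>det B\<bar> * (\<integral>\<^sup>+y. F (B *v y) \<partial>lborel)"
    using assms(1) F by (simp add: scales_lborel_def)
  also have "(\<integral>\<^sup>+y. F (B *v y) \<partial>lborel) = ennreal \<bar>det E\<bar> * (\<integral>\<^sup>+y. F (B *v (E *v y)) \<partial>lborel)"
    using assms(2) measurable_compose[OF measurable_matrix_vector_mult F, of B] by (simp add: scales_lborel_def)
  finally show "(\<integral>\<^sup>+y. F y \<partial>lborel) = ennreal \<bar>det (B ** E)\<bar> * (\<integral>\<^sup>+y. F (B ** E *v y) \<partial>lborel)"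
    by (simp add: det_mul abs_mult ennreal_mult matrix_vector_mul_assoc mult.assoc)
qed

lemma det_nz_imp_mult_nz:
  fixes B :: "((real, 'n::{finite,linorder}) vec, 'n) vec"
  assumes "det B \<noteq> 0" "v \<noteq> 0" shows "B *v v \<noteq> 0"
proof
  assume "B *v v = 0"
  obtain C where "C ** B = mat 1" using assms(1) invertible_det_nz[of B] by (auto simp: invertible_def)
  then have "v = C *v (B *v v)" by (simp add: matrix_vector_mul_assoc)
  with \<open>B *v v = 0\<close> assms(2) show False by simp
qed

lemma inner_transpose_mult: "v \<bullet> (transpose B *v w) = (B *v v) \<bullet> (w :: (real, 'n::{finite,linorder}) vec)"
  by (metis dot_lmul_matrix inner_commute vector_transpose_matrix transpose_transpose)

text \<open>Gaussian elimination by congruences; each step only touches one coordinate, so that its effect on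
  Lebesgue measure follows from the one-dimensional affine substitution.\<close>

lemma pos_def_congruent_identity:
  fixes A :: "((real, 'n::{finite,linorder}) vec, 'n) vec"
  assumes sym: "transpose A = A" and pd: "\<And>v. v \<noteq> 0 \<Longrightarrow> 0 < v \<bullet> (A *v v)"
  shows "\<exists>B. det B \<noteq> 0 \<and> scales_lborel B \<and> transpose B ** A ** B = mat 1"
proof -
  \<comment> \<open>The rows in \<open>T\<close> are already those of the identity; each step treats
    one further index.\<close>
  have "\<exists>B. det B \<noteq> 0 \<and> scales_lborel B \<and>
      (\<forall>i j. i \<in> T \<longrightarrow> (transpose B ** A ** B) $ i $ j = (if i = j then 1 else 0))" if "finite T" for T
    using that
  proof (induction T rule: finite_induct)
    case empty
    have "scales_lborel (mat 1 :: ((real,'n) vec, 'n) vec)" by (simp add: scales_lborel_def)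
    then show ?case by (intro exI[of _ "mat 1"]) simp
  next
    case (insert k T)
    then obtain B where B: "det B \<noteq> 0" "scales_lborel B"
      "\<And>i j. i \<in> T \<Longrightarrow> (transpose B ** A ** B) $ i $ j = (if i = j then 1 else 0)" by blast
    define G where "G = transpose B ** A ** B"
    have Gs: "G $ i $ j = G $ j $ i" for i j
    proof -
      have "transpose G = G" unfolding G_def by (simp add: matrix_transpose_mul sym matrix_mul_assoc)
      then have "transpose G $ i $ j = G $ i $ j" by simp
      then show ?thesis by (simp add: transpose_def)
    qed
    have g: "0 < G $ k $ k"
    proof -
      have "B *v axis k 1 \<noteq> 0" by (rule det_nz_imp_mult_nz[OF B(1)]) simp
      then have "0 < (B *v axis k 1) \<bullet> (A *v (B *v axis k 1))" by (rule pd)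
      also have "\<dots> = axis k 1 \<bullet> (G *v axis k 1)"
        unfolding G_def by (simp only: inner_transpose_mult matrix_vector_mul_assoc[symmetric])
      also have "\<dots> = G $ k $ k"
      proof -
        have "(G *v axis k 1) $ k = G $ k $ k"
          by (simp add: matrix_vector_mult_def axis_def if_distrib cong: if_cong)
        then show ?thesis by (simp add: inner_axis')
      qed
      finally show ?thesis .
    qed
    \<comment> \<open>The entry at \<open>k\<close> normalises the pivot to 1, the others clear the
      rest of row \<open>k\<close>.\<close>
    define d where "d = (\<chi> j. if j = k then 1 / sqrt (G $ k $ k) - 1 else - G $ k $ j / G $ k $ k)"
    define E where "E = elim_mat k d"
    have dk: "1 + d $ k = 1 / sqrt (G $ k $ k)" by (simp add: d_def)
    have dE: "det E = 1 / sqrt (G $ k $ k)" by (simp add: E_def det_elim_mat dk)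
    have "scales_lborel E"
      unfolding scales_lborel_def E_def det_elim_mat
      using nn_integral_elim_mat[of _ d k] g by (simp add: dk)
    then have sBE: "scales_lborel (B ** E)" by (rule scales_lborel_mult[OF B(2)])
    have dBE: "det (B ** E) \<noteq> 0" using B(1) dE g by (simp add: det_mul)
    have "transpose (B ** E) ** A ** (B ** E) = transpose E ** G ** E"
      by (simp add: G_def matrix_transpose_mul matrix_mul_assoc)
    then have ent: "(transpose (B ** E) ** A ** (B ** E)) $ i $ j =
        G $ i $ j + d $ j * G $ i $ k + d $ i * G $ k $ j + d $ i * d $ j * G $ k $ k" for i j
      by (simp add: E_def elim_mat_congruence)
    have "(transpose (B ** E) ** A ** (B ** E)) $ i $ j = (if i = j then 1 else 0)" if "i \<in> insert k T" for i j
    proof (cases "i = k")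
      case True
      show ?thesis
      proof (cases "j = k")
        case True
        have "(transpose (B ** E) ** A ** (B ** E)) $ k $ k = (1 + d $ k)\<^sup>2 * G $ k $ k"
          unfolding ent by (simp add: power2_eq_square algebra_simps)
        also have "\<dots> = 1" unfolding dk using g by (simp add: power_divide)
        finally show ?thesis using True \<open>i = k\<close> by simp
      next
        case False
        then have "d $ j * G $ k $ k = - G $ k $ j" using g by (simp add: d_def)
        then have "(transpose (B ** E) ** A ** (B ** E)) $ k $ j = 0"
          unfolding ent by (simp add: mult.assoc)
        then show ?thesis using True False by simp
      qed
    next
      case False
      then have i: "i \<in> T" using that by simp
      then have Gi: "G $ i $ j = (if i = j then 1 else 0)" for j using B(3) by (simp add: G_def)
      have "G $ i $ k = 0" using Gi[of k] False by simp
      \<comment> \<open>By symmetry a row reduced earlier has entry 0 in column \<open>k\<close>, so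
        the present step leaves it alone.\<close>
      moreover have "d $ i = 0" using False Gs[of k i] calculation by (simp add: d_def)
      ultimately show ?thesis unfolding ent using Gi[of j] by simp
    qed
    then show ?case using dBE sBE by blast
  qed
  from this[of UNIV] show ?thesis
    by (auto simp: vec_eq_iff mat_def)
qed

definition std_gauss :: "(real, 'n::{finite,linorder}) vec measure" where
  "std_gauss = density lborel (\<lambda>y. ennreal ((2 * pi) powr (- real CARD('n) / 2) * exp (- (y \<bullet> y) / 2)))"

lemma std_gauss_density_prod:
  fixes y :: "(real, 'n::{finite,linorder}) vec"
  shows "(2 * pi) powr (- real CARD('n) / 2) * exp (- (y \<bullet> y) / 2) = (\<Prod>b\<in>Basis. std_normal_density (y \<bullet> b))"
proof -
  have "(\<Prod>b\<in>Basis. std_normal_density (y \<bullet> b)) =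
      (\<Prod>b\<in>(Basis :: (real,'n) vec set). 1 / sqrt (2 * pi)) * (\<Prod>b\<in>Basis. exp (- (y \<bullet> b)\<^sup>2 / 2))"
    by (simp only: std_normal_density_def prod.distrib)
  also have "(\<Prod>b\<in>Basis. exp (- (y \<bullet> b)\<^sup>2 / 2)) = exp (\<Sum>b\<in>Basis. - (y \<bullet> b)\<^sup>2 / 2)"
    by (rule exp_sum[symmetric]) simp
  also have "(\<Sum>b\<in>Basis. - (y \<bullet> b)\<^sup>2 / 2) = - (y \<bullet> y) / 2"
    unfolding euclidean_inner[of y y] by (simp add: sum_divide_distrib[symmetric] sum_negf power2_eq_square)
  also have "(\<Prod>b\<in>(Basis :: (real,'n) vec set). 1 / sqrt (2 * pi)) = (2 * pi) powr (- real CARD('n) / 2)"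
  proof -
    have "(1 / sqrt (2 * pi)) = (2 * pi) powr (- (1/2))"
      by (simp add: powr_minus_divide powr_half_sqrt)
    then have "(1 / sqrt (2 * pi)) ^ CARD('n) = (2 * pi) powr (- (1/2) * real CARD('n))"
      by (simp add: powr_powr powr_realpow[symmetric])
    then show ?thesis by (simp add: prod_constant DIM_cart)
  qed
  finally show ?thesis by simp
qed

text \<open>The integrand is a product of functions of single coordinates, so the one-dimensional
  characteristic functions multiply.\<close>

lemma std_gauss_char:
  fixes \<zeta> :: "(real, 'n::{finite,linorder}) vec"
  shows "(\<integral>y. iexp (\<zeta> \<bullet> y) \<partial>std_gauss) = exp (- (\<zeta> \<bullet> \<zeta>) / 2)"
proof -
  let ?B = "Basis :: (real,'n) vec set"
  interpret P: product_sigma_finite "\<lambda>_ :: (real,'n) vec. lborel :: real measure" by unfold_locales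
  define h where "h b v = complex_of_real (std_normal_density v) * iexp ((\<zeta> \<bullet> b) * v)" for b :: "(real,'n) vec" and v
  have hi: "integrable lborel (h b)" for b
  proof -
    have "integrable lborel (\<lambda>v. norm (std_normal_density v))" by simp
    then show ?thesis
      by (rule Bochner_Integration.integrable_bound) (auto simp: h_def[abs_def] norm_mult)
  qed
  have hI: "(\<integral>v. h b v \<partial>lborel) = exp (- (\<zeta> \<bullet> b)\<^sup>2 / 2)" for b
  proof -
    have "(\<integral>v. h b v \<partial>lborel) = char std_normal_distribution (\<zeta> \<bullet> b)"
      unfolding char_def h_def by (subst integral_density) (auto simp: scaleR_conv_of_real)
    then show ?thesis by (simp add: char_std_normal_distribution)
  qed
  have prod: "complex_of_real ((2 * pi) powr (- real CARD('n) / 2) * exp (- (y \<bullet> y) / 2)) * iexp (\<zeta> \<bullet> y) = (\<Prod>b\<in>?B. h b (y \<bullet> b))" for y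
  proof -
    have "iexp (\<zeta> \<bullet> y) = exp (\<Sum>b\<in>?B. \<i> * complex_of_real ((\<zeta> \<bullet> b) * (y \<bullet> b)))"
      by (simp add: euclidean_inner[of \<zeta> y] sum_distrib_left)
    also have "\<dots> = (\<Prod>b\<in>?B. iexp ((\<zeta> \<bullet> b) * (y \<bullet> b)))" by (rule exp_sum) simp
    finally show ?thesis unfolding std_gauss_density_prod h_def by (simp add: prod.distrib of_real_prod)
  qed
  have "(\<integral>y. iexp (\<zeta> \<bullet> y) \<partial>std_gauss) =
      (\<integral>y. complex_of_real ((2 * pi) powr (- real CARD('n) / 2) * exp (- (y \<bullet> y) / 2)) * iexp (\<zeta> \<bullet> y) \<partial>lborel)"
    unfolding std_gauss_def by (subst integral_density) (auto simp: scaleR_conv_of_real)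
  also have "\<dots> = (\<integral>y. (\<Prod>b\<in>?B. h b (y \<bullet> b)) \<partial>lborel)" unfolding prod ..
  also have "\<dots> = (\<integral>f. (\<Prod>b\<in>?B. h b ((\<Sum>c\<in>?B. f c *\<^sub>R c) \<bullet> b)) \<partial>Pi\<^sub>M ?B (\<lambda>_. lborel))"
    unfolding h_def by (subst lborel_eq, subst integral_distr) auto
  also have "\<dots> = (\<integral>f. (\<Prod>b\<in>?B. h b (f b)) \<partial>Pi\<^sub>M ?B (\<lambda>_. lborel))"
    by (intro Bochner_Integration.integral_cong refl prod.cong)
       (simp add: inner_sum_left inner_Basis if_distrib if_distribR cong: if_cong)
  also have "\<dots> = (\<Prod>b\<in>?B. \<integral>v. h b v \<partial>lborel)"
    by (rule P.product_integral_prod) (auto simp: hi)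
  also have "\<dots> = exp (\<Sum>b\<in>?B. - (\<zeta> \<bullet> b)\<^sup>2 / 2)"
    unfolding hI by (subst exp_sum) (simp_all add: of_real_prod)
  also have "(\<Sum>b\<in>?B. - (\<zeta> \<bullet> b)\<^sup>2 / 2) = - (\<zeta> \<bullet> \<zeta>) / 2"
    unfolding euclidean_inner[of \<zeta> \<zeta>] by (simp add: sum_divide_distrib[symmetric] sum_negf power2_eq_square)
  finally show ?thesis .
qed

lemma prob_space_std_gauss: "prob_space (std_gauss :: (real, 'n::{finite,linorder}) vec measure)"
proof -
  let ?f = "\<lambda>y :: (real,'n) vec. (2 * pi) powr (- real CARD('n) / 2) * exp (- (y \<bullet> y) / 2)"
  have f0: "0 \<le> ?f y" for y by simp
  have "(\<integral>y. complex_of_real (?f y) \<partial>lborel) = (\<integral>y. iexp (0 \<bullet> y) \<partial>(std_gauss :: (real, 'n) vec measure))"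
    unfolding std_gauss_def by (subst integral_density) (auto simp: scaleR_conv_of_real)
  also have "\<dots> = 1" by (subst std_gauss_char) simp
  finally have "complex_of_real (\<integral>y. ?f y \<partial>lborel) = 1" by simp
  then have I: "(\<integral>y. ?f y \<partial>lborel) = 1" by (simp only: of_real_eq_1_iff)
  \<comment> \<open>A nonintegrable function has integral 0 by convention, so the value 1 proves
    integrability.\<close>
  then have "integrable lborel ?f" using not_integrable_integral_eq by fastforce
  then have "(\<integral>\<^sup>+y. ennreal (?f y) \<partial>lborel) = 1"
    using I by (subst nn_integral_eq_integral) auto
  then show ?thesis
    by (intro prob_spaceI) (simp add: std_gauss_def emeasure_density)
qed

context
  fixes A C :: "((real, 'n::{finite,linorder}) vec, 'n) vec"
  assumes sym: "transpose A = A" and pd: "\<And>v. v \<noteq> 0 \<Longrightarrow> 0 < v \<bullet> (A *v v)" and inv: "A ** C = mat 1"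
begin

lemma matrix_inv_C: "matrix_inv C = A"
proof -
  have "C ** A = mat 1" using inv matrix_left_right_inverse by blast
  then have "\<exists>A'. C ** A' = mat 1 \<and> A' ** C = mat 1" using inv by blast
  then have m: "C ** matrix_inv C = mat 1 \<and> matrix_inv C ** C = mat 1"
    unfolding matrix_inv_def by (rule someI_ex)
  have "matrix_inv C = (A ** C) ** matrix_inv C" using inv by simp
  also have "\<dots> = A" using m by (simp add: matrix_mul_assoc[symmetric])
  finally show ?thesis .
qed

text \<open>\<open>A\<close> is the inverse covariance. A congruence of \<open>A\<close> to the
  identity pulls the quadratic form back to the standard one, and inverting it gives
  \<open>C\<close> as \<open>B\<close> times its transpose.\<close>

lemma normal_vec_eq_distr:
  "\<exists>B :: ((real, 'n) vec, 'n) vec. normal_vec C = distr std_gauss borel (\<lambda>u. B *v u) \<and> B ** transpose B = C"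
proof -
  obtain B where B: "det B \<noteq> 0" "scales_lborel B" "transpose B ** A ** B = mat 1"
    using pos_def_congruent_identity[OF sym pd] by blast
  have BC: "B ** transpose B = C"
  proof -
    have "B ** (transpose B ** A) = mat 1"
      using B(3) matrix_left_right_inverse by blast
    then have "(B ** transpose B) ** A ** C = C" by (simp add: matrix_mul_assoc)
    then show ?thesis by (simp add: matrix_mul_assoc[symmetric] inv)
  qed
  then have detC: "det C = (det B)\<^sup>2" by (metis det_mul det_transpose power2_eq_square)
  define \<rho> where "\<rho> y = (2 * pi) powr (- real CARD('n) / 2) / sqrt (det C) * exp (- (y \<bullet> (matrix_inv C *v y)) / 2)" for y
  have quad: "(B *v u) \<bullet> (A *v (B *v u)) = u \<bullet> u" for u
    using inner_transpose_mult[of u B "A *v (B *v u)"] B(3)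
    by (simp add: matrix_vector_mul_assoc matrix_mul_assoc)
  have \<rho>B: "\<bar>det B\<bar> * \<rho> (B *v u) = (2 * pi) powr (- real CARD('n) / 2) * exp (- (u \<bullet> u) / 2)" for u
    unfolding \<rho>_def matrix_inv_C quad detC using B(1) by simp
  have \<rho>0: "0 \<le> \<rho> y" for y unfolding \<rho>_def detC by simp
  have dens: "ennreal \<bar>det B\<bar> * ennreal (\<rho> (B *v u)) = ennreal ((2 * pi) powr (- real CARD('n) / 2) * exp (- (u \<bullet> u) / 2))" for u
    unfolding \<rho>B[symmetric] using \<rho>0 by (simp only: ennreal_mult abs_ge_zero)
  have \<rho>m: "\<rho> \<in> borel_measurable borel"
    unfolding \<rho>_def
    by (intro borel_measurable_continuous_onI continuous_intros matrix_vector_mult_linear_continuous_on) auto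
  have "normal_vec C = distr std_gauss borel (\<lambda>u. B *v u)"
  proof (rule measure_eqI)
    show "sets (normal_vec C) = sets (distr std_gauss borel (\<lambda>u. B *v u))" by (simp add: normal_vec_def)
    fix S assume "S \<in> sets (normal_vec C)"
    then have S: "S \<in> sets borel" by (simp add: normal_vec_def)
    have Sm: "(\<lambda>y. ennreal (\<rho> y) * indicator S y) \<in> borel_measurable borel" using \<rho>m S by measurable
    have nv: "normal_vec C = density lborel (\<lambda>y. ennreal (\<rho> y))" by (simp add: normal_vec_def \<rho>_def)
    have "emeasure (normal_vec C) S = (\<integral>\<^sup>+y. ennreal (\<rho> y) * indicator S y \<partial>lborel)"
      unfolding nv using \<rho>m S by (subst emeasure_density) auto
    also have "\<dots> = ennreal \<bar>det B\<bar> * (\<integral>\<^sup>+u. ennreal (\<rho> (B *v u)) * indicator S (B *v u) \<partial>lborel)"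
      using B(2) Sm unfolding scales_lborel_def by blast
    also have "\<dots> = (\<integral>\<^sup>+u. ennreal \<bar>det B\<bar> * (ennreal (\<rho> (B *v u)) * indicator S (B *v u)) \<partial>lborel)"
      by (rule nn_integral_cmult[symmetric])
         (use measurable_compose[OF measurable_matrix_vector_mult Sm, of B] in simp)
    also have "\<dots> = (\<integral>\<^sup>+u. ennreal ((2 * pi) powr (- real CARD('n) / 2) * exp (- (u \<bullet> u) / 2)) * indicator ((\<lambda>u. B *v u) -` S) u \<partial>lborel)"
      by (intro nn_integral_cong, subst mult.assoc[symmetric], subst dens, simp add: indicator_def)
    also have "\<dots> = emeasure std_gauss ((\<lambda>u. B *v u) -` S)"
      unfolding std_gauss_def using measurable_sets_borel[OF measurable_matrix_vector_mult S, of B]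
      by (subst emeasure_density) auto
    also have "\<dots> = emeasure (distr std_gauss borel (\<lambda>u. B *v u)) S"
      using S measurable_matrix_vector_mult[of B] by (subst emeasure_distr) (auto simp: std_gauss_def)
    finally show "emeasure (normal_vec C) S = emeasure (distr std_gauss borel (\<lambda>u. B *v u)) S" .
  qed
  with BC show ?thesis by (intro exI[of _ B] conjI)
qed

lemma prob_space_normal_vec: "prob_space (normal_vec C)"
proof -
  obtain B :: "((real, 'n) vec, 'n) vec" where B: "normal_vec C = distr std_gauss borel (\<lambda>u. B *v u)" using normal_vec_eq_distr by blast
  have "(\<lambda>u. B *v u) \<in> measurable std_gauss borel"
    using measurable_matrix_vector_mult[of B] by (simp add: std_gauss_def)
  then show ?thesis unfolding B by (rule prob_space.prob_space_distr[OF prob_space_std_gauss])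
qed

lemma normal_vec_cos: "(\<integral>y. cos (\<zeta> \<bullet> y + d) \<partial>normal_vec C) = exp (- (\<zeta> \<bullet> (C *v \<zeta>)) / 2) * cos d"
proof -
  obtain B :: "((real, 'n) vec, 'n) vec" where B: "normal_vec C = distr std_gauss borel (\<lambda>u. B *v u)" "B ** transpose B = C"
    using normal_vec_eq_distr by blast
  interpret G: prob_space "std_gauss :: (real, 'n) vec measure" by (rule prob_space_std_gauss)
  define \<xi> where "\<xi> = transpose B *v \<zeta>"
  have xi: "\<zeta> \<bullet> (B *v u) = \<xi> \<bullet> u" for u
    unfolding \<xi>_def using inner_transpose_mult[of u B \<zeta>] by (simp add: inner_commute)
  have qq: "\<zeta> \<bullet> (C *v \<zeta>) = \<xi> \<bullet> \<xi>"
    unfolding B(2)[symmetric] matrix_vector_mul_assoc[symmetric] xi \<xi>_def ..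
  have int: "integrable std_gauss (\<lambda>u. iexp (\<xi> \<bullet> u + d))"
    by (rule G.integrable_const_bound[where B = 1]) (auto simp: std_gauss_def)
  have "(\<integral>y. cos (\<zeta> \<bullet> y + d) \<partial>normal_vec C) = (\<integral>u. cos (\<xi> \<bullet> u + d) \<partial>std_gauss)"
    unfolding B(1) using measurable_matrix_vector_mult[of B]
    by (subst integral_distr) (auto simp: xi std_gauss_def)
  also have "\<dots> = (\<integral>u. Re (iexp (\<xi> \<bullet> u + d)) \<partial>std_gauss)"
    by (simp add: cis_conv_exp[symmetric] flip: of_real_add)
  also have "\<dots> = Re (\<integral>u. iexp (\<xi> \<bullet> u + d) \<partial>std_gauss)" by (rule integral_Re[OF int])
  also have "(\<integral>u. iexp (\<xi> \<bullet> u + d) \<partial>std_gauss) = (\<integral>u. iexp d * iexp (\<xi> \<bullet> u) \<partial>std_gauss)"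
    by (simp add: exp_add[symmetric] algebra_simps)
  also have "\<dots> = iexp d * exp (- (\<xi> \<bullet> \<xi>) / 2)" by (simp add: std_gauss_char)
  also have "Re \<dots> = exp (- (\<xi> \<bullet> \<xi>) / 2) * cos d" by (simp add: Re_exp)
  finally show ?thesis unfolding qq .
qed

end

section \<open>The limiting variance\<close>

text \<open>The solution of the backward equation \<open>a\<^sub>k' = - c\<^sub>k a\<^sub>k\<^sub>+\<^sub>1\<close> in terms of the remaining time \<open>\<tau>\<close>,
  with terminal value \<open>\<theta>\<close>.\<close>

definition acoef :: "nat \<Rightarrow> real \<Rightarrow> real \<Rightarrow> (nat \<Rightarrow> real) \<Rightarrow> nat \<Rightarrow> real \<Rightarrow> real" where
  "acoef N \<sigma> \<nu> \<theta> k \<tau> = (\<Sum>m\<in>{k..N}. \<theta> m * (\<tau> ^ (m - k) / fact (m - k)) * (\<Prod>j\<in>{k..<m}. es_coeff N \<sigma> \<nu> j))"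

lemma acoef_deriv:
  assumes "k \<le> N"
  shows "(acoef N \<sigma> \<nu> \<theta> k has_real_derivative es_coeff N \<sigma> \<nu> k * acoef N \<sigma> \<nu> \<theta> (Suc k) \<tau>) (at \<tau>)"
proof -
  let ?c = "es_coeff N \<sigma> \<nu>"
  have f: "((\<lambda>\<tau>::real. \<tau> ^ Suc p / fact (Suc p)) has_real_derivative \<tau> ^ p / fact p) (at \<tau>)" for p \<tau>
    by (rule DERIV_cong[OF DERIV_cdivide[OF DERIV_pow]]) (simp del: of_nat_Suc)
  have e: "acoef N \<sigma> \<nu> \<theta> k = (\<lambda>\<tau>. \<theta> k + (\<Sum>m\<in>{Suc k..N}. \<theta> m * (\<tau> ^ (m - k) / fact (m - k)) * (\<Prod>j\<in>{k..<m}. ?c j)))"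
    unfolding acoef_def using assms by (subst sum.atLeast_Suc_atMost) auto
  have "((\<lambda>\<tau>. \<theta> k + (\<Sum>m\<in>{Suc k..N}. \<theta> m * (\<tau> ^ (m - k) / fact (m - k)) * (\<Prod>j\<in>{k..<m}. ?c j))) has_real_derivative
     0 + (\<Sum>m\<in>{Suc k..N}. \<theta> m * (\<tau> ^ (m - Suc k) / fact (m - Suc k)) * (\<Prod>j\<in>{k..<m}. ?c j))) (at \<tau>)"
  proof (intro DERIV_add DERIV_const DERIV_sum DERIV_cmult_right DERIV_cmult)
    fix m assume "m \<in> {Suc k..N}"
    then have "m - k = Suc (m - Suc k)" by auto
    then show "((\<lambda>\<tau>. \<tau> ^ (m - k) / fact (m - k)) has_real_derivative \<tau> ^ (m - Suc k) / fact (m - Suc k)) (at \<tau>)"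
      using f[of "m - Suc k" \<tau>] by simp
  qed
  moreover have "(\<Sum>m\<in>{Suc k..N}. \<theta> m * (\<tau> ^ (m - Suc k) / fact (m - Suc k)) * (\<Prod>j\<in>{k..<m}. ?c j)) = ?c k * acoef N \<sigma> \<nu> \<theta> (Suc k) \<tau>"
    unfolding acoef_def sum_distrib_left
    by (intro sum.cong refl) (auto simp: prod.atLeast_Suc_lessThan)
  ultimately show ?thesis unfolding e by simp
qed

lemma acoef_0: "k \<le> N \<Longrightarrow> acoef N \<sigma> \<nu> \<theta> k 0 = \<theta> k"
  unfolding acoef_def by (subst sum.atLeast_Suc_atMost) (auto intro!: sum.neutral)

lemma acoef_continuous: "continuous_on S (\<lambda>z. acoef N (f z) \<nu> \<theta> k (g z))"
  if "continuous_on S f" "continuous_on S g" for f g :: "'a::topological_space \<Rightarrow> real"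
  unfolding acoef_def es_coeff_def by (intro continuous_intros that) auto

lemma acoef_bound: "\<exists>A\<ge>0. \<forall>\<sigma>\<in>{0..1}. \<forall>\<tau>\<in>{0..T}. \<forall>k\<le>N. \<bar>acoef N \<sigma> \<nu> \<theta> k \<tau>\<bar> \<le> A"
proof -
  have "\<exists>B\<ge>0. \<forall>z\<in>{0..1}\<times>{0..T}. \<bar>acoef N (fst z) \<nu> \<theta> k (snd z)\<bar> \<le> B" for k
  proof -
    have "compact ((\<lambda>z. acoef N (fst z) \<nu> \<theta> k (snd z)) ` ({0..1}\<times>{0..T}))"
      by (intro compact_continuous_image acoef_continuous compact_Times continuous_intros) auto
    then obtain B where "B > 0" "\<forall>y\<in>(\<lambda>z. acoef N (fst z) \<nu> \<theta> k (snd z)) ` ({0..1}\<times>{0..T}). norm y \<le> B"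
      using compact_imp_bounded bounded_pos by blast
    then show ?thesis by (intro exI[of _ B]) auto
  qed
  then obtain B where B: "\<And>k. B k \<ge> 0" "\<And>k z. z \<in> {0..1}\<times>{0..T} \<Longrightarrow> \<bar>acoef N (fst z) \<nu> \<theta> k (snd z)\<bar> \<le> B k"
    by metis
  show ?thesis
  proof (intro exI[of _ "\<Sum>k\<le>N. B k"] conjI ballI allI impI)
    show "0 \<le> (\<Sum>k\<le>N. B k)" by (intro sum_nonneg B)
    fix \<sigma> \<tau> :: real and k assume "\<sigma> \<in> {0..1}" "\<tau> \<in> {0..T}" "k \<le> N"
    then show "\<bar>acoef N \<sigma> \<nu> \<theta> k \<tau>\<bar> \<le> (\<Sum>k\<le>N. B k)"
      using B(2)[of "(\<sigma>, \<tau>)" k] member_le_sum[of k "{..N}" B] B(1) by fastforce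
  qed
qed

text \<open>On the compact part where \<Psi> is at least \<epsilon>, \<open>D\<close> has a positive
  minimum, and \<open>C\<close> is the maximum of \<Psi> there divided by it. This replaces explicit
  estimates: once \<open>D\<close> has small expectation, so has \<Psi>, up to \<epsilon>.\<close>

lemma compact_domination:
  fixes \<Psi> D :: "'a::metric_space \<Rightarrow> real"
  assumes K: "compact K" "continuous_on K \<Psi>" "continuous_on K D"
    and D: "\<And>z. z \<in> K \<Longrightarrow> 0 \<le> D z" "\<And>z. z \<in> K \<Longrightarrow> D z = 0 \<Longrightarrow> \<Psi> z \<le> 0" and e: "0 < \<epsilon>"
  shows "\<exists>C\<ge>0. \<forall>z\<in>K. \<Psi> z \<le> \<epsilon> + C * D z"
proof -
  define K' where "K' = K \<inter> \<Psi> -` {\<epsilon>..}"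
  have "closed K'" unfolding K'_def by (rule continuous_closed_preimage[OF K(2) compact_imp_closed[OF K(1)]]) simp
  then have K': "compact K'" "K' \<subseteq> K" using compact_Int_closed[OF K(1), of K'] by (auto simp: K'_def Int_absorb2 inf.absorb2)
  show ?thesis
  proof (cases "K' = {}")
    case True
    then have "\<Psi> z \<le> \<epsilon> + 0 * D z" if "z \<in> K" for z using that by (force simp: K'_def)
    then show ?thesis by blast
  next
    case False
    obtain z0 where z0: "z0 \<in> K'" "\<And>z. z \<in> K' \<Longrightarrow> D z0 \<le> D z"
      using continuous_attains_inf[OF K'(1) False continuous_on_subset[OF K(3) K'(2)]] by blast
    obtain z1 where z1: "z1 \<in> K'" "\<And>z. z \<in> K' \<Longrightarrow> \<Psi> z \<le> \<Psi> z1"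
      using continuous_attains_sup[OF K'(1) False continuous_on_subset[OF K(2) K'(2)]] by blast
    have p: "0 < \<Psi> z1" using z1(1) e by (simp add: K'_def)
    have d: "0 < D z0" using D z0(1) e K'(2) by (force simp: K'_def less_le)
    have "\<Psi> z \<le> \<epsilon> + \<Psi> z1 / D z0 * D z" if z: "z \<in> K" for z
    proof (cases "z \<in> K'")
      case True
      have "\<Psi> z \<le> \<Psi> z1 / D z0 * D z0" using z1(2)[OF True] d by simp
      also have "\<dots> \<le> \<Psi> z1 / D z0 * D z" using z0(2)[OF True] p d by (intro mult_left_mono) auto
      finally show ?thesis using e by simp
    next
      case False
      then have "\<Psi> z \<le> \<epsilon>" using z by (simp add: K'_def)
      moreover have "0 \<le> \<Psi> z1 / D z0 * D z" using p d D(1)[OF z] by simp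
      ultimately show ?thesis by simp
    qed
    then show ?thesis using p d by (intro exI[of _ "\<Psi> z1 / D z0"]) auto
  qed
qed

text \<open>The elements below \<open>i\<close> inject into those below its image, and likewise
  above, which excludes any shift.\<close>

lemma strict_mono_finite_id:
  fixes \<pi> :: "'n::{finite,linorder} \<Rightarrow> 'n"
  assumes mono: "\<And>i j. i < j \<Longrightarrow> \<pi> i < \<pi> j"
  shows "\<pi> i = i"
proof (rule ccontr)
  assume ne: "\<pi> i \<noteq> i"
  have inj: "inj_on \<pi> S" for S by (rule inj_onI) (metis linorder_less_linear mono less_irrefl)
  have 1: "card {..<i} \<le> card {..<\<pi> i}"
    by (rule card_inj_on_le[OF inj]) (auto intro: mono)
  have 2: "card {i<..} \<le> card {\<pi> i<..}"
    by (rule card_inj_on_le[OF inj]) (auto intro: mono)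
  from ne consider "\<pi> i < i" | "i < \<pi> i" by (meson linorder_less_linear)
  then show False
  proof cases
    case 1
    then have "{..<\<pi> i} \<subset> {..<i}" by auto
    then have "card {..<\<pi> i} < card {..<i}" by (intro psubset_card_mono) auto
    with \<open>card {..<i} \<le> card {..<\<pi> i}\<close> show False by simp
  next
    case 2
    then have "{\<pi> i<..} \<subset> {i<..}" by auto
    then have "card {\<pi> i<..} < card {i<..}" by (intro psubset_card_mono) auto
    with \<open>card {i<..} \<le> card {\<pi> i<..}\<close> show False by simp
  qed
qed

lemma es_scaled_gradient: "c * pd i (es k UNIV) (c *\<^sub>R x) = (c\<^sup>2) ^ k * pd i (es k UNIV) x"
proof -
  have "pd i (\<lambda>x. es k UNIV (c *\<^sub>R x)) x = c * pd i (es k UNIV) (c *\<^sub>R x)"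
    by (simp add: pd_scale[OF C2D(1)[OF C2_es]])
  moreover have "pd i (\<lambda>x. es k UNIV (c *\<^sub>R x)) x = (c\<^sup>2) ^ k * pd i (es k UNIV) x"
    unfolding es_scale by (simp add: pd_cmult[OF C2_es])
  ultimately show ?thesis by simp
qed

lemma grad_inner_esum:
  fixes x :: "(real, 'n::{finite,linorder}) vec"
  shows "grad_inner (esum a) (esum a) x = (\<Sum>i\<in>UNIV. (\<Sum>k\<le>CARD('n). a k * pd i (es k UNIV) x)\<^sup>2)"
  by (simp add: grad_inner_def pd_esum power2_eq_square)

lemma grad_inner_esum_bound:
  "\<exists>K m. 0 \<le> K \<and> (\<forall>A (a :: nat \<Rightarrow> real) (x :: (real, 'n::{finite,linorder}) vec). (\<forall>k\<le>CARD('n). \<bar>a k\<bar> \<le> A) \<longrightarrow>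
     \<bar>grad_inner (esum a) (esum a) x\<bar> \<le> A\<^sup>2 * (K * wt x ^ m))"
proof -
  define P where "P x = (\<Sum>i\<in>UNIV. (\<Sum>k\<le>CARD('n). \<bar>pd i (es k UNIV) x\<bar>) * (\<Sum>k\<le>CARD('n). \<bar>pd i (es k UNIV) x\<bar>))"
    for x :: "(real, 'n) vec"
  have ab: "pgrowth (\<lambda>x :: (real,'n) vec. \<bar>pd i (es k UNIV) x\<bar>)" for i k
    by (rule pgrowth_mono[OF pgrowth_pd_es[of i k]]) simp
  have "pgrowth P" unfolding P_def[abs_def] by (intro pgrowth_sum pgrowth_mult ab)
  then obtain K m where K: "0 \<le> K" "\<And>x. \<bar>P x\<bar> \<le> K * wt x ^ m" by (auto simp: pgrowth_def)
  have "\<bar>grad_inner (esum a) (esum a) x\<bar> \<le> A\<^sup>2 * (K * wt x ^ m)" if A: "\<forall>k\<le>CARD('n). \<bar>a k\<bar> \<le> A"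
    for A and a :: "nat \<Rightarrow> real" and x :: "(real, 'n) vec"
  proof -
    have "\<bar>grad_inner (esum a) (esum a) x\<bar> = (\<Sum>i\<in>UNIV. (\<Sum>k\<le>CARD('n). a k * pd i (es k UNIV) x)\<^sup>2)"
      unfolding grad_inner_esum by (intro abs_of_nonneg sum_nonneg) auto
    also have "\<dots> \<le> (\<Sum>i\<in>UNIV. (A * (\<Sum>k\<le>CARD('n). \<bar>pd i (es k UNIV) x\<bar>))\<^sup>2)"
    proof (rule sum_mono)
      fix i
      have "\<bar>\<Sum>k\<le>CARD('n). a k * pd i (es k UNIV) x\<bar> \<le> (\<Sum>k\<le>CARD('n). A * \<bar>pd i (es k UNIV) x\<bar>)"
        using A by (intro order_trans[OF sum_abs] sum_mono) (auto simp: abs_mult intro!: mult_right_mono)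
      then have "\<bar>\<Sum>k\<le>CARD('n). a k * pd i (es k UNIV) x\<bar> \<le> A * (\<Sum>k\<le>CARD('n). \<bar>pd i (es k UNIV) x\<bar>)"
        by (simp add: sum_distrib_left)
      then show "(\<Sum>k\<le>CARD('n). a k * pd i (es k UNIV) x)\<^sup>2 \<le> (A * (\<Sum>k\<le>CARD('n). \<bar>pd i (es k UNIV) x\<bar>))\<^sup>2"
        by (rule abs_le_square_iff[THEN iffD1, OF order_trans[OF _ abs_ge_self]])
    qed
    also have "\<dots> = A\<^sup>2 * P x" by (simp add: P_def power2_eq_square sum_distrib_left mult_ac)
    also have "\<dots> \<le> A\<^sup>2 * (K * wt x ^ m)" using K(2)[of x] by (intro mult_left_mono) auto
    finally show ?thesis .
  qed
  then show ?thesis using K(1) by blast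
qed

lemma chamberB_closed: "closed (chamberB :: (real, 'n::{finite,linorder}) vec set)"
proof -
  have "chamberB = (\<Inter>i. \<Inter>j\<in>{j. i \<le> j}. {x :: (real, 'n) vec. x $ j \<le> x $ i}) \<inter> (\<Inter>i. {x. 0 \<le> x $ i})"
    by (auto simp: chamberB_def)
  moreover have "closed \<dots>"
    by (intro closed_Int closed_INT ballI closed_Collect_le continuous_intros)
  ultimately show ?thesis by simp
qed

section \<open>The gradient term along the limit curve\<close>

context laguerre_point
begin

lemma es_r: "es k UNIV r = (\<Prod>j<k. es_coeff CARD('n) 0 \<nu> j) / fact k"
proof (induction k)
  case (Suc k)
  have "es (Suc k) UNIV r = es_coeff CARD('n) 0 \<nu> k * es k UNIV r / real (Suc k)"
    using r_rec[of k] by (simp add: field_simps)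
  then show ?case unfolding Suc by (simp add: mult_ac)
qed simp

lemma es_sqrt_r: "0 \<le> s \<Longrightarrow> es k UNIV (sqrt s *\<^sub>R r) = s ^ k * es k UNIV r"
  by (simp add: es_scale)

lemma esum_acoef_0: "0 \<le> t \<Longrightarrow> esum \<theta> (sqrt t *\<^sub>R r) = acoef CARD('n) 0 \<nu> \<theta> 0 t"
  unfolding esum_def acoef_def
  by (simp add: es_sqrt_r es_r atMost_atLeast0 atLeast0LessThan mult_ac)

text \<open>By Vieta the squared coordinates of \<open>x\<close> are the zeros of the polynomial
  whose zeros are the squared coordinates of the curve point; the ordering in the chamber leaves one
  arrangement.\<close>

lemma es_injective:
  assumes x: "x \<in> chamberB" and s: "0 \<le> s" and e: "\<And>k. k \<le> CARD('n) \<Longrightarrow> es k UNIV x = es k UNIV (sqrt s *\<^sub>R r)"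
  shows "x = sqrt s *\<^sub>R r"
proof (cases "s = 0")
  case True
  have "es (Suc 0) UNIV x = es (Suc 0) UNIV (0 :: (real, 'n) vec)" using e[of "Suc 0"] True by (simp add: Suc_leI)
  then have "sqn x = 0" by (simp only: sqn_es[symmetric]) (simp add: sqn_norm)
  then show ?thesis using True by (simp add: sqn_norm)
next
  case False
  define c where "c = sqrt s *\<^sub>R r"
  have c: "0 < c $ i" for i using False s r_pos by (simp add: c_def)
  have cd: "i < j \<Longrightarrow> c $ j < c $ i" for i j using False s r_dec by (simp add: c_def)
  have "\<exists>l. x $ l = c $ i" for i
  proof -
    have "(\<Prod>l\<in>UNIV. (c $ i)\<^sup>2 - (x $ l)\<^sup>2) = (\<Prod>l\<in>UNIV. (c $ i)\<^sup>2 - (c $ l)\<^sup>2)"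
      using e unfolding prod_elsym[OF finite] es_def c_def by (intro sum.cong refl) auto
    also have "\<dots> = 0" by (rule prod_zero) auto
    finally obtain l where "(c $ i)\<^sup>2 = (x $ l)\<^sup>2" by (auto simp: prod_zero_iff)
    moreover have "0 \<le> x $ l" using x by (simp add: chamberB_def)
    ultimately show ?thesis using c[of i] by (metis less_imp_le power2_eq_imp_eq)
  qed
  then obtain \<pi> where p: "\<And>i. x $ \<pi> i = c $ i" by metis
  have "\<pi> i < \<pi> j" if "i < j" for i j
  proof (rule ccontr)
    assume "\<not> \<pi> i < \<pi> j"
    then have "x $ \<pi> i \<le> x $ \<pi> j" using x by (simp add: chamberB_def)
    then show False using cd[OF that] p by simp
  qed
  then have "\<pi> i = i" for i by (rule strict_mono_finite_id)
  then show ?thesis using p by (simp add: vec_eq_iff c_def)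
qed

text \<open>A polynomial substitute for the squared distance from \<open>sqrt s r\<close>. In the
  chamber it vanishes at that point only, and its expectation is accessible through the
  \<open>es k\<close>.\<close>

definition dev :: "real \<Rightarrow> (real, 'n) vec \<Rightarrow> real" where
  "dev s x = (\<Sum>k\<le>CARD('n). (es k UNIV x - s ^ k * es k UNIV r)\<^sup>2)"

lemma dev_nonneg: "0 \<le> dev s x" unfolding dev_def by (intro sum_nonneg) auto

lemma dev_eq_0:
  assumes "x \<in> chamberB" "0 \<le> s" "dev s x = 0" shows "x = sqrt s *\<^sub>R r"
proof (rule es_injective[OF assms(1,2)])
  fix k assume "k \<le> CARD('n)"
  then have "(es k UNIV x - s ^ k * es k UNIV r)\<^sup>2 = 0"
    using assms(3) unfolding dev_def by (subst (asm) sum_nonneg_eq_0_iff) auto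
  then show "es k UNIV x = es k UNIV (sqrt s *\<^sub>R r)" using assms(2) by (simp add: es_sqrt_r)
qed

lemma continuous_dev: "continuous_on S f \<Longrightarrow> continuous_on S g \<Longrightarrow> continuous_on S (\<lambda>z. dev (f z) (g z))"
  unfolding dev_def
  by (intro continuous_intros continuous_on_compose2[OF C2_continuous(1)[OF C2_es]]) auto

text \<open>The gradient at \<open>sqrt s r\<close> of the noiseless functional, multiplied by
  \<open>sqrt s\<close>. This factor makes it polynomial in \<open>s\<close> and zero at the
  singular time 0.\<close>

definition eta :: "(nat \<Rightarrow> real) \<Rightarrow> real \<Rightarrow> real \<Rightarrow> (real, 'n) vec" where
  "eta \<theta> t s = (\<chi> i. \<Sum>k\<le>CARD('n). acoef CARD('n) 0 \<nu> \<theta> k (t - s) * s ^ k * pd i (es k UNIV) r)"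

text \<open>Chosen as an explicit antiderivative of \<open>limit_grad\<close> with value 0 at time
  0, so that the variance needs no integration.\<close>

definition kappa :: "(nat \<Rightarrow> real) \<Rightarrow> real \<Rightarrow> real \<Rightarrow> real" where
  "kappa \<theta> t s = eta \<theta> t s \<bullet> (matrix_inv (S_mat \<nu> r) *v eta \<theta> t s)"

definition limit_grad :: "(nat \<Rightarrow> real) \<Rightarrow> real \<Rightarrow> real \<Rightarrow> real" where
  "limit_grad \<theta> t s = grad_inner (esum (\<lambda>k. acoef CARD('n) 0 \<nu> \<theta> k (t - s))) (esum (\<lambda>k. acoef CARD('n) 0 \<nu> \<theta> k (t - s))) (sqrt s *\<^sub>R r)"

lemma S_inverse: "S_mat \<nu> r ** matrix_inv (S_mat \<nu> r) = mat 1" "matrix_inv (S_mat \<nu> r) ** S_mat \<nu> r = mat 1"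
proof -
  have "\<exists>A'. S_mat \<nu> r ** A' = mat 1 \<and> A' ** S_mat \<nu> r = mat 1"
    using S_invertible unfolding invertible_def .
  then have "S_mat \<nu> r ** matrix_inv (S_mat \<nu> r) = mat 1 \<and> matrix_inv (S_mat \<nu> r) ** S_mat \<nu> r = mat 1"
    unfolding matrix_inv_def by (rule someI_ex)
  then show "S_mat \<nu> r ** matrix_inv (S_mat \<nu> r) = mat 1" "matrix_inv (S_mat \<nu> r) ** S_mat \<nu> r = mat 1" by auto
qed

lemma S_self_adjoint: "(S_mat \<nu> r *v v) \<bullet> w = v \<bullet> (S_mat \<nu> r *v w)"
  using inner_transpose_mult[of v "S_mat \<nu> r" w] S_symmetric by simp

lemma limit_grad_eta:
  assumes "0 < s"
  shows "limit_grad \<theta> t s = (eta \<theta> t s \<bullet> eta \<theta> t s) / s"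
proof -
  let ?a = "\<lambda>k. acoef CARD('n) 0 \<nu> \<theta> k (t - s)"
  have "sqrt s * (\<Sum>k\<le>CARD('n). ?a k * pd i (es k UNIV) (sqrt s *\<^sub>R r)) = eta \<theta> t s $ i" for i
  proof -
    have st: "sqrt s * (?a k * pd i (es k UNIV) (sqrt s *\<^sub>R r)) = ?a k * s ^ k * pd i (es k UNIV) r" for k
      using arg_cong[OF es_scaled_gradient[of "sqrt s" i k r], of "\<lambda>v. ?a k * v"] assms by (simp add: mult_ac)
    show ?thesis unfolding eta_def vec_lambda_beta sum_distrib_left st ..
  qed
  then have "(\<Sum>k\<le>CARD('n). ?a k * pd i (es k UNIV) (sqrt s *\<^sub>R r)) = eta \<theta> t s $ i / sqrt s" for i
    using assms by (simp add: field_simps)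
  then show ?thesis
    unfolding limit_grad_def grad_inner_esum using assms
    by (simp add: power_divide inner_vec_def power2_eq_square sum_divide_distrib)
qed

text \<open>\<open>es_gradient_S\<close> and the backward equation give
  \<open>S eta = 2 s eta'\<close>. Hence the derivative of the quadratic form of the inverse of
  \<open>S\<close> at \<open>eta\<close> is the squared norm of \<open>eta\<close> divided by
  \<open>s\<close>.\<close>

lemma kappa_deriv:
  assumes s: "0 < s"
  shows "(kappa \<theta> t has_real_derivative limit_grad \<theta> t s) (at s)"
proof -
  let ?N = "CARD('n)"
  let ?a = "\<lambda>k s. acoef ?N 0 \<nu> \<theta> k (t - s)"
  let ?Sg = "matrix_inv (S_mat \<nu> r)"
  \<comment> \<open>The time derivative of \<open>eta\<close>: the backward equation for the
    coefficients and the power rule for \<open>s^k\<close>.\<close>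
  define d where "d = (\<chi> i. \<Sum>k\<le>?N. (- (es_coeff CARD('n) 0 \<nu> k * ?a (Suc k) s) * s ^ k + ?a k s * (real k * s ^ (k - 1))) * pd i (es k UNIV) r)"
  have eD: "((\<lambda>s. eta \<theta> t s $ i) has_real_derivative d $ i) (at s)" for i
    unfolding eta_def d_def vec_lambda_beta
  proof (intro DERIV_sum DERIV_cmult_right)
    fix k assume "k \<in> {..?N}"
    then have "((\<lambda>s. ?a k s) has_real_derivative es_coeff CARD('n) 0 \<nu> k * ?a (Suc k) s * (0 - 1)) (at s)"
      by (intro DERIV_chain2[OF acoef_deriv] DERIV_diff DERIV_const DERIV_ident) auto
    from DERIV_mult[OF this DERIV_pow[of k s]]
    show "((\<lambda>s. ?a k s * s ^ k) has_real_derivative - (es_coeff CARD('n) 0 \<nu> k * ?a (Suc k) s) * s ^ k + ?a k s * (real k * s ^ (k - 1))) (at s)"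
      by (simp add: mult_ac)
  qed
  have Sd: "S_mat \<nu> r *v eta \<theta> t s = (2 * s) *\<^sub>R d"
  proof (subst vec_eq_iff, rule allI)
    fix j
    have "(S_mat \<nu> r *v eta \<theta> t s) $ j = (\<Sum>i\<in>UNIV. S_mat \<nu> r $ i $ j * eta \<theta> t s $ i)"
    proof -
      have "S_mat \<nu> r $ j $ i = S_mat \<nu> r $ i $ j" for i
      proof -
        have "transpose (S_mat \<nu> r) $ i $ j = S_mat \<nu> r $ i $ j" using S_symmetric by simp
        then show ?thesis by (simp add: transpose_def)
      qed
      then show ?thesis by (simp add: matrix_vector_mult_def)
    qed
    also have "\<dots> = (\<Sum>k\<le>?N. ?a k s * s ^ k * (\<Sum>i\<in>UNIV. S_mat \<nu> r $ i $ j * pd i (es k UNIV) r))"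
      unfolding eta_def vec_lambda_beta sum_distrib_left by (subst sum.swap) (simp add: mult_ac)
    also have "\<dots> = (\<Sum>k<?N. ?a (Suc k) s * s ^ Suc k * (2 * (real (Suc k) * pd j (es (Suc k) UNIV) r - es_coeff CARD('n) 0 \<nu> k * pd j (es k UNIV) r)))"
      unfolding sum.atMost_shift es_gradient_S by simp
    also have "\<dots> = 2 * ((\<Sum>k<?N. real (Suc k) * ?a (Suc k) s * s ^ Suc k * pd j (es (Suc k) UNIV) r)
        - (\<Sum>k<?N. es_coeff CARD('n) 0 \<nu> k * ?a (Suc k) s * s ^ Suc k * pd j (es k UNIV) r))"
      by (simp only: sum_subtractf[symmetric] sum_distrib_left) (intro sum.cong refl, simp add: algebra_simps)
    also have "(\<Sum>k<?N. real (Suc k) * ?a (Suc k) s * s ^ Suc k * pd j (es (Suc k) UNIV) r) = (\<Sum>k\<le>?N. real k * ?a k s * s ^ k * pd j (es k UNIV) r)"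
      by (subst sum.atMost_shift) simp
    also have "(\<Sum>k<?N. es_coeff CARD('n) 0 \<nu> k * ?a (Suc k) s * s ^ Suc k * pd j (es k UNIV) r) = (\<Sum>k\<le>?N. es_coeff CARD('n) 0 \<nu> k * ?a (Suc k) s * s ^ Suc k * pd j (es k UNIV) r)"
      \<comment> \<open>The top summand may be added, as \<open>es_coeff\<close> is 0 at
        \<open>k = N\<close>.\<close>
      unfolding lessThan_Suc_atMost[symmetric] by (simp add: es_coeff_def)
    also have "2 * ((\<Sum>k\<le>?N. real k * ?a k s * s ^ k * pd j (es k UNIV) r) - (\<Sum>k\<le>?N. es_coeff CARD('n) 0 \<nu> k * ?a (Suc k) s * s ^ Suc k * pd j (es k UNIV) r)) = ((2 * s) *\<^sub>R d) $ j"
    proof -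
      have k: "s * (real k * s ^ (k - 1)) = real k * s ^ k" for k by (cases k) auto
      have "2 * s * ((- (es_coeff CARD('n) 0 \<nu> k * ?a (Suc k) s) * s ^ k + ?a k s * (real k * s ^ (k - 1))) * pd j (es k UNIV) r) =
          2 * (real k * ?a k s * s ^ k * pd j (es k UNIV) r - es_coeff CARD('n) 0 \<nu> k * ?a (Suc k) s * s ^ Suc k * pd j (es k UNIV) r)" for k
      proof -
        have "2 * s * ((- (es_coeff CARD('n) 0 \<nu> k * ?a (Suc k) s) * s ^ k + ?a k s * (real k * s ^ (k - 1))) * pd j (es k UNIV) r) =
          2 * (?a k s * (s * (real k * s ^ (k - 1))) * pd j (es k UNIV) r - es_coeff CARD('n) 0 \<nu> k * ?a (Suc k) s * s ^ Suc k * pd j (es k UNIV) r)"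
          by (simp add: algebra_simps)
        then show ?thesis unfolding k by (simp add: mult_ac)
      qed
      then show ?thesis by (simp add: d_def sum_distrib_left sum_subtractf[symmetric])
    qed
    finally show "(S_mat \<nu> r *v eta \<theta> t s) $ j = ((2 * s) *\<^sub>R d) $ j" .
  qed
  have "((\<lambda>s. \<Sum>i\<in>UNIV. eta \<theta> t s $ i * (\<Sum>j\<in>UNIV. ?Sg $ i $ j * eta \<theta> t s $ j)) has_real_derivative
      (\<Sum>i\<in>UNIV. d $ i * (\<Sum>j\<in>UNIV. ?Sg $ i $ j * eta \<theta> t s $ j) + (\<Sum>j\<in>UNIV. ?Sg $ i $ j * d $ j) * eta \<theta> t s $ i)) (at s)"
    by (intro DERIV_sum DERIV_mult DERIV_cmult eD)
  moreover have "(\<Sum>i\<in>UNIV. d $ i * (\<Sum>j\<in>UNIV. ?Sg $ i $ j * eta \<theta> t s $ j) + (\<Sum>j\<in>UNIV. ?Sg $ i $ j * d $ j) * eta \<theta> t s $ i)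
      = d \<bullet> (?Sg *v eta \<theta> t s) + (?Sg *v d) \<bullet> eta \<theta> t s"
    by (simp add: inner_vec_def matrix_vector_mult_def sum.distrib)
  moreover have "kappa \<theta> t = (\<lambda>s. \<Sum>i\<in>UNIV. eta \<theta> t s $ i * (\<Sum>j\<in>UNIV. ?Sg $ i $ j * eta \<theta> t s $ j))"
    by (simp add: kappa_def[abs_def] inner_vec_def matrix_vector_mult_def)
  moreover have "d \<bullet> (?Sg *v eta \<theta> t s) + (?Sg *v d) \<bullet> eta \<theta> t s = limit_grad \<theta> t s"
  proof -
    have d: "d = (1 / (2 * s)) *\<^sub>R (S_mat \<nu> r *v eta \<theta> t s)" unfolding Sd using s by simp
    have "d \<bullet> (?Sg *v eta \<theta> t s) = (1 / (2 * s)) * (eta \<theta> t s \<bullet> eta \<theta> t s)"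
      unfolding d inner_scaleR_left S_self_adjoint matrix_vector_mul_assoc S_inverse by simp
    moreover have "(?Sg *v d) \<bullet> eta \<theta> t s = (1 / (2 * s)) * (eta \<theta> t s \<bullet> eta \<theta> t s)"
      unfolding d by (simp add: matrix_vector_mult_scaleR matrix_vector_mul_assoc S_inverse)
    ultimately show ?thesis unfolding limit_grad_eta[OF s] using s by (simp add: field_simps)
  qed
  ultimately show ?thesis by simp
qed

lemma kappa_continuous: "continuous_on UNIV (kappa \<theta> t)"
  unfolding kappa_def eta_def inner_vec_def matrix_vector_mult_def vec_lambda_beta
  by (intro continuous_intros acoef_continuous)

lemma kappa_0: "kappa \<theta> t 0 = 0"
proof -
  have "eta \<theta> t 0 $ i = 0" for i
    unfolding eta_def vec_lambda_beta
  proof (rule sum.neutral, rule ballI)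
    fix k show "acoef CARD('n) 0 \<nu> \<theta> k (t - 0) * 0 ^ k * pd i (es k UNIV) r = 0" by (cases k) auto
  qed
  then have "eta \<theta> t 0 = 0" by (simp add: vec_eq_iff)
  then show ?thesis by (simp add: kappa_def)
qed

text \<open>With no time left the coefficients equal their terminal values, whose gradient at
  \<open>sqrt t r\<close> is \<zeta> by \<open>lagr_coeff_pd\<close>; so \<open>eta\<close> is
  \<open>sqrt t\<close> times \<zeta>.\<close>

lemma kappa_terminal:
  assumes "0 < t"
  shows "kappa (lagr_coeff (sqrt t *\<^sub>R r) \<zeta>) t t = \<zeta> \<bullet> ((t *\<^sub>R matrix_inv (S_mat \<nu> r)) *v \<zeta>)"
proof -
  let ?c = "sqrt t *\<^sub>R r"
  have "eta (lagr_coeff ?c \<zeta>) t t $ i = sqrt t * \<zeta> $ i" for i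
  proof -
    have "eta (lagr_coeff ?c \<zeta>) t t $ i = (\<Sum>k\<le>CARD('n). lagr_coeff ?c \<zeta> k * (t ^ k * pd i (es k UNIV) r))"
      unfolding eta_def vec_lambda_beta by (intro sum.cong refl) (simp add: acoef_0)
    also have "\<dots> = sqrt t * (\<Sum>k\<le>CARD('n). lagr_coeff ?c \<zeta> k * pd i (es k UNIV) ?c)"
    proof -
      have st: "sqrt t * (lagr_coeff ?c \<zeta> k * pd i (es k UNIV) ?c) = lagr_coeff ?c \<zeta> k * (t ^ k * pd i (es k UNIV) r)" for k
        using arg_cong[OF es_scaled_gradient[of "sqrt t" i k r], of "\<lambda>v. lagr_coeff ?c \<zeta> k * v"] assms by (simp add: mult_ac)
      show ?thesis unfolding sum_distrib_left st ..
    qed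
    also have "(\<Sum>k\<le>CARD('n). lagr_coeff ?c \<zeta> k * pd i (es k UNIV) ?c) = \<zeta> $ i"
      by (rule lagr_coeff_pd) (use assms r_nz r_sq_distinct in \<open>auto simp: power_mult_distrib\<close>)
    finally show ?thesis .
  qed
  then have e: "eta (lagr_coeff ?c \<zeta>) t t = sqrt t *\<^sub>R \<zeta>" by (simp add: vec_eq_iff)
  have m: "(t *\<^sub>R A) *v \<zeta> = t *\<^sub>R (A *v \<zeta>)" for A :: "((real, 'n) vec, 'n) vec"
    by (simp add: vec_eq_iff matrix_vector_mult_def sum_distrib_left mult.assoc)
  show ?thesis unfolding kappa_def e m using assms by (simp add: matrix_vector_mult_scaleR)
qed

text \<open>On a ball \<open>compact_domination\<close> applies with \<open>\<sigma> + dev\<close>,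
  which vanishes only in the noiseless situation on the curve. Outside, one surplus power of the
  weight beats the crude polynomial bound. The exponent is fixed before \<epsilon>, so the moment it
  calls for does not depend on \<epsilon>.\<close>

lemma grad_domination:
  assumes t: "0 \<le> t"
  shows "\<exists>m. \<forall>\<epsilon>>0. \<exists>C\<ge>0. \<forall>\<sigma>\<in>{0..1}. \<forall>s\<in>{0..t}. \<forall>x\<in>chamberB.
    \<bar>grad_inner (esum (\<lambda>k. acoef CARD('n) \<sigma> \<nu> \<theta> k (t - s))) (esum (\<lambda>k. acoef CARD('n) \<sigma> \<nu> \<theta> k (t - s))) x - limit_grad \<theta> t s\<bar>
      \<le> \<epsilon> * wt x ^ m + C * (\<sigma> + dev s x)"
proof -
  let ?N = "CARD('n)"
  let ?G = "\<lambda>\<sigma> s x. grad_inner (esum (\<lambda>k. acoef ?N \<sigma> \<nu> \<theta> k (t - s))) (esum (\<lambda>k. acoef ?N \<sigma> \<nu> \<theta> k (t - s))) (x :: (real,'n) vec)"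
  obtain A where A: "0 \<le> A" "\<forall>\<sigma>\<in>{0..1}. \<forall>\<tau>\<in>{0..t}. \<forall>k\<le>?N. \<bar>acoef ?N \<sigma> \<nu> \<theta> k \<tau>\<bar> \<le> A" using acoef_bound by blast
  obtain K m where K: "0 \<le> K" "\<And>A (a :: nat \<Rightarrow> real) (x :: (real, 'n) vec). \<forall>k\<le>?N. \<bar>a k\<bar> \<le> A \<Longrightarrow>
     \<bar>grad_inner (esum a) (esum a) x\<bar> \<le> A\<^sup>2 * (K * wt x ^ m)" using grad_inner_esum_bound by metis
  have Gb: "\<bar>?G \<sigma> s x\<bar> \<le> A\<^sup>2 * (K * wt x ^ m)" if "\<sigma> \<in> {0..1}" "s \<in> {0..t}" for \<sigma> s x
    by (rule K(2)) (use A(2) that in auto)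
  define w where "w = wt (sqrt t *\<^sub>R r)"
  have w1: "1 \<le> w" unfolding w_def by (rule wt_ge_1)
  have Lb: "\<bar>limit_grad \<theta> t s\<bar> \<le> A\<^sup>2 * (K * w ^ m)" if s: "s \<in> {0..t}" for s
  proof -
    have "\<bar>limit_grad \<theta> t s\<bar> \<le> A\<^sup>2 * (K * wt (sqrt s *\<^sub>R r) ^ m)" unfolding limit_grad_def by (rule Gb) (use s in auto)
    also have "\<dots> \<le> A\<^sup>2 * (K * w ^ m)"
    proof (intro mult_left_mono power_mono)
      show "wt (sqrt s *\<^sub>R r) \<le> w" using s unfolding w_def wt_def sqn_norm
        by (simp add: power_mult_distrib mult_right_mono)
    qed (use K(1) wt_ge_1[of "sqrt s *\<^sub>R r"] in auto)
    finally show ?thesis .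
  qed
  define c where "c = A\<^sup>2 * K * (1 + w ^ m)"
  have c0: "0 \<le> c" using K w1 by (simp add: c_def)
  have big: "\<bar>?G \<sigma> s x - limit_grad \<theta> t s\<bar> \<le> c * wt x ^ m" if "\<sigma> \<in> {0..1}" "s \<in> {0..t}" for \<sigma> s x
  proof -
    have "A\<^sup>2 * (K * w ^ m) * 1 \<le> A\<^sup>2 * (K * w ^ m) * wt x ^ m"
      using K w1 wt_power_ge_1[of x m] by (intro mult_left_mono) auto
    then show ?thesis using Gb[OF that, of x] Lb[OF that(2)] by (simp add: c_def algebra_simps)
  qed
  show ?thesis
  proof (intro exI[of _ "Suc m"] allI impI)
    fix \<epsilon> :: real assume e: "0 < \<epsilon>"
    \<comment> \<open>Outside this radius the weight is at least
      \<open>c / \<epsilon>\<close>.\<close>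
    define R where "R = sqrt (c / \<epsilon>)"
    define KK where "KK = {0..1::real} \<times> ({0..t} \<times> (chamberB \<inter> cball (0 :: (real,'n) vec) R))"
    have k1: "compact KK" unfolding KK_def
      using compact_Int_closed[OF compact_cball chamberB_closed] by (intro compact_Times compact_Icc) (simp add: Int_commute)
    define \<Psi> where "\<Psi> = (\<lambda>z. \<bar>?G (fst z) (fst (snd z)) (snd (snd z)) - limit_grad \<theta> t (fst (snd z))\<bar>)"
    define D where "D = (\<lambda>z :: real \<times> real \<times> (real,'n) vec. fst z + dev (fst (snd z)) (snd (snd z)))"
    have k2: "continuous_on KK \<Psi>"
      unfolding \<Psi>_def limit_grad_def grad_inner_esum
      by (intro continuous_intros acoef_continuous continuous_on_compose2[OF C2_continuous(2)[OF C2_es]]) auto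
    have k3: "continuous_on KK D"
      unfolding D_def by (intro continuous_intros continuous_dev)
    have k4: "0 \<le> D z" if "z \<in> KK" for z
      using that dev_nonneg by (auto simp: KK_def D_def intro!: add_nonneg_nonneg)
    have k5: "\<Psi> z \<le> 0" if z: "z \<in> KK" "D z = 0" for z
    proof -
      have "fst z \<ge> 0" using z(1) by (auto simp: KK_def)
      with z(2) dev_nonneg[of "fst (snd z)" "snd (snd z)"]
      have "fst z = 0" "dev (fst (snd z)) (snd (snd z)) = 0" unfolding D_def by linarith+
      moreover from this have "snd (snd z) = sqrt (fst (snd z)) *\<^sub>R r"
        using z(1) by (intro dev_eq_0) (auto simp: KK_def)
      ultimately show ?thesis by (simp add: \<Psi>_def limit_grad_def)
    qed
    obtain C where C: "0 \<le> C" "\<And>z. z \<in> KK \<Longrightarrow> \<Psi> z \<le> \<epsilon> + C * D z"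
      using compact_domination[OF k1 k2 k3 k4 k5 e] by blast
    show "\<exists>C\<ge>0. \<forall>\<sigma>\<in>{0..1}. \<forall>s\<in>{0..t}. \<forall>x\<in>chamberB. \<bar>?G \<sigma> s x - limit_grad \<theta> t s\<bar> \<le> \<epsilon> * wt x ^ Suc m + C * (\<sigma> + dev s x)"
    proof (intro exI[of _ C] conjI ballI C)
      fix \<sigma> s :: real and x :: "(real,'n) vec" assume a: "\<sigma> \<in> {0..1}" "s \<in> {0..t}" "x \<in> chamberB"
      have nn: "0 \<le> C * (\<sigma> + dev s x)" using C(1) a dev_nonneg by (intro mult_nonneg_nonneg add_nonneg_nonneg) auto
      show "\<bar>?G \<sigma> s x - limit_grad \<theta> t s\<bar> \<le> \<epsilon> * wt x ^ Suc m + C * (\<sigma> + dev s x)"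
      proof (cases "norm x \<le> R")
        case True
        have "\<bar>?G \<sigma> s x - limit_grad \<theta> t s\<bar> \<le> \<epsilon> + C * (\<sigma> + dev s x)"
          using C(2)[of "(\<sigma>, s, x)"] a True by (simp add: KK_def \<Psi>_def D_def)
        moreover have "\<epsilon> * 1 \<le> \<epsilon> * wt x ^ Suc m" using e wt_power_ge_1[of x "Suc m"] by (intro mult_left_mono) auto
        ultimately show ?thesis by simp
      next
        case False
        then have "R\<^sup>2 \<le> (norm x)\<^sup>2" using e c0 by (intro power_mono) (auto simp: R_def)
        then have "c / \<epsilon> \<le> wt x" using e c0 by (simp add: R_def wt_def sqn_norm)
        then have "c \<le> \<epsilon> * wt x" using e by (simp add: pos_divide_le_eq mult.commute)
        then have "c * wt x ^ m \<le> (\<epsilon> * wt x) * wt x ^ m" using wt_power_ge_1[of x m] by (intro mult_right_mono) auto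
        then show ?thesis using big[OF a(1,2), of x] nn by (simp add: mult.assoc)
      qed
    qed
  qed
qed

end

section \<open>The central limit theorem\<close>

lemma mean_value_within:
  fixes f f' :: "real \<Rightarrow> real"
  assumes "0 < t" "continuous_on {0..t} f"
    and "\<And>s. 0 < s \<Longrightarrow> s < t \<Longrightarrow> (f has_real_derivative f' s) (at s within {0..t})"
  shows "\<exists>z. 0 < z \<and> z < t \<and> f t - f 0 = t * f' z"
proof -
  have d: "(f has_real_derivative f' s) (at s)" if "0 < s" "s < t" for s
    using assms(3)[OF that] that by (simp add: at_within_Icc_at)
  have "\<exists>l z. 0 < z \<and> z < t \<and> (f has_real_derivative l) (at z) \<and> f t - f 0 = (t - 0) * l"
    by (rule MVT[OF assms(1,2)]) (use d in \<open>auto simp: real_differentiable_def\<close>)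
  then obtain l z where z: "0 < z" "z < t" "(f has_real_derivative l) (at z)" "f t - f 0 = t * l" by auto
  then show ?thesis using DERIV_unique[OF z(3) d[OF z(1,2)]] by auto
qed

lemma pgrowth_power2: "pgrowth p \<Longrightarrow> pgrowth (\<lambda>x. (p x)\<^sup>2)"
  unfolding power2_eq_square by (rule pgrowth_mult)

lemma pgrowth_minus: "pgrowth p \<Longrightarrow> pgrowth (\<lambda>x. p x - c)"
  using pgrowth_add[OF _ pgrowth_const[of "- c"], of p] by simp

lemma esum_lagr_coeff: "esum (lagr_coeff c \<zeta>) x = (\<Sum>i\<in>UNIV. \<zeta> $ i * lagr c i x)"
  unfolding esum_def by (rule lagr_coeff_sum)

lemma esum_lagr_axis: "esum (lagr_coeff c (axis i 1)) x = lagr c i x"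
  unfolding esum_lagr_coeff by (simp add: axis_def if_distrib if_distribR cong: if_cong)

text \<open>The quotient of \<open>lagr c i\<close> by \<open>x_i - c_i\<close>: continuous, and
  equal to 1 at \<open>c\<close>. It measures how far the Lagrange coordinate is from the Euclidean
  one.\<close>

definition wfac :: "(real, 'n::{finite,linorder}) vec \<Rightarrow> 'n \<Rightarrow> (real, 'n) vec \<Rightarrow> real" where
  "wfac c i x = (x $ i + c $ i) / (2 * c $ i) * (\<Prod>l\<in>UNIV - {i}. ((c $ i)\<^sup>2 - (x $ l)\<^sup>2) / ((c $ i)\<^sup>2 - (c $ l)\<^sup>2))"

lemma lagr_wfac:
  assumes "c $ i \<noteq> 0"
  shows "lagr c i x = (x $ i - c $ i) * wfac c i x"
proof -
  have "(\<Prod>l\<in>UNIV. (c $ i)\<^sup>2 - (x $ l)\<^sup>2) = ((c $ i)\<^sup>2 - (x $ i)\<^sup>2) * (\<Prod>l\<in>UNIV - {i}. (c $ i)\<^sup>2 - (x $ l)\<^sup>2)"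
    by (rule prod.remove) auto
  also have "(c $ i)\<^sup>2 - (x $ i)\<^sup>2 = - ((x $ i - c $ i) * (x $ i + c $ i))"
    by (simp add: power2_eq_square algebra_simps)
  finally show ?thesis
    by (simp add: lagr_def lagr_norm_def wfac_def prod_dividef)
qed

lemma wfac_self:
  assumes "c $ i \<noteq> 0" "\<And>l. l \<noteq> i \<Longrightarrow> (c $ i)\<^sup>2 \<noteq> (c $ l)\<^sup>2"
  shows "wfac c i c = 1"
  using assms by (simp add: wfac_def prod.neutral)

lemma continuous_wfac: "continuous_on UNIV (wfac c i)"
  unfolding wfac_def divide_inverse by (intro continuous_intros)

lemma differentiable_prod_real:
  fixes f :: "'a \<Rightarrow> real \<Rightarrow> real"
  shows "(\<And>j. j \<in> S \<Longrightarrow> f j differentiable (at x)) \<Longrightarrow> (\<lambda>x. \<Prod>j\<in>S. f j x) differentiable (at x)"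
  by (induction S rule: infinite_finite_induct) auto

lemma abs_cos_diff: "\<bar>cos a - cos b\<bar> \<le> \<bar>a - b :: real\<bar>"
proof -
  have "norm (cos a - cos b) \<le> 1 * norm (a - b)"
    by (rule field_differentiable_bound[of UNIV cos "\<lambda>x. - sin x"])
       (auto intro!: derivative_eq_intros)
  then show ?thesis by simp
qed

locale laguerre_start = laguerre_point \<nu> r for \<nu> :: real and r :: "(real, 'n::{finite,linorder}) vec" +
  fixes x :: "(real, 'n) vec"
begin

text \<open>The value at time 0 of the martingale that ends at time \<open>s\<close> in
  \<open>esum \<theta>\<close>; the natural centring constant. The scaled starting point supplies
  the powers of \<sigma>.\<close>

definition nval :: "(nat \<Rightarrow> real) \<Rightarrow> real \<Rightarrow> real \<Rightarrow> real" where
  "nval \<theta> \<sigma> s = (\<Sum>k\<le>CARD('n). acoef CARD('n) \<sigma> \<nu> \<theta> k s * \<sigma> ^ k * es k UNIV x)"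

lemma nval_esum: "0 \<le> \<sigma> \<Longrightarrow> esum (\<lambda>k. acoef CARD('n) \<sigma> \<nu> \<theta> k s) (sqrt \<sigma> *\<^sub>R x) = nval \<theta> \<sigma> s"
  by (simp add: esum_def nval_def es_scale mult.assoc)

lemma nval_0: "0 \<le> s \<Longrightarrow> nval \<theta> 0 s = esum \<theta> (sqrt s *\<^sub>R r)"
proof -
  assume "0 \<le> s"
  have "nval \<theta> 0 s = acoef CARD('n) 0 \<nu> \<theta> 0 s"
    unfolding nval_def sum.atMost_shift by simp
  then show ?thesis using esum_acoef_0[OF \<open>0 \<le> s\<close>] by simp
qed

lemma wt_start: "0 \<le> \<sigma> \<Longrightarrow> \<sigma> \<le> 1 \<Longrightarrow> wt (sqrt \<sigma> *\<^sub>R x) \<le> wt x"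
  by (simp add: wt_def sqn_norm power_mult_distrib mult_left_le_one_le)

lemma process_moments:
  assumes "0 \<le> T"
  shows "\<exists>A\<ge>0. \<forall>(M :: 'w measure) \<sigma> Y s. dynkin_process M \<sigma> \<nu> (sqrt \<sigma> *\<^sub>R x) Y \<longrightarrow> s \<in> {0..T} \<longrightarrow>
    (\<integral>\<omega>. wt (Y s \<omega>) ^ m \<partial>M) \<le> A"
proof -
  obtain A where A: "\<forall>(M :: 'w measure) \<sigma> (x0 :: (real, 'n) vec) Y s.
    dynkin_process M \<sigma> \<nu> x0 Y \<longrightarrow> wt x0 \<le> wt x \<longrightarrow> s \<in> {0..T} \<longrightarrow>
    integrable M (\<lambda>\<omega>. wt (Y s \<omega>) ^ m) \<and> (\<integral>\<omega>. wt (Y s \<omega>) ^ m \<partial>M) \<le> A"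
    using uniform_moments[OF assms, where Q = "wt x" and m = m] by blast
  show ?thesis
  proof (intro exI[of _ "max 0 A"] conjI allI impI)
    fix M :: "'w measure" and \<sigma> s and Y :: "real \<Rightarrow> 'w \<Rightarrow> (real, 'n) vec"
    assume p: "dynkin_process M \<sigma> \<nu> (sqrt \<sigma> *\<^sub>R x) Y" and s: "s \<in> {0..T}"
    interpret dynkin_process M \<sigma> \<nu> "sqrt \<sigma> *\<^sub>R x" Y by (rule p)
    have "wt (sqrt \<sigma> *\<^sub>R x) \<le> wt x" using sigma by (intro wt_start) auto
    then have "(\<integral>\<omega>. wt (Y s \<omega>) ^ m \<partial>M) \<le> A" using A p s by blast
    then show "(\<integral>\<omega>. wt (Y s \<omega>) ^ m \<partial>M) \<le> max 0 A" by simp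
  qed simp
qed

lemma acoef_time_deriv:
  assumes "k \<le> N"
  shows "((\<lambda>s. acoef N \<sigma> \<nu> \<theta> k (t - s)) has_real_derivative - (es_coeff N \<sigma> \<nu> k * acoef N \<sigma> \<nu> \<theta> (Suc k) (t - s))) (at s)"
proof -
  have "((\<lambda>s. acoef N \<sigma> \<nu> \<theta> k (t - s)) has_real_derivative (es_coeff N \<sigma> \<nu> k * acoef N \<sigma> \<nu> \<theta> (Suc k) (t - s)) * (0 - 1)) (at s)"
    by (rule DERIV_chain2[OF acoef_deriv[OF assms] DERIV_diff[OF DERIV_const DERIV_ident]])
  then show ?thesis by simp
qed

lemma esum_terminal: "esum (\<lambda>k. acoef CARD('n) \<sigma> \<nu> \<theta> k (t - t)) y = esum \<theta> (y :: (real, 'n) vec)"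
  unfolding esum_def by (intro sum.cong refl) (simp add: acoef_0)

text \<open>\<open>time_dependent\<close> with the centred square: the expectation is 0 at time 0
  and its derivative is \<sigma> times a gradient term with bounded expectation.\<close>

lemma variance_bound:
  assumes T: "0 \<le> T"
  shows "\<exists>C\<ge>0. \<forall>(M :: 'w measure) \<sigma> Y t. dynkin_process M \<sigma> \<nu> (sqrt \<sigma> *\<^sub>R x) Y \<longrightarrow> t \<in> {0..T} \<longrightarrow>
    (\<integral>\<omega>. (esum \<theta> (Y t \<omega>) - nval \<theta> \<sigma> t)\<^sup>2 \<partial>M) \<le> C * \<sigma>"
proof -
  let ?N = "CARD('n)"
  obtain A where A: "0 \<le> A" "\<forall>\<sigma>\<in>{0..1}. \<forall>\<tau>\<in>{0..T}. \<forall>k\<le>?N. \<bar>acoef ?N \<sigma> \<nu> \<theta> k \<tau>\<bar> \<le> A" using acoef_bound by blast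
  obtain K m where K: "0 \<le> K" "\<And>A (a :: nat \<Rightarrow> real) (x :: (real, 'n) vec). \<forall>k\<le>?N. \<bar>a k\<bar> \<le> A \<Longrightarrow>
     \<bar>grad_inner (esum a) (esum a) x\<bar> \<le> A\<^sup>2 * (K * wt x ^ m)" using grad_inner_esum_bound by metis
  obtain B where B: "0 \<le> B" "\<And>(M :: 'w measure) \<sigma> Y s. dynkin_process M \<sigma> \<nu> (sqrt \<sigma> *\<^sub>R x) Y \<Longrightarrow> s \<in> {0..T} \<Longrightarrow>
    (\<integral>\<omega>. wt (Y s \<omega>) ^ m \<partial>M) \<le> B" using process_moments[OF T, of m] by metis
  show ?thesis
  proof (intro exI[of _ "T * (A\<^sup>2 * K * B)"] conjI allI impI)
    show "0 \<le> T * (A\<^sup>2 * K * B)" using T K B by simp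
    fix M :: "'w measure" and \<sigma> t and Y :: "real \<Rightarrow> 'w \<Rightarrow> (real, 'n) vec"
    assume p: "dynkin_process M \<sigma> \<nu> (sqrt \<sigma> *\<^sub>R x) Y" and t: "t \<in> {0..T}"
    interpret dynkin_process M \<sigma> \<nu> "sqrt \<sigma> *\<^sub>R x" Y by (rule p)
    let ?a = "\<lambda>k s. acoef ?N \<sigma> \<nu> \<theta> k (t - s)"
    define e where "e s = (esum (\<lambda>k. ?a k s) :: (real, 'n) vec \<Rightarrow> real)" for s
    define n where "n = nval \<theta> \<sigma> t"
    have c2: "c2_bounded (\<lambda>v. (v - n)\<^sup>2) (\<lambda>v. 2 * (v - n)) (\<lambda>v. 2) 2"
      by unfold_locales (auto intro!: derivative_eq_intros)
    define f where "f s = expectation (\<lambda>\<omega>. (e s (Y s \<omega>) - n)\<^sup>2)" for s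
    have d: "(f has_real_derivative \<sigma> * expectation (\<lambda>\<omega>. grad_inner (e s) (e s) (Y s \<omega>))) (at s within {0..t})" if "s \<in> {0..t}" for s
      using time_dependent[where a = "\<lambda>k s. acoef ?N \<sigma> \<nu> \<theta> k (t - s)", OF acoef_time_deriv c2 that] unfolding f_def e_def by simp
    have f0: "f 0 = 0"
    proof -
      have "e 0 (Y 0 \<omega>) = n" if "\<omega> \<in> space M" for \<omega>
        using X_start[OF that] nval_esum[of \<sigma> \<theta> t] sigma unfolding e_def n_def by simp
      then have "f 0 = expectation (\<lambda>\<omega>. 0)" unfolding f_def by (intro Bochner_Integration.integral_cong) auto
      then show ?thesis by simp
    qed
    have ft: "f t = (\<integral>\<omega>. (esum \<theta> (Y t \<omega>) - nval \<theta> \<sigma> t)\<^sup>2 \<partial>M)"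
      unfolding f_def e_def n_def esum_terminal ..
    have le: "expectation (\<lambda>\<omega>. grad_inner (e s) (e s) (Y s \<omega>)) \<le> A\<^sup>2 * K * B" if s: "s \<in> {0..t}" for s
    proof -
      have "\<bar>expectation (\<lambda>\<omega>. grad_inner (e s) (e s) (Y s \<omega>))\<bar> \<le> (A\<^sup>2 * K) * expectation (\<lambda>\<omega>. wt (Y s \<omega>) ^ m)"
      proof (rule expectation_pgrowth_bound)
        show "continuous_on UNIV (grad_inner (e s) (e s))" unfolding e_def by (intro grad_inner_props C2_esum)
        show "\<bar>grad_inner (e s) (e s) y\<bar> \<le> A\<^sup>2 * K * wt y ^ m" for y
          using K(2)[of "\<lambda>k. ?a k s" A y] A(2) sigma s t unfolding e_def by (simp add: mult.assoc)
      qed (use s in auto)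
      also have "\<dots> \<le> (A\<^sup>2 * K) * B" using B(2)[OF p, of s] s t K by (intro mult_left_mono) auto
      finally show ?thesis by simp
    qed
    have "f t \<le> T * (A\<^sup>2 * K * B) * \<sigma>"
    proof (cases "t = 0")
      case True
      then show ?thesis using f0 sigma T K B by simp
    next
      case False
      then have "0 < t" using t by simp
      moreover have "continuous_on {0..t} f"
        by (rule DERIV_continuous_on[OF d])
      ultimately obtain z where z: "0 < z" "z < t" "f t - f 0 = t * (\<sigma> * expectation (\<lambda>\<omega>. grad_inner (e z) (e z) (Y z \<omega>)))"
        using mean_value_within[of t f "\<lambda>s. \<sigma> * expectation (\<lambda>\<omega>. grad_inner (e s) (e s) (Y s \<omega>))"] d by auto
      then have "f t \<le> t * (\<sigma> * (A\<^sup>2 * K * B))"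
        using le[of z] sigma f0 by simp
      also have "\<dots> \<le> T * (\<sigma> * (A\<^sup>2 * K * B))" using t sigma K B by (intro mult_right_mono) auto
      finally show ?thesis by (simp add: mult_ac)
    qed
    then show "(\<integral>\<omega>. (esum \<theta> (Y t \<omega>) - nval \<theta> \<sigma> t)\<^sup>2 \<partial>M) \<le> T * (A\<^sup>2 * K * B) * \<sigma>" unfolding ft .
  qed
qed

lemma continuous_nval: "continuous_on S f \<Longrightarrow> continuous_on S g \<Longrightarrow> continuous_on S (\<lambda>z. nval \<theta> (f z) (g z))"
  unfolding nval_def by (intro continuous_intros acoef_continuous)

lemma pgrowth_dev: "pgrowth (dev s)"
  unfolding dev_def[abs_def] by (intro pgrowth_sum pgrowth_power2 pgrowth_minus pgrowth_es)

text \<open>Each \<open>es k\<close> deviates from its value on the curve by a fluctuation, of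
  variance \<open>O(\<sigma>)\<close>, and a bias \<open>nval \<sigma> - nval 0\<close>, which
  \<open>compact_domination\<close> makes small.\<close>

lemma deviation_bound:
  assumes T: "0 \<le> T" and e: "0 < \<epsilon>"
  shows "\<exists>C\<ge>0. \<forall>(M :: 'w measure) \<sigma> Y s. dynkin_process M \<sigma> \<nu> (sqrt \<sigma> *\<^sub>R x) Y \<longrightarrow> s \<in> {0..T} \<longrightarrow>
    (\<integral>\<omega>. dev s (Y s \<omega>) \<partial>M) \<le> \<epsilon> + C * \<sigma>"
proof -
  let ?N = "CARD('n)"
  \<comment> \<open>Unit coefficient vectors, so that \<open>variance_bound\<close> applies to a
    single \<open>es k\<close>.\<close>
  define u where "u k = (\<lambda>j. if j = k then 1 else 0 :: real)" for k :: nat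
  have u: "esum (u k) y = es k UNIV y" if "k \<le> ?N" for k and y :: "(real, 'n) vec"
    unfolding esum_def u_def using that by (simp add: if_distrib if_distribR cong: if_cong)
  \<comment> \<open>Twice the squared bias; the factor 2 comes from splitting a square of a
    sum.\<close>
  define \<Psi> where "\<Psi> = (\<lambda>z :: real \<times> real. 2 * (\<Sum>k\<le>?N. (nval (u k) (fst z) (snd z) - nval (u k) 0 (snd z))\<^sup>2))"
  have k1: "compact ({0..1::real} \<times> {0..T})" by (intro compact_Times compact_Icc)
  have k2: "continuous_on ({0..1::real} \<times> {0..T}) \<Psi>"
    unfolding \<Psi>_def by (intro continuous_intros continuous_nval)
  have k3: "continuous_on ({0..1::real} \<times> {0..T}) (fst :: real \<times> real \<Rightarrow> real)" by (intro continuous_intros)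
  have k4: "0 \<le> fst z" if "z \<in> {0..1::real} \<times> {0..T}" for z using that by auto
  have k5: "\<Psi> z \<le> 0" if "z \<in> {0..1::real} \<times> {0..T}" "fst z = 0" for z using that by (simp add: \<Psi>_def)
  obtain C where C: "0 \<le> C" "\<And>z. z \<in> {0..1::real} \<times> {0..T} \<Longrightarrow> \<Psi> z \<le> \<epsilon> + C * fst z"
    using compact_domination[OF k1 k2 k3 k4 k5 e] by blast
  have "\<forall>k. \<exists>C\<ge>0. \<forall>(M :: 'w measure) \<sigma> Y t. dynkin_process M \<sigma> \<nu> (sqrt \<sigma> *\<^sub>R x) Y \<longrightarrow> t \<in> {0..T} \<longrightarrow>
    (\<integral>\<omega>. (esum (u k) (Y t \<omega>) - nval (u k) \<sigma> t)\<^sup>2 \<partial>M) \<le> C * \<sigma>" using variance_bound[OF T] by blast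
  then obtain D where D: "\<And>k. 0 \<le> D k" "\<And>k (M :: 'w measure) \<sigma> Y t. dynkin_process M \<sigma> \<nu> (sqrt \<sigma> *\<^sub>R x) Y \<Longrightarrow> t \<in> {0..T} \<Longrightarrow>
    (\<integral>\<omega>. (esum (u k) (Y t \<omega>) - nval (u k) \<sigma> t)\<^sup>2 \<partial>M) \<le> D k * \<sigma>" by metis
  show ?thesis
  proof (intro exI[of _ "2 * (\<Sum>k\<le>?N. D k) + C"] conjI allI impI)
    show "0 \<le> 2 * (\<Sum>k\<le>?N. D k) + C" using C D by (simp add: sum_nonneg)
    fix M :: "'w measure" and \<sigma> s and Y :: "real \<Rightarrow> 'w \<Rightarrow> (real, 'n) vec"
    assume p: "dynkin_process M \<sigma> \<nu> (sqrt \<sigma> *\<^sub>R x) Y" and s: "s \<in> {0..T}"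
    interpret dynkin_process M \<sigma> \<nu> "sqrt \<sigma> *\<^sub>R x" Y by (rule p)
    have s0: "0 \<le> s" using s by simp
    have pw: "dev s y \<le> 2 * (\<Sum>k\<le>?N. (esum (u k) y - nval (u k) \<sigma> s)\<^sup>2) + \<Psi> (\<sigma>, s)" for y
    proof -
      have "(es k UNIV y - s ^ k * es k UNIV r)\<^sup>2 \<le> 2 * (esum (u k) y - nval (u k) \<sigma> s)\<^sup>2 + 2 * (nval (u k) \<sigma> s - nval (u k) 0 s)\<^sup>2"
        if "k \<le> ?N" for k
      proof -
        have n0: "nval (u k) 0 s = s ^ k * es k UNIV r" using nval_0[OF s0] u[OF that] es_sqrt_r[OF s0] by simp
        have "(a - c)\<^sup>2 \<le> 2 * (a - b)\<^sup>2 + 2 * (b - c)\<^sup>2" for a b c :: real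
        proof -
          have "2 * (a - b)\<^sup>2 + 2 * (b - c)\<^sup>2 - (a - c)\<^sup>2 = (a - 2 * b + c)\<^sup>2" by (simp add: power2_eq_square algebra_simps)
          then show ?thesis by (smt (verit) zero_le_power2)
        qed
        then show ?thesis unfolding n0[symmetric] u[OF that] .
      qed
      then have "dev s y \<le> (\<Sum>k\<le>?N. 2 * (esum (u k) y - nval (u k) \<sigma> s)\<^sup>2 + 2 * (nval (u k) \<sigma> s - nval (u k) 0 s)\<^sup>2)"
        unfolding dev_def by (intro sum_mono) auto
      then show ?thesis by (simp add: \<Psi>_def sum.distrib sum_distrib_left)
    qed
    have int: "integrable M (\<lambda>\<omega>. (esum (u k) (Y s \<omega>) - nval (u k) \<sigma> s)\<^sup>2)" for k
      by (rule integrable_pgrowth[OF _ _ s0])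
         (auto intro!: continuous_intros C2_continuous(1)[OF C2_esum] pgrowth_power2 pgrowth_minus pgrowth_esum)
    have "(\<integral>\<omega>. dev s (Y s \<omega>) \<partial>M) \<le> (\<integral>\<omega>. 2 * (\<Sum>k\<le>?N. (esum (u k) (Y s \<omega>) - nval (u k) \<sigma> s)\<^sup>2) + \<Psi> (\<sigma>, s) \<partial>M)"
    proof (rule integral_mono[OF _ _ pw])
      show "integrable M (\<lambda>\<omega>. dev s (Y s \<omega>))"
        by (rule integrable_pgrowth[OF continuous_dev[OF continuous_on_const continuous_on_id] pgrowth_dev s0])
      show "integrable M (\<lambda>\<omega>. 2 * (\<Sum>k\<le>?N. (esum (u k) (Y s \<omega>) - nval (u k) \<sigma> s)\<^sup>2) + \<Psi> (\<sigma>, s))"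
        using int by simp
    qed
    also have "\<dots> = 2 * (\<Sum>k\<le>?N. \<integral>\<omega>. (esum (u k) (Y s \<omega>) - nval (u k) \<sigma> s)\<^sup>2 \<partial>M) + \<Psi> (\<sigma>, s)"
      using int by (simp add: prob_space)
    also have "\<dots> \<le> 2 * (\<Sum>k\<le>?N. D k * \<sigma>) + (\<epsilon> + C * \<sigma>)"
      using D(2)[OF p s] C(2)[of "(\<sigma>, s)"] sigma s by (intro add_mono mult_left_mono sum_mono) auto
    finally show "(\<integral>\<omega>. dev s (Y s \<omega>) \<partial>M) \<le> \<epsilon> + (2 * (\<Sum>k\<le>?N. D k) + C) * \<sigma>"
      by (simp add: sum_distrib_right[symmetric] distrib_right)
  qed
qed

text \<open>The cosine on the scale \<open>sqrt \<sigma>\<close> gives \<open>q' = - g / 2\<close>,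
  where \<open>g\<close> is the expectation of the cosine times the gradient term. Concentration
  replaces that term by \<open>limit_grad\<close>, so \<open>q\<close> nearly solves
  \<open>q' = - limit_grad q / 2\<close>, whose integrating factor is
  \<open>exp (kappa / 2)\<close>.\<close>

lemma char_limit:
  assumes t: "0 < t" and \<epsilon>: "0 < \<epsilon>"
  shows "\<exists>\<sigma>0>0. \<forall>(M :: 'w measure) \<sigma> Y. dynkin_process M \<sigma> \<nu> (sqrt \<sigma> *\<^sub>R x) Y \<longrightarrow> \<sigma> < \<sigma>0 \<longrightarrow>
    \<bar>(\<integral>\<omega>. cos ((esum \<theta> (Y t \<omega>) - nval \<theta> \<sigma> t) / sqrt \<sigma> + d) \<partial>M) - exp (- kappa \<theta> t t / 2) * cos d\<bar> \<le> \<epsilon>"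
proof -
  let ?N = "CARD('n)"
  let ?G = "\<lambda>\<sigma> s y. grad_inner (esum (\<lambda>k. acoef ?N \<sigma> \<nu> \<theta> k (t - s))) (esum (\<lambda>k. acoef ?N \<sigma> \<nu> \<theta> k (t - s))) (y :: (real,'n) vec)"
  have t0: "0 \<le> t" using t by simp
  obtain m where m: "\<forall>\<epsilon>>0. \<exists>C\<ge>0. \<forall>\<sigma>\<in>{0..1}. \<forall>s\<in>{0..t}. \<forall>y\<in>chamberB.
    \<bar>?G \<sigma> s y - limit_grad \<theta> t s\<bar> \<le> \<epsilon> * wt y ^ m + C * (\<sigma> + dev s y)"
    by (rule exE[OF grad_domination[OF t0, of \<theta>]])
  obtain A where A: "0 \<le> A" "\<And>(M :: 'w measure) \<sigma> Y s. dynkin_process M \<sigma> \<nu> (sqrt \<sigma> *\<^sub>R x) Y \<Longrightarrow> s \<in> {0..t} \<Longrightarrow>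
    (\<integral>\<omega>. wt (Y s \<omega>) ^ m \<partial>M) \<le> A" using process_moments[OF t0, of m] by metis
  have "compact (kappa \<theta> t ` {0..t})"
    by (intro compact_continuous_image continuous_on_subset[OF kappa_continuous]) auto
  then obtain Kx where Kx: "\<And>s. s \<in> {0..t} \<Longrightarrow> kappa \<theta> t s \<le> Kx"
    using compact_imp_bounded[of "kappa \<theta> t ` {0..t}"] unfolding bounded_iff by (force simp: abs_le_iff)
  \<comment> \<open>The factor by which the final estimate multiplies the error \<open>err\<close>,
    enlarged by 1.\<close>
  define W where "W = t / 2 * exp (Kx / 2) * exp (- kappa \<theta> t t / 2) + 1"
  have W: "0 < W" using t by (simp add: W_def add_pos_nonneg add_nonneg_pos)
  \<comment> \<open>The constants are chosen in the order \<epsilon>2, \<open>C\<close>,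
    \<epsilon>3, \<open>C'\<close>, \<sigma>0, each depending on the earlier ones; every one of the
    three error terms then costs at most \<open>\<epsilon> / 4\<close>.\<close>
  define \<epsilon>2 where "\<epsilon>2 = \<epsilon> / (4 * W * (A + 1))"
  have e2: "0 < \<epsilon>2" using \<epsilon> W A by (simp add: \<epsilon>2_def)
  obtain C where C: "0 \<le> C" "\<And>\<sigma> s y. \<sigma> \<in> {0..1} \<Longrightarrow> s \<in> {0..t} \<Longrightarrow> y \<in> chamberB \<Longrightarrow>
    \<bar>?G \<sigma> s y - limit_grad \<theta> t s\<bar> \<le> \<epsilon>2 * wt y ^ m + C * (\<sigma> + dev s y)" using m[rule_format, OF e2] by (elim exE conjE) blast
  define \<epsilon>3 where "\<epsilon>3 = \<epsilon> / (4 * W * (C + 1))"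
  have e3: "0 < \<epsilon>3" using \<epsilon> W C by (simp add: \<epsilon>3_def)
  obtain C' where C': "0 \<le> C'" "\<And>(M :: 'w measure) \<sigma> Y s. dynkin_process M \<sigma> \<nu> (sqrt \<sigma> *\<^sub>R x) Y \<Longrightarrow> s \<in> {0..t} \<Longrightarrow>
    (\<integral>\<omega>. dev s (Y s \<omega>) \<partial>M) \<le> \<epsilon>3 + C' * \<sigma>" using deviation_bound[OF t0 e3] by metis
  define \<sigma>0 where "\<sigma>0 = \<epsilon> / (4 * W * (C * (1 + C') + 1))"
  have CC: "0 \<le> C * (1 + C')" using C C' by simp
  have s0: "0 < \<sigma>0" using \<epsilon> W CC by (simp add: \<sigma>0_def)
  define err where "err = \<epsilon>2 * A + C * \<epsilon>3 + C * (1 + C') * \<sigma>0"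
  have Werr: "W * err \<le> \<epsilon>"
  proof -
    have w: "W * (\<epsilon>2 * A) = \<epsilon> / 4 * (A / (A + 1))" "W * (C * \<epsilon>3) = \<epsilon> / 4 * (C / (C + 1))"
      "W * (C * (1 + C') * \<sigma>0) = \<epsilon> / 4 * (C * (1 + C') / (C * (1 + C') + 1))"
      using W by (simp_all add: \<epsilon>2_def \<epsilon>3_def \<sigma>0_def)
    have b: "\<epsilon> / 4 * (q / (q + 1)) \<le> \<epsilon> / 4" if "0 \<le> q" for q
      using that \<epsilon> by (intro mult_left_le) auto
    have "W * err = W * (\<epsilon>2 * A) + W * (C * \<epsilon>3) + W * (C * (1 + C') * \<sigma>0)"
      by (simp add: err_def algebra_simps)
    then show ?thesis unfolding w
      using b[OF A(1)] b[OF C(1)] b[OF CC] \<epsilon> by linarith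
  qed
  show ?thesis
  proof (intro exI[of _ \<sigma>0] conjI allI impI s0)
    fix M :: "'w measure" and \<sigma> and Y :: "real \<Rightarrow> 'w \<Rightarrow> (real, 'n) vec"
    assume p: "dynkin_process M \<sigma> \<nu> (sqrt \<sigma> *\<^sub>R x) Y" and ss: "\<sigma> < \<sigma>0"
    interpret dynkin_process M \<sigma> \<nu> "sqrt \<sigma> *\<^sub>R x" Y by (rule p)
    have sg: "\<sigma> \<in> {0..1}" using sigma by simp
    define e where "e s = (esum (\<lambda>k. acoef ?N \<sigma> \<nu> \<theta> k (t - s)) :: (real, 'n) vec \<Rightarrow> real)" for s
    define n where "n = nval \<theta> \<sigma> t"
    define l where "l = 1 / sqrt \<sigma>"
    have l: "\<sigma> * (l * l) = 1" using sigma by (simp add: l_def)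
    have c2: "c2_bounded (\<lambda>v. cos ((v - n) * l + d)) (\<lambda>v. - l * sin ((v - n) * l + d)) (\<lambda>v. - (l * l) * cos ((v - n) * l + d)) (l * l)"
    proof unfold_locales
      show "\<bar>- (l * l) * cos ((v - n) * l + d)\<bar> \<le> l * l" for v
        using abs_cos_le_one[of "(v - n) * l + d"] by (simp add: abs_mult mult_left_le)
    qed (auto intro!: derivative_eq_intros continuous_intros)
    define q where "q s = expectation (\<lambda>\<omega>. cos ((e s (Y s \<omega>) - n) * l + d))" for s
    define g where "g s = expectation (\<lambda>\<omega>. cos ((e s (Y s \<omega>) - n) * l + d) * grad_inner (e s) (e s) (Y s \<omega>))" for s
    have qd: "(q has_real_derivative - g s / 2) (at s within {0..t})" if "s \<in> {0..t}" for s
    proof -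
      have "(q has_real_derivative \<sigma> / 2 * expectation (\<lambda>\<omega>. - (l * l) * cos ((e s (Y s \<omega>) - n) * l + d) * grad_inner (e s) (e s) (Y s \<omega>))) (at s within {0..t})"
        using time_dependent[where a = "\<lambda>k s. acoef ?N \<sigma> \<nu> \<theta> k (t - s)", OF acoef_time_deriv c2 that] unfolding q_def e_def by simp
      also have "expectation (\<lambda>\<omega>. - (l * l) * cos ((e s (Y s \<omega>) - n) * l + d) * grad_inner (e s) (e s) (Y s \<omega>)) = - (l * l) * g s"
        unfolding g_def by (simp add: mult.assoc)
      also have "\<sigma> / 2 * (- (l * l) * g s) = - (\<sigma> * (l * l)) * g s / 2" by simp
      finally show ?thesis unfolding l by simp
    qed
    \<comment> \<open>Constant in the limit. The mean value theorem requires its derivative at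
      interior times only, so the singular time 0 is avoided.\<close>
    define F where "F s = q s * exp (kappa \<theta> t s / 2)" for s
    have q0: "q 0 = cos d"
    proof -
      have "e 0 (Y 0 \<omega>) = n" if "\<omega> \<in> space M" for \<omega>
        using X_start[OF that] nval_esum[of \<sigma> \<theta> t] sigma unfolding e_def n_def by simp
      then have "q 0 = expectation (\<lambda>\<omega>. cos d)" unfolding q_def by (intro Bochner_Integration.integral_cong) auto
      then show ?thesis by (simp add: prob_space)
    qed
    have qt: "q t = (\<integral>\<omega>. cos ((esum \<theta> (Y t \<omega>) - nval \<theta> \<sigma> t) / sqrt \<sigma> + d) \<partial>M)"
      unfolding q_def e_def n_def esum_terminal l_def by simp
    have Fd: "(F has_real_derivative exp (kappa \<theta> t s / 2) / 2 * (limit_grad \<theta> t s * q s - g s)) (at s within {0..t})"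
      if "0 < s" "s < t" for s
    proof -
      have k: "((\<lambda>s. exp (kappa \<theta> t s / 2)) has_real_derivative exp (kappa \<theta> t s / 2) * (limit_grad \<theta> t s / 2)) (at s within {0..t})"
        by (rule DERIV_chain2[OF DERIV_exp DERIV_cdivide[OF has_field_derivative_at_within[OF kappa_deriv[OF that(1)]]]])
      show ?thesis unfolding F_def
        by (rule DERIV_cong[OF DERIV_mult[OF qd k]]) (use that in \<open>auto simp: algebra_simps diff_divide_distrib\<close>)
    qed
    have Fc: "continuous_on {0..t} F"
      unfolding F_def
      by (intro continuous_intros continuous_on_subset[OF kappa_continuous] DERIV_continuous_on[OF qd]) auto
    obtain z where z: "0 < z" "z < t" "F t - F 0 = t * (exp (kappa \<theta> t z / 2) / 2 * (limit_grad \<theta> t z * q z - g z))"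
      using mean_value_within[OF t Fc Fd] by blast
    have zi: "z \<in> {0..t}" "0 \<le> z" using z by auto
    have grc: "continuous_on UNIV (\<lambda>y. grad_inner (e z) (e z) y)" unfolding e_def by (intro grad_inner_props C2_esum)
    have grg: "pgrowth (\<lambda>y. grad_inner (e z) (e z) y)" unfolding e_def
      by (intro pgrowth_grad_inner pgrowth_pd_esum)
    have cc: "continuous_on UNIV (\<lambda>y. cos ((e z y - n) * l + d))"
      unfolding e_def by (intro continuous_intros C2_continuous(1)[OF C2_esum])
    have cg: "pgrowth (\<lambda>y. cos ((e z y - n) * l + d))"
      by (rule pgrowthI[of _ 1 0]) simp
    have i1: "integrable M (\<lambda>\<omega>. cos ((e z (Y z \<omega>) - n) * l + d))" by (rule integrable_pgrowth[OF cc cg zi(2)])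
    have i2: "integrable M (\<lambda>\<omega>. cos ((e z (Y z \<omega>) - n) * l + d) * grad_inner (e z) (e z) (Y z \<omega>))"
      by (rule integrable_pgrowth[OF continuous_on_mult[OF cc grc] pgrowth_mult[OF cg grg] zi(2)])
    have i3: "integrable M (\<lambda>\<omega>. grad_inner (e z) (e z) (Y z \<omega>))" by (rule integrable_pgrowth[OF grc grg zi(2)])
    have i4: "integrable M (\<lambda>\<omega>. dev z (Y z \<omega>))"
      by (rule integrable_pgrowth[OF continuous_dev[OF continuous_on_const continuous_on_id] pgrowth_dev zi(2)])
    have i5: "integrable M (\<lambda>\<omega>. wt (Y z \<omega>) ^ m)" by (rule integrable_wt[OF zi(2)])
    have "\<bar>limit_grad \<theta> t z * q z - g z\<bar> = \<bar>expectation (\<lambda>\<omega>. cos ((e z (Y z \<omega>) - n) * l + d) * (limit_grad \<theta> t z - grad_inner (e z) (e z) (Y z \<omega>)))\<bar>"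
      unfolding q_def g_def using i1 i2 by (simp add: right_diff_distrib mult.commute)
    also have "\<dots> \<le> expectation (\<lambda>\<omega>. \<bar>cos ((e z (Y z \<omega>) - n) * l + d) * (limit_grad \<theta> t z - grad_inner (e z) (e z) (Y z \<omega>))\<bar>)"
      by (rule integral_abs_bound)
    also have "\<dots> \<le> expectation (\<lambda>\<omega>. \<epsilon>2 * wt (Y z \<omega>) ^ m + C * (\<sigma> + dev z (Y z \<omega>)))"
    proof (rule integral_mono)
      show "integrable M (\<lambda>\<omega>. \<bar>cos ((e z (Y z \<omega>) - n) * l + d) * (limit_grad \<theta> t z - grad_inner (e z) (e z) (Y z \<omega>))\<bar>)"
        using i1 i2 by (simp add: right_diff_distrib)
      show "integrable M (\<lambda>\<omega>. \<epsilon>2 * wt (Y z \<omega>) ^ m + C * (\<sigma> + dev z (Y z \<omega>)))" using i4 i5 by simp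
      fix \<omega> assume w: "\<omega> \<in> space M"
      have "\<bar>cos ((e z (Y z \<omega>) - n) * l + d)\<bar> * \<bar>limit_grad \<theta> t z - grad_inner (e z) (e z) (Y z \<omega>)\<bar> \<le> 1 * \<bar>limit_grad \<theta> t z - grad_inner (e z) (e z) (Y z \<omega>)\<bar>"
        by (intro mult_right_mono) auto
      also have "\<dots> = \<bar>?G \<sigma> z (Y z \<omega>) - limit_grad \<theta> t z\<bar>" by (simp add: e_def abs_minus_commute)
      also have "\<dots> \<le> \<epsilon>2 * wt (Y z \<omega>) ^ m + C * (\<sigma> + dev z (Y z \<omega>))"
        by (rule C(2)[OF sg zi(1) X_chamber[OF zi(2) w]])
      finally show "\<bar>cos ((e z (Y z \<omega>) - n) * l + d) * (limit_grad \<theta> t z - grad_inner (e z) (e z) (Y z \<omega>))\<bar> \<le> \<epsilon>2 * wt (Y z \<omega>) ^ m + C * (\<sigma> + dev z (Y z \<omega>))"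
        by (simp only: abs_mult)
    qed
    also have "\<dots> = \<epsilon>2 * expectation (\<lambda>\<omega>. wt (Y z \<omega>) ^ m) + C * (\<sigma> + expectation (\<lambda>\<omega>. dev z (Y z \<omega>)))"
      using i4 i5 by (simp add: prob_space)
    also have "\<dots> \<le> \<epsilon>2 * A + C * (\<sigma> + (\<epsilon>3 + C' * \<sigma>))"
      using A(2)[OF p zi(1)] C'(2)[OF p zi(1)] e2 C(1) by (intro add_mono mult_left_mono) auto
    also have "\<dots> \<le> err"
      unfolding err_def using mult_left_mono[OF less_imp_le[OF ss] CC] by (simp add: algebra_simps)
    finally have E: "\<bar>limit_grad \<theta> t z * q z - g z\<bar> \<le> err" .
    then have err0: "0 \<le> err" by linarith
    have "\<bar>F t - F 0\<bar> = t * (exp (kappa \<theta> t z / 2) / 2 * \<bar>limit_grad \<theta> t z * q z - g z\<bar>)"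
      unfolding z(3) using t by (simp add: abs_mult)
    also have "\<dots> \<le> t * (exp (Kx / 2) / 2 * err)"
      using E t Kx[OF zi(1)] by (intro mult_left_mono mult_mono) auto
    finally have Fb: "\<bar>F t - F 0\<bar> \<le> t * (exp (Kx / 2) / 2 * err)" .
    have "q t - exp (- kappa \<theta> t t / 2) * cos d = exp (- kappa \<theta> t t / 2) * (F t - F 0)"
      unfolding F_def q0 kappa_0 by (simp add: right_diff_distrib exp_minus)
    then have "\<bar>q t - exp (- kappa \<theta> t t / 2) * cos d\<bar> = exp (- kappa \<theta> t t / 2) * \<bar>F t - F 0\<bar>"
      by (simp add: abs_mult)
    also have "\<dots> \<le> exp (- kappa \<theta> t t / 2) * (t * (exp (Kx / 2) / 2 * err))"
      using Fb by (intro mult_left_mono) auto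
    also have "\<dots> = (W - 1) * err" by (simp add: W_def)
    also have "\<dots> \<le> W * err" using err0 by (intro mult_right_mono) auto
    also have "\<dots> \<le> \<epsilon>" by (rule Werr)
    finally show "\<bar>(\<integral>\<omega>. cos ((esum \<theta> (Y t \<omega>) - nval \<theta> \<sigma> t) / sqrt \<sigma> + d) \<partial>M) - exp (- kappa \<theta> t t / 2) * cos d\<bar> \<le> \<epsilon>"
      unfolding qt .
  qed
qed

end

section \<open>From Lagrange coordinates to the process itself\<close>

context laguerre_start
begin

text \<open>\<open>nval\<close> is polynomial in \<sigma> and vanishes at 0, so the bias is
  \<open>O(\<sigma>)\<close> and disappears after division by \<open>sqrt \<sigma>\<close>.\<close>

lemma nval_small:
  assumes "0 \<le> t" "nval \<theta> 0 t = 0" "0 < \<epsilon>"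
  shows "\<exists>\<sigma>0>0. \<forall>\<sigma>. 0 < \<sigma> \<longrightarrow> \<sigma> < \<sigma>0 \<longrightarrow> \<bar>nval \<theta> \<sigma> t / sqrt \<sigma>\<bar> \<le> \<epsilon>"
proof -
  have "(\<lambda>\<sigma>. nval \<theta> \<sigma> t) differentiable (at 0)"
  proof -
    have s: "(\<lambda>x. \<Sum>k\<in>I. f k x) differentiable (at 0)" if "\<And>k. k \<in> I \<Longrightarrow> f k differentiable (at 0)"
      for I :: "nat set" and f :: "nat \<Rightarrow> real \<Rightarrow> real"
      using that by (induction I rule: infinite_finite_induct) auto
    have c: "(\<lambda>\<sigma>. es_coeff CARD('n) \<sigma> \<nu> j) differentiable (at 0)" for j
      unfolding es_coeff_def by auto
    have "(\<lambda>\<sigma>. acoef CARD('n) \<sigma> \<nu> \<theta> k t) differentiable (at 0)" for k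
      unfolding acoef_def by (intro s differentiable_mult differentiable_const differentiable_prod_real c)
    then show ?thesis
      unfolding nval_def by (intro s differentiable_mult differentiable_const differentiable_power differentiable_ident)
  qed
  then obtain D where "((\<lambda>\<sigma>. nval \<theta> \<sigma> t) has_real_derivative D) (at 0)" by (auto simp: real_differentiable_def)
  then have "((\<lambda>\<sigma>. nval \<theta> \<sigma> t / \<sigma>) \<longlongrightarrow> D) (at 0)"
    unfolding has_field_derivative_iff using assms(2) by simp
  then have "((\<lambda>\<sigma>. nval \<theta> \<sigma> t / \<sigma>) \<longlongrightarrow> D) (at_right 0)" by (rule filterlim_mono) (auto simp: at_le)
  moreover have "((\<lambda>\<sigma>. sqrt \<sigma>) \<longlongrightarrow> sqrt 0) (at_right 0)" by (intro tendsto_intros)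
  ultimately have "((\<lambda>\<sigma>. nval \<theta> \<sigma> t / \<sigma> * sqrt \<sigma>) \<longlongrightarrow> D * sqrt 0) (at_right 0)" by (rule tendsto_mult)
  then have "\<forall>\<^sub>F \<sigma> in at_right 0. dist (nval \<theta> \<sigma> t / \<sigma> * sqrt \<sigma>) (D * sqrt 0) < \<epsilon>" using assms(3) by (rule tendstoD)
  then obtain b where b: "0 < b" "\<And>\<sigma>. 0 < \<sigma> \<Longrightarrow> \<sigma> < b \<Longrightarrow> \<bar>nval \<theta> \<sigma> t / \<sigma> * sqrt \<sigma>\<bar> < \<epsilon>"
    unfolding eventually_at_right_field by auto
  have "\<bar>nval \<theta> \<sigma> t / sqrt \<sigma>\<bar> \<le> \<epsilon>" if "0 < \<sigma>" "\<sigma> < b" for \<sigma>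
  proof -
    have "nval \<theta> \<sigma> t / \<sigma> * sqrt \<sigma> = nval \<theta> \<sigma> t / sqrt \<sigma>"
      using that(1) by (simp add: field_simps flip: real_sqrt_mult)
    then show ?thesis using b(2)[OF that] by simp
  qed
  then show ?thesis using b(1) by blast
qed

context
  fixes t :: real
  assumes t: "0 < t"
begin

lemma ctr_nz: "(sqrt t *\<^sub>R r) $ i \<noteq> 0" "l \<noteq> i \<Longrightarrow> ((sqrt t *\<^sub>R r) $ i)\<^sup>2 \<noteq> ((sqrt t *\<^sub>R r) $ l)\<^sup>2"
  using t r_nz r_sq_distinct by (auto simp: power_mult_distrib)

lemma lagr_ctr: "lagr (sqrt t *\<^sub>R r) i (sqrt t *\<^sub>R r) = 0"
  by (simp add: lagr_wfac[OF ctr_nz(1)])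

lemma nval_lagr_0: "nval (lagr_coeff (sqrt t *\<^sub>R r) \<zeta>) 0 t = 0"
  using t by (simp add: nval_0 esum_lagr_coeff lagr_ctr)

text \<open>\<open>compact_domination\<close> for the distance of \<open>wfac\<close> from 1: within
  a bounded part of the chamber, closeness in \<open>dev\<close> forces closeness to the curve
  point.\<close>

lemma wfac_near:
  assumes e: "0 < e"
  shows "\<exists>\<delta>>0. \<forall>y\<in>chamberB. norm y \<le> R \<longrightarrow> dev t y < \<delta> \<longrightarrow> (\<forall>i. \<bar>wfac (sqrt t *\<^sub>R r) i y - 1\<bar> \<le> e)"
proof -
  let ?c = "sqrt t *\<^sub>R r"
  define KK where "KK = chamberB \<inter> cball (0 :: (real, 'n) vec) R"
  define \<Psi> where "\<Psi> = (\<lambda>y. \<Sum>i\<in>UNIV. \<bar>wfac ?c i y - 1\<bar>)"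
  have k1: "compact KK" unfolding KK_def
    using compact_Int_closed[OF compact_cball chamberB_closed] by (simp add: Int_commute)
  have k2: "continuous_on KK \<Psi>" unfolding \<Psi>_def
    by (intro continuous_intros continuous_on_subset[OF continuous_wfac]) auto
  have k3: "continuous_on KK (dev t)" by (rule continuous_dev[OF continuous_on_const continuous_on_id])
  have k4: "0 \<le> dev t y" for y by (rule dev_nonneg)
  have k5: "\<Psi> y \<le> 0" if "y \<in> KK" "dev t y = 0" for y
  proof -
    have "y = ?c" using that t by (intro dev_eq_0) (auto simp: KK_def)
    then show ?thesis by (simp add: \<Psi>_def wfac_self[OF ctr_nz])
  qed
  have e2: "0 < e / 2" using e by simp
  obtain C where C: "0 \<le> C" "\<And>y. y \<in> KK \<Longrightarrow> \<Psi> y \<le> e / 2 + C * dev t y"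
    using compact_domination[OF k1 k2 k3 k4 k5 e2] by blast
  show ?thesis
  proof (intro exI[of _ "e / (2 * (C + 1))"] conjI ballI impI allI)
    show "0 < e / (2 * (C + 1))" using e C by simp
    fix y i assume y: "y \<in> chamberB" "norm y \<le> R" "dev t y < e / (2 * (C + 1))"
    have "\<bar>wfac ?c i y - 1\<bar> \<le> \<Psi> y" unfolding \<Psi>_def by (rule member_le_sum[where f = "\<lambda>i. \<bar>wfac ?c i y - 1\<bar>"]) auto
    also have "\<dots> \<le> e / 2 + C * dev t y" using y by (intro C) (simp add: KK_def)
    also have "C * dev t y \<le> (C + 1) * (e / (2 * (C + 1)))"
      using y(3) C(1) dev_nonneg[of t y] by (intro mult_mono) auto
    also have "\<dots> = e / 2" using C(1) by (simp add: field_simps)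
    finally show "\<bar>wfac ?c i y - 1\<bar> \<le> e" by simp
  qed
qed

text \<open>The fluctuation in the coordinates that the martingales reach; \<open>yfun\<close> is
  the same fluctuation in Euclidean coordinates, the quantity of the theorem.\<close>

definition vfun :: "real \<Rightarrow> (real, 'n) vec \<Rightarrow> 'n \<Rightarrow> real" where
  "vfun \<sigma> y i = lagr (sqrt t *\<^sub>R r) i y / sqrt \<sigma>"

definition yfun :: "real \<Rightarrow> (real, 'n) vec \<Rightarrow> (real, 'n) vec" where
  "yfun \<sigma> y = (1 / sqrt \<sigma>) *\<^sub>R (y - sqrt t *\<^sub>R r)"

lemma yfun_vfun_close:
  assumes "\<bar>wfac (sqrt t *\<^sub>R r) i y - 1\<bar> \<le> e" "e \<le> 1/2"
  shows "\<bar>yfun \<sigma> y $ i - vfun \<sigma> y i\<bar> \<le> e * (1 + (vfun \<sigma> y i)\<^sup>2)" "\<bar>yfun \<sigma> y $ i\<bar> \<le> 1 + (vfun \<sigma> y i)\<^sup>2"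
proof -
  let ?w = "wfac (sqrt t *\<^sub>R r) i y"
  let ?v = "vfun \<sigma> y i"
  have v: "?v = yfun \<sigma> y $ i * ?w"
    unfolding vfun_def yfun_def lagr_wfac[OF ctr_nz(1)] by simp
  have "1/2 \<le> \<bar>?w\<bar>" using assms by linarith
  then have "\<bar>yfun \<sigma> y $ i\<bar> * (1/2) \<le> \<bar>yfun \<sigma> y $ i\<bar> * \<bar>?w\<bar>" by (intro mult_left_mono) auto
  then have y: "\<bar>yfun \<sigma> y $ i\<bar> \<le> 2 * \<bar>?v\<bar>" unfolding v abs_mult by simp
  have q: "2 * \<bar>?v\<bar> \<le> 1 + ?v\<^sup>2" using sum_squares_bound[of "\<bar>?v\<bar>" 1] by simp
  show "\<bar>yfun \<sigma> y $ i\<bar> \<le> 1 + ?v\<^sup>2" using y q by linarith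
  have "yfun \<sigma> y $ i - ?v = yfun \<sigma> y $ i * (1 - ?w)" unfolding v by (simp add: right_diff_distrib)
  then have "\<bar>yfun \<sigma> y $ i - ?v\<bar> = \<bar>yfun \<sigma> y $ i\<bar> * \<bar>?w - 1\<bar>" by (simp add: abs_mult abs_minus_commute)
  also have "\<dots> \<le> (1 + ?v\<^sup>2) * e" using y q assms by (intro mult_mono) auto
  finally show "\<bar>yfun \<sigma> y $ i - ?v\<bar> \<le> e * (1 + ?v\<^sup>2)" by (simp add: mult.commute)
qed

text \<open>On the good event both coordinates are close by \<open>wfac_near\<close>. On the bad
  event \<open>dev t y / \<delta> + wt y / R^2\<close> is at least 1 and absorbs the trivial bounds
  2 and 1, a pointwise form of Markov's inequality.\<close>

lemma pointwise_bounds: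
  assumes e: "0 < e" "e \<le> 1/2" and R: "0 < R"
  shows "\<exists>\<delta>>0. \<forall>y\<in>chamberB. \<forall>\<sigma> \<zeta> d. \<forall>B>0.
    \<bar>cos (\<zeta> \<bullet> yfun \<sigma> y + d) - cos ((\<Sum>i\<in>UNIV. \<zeta> $ i * vfun \<sigma> y i) + d)\<bar>
      \<le> norm \<zeta> * e * (\<Sum>i\<in>UNIV. 1 + (vfun \<sigma> y i)\<^sup>2) + 2 * (dev t y / \<delta> + wt y / R\<^sup>2) \<and>
    indicator {u. B < norm u} (yfun \<sigma> y) \<le> (\<Sum>i\<in>UNIV. 1 + (vfun \<sigma> y i)\<^sup>2) / B + (dev t y / \<delta> + wt y / R\<^sup>2)"
proof -
  obtain \<delta> where \<delta>: "0 < \<delta>" "\<And>y i. y \<in> chamberB \<Longrightarrow> norm y \<le> R \<Longrightarrow> dev t y < \<delta> \<Longrightarrow> \<bar>wfac (sqrt t *\<^sub>R r) i y - 1\<bar> \<le> e"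
    using wfac_near[OF e(1), of R] by blast
  show ?thesis
  proof (intro exI[of _ \<delta>] conjI ballI allI impI \<delta>(1))
    fix y \<zeta> :: "(real,'n) vec" and \<sigma> d B :: real
    assume y: "y \<in> chamberB" and B: "0 < B"
    define V where "V = (\<Sum>i\<in>UNIV. 1 + (vfun \<sigma> y i)\<^sup>2)"
    define Q where "Q = dev t y / \<delta> + wt y / R\<^sup>2"
    have V0: "0 \<le> V" unfolding V_def by (intro sum_nonneg) auto
    have Q0: "0 \<le> Q" unfolding Q_def using \<delta>(1) dev_nonneg[of t y] wt_ge_1[of y] by (intro add_nonneg_nonneg divide_nonneg_nonneg) auto
    have "\<bar>cos (\<zeta> \<bullet> yfun \<sigma> y + d) - cos ((\<Sum>i\<in>UNIV. \<zeta> $ i * vfun \<sigma> y i) + d)\<bar> \<le> norm \<zeta> * e * V + 2 * Q \<and>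
      indicator {u. B < norm u} (yfun \<sigma> y) \<le> V / B + Q"
    proof (cases "norm y \<le> R \<and> dev t y < \<delta>")
      case True
      then have w: "\<bar>wfac (sqrt t *\<^sub>R r) i y - 1\<bar> \<le> e" for i using \<delta>(2)[OF y] by blast
      note c = yfun_vfun_close[OF w e(2)]
      have "\<bar>(\<zeta> \<bullet> yfun \<sigma> y + d) - ((\<Sum>i\<in>UNIV. \<zeta> $ i * vfun \<sigma> y i) + d)\<bar> = \<bar>\<Sum>i\<in>UNIV. \<zeta> $ i * (yfun \<sigma> y $ i - vfun \<sigma> y i)\<bar>"
        by (simp add: inner_vec_def sum_subtractf right_diff_distrib)
      also have "\<dots> \<le> (\<Sum>i\<in>UNIV. norm \<zeta> * (e * (1 + (vfun \<sigma> y i)\<^sup>2)))"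
        by (intro order_trans[OF sum_abs] sum_mono) (auto simp: abs_mult intro!: mult_mono c component_le_norm_cart)
      also have "\<dots> = norm \<zeta> * e * V" by (simp add: V_def sum_distrib_left mult.assoc)
      finally have 1: "\<bar>cos (\<zeta> \<bullet> yfun \<sigma> y + d) - cos ((\<Sum>i\<in>UNIV. \<zeta> $ i * vfun \<sigma> y i) + d)\<bar> \<le> norm \<zeta> * e * V"
        by (rule order_trans[OF abs_cos_diff])
      have "norm (yfun \<sigma> y) \<le> (\<Sum>i\<in>UNIV. \<bar>yfun \<sigma> y $ i\<bar>)" by (rule norm_le_l1_cart)
      also have "\<dots> \<le> V" unfolding V_def by (intro sum_mono c)
      finally have "indicator {u. B < norm u} (yfun \<sigma> y) \<le> V / B" using B V0 by (auto simp: indicator_def field_simps)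
      then show ?thesis using 1 Q0 by simp
    next
      case False
      have "1 \<le> Q"
      proof (cases "norm y \<le> R")
        case True
        then have "1 \<le> dev t y / \<delta>" using False \<delta>(1) by (simp add: field_simps)
        moreover have "0 \<le> wt y / R\<^sup>2" using wt_ge_1[of y] by simp
        ultimately show ?thesis by (simp add: Q_def)
      next
        case F: False
        then have "R\<^sup>2 \<le> (norm y)\<^sup>2" using R by (intro power_mono) auto
        then have "R\<^sup>2 \<le> wt y" by (simp add: wt_def sqn_norm)
        then have "1 \<le> wt y / R\<^sup>2" using R by simp
        moreover have "0 \<le> dev t y / \<delta>" using \<delta>(1) dev_nonneg[of t y] by simp
        ultimately show ?thesis by (simp add: Q_def)
      qed
      moreover have "\<bar>cos (\<zeta> \<bullet> yfun \<sigma> y + d) - cos ((\<Sum>i\<in>UNIV. \<zeta> $ i * vfun \<sigma> y i) + d)\<bar> \<le> 2"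
        using abs_cos_le_one[of "\<zeta> \<bullet> yfun \<sigma> y + d"] abs_cos_le_one[of "(\<Sum>i\<in>UNIV. \<zeta> $ i * vfun \<sigma> y i) + d"] by linarith
      moreover have "0 \<le> norm \<zeta> * e * V" "0 \<le> V / B" using e V0 B by auto
      moreover have "indicator {u. B < norm u} (yfun \<sigma> y) \<le> (1 :: real)" by (simp add: indicator_def)
      ultimately show ?thesis by linarith
    qed
    then show "\<bar>cos (\<zeta> \<bullet> yfun \<sigma> y + d) - cos ((\<Sum>i\<in>UNIV. \<zeta> $ i * vfun \<sigma> y i) + d)\<bar>
      \<le> norm \<zeta> * e * (\<Sum>i\<in>UNIV. 1 + (vfun \<sigma> y i)\<^sup>2) + 2 * (dev t y / \<delta> + wt y / R\<^sup>2)"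
      "indicator {u. B < norm u} (yfun \<sigma> y) \<le> (\<Sum>i\<in>UNIV. 1 + (vfun \<sigma> y i)\<^sup>2) / B + (dev t y / \<delta> + wt y / R\<^sup>2)"
      unfolding V_def Q_def by auto
  qed
qed

text \<open>After division by \<sigma>, the variance bound \<open>C \<sigma>\<close> is bounded and
  the squared bias is at most 1 for small \<sigma>.\<close>

lemma vfun_second_moment:
  "\<exists>B\<ge>0. \<exists>\<sigma>0>0. \<forall>(M :: 'w measure) \<sigma> Y. dynkin_process M \<sigma> \<nu> (sqrt \<sigma> *\<^sub>R x) Y \<longrightarrow> \<sigma> < \<sigma>0 \<longrightarrow>
    (\<forall>i. integrable M (\<lambda>\<omega>. (vfun \<sigma> (Y t \<omega>) i)\<^sup>2)) \<and> (\<integral>\<omega>. (\<Sum>i\<in>UNIV. 1 + (vfun \<sigma> (Y t \<omega>) i)\<^sup>2) \<partial>M) \<le> B"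
proof -
  let ?\<theta> = "\<lambda>i. lagr_coeff (sqrt t *\<^sub>R r) (axis i 1)"
  have t0: "0 \<le> t" using t by simp
  have "\<forall>i. \<exists>C\<ge>0. \<forall>(M :: 'w measure) \<sigma> Y s. dynkin_process M \<sigma> \<nu> (sqrt \<sigma> *\<^sub>R x) Y \<longrightarrow> s \<in> {0..t} \<longrightarrow>
    (\<integral>\<omega>. (esum (?\<theta> i) (Y s \<omega>) - nval (?\<theta> i) \<sigma> s)\<^sup>2 \<partial>M) \<le> C * \<sigma>" using variance_bound[OF t0] by blast
  then obtain C where C: "\<And>i. 0 \<le> C i" "\<And>i (M :: 'w measure) \<sigma> Y s. dynkin_process M \<sigma> \<nu> (sqrt \<sigma> *\<^sub>R x) Y \<Longrightarrow> s \<in> {0..t} \<Longrightarrow>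
    (\<integral>\<omega>. (esum (?\<theta> i) (Y s \<omega>) - nval (?\<theta> i) \<sigma> s)\<^sup>2 \<partial>M) \<le> C i * \<sigma>" by metis
  have "\<forall>i. \<exists>\<sigma>0>0. \<forall>\<sigma>. 0 < \<sigma> \<longrightarrow> \<sigma> < \<sigma>0 \<longrightarrow> \<bar>nval (?\<theta> i) \<sigma> t / sqrt \<sigma>\<bar> \<le> 1"
    using nval_small[OF t0 nval_lagr_0 zero_less_one] by blast
  then obtain s0 where s0: "\<And>i. 0 < s0 i" "\<And>i \<sigma>. 0 < \<sigma> \<Longrightarrow> \<sigma> < s0 i \<Longrightarrow> \<bar>nval (?\<theta> i) \<sigma> t / sqrt \<sigma>\<bar> \<le> 1" by metis
  define \<sigma>0 where "\<sigma>0 = Min (range s0)"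
  have m0: "0 < \<sigma>0" "\<sigma>0 \<le> s0 i" for i using s0(1) by (auto simp: \<sigma>0_def)
  have nn: "0 \<le> (\<Sum>i\<in>UNIV. 3 + 2 * C i)" using C(1) by (intro sum_nonneg) auto
  have key: "(\<forall>i. integrable M (\<lambda>\<omega>. (vfun \<sigma> (Y t \<omega>) i)\<^sup>2)) \<and>
      (\<integral>\<omega>. (\<Sum>i\<in>UNIV. 1 + (vfun \<sigma> (Y t \<omega>) i)\<^sup>2) \<partial>M) \<le> (\<Sum>i\<in>UNIV. 3 + 2 * C i)"
    if p: "dynkin_process M \<sigma> \<nu> (sqrt \<sigma> *\<^sub>R x) Y" and ss: "\<sigma> < \<sigma>0"
    for M :: "'w measure" and \<sigma> and Y :: "real \<Rightarrow> 'w \<Rightarrow> (real, 'n) vec"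
  proof -
    interpret dynkin_process M \<sigma> \<nu> "sqrt \<sigma> *\<^sub>R x" Y by (rule p)
    have v: "vfun \<sigma> y i = esum (?\<theta> i) y / sqrt \<sigma>" for y i by (simp add: vfun_def esum_lagr_axis)
    have int: "integrable M (\<lambda>\<omega>. (vfun \<sigma> (Y t \<omega>) i)\<^sup>2)" for i
      unfolding v power_divide
      by (intro integrable_divide_zero integrable_pgrowth[OF _ _ t0, where p = "\<lambda>y. (esum (?\<theta> i) y)\<^sup>2"] pgrowth_power2 pgrowth_esum
          continuous_intros C2_continuous(1)[OF C2_esum])
    have "(\<integral>\<omega>. (vfun \<sigma> (Y t \<omega>) i)\<^sup>2 \<partial>M) \<le> 2 * C i + 2" for i
    proof -
      let ?n = "nval (?\<theta> i) \<sigma> t"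
      have i1: "integrable M (\<lambda>\<omega>. (esum (?\<theta> i) (Y t \<omega>) - ?n)\<^sup>2)"
        by (intro integrable_pgrowth[OF _ _ t0, where p = "\<lambda>y. (esum (?\<theta> i) y - ?n)\<^sup>2"] pgrowth_power2 pgrowth_minus pgrowth_esum
          continuous_intros C2_continuous(1)[OF C2_esum])
      have "(\<integral>\<omega>. (vfun \<sigma> (Y t \<omega>) i)\<^sup>2 \<partial>M) \<le> (\<integral>\<omega>. 2 / \<sigma> * (esum (?\<theta> i) (Y t \<omega>) - ?n)\<^sup>2 + 2 * (?n / sqrt \<sigma>)\<^sup>2 \<partial>M)"
      proof (rule integral_mono[OF int])
        show "integrable M (\<lambda>\<omega>. 2 / \<sigma> * (esum (?\<theta> i) (Y t \<omega>) - ?n)\<^sup>2 + 2 * (?n / sqrt \<sigma>)\<^sup>2)" using i1 by simp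
        fix \<omega>
        let ?a = "esum (?\<theta> i) (Y t \<omega>)"
        have "2 * (?a - ?n)\<^sup>2 + 2 * ?n\<^sup>2 - ?a\<^sup>2 = (?a - 2 * ?n)\<^sup>2" by (simp add: power2_eq_square algebra_simps)
        then have "?a\<^sup>2 \<le> 2 * (?a - ?n)\<^sup>2 + 2 * ?n\<^sup>2" using zero_le_power2[of "?a - 2 * ?n"] by linarith
        then have "?a\<^sup>2 / \<sigma> \<le> (2 * (?a - ?n)\<^sup>2 + 2 * ?n\<^sup>2) / \<sigma>" using sigma by (intro divide_right_mono) auto
        then show "(vfun \<sigma> (Y t \<omega>) i)\<^sup>2 \<le> 2 / \<sigma> * (?a - ?n)\<^sup>2 + 2 * (?n / sqrt \<sigma>)\<^sup>2"
          unfolding v power_divide using sigma by (simp add: add_divide_distrib)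
      qed
      also have "\<dots> = 2 / \<sigma> * (\<integral>\<omega>. (esum (?\<theta> i) (Y t \<omega>) - ?n)\<^sup>2 \<partial>M) + 2 * (?n / sqrt \<sigma>)\<^sup>2"
        using i1 by (simp add: prob_space)
      also have "\<dots> \<le> 2 / \<sigma> * (C i * \<sigma>) + 2 * 1"
      proof (intro add_mono mult_left_mono)
        show "(\<integral>\<omega>. (esum (?\<theta> i) (Y t \<omega>) - ?n)\<^sup>2 \<partial>M) \<le> C i * \<sigma>" using C(2)[OF p, of t i] t by simp
        have "\<bar>?n / sqrt \<sigma>\<bar> \<le> 1" using s0(2)[OF sigma(1)] ss m0(2)[of i] by simp
        then show "(?n / sqrt \<sigma>)\<^sup>2 \<le> 1" by (simp add: abs_square_le_1)
      qed (use sigma in auto)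
      also have "\<dots> = 2 * C i + 2" using sigma by simp
      finally show ?thesis .
    qed
    then have "(\<Sum>i\<in>UNIV. 1 + (\<integral>\<omega>. (vfun \<sigma> (Y t \<omega>) i)\<^sup>2 \<partial>M)) \<le> (\<Sum>i\<in>UNIV. 3 + 2 * C i)"
      by (intro sum_mono) (simp add: add.commute)
    then have "(\<integral>\<omega>. (\<Sum>i\<in>UNIV. 1 + (vfun \<sigma> (Y t \<omega>) i)\<^sup>2) \<partial>M) \<le> (\<Sum>i\<in>UNIV. 3 + 2 * C i)"
      using int by (simp add: prob_space)
    then show ?thesis using int by blast
  qed
  show ?thesis
    by (rule exI[of _ "\<Sum>i\<in>UNIV. 3 + 2 * C i"], rule conjI[OF nn], rule exI[of _ \<sigma>0], rule conjI[OF m0(1)])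
       (use key in blast)
qed

text \<open>Error budget for the cosine: \<open>5 \<epsilon> / 8\<close> for passing from
  \<open>yfun\<close> to \<open>vfun\<close>, \<open>\<epsilon> / 8\<close> for removing the
  centring \<open>nval\<close>, and \<open>\<epsilon> / 8\<close> from \<open>char_limit\<close>.
  For the tail: three times \<open>\<epsilon> / 8\<close>.\<close>

lemma limit_bounds:
  assumes \<epsilon>: "0 < \<epsilon>"
  shows "\<exists>\<sigma>0>0. \<forall>(M :: 'w measure) \<sigma> Y. dynkin_process M \<sigma> \<nu> (sqrt \<sigma> *\<^sub>R x) Y \<longrightarrow> \<sigma> < \<sigma>0 \<longrightarrow>
    \<bar>(\<integral>\<omega>. cos (\<zeta> \<bullet> yfun \<sigma> (Y t \<omega>) + d) \<partial>M) - exp (- (\<zeta> \<bullet> ((t *\<^sub>R matrix_inv (S_mat \<nu> r)) *v \<zeta>)) / 2) * cos d\<bar> \<le> \<epsilon>"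
    "\<exists>\<sigma>0>0. \<exists>B>0. \<forall>(M :: 'w measure) \<sigma> Y. dynkin_process M \<sigma> \<nu> (sqrt \<sigma> *\<^sub>R x) Y \<longrightarrow> \<sigma> < \<sigma>0 \<longrightarrow>
    (\<integral>\<omega>. indicator {u. B < norm u} (yfun \<sigma> (Y t \<omega>)) \<partial>M) \<le> \<epsilon>"
proof -
  have t0: "0 \<le> t" using t by simp
  obtain V \<sigma>1 where V: "0 \<le> V" "0 < \<sigma>1" "\<And>(M :: 'w measure) \<sigma> Y. dynkin_process M \<sigma> \<nu> (sqrt \<sigma> *\<^sub>R x) Y \<Longrightarrow> \<sigma> < \<sigma>1 \<Longrightarrow>
    (\<forall>i. integrable M (\<lambda>\<omega>. (vfun \<sigma> (Y t \<omega>) i)\<^sup>2)) \<and> (\<integral>\<omega>. (\<Sum>i\<in>UNIV. 1 + (vfun \<sigma> (Y t \<omega>) i)\<^sup>2) \<partial>M) \<le> V"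
    using vfun_second_moment by metis
  obtain A where A: "0 \<le> A" "\<And>(M :: 'w measure) \<sigma> Y s. dynkin_process M \<sigma> \<nu> (sqrt \<sigma> *\<^sub>R x) Y \<Longrightarrow> s \<in> {0..t} \<Longrightarrow>
    (\<integral>\<omega>. wt (Y s \<omega>) ^ 1 \<partial>M) \<le> A" using process_moments[OF t0, of 1] by metis
  \<comment> \<open>Small enough for \<open>norm \<zeta> * e * V\<close> to cost
    \<open>\<epsilon> / 8\<close>; the cap 1/2 keeps \<open>wfac\<close> away from 0.\<close>
  define e where "e = min (1/2) (\<epsilon> / (8 * ((norm \<zeta> + 1) * (V + 1))))"
  have nz: "0 < (norm \<zeta> + 1) * (V + 1)" using V(1) norm_ge_zero[of \<zeta>] by (intro mult_pos_pos) linarith+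
  have e: "0 < e" "e \<le> 1/2" using \<epsilon> nz by (auto simp: e_def)
  have eV: "norm \<zeta> * e * V \<le> \<epsilon> / 8"
  proof -
    have "norm \<zeta> * e * V = e * (norm \<zeta> * V)" by simp
    also have "\<dots> \<le> \<epsilon> / (8 * ((norm \<zeta> + 1) * (V + 1))) * ((norm \<zeta> + 1) * (V + 1))"
    proof (rule mult_mono)
      show "e \<le> \<epsilon> / (8 * ((norm \<zeta> + 1) * (V + 1)))" unfolding e_def by (rule min.cobounded2)
      show "norm \<zeta> * V \<le> (norm \<zeta> + 1) * (V + 1)" using V(1) by (intro mult_mono) auto
      show "0 \<le> \<epsilon> / (8 * ((norm \<zeta> + 1) * (V + 1)))" using \<epsilon> nz by (intro divide_nonneg_pos) linarith+
      show "0 \<le> norm \<zeta> * V" using V(1) by simp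
    qed
    also have "\<dots> = \<epsilon> / 8"
    proof -
      have "\<epsilon> / (8 * P) * P = \<epsilon> / 8" if "0 < P" for P using that by simp
      from this[OF nz] show ?thesis .
    qed
    finally show ?thesis .
  qed
  define R where "R = sqrt (8 * (A + 1) / \<epsilon>)"
  have R: "0 < R" using A \<epsilon> by (simp add: R_def)
  have AR: "A / R\<^sup>2 \<le> \<epsilon> / 8" using A \<epsilon> by (simp add: R_def field_simps)
  obtain \<delta> where \<delta>0: "0 < \<delta>" and \<delta>': "\<forall>y\<in>chamberB. \<forall>\<sigma> \<zeta> d. \<forall>B>0.
    \<bar>cos (\<zeta> \<bullet> yfun \<sigma> y + d) - cos ((\<Sum>i\<in>UNIV. \<zeta> $ i * vfun \<sigma> y i) + d)\<bar>
      \<le> norm \<zeta> * e * (\<Sum>i\<in>UNIV. 1 + (vfun \<sigma> y i)\<^sup>2) + 2 * (dev t y / \<delta> + wt y / R\<^sup>2) \<and>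
    indicator {u. B < norm u} (yfun \<sigma> y) \<le> (\<Sum>i\<in>UNIV. 1 + (vfun \<sigma> y i)\<^sup>2) / B + (dev t y / \<delta> + wt y / R\<^sup>2)"
    by (rule exE[OF pointwise_bounds[OF e R]], erule conjE)
  note \<delta> = \<delta>0 \<delta>'[rule_format]
  have ed: "0 < \<epsilon> * \<delta> / 16" using \<epsilon> \<delta> by simp
  obtain C where C: "0 \<le> C" "\<And>(M :: 'w measure) \<sigma> Y s. dynkin_process M \<sigma> \<nu> (sqrt \<sigma> *\<^sub>R x) Y \<Longrightarrow> s \<in> {0..t} \<Longrightarrow>
    (\<integral>\<omega>. dev s (Y s \<omega>) \<partial>M) \<le> \<epsilon> * \<delta> / 16 + C * \<sigma>" using deviation_bound[OF t0 ed] by metis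
  \<comment> \<open>Balances \<open>C * \<sigma>\<close> with the
    \<open>\<epsilon> * \<delta> / 16\<close> left by \<open>deviation_bound\<close>, so that the
    expectation of \<open>dev\<close> divided by \<delta> costs
    \<open>\<epsilon> / 8\<close>.\<close>
  define \<sigma>2 where "\<sigma>2 = \<epsilon> * \<delta> / (16 * (C + 1))"
  have s2: "0 < \<sigma>2" using \<epsilon> \<delta> C by (simp add: \<sigma>2_def)
  have dev: "(\<integral>\<omega>. dev t (Y t \<omega>) \<partial>M) / \<delta> \<le> \<epsilon> / 8"
    if p: "dynkin_process M \<sigma> \<nu> (sqrt \<sigma> *\<^sub>R x) Y" and s: "\<sigma> < \<sigma>2" for M :: "'w measure" and \<sigma> Y
  proof -
    have "0 < \<sigma>" using p by (simp add: dynkin_process_def dynkin_process_axioms_def)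
    have "C * \<sigma> \<le> (C + 1) * \<sigma>2" using s C \<open>0 < \<sigma>\<close> by (intro mult_mono) auto
    also have "\<dots> = \<epsilon> * \<delta> / 16" using C(1) by (simp add: \<sigma>2_def field_simps)
    finally have "(\<integral>\<omega>. dev t (Y t \<omega>) \<partial>M) \<le> \<epsilon> * \<delta> / 8" using C(2)[OF p, of t] t by simp
    then show ?thesis using \<delta> by (simp add: pos_divide_le_eq)
  qed
  have wtA: "(\<integral>\<omega>. wt (Y t \<omega>) \<partial>M) / R\<^sup>2 \<le> \<epsilon> / 8"
    if p: "dynkin_process M \<sigma> \<nu> (sqrt \<sigma> *\<^sub>R x) Y" for M :: "'w measure" and \<sigma> Y
    using A(2)[OF p, of t] t AR by (intro order_trans[OF divide_right_mono AR]) auto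
  have Qint: "integrable M (\<lambda>\<omega>. dev t (Y t \<omega>))" "integrable M (\<lambda>\<omega>. wt (Y t \<omega>))"
    if p: "dynkin_process M \<sigma> \<nu> (sqrt \<sigma> *\<^sub>R x) Y" for M :: "'w measure" and \<sigma> Y
  proof -
    interpret dynkin_process M \<sigma> \<nu> "sqrt \<sigma> *\<^sub>R x" Y by (rule p)
    show "integrable M (\<lambda>\<omega>. dev t (Y t \<omega>))"
      by (rule integrable_pgrowth[OF continuous_dev[OF continuous_on_const continuous_on_id] pgrowth_dev t0])
    show "integrable M (\<lambda>\<omega>. wt (Y t \<omega>))" using integrable_wt[OF t0, of 1] by simp
  qed
  let ?\<theta> = "lagr_coeff (sqrt t *\<^sub>R r) \<zeta>"
  have "0 < \<epsilon> / 8" using \<epsilon> by simp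
  from char_limit[OF t this, of ?\<theta> d, where 'w = 'w]
  obtain \<sigma>3 where s3: "0 < \<sigma>3" "\<And>(M :: 'w measure) \<sigma> Y. dynkin_process M \<sigma> \<nu> (sqrt \<sigma> *\<^sub>R x) Y \<Longrightarrow> \<sigma> < \<sigma>3 \<Longrightarrow>
    \<bar>(\<integral>\<omega>. cos ((esum ?\<theta> (Y t \<omega>) - nval ?\<theta> \<sigma> t) / sqrt \<sigma> + d) \<partial>M) - exp (- kappa ?\<theta> t t / 2) * cos d\<bar> \<le> \<epsilon> / 8" by metis
  obtain \<sigma>4 where s4: "0 < \<sigma>4" "\<And>\<sigma>. 0 < \<sigma> \<Longrightarrow> \<sigma> < \<sigma>4 \<Longrightarrow> \<bar>nval ?\<theta> \<sigma> t / sqrt \<sigma>\<bar> \<le> \<epsilon> / 8"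
    using nval_small[OF t0 nval_lagr_0 \<open>0 < \<epsilon> / 8\<close>] by blast
  show "\<exists>\<sigma>0>0. \<forall>(M :: 'w measure) \<sigma> Y. dynkin_process M \<sigma> \<nu> (sqrt \<sigma> *\<^sub>R x) Y \<longrightarrow> \<sigma> < \<sigma>0 \<longrightarrow>
    \<bar>(\<integral>\<omega>. cos (\<zeta> \<bullet> yfun \<sigma> (Y t \<omega>) + d) \<partial>M) - exp (- (\<zeta> \<bullet> ((t *\<^sub>R matrix_inv (S_mat \<nu> r)) *v \<zeta>)) / 2) * cos d\<bar> \<le> \<epsilon>"
  proof (intro exI[of _ "min (min \<sigma>1 \<sigma>2) (min \<sigma>3 \<sigma>4)"] conjI allI impI)
    show "0 < min (min \<sigma>1 \<sigma>2) (min \<sigma>3 \<sigma>4)" using V s2 s3 s4 by simp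
    fix M :: "'w measure" and \<sigma> and Y :: "real \<Rightarrow> 'w \<Rightarrow> (real, 'n) vec"
    assume p: "dynkin_process M \<sigma> \<nu> (sqrt \<sigma> *\<^sub>R x) Y" and ss: "\<sigma> < min (min \<sigma>1 \<sigma>2) (min \<sigma>3 \<sigma>4)"
    interpret dynkin_process M \<sigma> \<nu> "sqrt \<sigma> *\<^sub>R x" Y by (rule p)
    have ic: "integrable M (\<lambda>\<omega>. cos (f (Y t \<omega>)))" if "continuous_on UNIV f" for f :: "(real, 'n) vec \<Rightarrow> real"
      by (rule integrable_pgrowth[OF _ _ t0, where p = "\<lambda>y. cos (f y)"])
         (auto intro!: continuous_intros that pgrowthI[of _ 1 0])
    have vs: "(\<Sum>i\<in>UNIV. \<zeta> $ i * vfun \<sigma> y i) = esum ?\<theta> y / sqrt \<sigma>" for y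
      by (simp add: esum_lagr_coeff vfun_def sum_divide_distrib)
    have i1: "integrable M (\<lambda>\<omega>. cos (\<zeta> \<bullet> yfun \<sigma> (Y t \<omega>) + d))"
      by (rule ic) (unfold yfun_def, intro continuous_intros)
    have i2: "integrable M (\<lambda>\<omega>. cos (esum ?\<theta> (Y t \<omega>) / sqrt \<sigma> + d))"
      unfolding divide_inverse by (rule ic[of "\<lambda>y. esum ?\<theta> y * inverse (sqrt \<sigma>) + d"]) (intro continuous_intros C2_continuous(1)[OF C2_esum])
    have i3: "integrable M (\<lambda>\<omega>. cos ((esum ?\<theta> (Y t \<omega>) - nval ?\<theta> \<sigma> t) / sqrt \<sigma> + d))"
      unfolding divide_inverse by (rule ic[of "\<lambda>y. (esum ?\<theta> y - nval ?\<theta> \<sigma> t) * inverse (sqrt \<sigma>) + d"]) (intro continuous_intros C2_continuous(1)[OF C2_esum])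
    have s1: "\<sigma> < \<sigma>1" "\<sigma> < \<sigma>2" "\<sigma> < \<sigma>3" "\<sigma> < \<sigma>4" using ss by simp_all
    note V' = V(3)[OF p s1(1)]
    have "\<bar>(\<integral>\<omega>. cos (\<zeta> \<bullet> yfun \<sigma> (Y t \<omega>) + d) \<partial>M) - (\<integral>\<omega>. cos (esum ?\<theta> (Y t \<omega>) / sqrt \<sigma> + d) \<partial>M)\<bar>
        = \<bar>\<integral>\<omega>. cos (\<zeta> \<bullet> yfun \<sigma> (Y t \<omega>) + d) - cos (esum ?\<theta> (Y t \<omega>) / sqrt \<sigma> + d) \<partial>M\<bar>"
      using i1 i2 by simp
    also have "\<dots> \<le> (\<integral>\<omega>. \<bar>cos (\<zeta> \<bullet> yfun \<sigma> (Y t \<omega>) + d) - cos (esum ?\<theta> (Y t \<omega>) / sqrt \<sigma> + d)\<bar> \<partial>M)"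
      by (rule integral_abs_bound)
    also have "\<dots> \<le> (\<integral>\<omega>. norm \<zeta> * e * (\<Sum>i\<in>UNIV. 1 + (vfun \<sigma> (Y t \<omega>) i)\<^sup>2) + 2 * (dev t (Y t \<omega>) / \<delta> + wt (Y t \<omega>) / R\<^sup>2) \<partial>M)"
    proof (rule integral_mono)
      show "integrable M (\<lambda>\<omega>. norm \<zeta> * e * (\<Sum>i\<in>UNIV. 1 + (vfun \<sigma> (Y t \<omega>) i)\<^sup>2) + 2 * (dev t (Y t \<omega>) / \<delta> + wt (Y t \<omega>) / R\<^sup>2))"
        using V' Qint[OF p] by simp
      fix \<omega> assume w: "\<omega> \<in> space M"
      show "\<bar>cos (\<zeta> \<bullet> yfun \<sigma> (Y t \<omega>) + d) - cos (esum ?\<theta> (Y t \<omega>) / sqrt \<sigma> + d)\<bar>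
          \<le> norm \<zeta> * e * (\<Sum>i\<in>UNIV. 1 + (vfun \<sigma> (Y t \<omega>) i)\<^sup>2) + 2 * (dev t (Y t \<omega>) / \<delta> + wt (Y t \<omega>) / R\<^sup>2)"
        by (rule \<delta>(2)[OF X_chamber[OF t0 w] zero_less_one, THEN conjunct1, of \<zeta> \<sigma> d, unfolded vs])
    qed (use i1 i2 in auto)
    also have "\<dots> = norm \<zeta> * e * (\<integral>\<omega>. (\<Sum>i\<in>UNIV. 1 + (vfun \<sigma> (Y t \<omega>) i)\<^sup>2) \<partial>M)
        + 2 * ((\<integral>\<omega>. dev t (Y t \<omega>) \<partial>M) / \<delta> + (\<integral>\<omega>. wt (Y t \<omega>) \<partial>M) / R\<^sup>2)"
      using V' Qint[OF p] by simp
    also have "\<dots> \<le> norm \<zeta> * e * V + 2 * (\<epsilon> / 8 + \<epsilon> / 8)"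
      using V' dev[OF p s1(2)] wtA[OF p] e by (intro add_mono mult_left_mono) auto
    also have "\<dots> \<le> 5 * \<epsilon> / 8" using eV by simp
    finally have d1: "\<bar>(\<integral>\<omega>. cos (\<zeta> \<bullet> yfun \<sigma> (Y t \<omega>) + d) \<partial>M) - (\<integral>\<omega>. cos (esum ?\<theta> (Y t \<omega>) / sqrt \<sigma> + d) \<partial>M)\<bar> \<le> 5 * \<epsilon> / 8" .
    have "\<bar>(\<integral>\<omega>. cos (esum ?\<theta> (Y t \<omega>) / sqrt \<sigma> + d) \<partial>M) - (\<integral>\<omega>. cos ((esum ?\<theta> (Y t \<omega>) - nval ?\<theta> \<sigma> t) / sqrt \<sigma> + d) \<partial>M)\<bar>
        = \<bar>\<integral>\<omega>. cos (esum ?\<theta> (Y t \<omega>) / sqrt \<sigma> + d) - cos ((esum ?\<theta> (Y t \<omega>) - nval ?\<theta> \<sigma> t) / sqrt \<sigma> + d) \<partial>M\<bar>"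
      using i2 i3 by simp
    also have "\<dots> \<le> (\<integral>\<omega>. \<bar>cos (esum ?\<theta> (Y t \<omega>) / sqrt \<sigma> + d) - cos ((esum ?\<theta> (Y t \<omega>) - nval ?\<theta> \<sigma> t) / sqrt \<sigma> + d)\<bar> \<partial>M)"
      by (rule integral_abs_bound)
    also have "\<dots> \<le> (\<integral>\<omega>. \<epsilon> / 8 \<partial>M)"
    proof (rule integral_mono)
      fix \<omega>
      have "\<bar>cos (esum ?\<theta> (Y t \<omega>) / sqrt \<sigma> + d) - cos ((esum ?\<theta> (Y t \<omega>) - nval ?\<theta> \<sigma> t) / sqrt \<sigma> + d)\<bar> \<le> \<bar>nval ?\<theta> \<sigma> t / sqrt \<sigma>\<bar>"
        by (rule order_trans[OF abs_cos_diff]) (simp add: diff_divide_distrib)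
      also have "\<dots> \<le> \<epsilon> / 8" by (rule s4(2)[OF sigma(1) s1(4)])
      finally show "\<bar>cos (esum ?\<theta> (Y t \<omega>) / sqrt \<sigma> + d) - cos ((esum ?\<theta> (Y t \<omega>) - nval ?\<theta> \<sigma> t) / sqrt \<sigma> + d)\<bar> \<le> \<epsilon> / 8" .
    qed (use i2 i3 in auto)
    also have "\<dots> = \<epsilon> / 8" by (simp add: prob_space)
    finally have d2: "\<bar>(\<integral>\<omega>. cos (esum ?\<theta> (Y t \<omega>) / sqrt \<sigma> + d) \<partial>M) - (\<integral>\<omega>. cos ((esum ?\<theta> (Y t \<omega>) - nval ?\<theta> \<sigma> t) / sqrt \<sigma> + d) \<partial>M)\<bar> \<le> \<epsilon> / 8" .
    note d3 = s3(2)[OF p s1(3), unfolded kappa_terminal[OF t]]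
    show "\<bar>(\<integral>\<omega>. cos (\<zeta> \<bullet> yfun \<sigma> (Y t \<omega>) + d) \<partial>M) - exp (- (\<zeta> \<bullet> ((t *\<^sub>R matrix_inv (S_mat \<nu> r)) *v \<zeta>)) / 2) * cos d\<bar> \<le> \<epsilon>"
    proof -
      have "\<bar>a1 - a4\<bar> \<le> \<epsilon>" if "\<bar>a1 - a2\<bar> \<le> 5 * \<epsilon> / 8" "\<bar>a2 - a3\<bar> \<le> \<epsilon> / 8" "\<bar>a3 - a4\<bar> \<le> \<epsilon> / 8" for a1 a2 a3 a4
        using that \<epsilon> by linarith
      from this[OF d1 d2 d3] show ?thesis .
    qed
  qed
  define B where "B = 8 * (V + 1) / \<epsilon>"
  have B: "0 < B" using V \<epsilon> by (simp add: B_def)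
  have VB: "V / B \<le> \<epsilon> / 8" using V \<epsilon> by (simp add: B_def field_simps)
  show "\<exists>\<sigma>0>0. \<exists>B>0. \<forall>(M :: 'w measure) \<sigma> Y. dynkin_process M \<sigma> \<nu> (sqrt \<sigma> *\<^sub>R x) Y \<longrightarrow> \<sigma> < \<sigma>0 \<longrightarrow>
    (\<integral>\<omega>. indicator {u. B < norm u} (yfun \<sigma> (Y t \<omega>)) \<partial>M) \<le> \<epsilon>"
  proof (rule exI[of _ "min \<sigma>1 \<sigma>2"], rule conjI, goal_cases)
    case 1
    show ?case using V s2 by simp
  next
    case 2
    show ?case
    proof (intro exI[of _ B] conjI allI impI B)
    fix M :: "'w measure" and \<sigma> and Y :: "real \<Rightarrow> 'w \<Rightarrow> (real, 'n) vec"
    assume p: "dynkin_process M \<sigma> \<nu> (sqrt \<sigma> *\<^sub>R x) Y" and ss: "\<sigma> < min \<sigma>1 \<sigma>2"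
    interpret dynkin_process M \<sigma> \<nu> "sqrt \<sigma> *\<^sub>R x" Y by (rule p)
    have s1: "\<sigma> < \<sigma>1" "\<sigma> < \<sigma>2" using ss by auto
    note V' = V(3)[OF p s1(1)]
    have "(\<lambda>\<omega>. yfun \<sigma> (Y t \<omega>)) \<in> borel_measurable M"
      unfolding yfun_def using X_measurable[OF t0] by measurable
    moreover have "{u :: (real, 'n) vec. B < norm u} \<in> sets borel"
      by (auto intro!: borel_open open_Collect_less continuous_intros)
    ultimately have m: "(\<lambda>\<omega>. indicator {u. B < norm u} (yfun \<sigma> (Y t \<omega>)) :: real) \<in> borel_measurable M"
      by (intro measurable_compose[OF _ borel_measurable_indicator])
    have "(\<integral>\<omega>. indicator {u. B < norm u} (yfun \<sigma> (Y t \<omega>)) \<partial>M) \<le> (\<integral>\<omega>. (\<Sum>i\<in>UNIV. 1 + (vfun \<sigma> (Y t \<omega>) i)\<^sup>2) / B + (dev t (Y t \<omega>) / \<delta> + wt (Y t \<omega>) / R\<^sup>2) \<partial>M)"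
    proof (rule integral_mono)
      show "integrable M (\<lambda>\<omega>. indicator {u. B < norm u} (yfun \<sigma> (Y t \<omega>)) :: real)"
        by (rule integrable_const_bound[where B = 1]) (use m in \<open>auto simp: indicator_def\<close>)
      show "integrable M (\<lambda>\<omega>. (\<Sum>i\<in>UNIV. 1 + (vfun \<sigma> (Y t \<omega>) i)\<^sup>2) / B + (dev t (Y t \<omega>) / \<delta> + wt (Y t \<omega>) / R\<^sup>2))"
        using V' Qint[OF p] by simp
      fix \<omega> assume w: "\<omega> \<in> space M"
      show "indicator {u. B < norm u} (yfun \<sigma> (Y t \<omega>)) \<le> (\<Sum>i\<in>UNIV. 1 + (vfun \<sigma> (Y t \<omega>) i)\<^sup>2) / B + (dev t (Y t \<omega>) / \<delta> + wt (Y t \<omega>) / R\<^sup>2)"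
        by (rule \<delta>(2)[OF X_chamber[OF t0 w] B, THEN conjunct2])
    qed
    also have "\<dots> = (\<integral>\<omega>. (\<Sum>i\<in>UNIV. 1 + (vfun \<sigma> (Y t \<omega>) i)\<^sup>2) \<partial>M) / B + ((\<integral>\<omega>. dev t (Y t \<omega>) \<partial>M) / \<delta> + (\<integral>\<omega>. wt (Y t \<omega>) \<partial>M) / R\<^sup>2)"
      using V' Qint[OF p] by simp
    also have "\<dots> \<le> V / B + (\<epsilon> / 8 + \<epsilon> / 8)"
      using V' dev[OF p s1(2)] wtA[OF p] B by (intro add_mono divide_right_mono) auto
    also have "\<dots> \<le> \<epsilon>" using VB \<epsilon> by linarith
    finally show "(\<integral>\<omega>. indicator {u. B < norm u} (yfun \<sigma> (Y t \<omega>)) \<partial>M) \<le> \<epsilon>" .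
    qed
  qed
qed

end

end

theorem theorem3p3:
  fixes \<nu> :: real and z :: "real ^ ('n::{finite,linorder})" and x :: "real ^ ('n::{finite,linorder})"
    and M :: "real \<Rightarrow> 'w measure" and X :: "real \<Rightarrow> real \<Rightarrow> 'w \<Rightarrow> real ^ ('n::{finite,linorder})"
  assumes nu: "\<nu> > 0"
    and z_zero: "\<And>i. laguerre CARD('n) (\<nu> - 1) (z $ i) = 0"
    and z_dec: "\<And>i j. i < j \<Longrightarrow> z $ j < z $ i"
    and z_pos: "\<And>i. z $ i > 0"
    and x: "x \<in> chamberB"
    and proc: "\<forall>\<^sub>F \<beta> in at_top. besselB_process (M \<beta>) (\<nu> * \<beta>) \<beta> x (X \<beta>)"
  defines "r \<equiv> (\<chi> i. sqrt (2 * z $ i))"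
  shows "invertible (S_mat \<nu> r) \<and>
    (\<forall>t>0. weak_conv_vec
        (\<lambda>\<beta>. distr (M \<beta>) borel (\<lambda>\<omega>. X \<beta> t \<omega> - sqrt (\<beta> * t) *\<^sub>R r))
        (normal_vec (t *\<^sub>R matrix_inv (S_mat \<nu> r)))
        at_top)"
proof -
  interpret laguerre_point \<nu> r unfolding r_def by (rule laguerre_point[OF nu z_zero z_dec z_pos])
  interpret laguerre_start \<nu> r x by unfold_locales
  have "weak_conv_vec (\<lambda>\<beta>. distr (M \<beta>) borel (\<lambda>\<omega>. X \<beta> t \<omega> - sqrt (\<beta> * t) *\<^sub>R r))
        (normal_vec (t *\<^sub>R matrix_inv (S_mat \<nu> r))) at_top" if t: "0 < t" for t
  proof -
    let ?S = "S_mat \<nu> r"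
    let ?Z = "\<lambda>\<beta> \<omega>. X \<beta> t \<omega> - sqrt (\<beta> * t) *\<^sub>R r"
    let ?C = "t *\<^sub>R matrix_inv ?S"
    have sc: "(a *\<^sub>R A) *v v = a *\<^sub>R (A *v v)" for a and A :: "((real, 'n) vec, 'n) vec" and v
      by (simp add: vec_eq_iff matrix_vector_mult_def sum_distrib_left mult.assoc)
    \<comment> \<open>The lemmas on \<open>normal_vec\<close> are phrased in terms of the inverse
      covariance, which is \<open>S / t\<close>.\<close>
    have Asym: "transpose ((1 / t) *\<^sub>R ?S) = (1 / t) *\<^sub>R ?S"
      using S_symmetric by (simp add: vec_eq_iff transpose_def)
    have Apd: "0 < v \<bullet> (((1 / t) *\<^sub>R ?S) *v v)" if "v \<noteq> 0" for v :: "(real, 'n) vec"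
    proof -
      have "0 < v \<bullet> v" using that by simp
      then have "0 < v \<bullet> (?S *v v)" using S_quadratic_ge[of v] by linarith
      then show ?thesis using t by (simp add: sc)
    qed
    have Ainv: "((1 / t) *\<^sub>R ?S) ** ?C = mat 1"
    proof -
      have "((1 / t) *\<^sub>R ?S) ** ?C = ?S ** matrix_inv ?S"
        using t by (simp add: vec_eq_iff matrix_matrix_mult_def)
      then show ?thesis using S_inverse by simp
    qed
    define Y where "Y \<beta> s \<omega> = (1 / sqrt \<beta>) *\<^sub>R X \<beta> s \<omega>" for \<beta> s \<omega>
    have dp: "\<forall>\<^sub>F \<beta> in at_top. \<beta> \<ge> 1 \<and> dynkin_process (M \<beta>) (1 / \<beta>) \<nu> (sqrt (1 / \<beta>) *\<^sub>R x) (Y \<beta>)"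
      using proc eventually_ge_at_top[of 1]
    proof eventually_elim
      case (elim \<beta>)
      then show ?case using besselB_process_scaled[OF elim(1,2) nu] by (simp add: Y_def[abs_def] real_sqrt_divide)
    qed
    have ev: "\<forall>\<^sub>F \<beta> in at_top. \<beta> \<ge> 1 \<and> 1 / \<beta> < \<sigma>0 \<and> dynkin_process (M \<beta>) (1 / \<beta>) \<nu> (sqrt (1 / \<beta>) *\<^sub>R x) (Y \<beta>)"
      if "0 < \<sigma>0" for \<sigma>0
      using dp eventually_gt_at_top[of "1 / \<sigma>0"]
    proof eventually_elim
      case (elim \<beta>)
      then show ?case using that by (simp add: field_simps)
    qed
    \<comment> \<open>With \<open>\<sigma> = 1 / \<beta>\<close> the two scalings cancel: the
      centred original process is exactly \<open>yfun\<close> of the rescaled one.\<close>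
    have Z: "?Z \<beta> \<omega> = yfun t (1 / \<beta>) (Y \<beta> t \<omega>)" if "\<beta> \<ge> 1" for \<beta> \<omega>
      using that t by (simp add: yfun_def[OF t] Y_def real_sqrt_divide real_sqrt_mult scaleR_diff_right)
    have meas: "?Z \<beta> \<in> borel_measurable (M \<beta>)" if b: "\<beta> \<ge> 1" and p: "dynkin_process (M \<beta>) (1 / \<beta>) \<nu> (sqrt (1 / \<beta>) *\<^sub>R x) (Y \<beta>)" for \<beta>
    proof -
      interpret dynkin_process "M \<beta>" "1 / \<beta>" \<nu> "sqrt (1 / \<beta>) *\<^sub>R x" "Y \<beta>" by (rule p)
      have "Y \<beta> t \<in> borel_measurable (M \<beta>)" by (rule X_measurable) (use t in simp)
      then show ?thesis unfolding Z[OF b] yfun_def[OF t] by measurable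
    qed
    have P: "\<forall>\<^sub>F \<beta> in at_top. prob_space (distr (M \<beta>) borel (?Z \<beta>)) \<and> sets (distr (M \<beta>) borel (?Z \<beta>)) = sets borel"
      using dp
    proof eventually_elim
      case (elim \<beta>)
      then have "prob_space (M \<beta>)" by (simp add: dynkin_process_def)
      then show ?case using meas elim by (simp add: prob_space.prob_space_distr)
    qed
    have conv: "((\<lambda>\<beta>. \<integral>y. cos (\<zeta> \<bullet> y + d) \<partial>distr (M \<beta>) borel (?Z \<beta>)) \<longlongrightarrow> (\<integral>y. cos (\<zeta> \<bullet> y + d) \<partial>normal_vec ?C)) at_top" for \<zeta> d
    proof -
      have "((\<lambda>\<beta>. \<integral>y. cos (\<zeta> \<bullet> y + d) \<partial>distr (M \<beta>) borel (?Z \<beta>)) \<longlongrightarrow> exp (- (\<zeta> \<bullet> (?C *v \<zeta>)) / 2) * cos d) at_top"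
      proof (rule tendstoI)
        fix e :: real assume e: "0 < e"
        then have e2: "0 < e / 2" by simp
        obtain \<sigma>0 where s0: "0 < \<sigma>0" "\<And>(M :: 'w measure) \<sigma> Y. dynkin_process M \<sigma> \<nu> (sqrt \<sigma> *\<^sub>R x) Y \<Longrightarrow> \<sigma> < \<sigma>0 \<Longrightarrow>
          \<bar>(\<integral>\<omega>. cos (\<zeta> \<bullet> yfun t \<sigma> (Y t \<omega>) + d) \<partial>M) - exp (- (\<zeta> \<bullet> (?C *v \<zeta>)) / 2) * cos d\<bar> \<le> e / 2"
          using limit_bounds(1)[OF t e2, of \<zeta> d, where 'w = 'w] by metis
        show "\<forall>\<^sub>F \<beta> in at_top. dist (\<integral>y. cos (\<zeta> \<bullet> y + d) \<partial>distr (M \<beta>) borel (?Z \<beta>)) (exp (- (\<zeta> \<bullet> (?C *v \<zeta>)) / 2) * cos d) < e"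
          using ev[OF s0(1)]
        proof eventually_elim
          case (elim \<beta>)
          have "(\<integral>y. cos (\<zeta> \<bullet> y + d) \<partial>distr (M \<beta>) borel (?Z \<beta>)) = (\<integral>\<omega>. cos (\<zeta> \<bullet> ?Z \<beta> \<omega> + d) \<partial>M \<beta>)"
            using meas elim by (intro integral_distr) auto
          also have "\<dots> = (\<integral>\<omega>. cos (\<zeta> \<bullet> yfun t (1 / \<beta>) (Y \<beta> t \<omega>) + d) \<partial>M \<beta>)" using Z elim by simp
          finally show ?case using s0(2)[of "M \<beta>" "1 / \<beta>" "Y \<beta>"] elim e by (simp add: dist_real_def)
        qed
      qed
      moreover have "(\<integral>y. cos (\<zeta> \<bullet> y + d) \<partial>normal_vec ?C) = exp (- (\<zeta> \<bullet> (?C *v \<zeta>)) / 2) * cos d"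
        by (rule normal_vec_cos[OF Asym _ Ainv]) (rule Apd)
      ultimately show ?thesis by simp
    qed
    have tight: "\<exists>R. \<forall>\<^sub>F \<beta> in at_top. measure (distr (M \<beta>) borel (?Z \<beta>)) {y. R < norm y} \<le> e" if e: "0 < e" for e
    proof -
      obtain \<sigma>0 B where s0: "0 < \<sigma>0" "\<And>(M :: 'w measure) \<sigma> Y. dynkin_process M \<sigma> \<nu> (sqrt \<sigma> *\<^sub>R x) Y \<Longrightarrow> \<sigma> < \<sigma>0 \<Longrightarrow>
          (\<integral>\<omega>. indicator {u. B < norm u} (yfun t \<sigma> (Y t \<omega>)) \<partial>M) \<le> e"
        using limit_bounds(2)[OF t e, where 'w = 'w] by metis
      have S: "{u :: (real, 'n) vec. B < norm u} \<in> sets borel"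
        by (auto intro!: borel_open open_Collect_less continuous_intros)
      show ?thesis
      proof (intro exI[of _ B])
        show "\<forall>\<^sub>F \<beta> in at_top. measure (distr (M \<beta>) borel (?Z \<beta>)) {y. B < norm y} \<le> e"
          using ev[OF s0(1)]
        proof eventually_elim
          case (elim \<beta>)
          have "measure (distr (M \<beta>) borel (?Z \<beta>)) {y. B < norm y} = (\<integral>y. indicator {y. B < norm y} y \<partial>distr (M \<beta>) borel (?Z \<beta>))"
            using S by simp
          also have "\<dots> = (\<integral>\<omega>. indicator {y. B < norm y} (?Z \<beta> \<omega>) \<partial>M \<beta>)"
            using meas elim S by (intro integral_distr) auto
          also have "\<dots> = (\<integral>\<omega>. indicator {y. B < norm y} (yfun t (1 / \<beta>) (Y \<beta> t \<omega>)) \<partial>M \<beta>)" using Z elim by simp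
          finally show ?case using s0(2)[of "M \<beta>" "1 / \<beta>" "Y \<beta>"] elim by simp
        qed
      qed
    qed
    show ?thesis
    proof (rule weak_conv_vecI_trig[OF P _ _ conv tight])
      show "prob_space (normal_vec ?C)"
        by (rule prob_space_normal_vec[OF Asym _ Ainv]) (rule Apd)
    qed (simp_all add: normal_vec_def)
  qed
  then show ?thesis using S_invertible by blast
qed

end
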